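(* For each large 2-category $\mathscr K$ and 2-functor $F\colon\mathscr K\to\mathbf{Set}_{\mathrm{lc}}$, let $\mathbb L F$ be the following virtual double category. (a) Objects are pairs $(K,x)$ with $K\in\mathscr K$ and $x\in FK$. (b) Vertical morphisms $(K,x)\to(L,y)$ are 1-cells $f\colon K\to L$ of $\mathscr K$ with $(Ff)x=y$. (c) There is exactly one horizontal morphism $(K,x)\nrightarrow(K',x')$ if $K=K'$, and none otherwise. (d) For objects $(K,x_0),\dots,(K,x_n)$ and $(L,y),(L,y')$ and vertical morphisms $f\colon(K,x_0)\to(L,y)$, $f'\colon(K,x_n)\to(L,y')$, the multicells from the path of horizontal morphisms $(K,x_0)\nrightarrow\cdots\nrightarrow(K,x_n)$ to the horizontal morphism $(L,y)\nrightarrow(L,y')$ over $(f,f')$ are the 2-cells $f\to f'$ in $\mathscr K$. Identity cells are given by identity 2-cells, and composition of multicells by pasting of 2-cells in $\mathscr K$: if $\theta_i\colon f_{i-1}\to f_i$ ($1\le i\le m$) and $\kappa\colon g\to g'$ are the 2-cells corresponding to composable multicells, then $\kappa\circ(\theta_1,\dots,\theta_m)$ corresponds to the horizontal composite of $\kappa$ with the vertical composite $\theta_m\cdots\theta_1\colon f_0\to f_m$, and if $m=0$ then $\kappa\circ(f)$ corresponds to the whiskering $\kappa f$. Then this construction $F\mapsto\mathbb L F$ gives rise to a left 2-adjoint $\mathbb L\colon 2\text{-}\mathbf{CAT}/\mathbf{Set}_{\mathrm{lc}}\to\mathbf{VDBL}$ of the 2-functor $\mathrm{Enr}_1\colon\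mathbf{VDBL}\to2\text{-}\mathbf{CAT}/\mathrm{Enr}(1)=2\text{-}\mathbf{CAT}/\mathbf{Set}_{\mathrm{lc}}$.
   Context: Size: fix Grothendieck universes $\mathcal U_1\in\mathcal U_2$; small means in $\mathcal U_1$, large means in $\mathcal U_2$. $2\text{-}\mathbf{CAT}$ is the 2-category of large 2-categories, 2-functors and 2-natural transformations; slices $\mathscr L/L$ are strict slice 2-categories. $\mathbf{Set}$ is the category of small sets, and $\mathbf{Set}_{\mathrm{lc}}$ is the locally chaotic 2-category with underlying category $\mathbf{Set}$ (exactly one 2-cell between any two parallel functions). Virtual double categories. A virtual double category $\mathbb A$ consists of: a category $\mathbb A_{\mathrm{vert}}$, whose objects and morphisms are the objects and vertical morphisms of $\mathbb A$; for each pair of objects a set of horizontal morphisms $\Gamma\colon A\nrightarrow A'$; for each $n\ge0$, each path of horizontal morphisms $\Gamma_i\colon A_{i-1}\nrightarrow A_i$ ($1\le i\le n$), each $\Delta\colon B\nrightarrow B'$ and vertical $u\colon A_0\to B$, $u'\colon A_n\to B'$, a set of multicells, written $\theta\colon(\Gamma_1,\dots,\Gamma_n)\Rightarrow\Delta$ over $(u,u')$ (for $n=0$ the top is a single object $A_0$; a cell is a multicell with $n=1$); identity cells $\mathrm{id}_\Gamma\colon(\Gamma)\Rightarrow\Gamma$ over identities; composites: for $\theta_i\colon(\Gamma_{i,1},\dots,\Gamma_{i,n_i})\Rightarrow\Delta_i$ over $(u_{i-1},u_i)$ ($1\le i\le m$) and $\kappa\colon(\Delta_1,\dots,\Delta_m)\Rightarrow\Lambda$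 over $(v,v')$, a multicell $\kappa\circ(\theta_1,\dots,\theta_m)\colon(\Gamma_{1,1},\dots,\Gamma_{m,n_m})\Rightarrow\Lambda$ over $(vu_0,v'u_m)$; for $m=0$, given $\kappa\colon()\Rightarrow\Lambda$ over $(v,v')$ with top $B$ and vertical $u\colon A\to B$, a composite $\kappa\circ(u)$ over $(vu,v'u)$. Evident unit and associativity axioms hold. A virtual double functor $F\colon\mathbb A\to\mathbb B$ sends objects, vertical and horizontal morphisms and multicells to those of $\mathbb B$, compatibly with boundaries, functorially on vertical morphisms, and preserving identity cells and composites. A vertical transformation $\alpha\colon F\to G$ consists of a natural transformation $F_{\mathrm{vert}}\to G_{\mathrm{vert}}$ with components $\alpha_A\colon FA\to GA$, and cells $\alpha_\Gamma\colon(F\Gamma)\Rightarrow G\Gamma$ over $(\alpha_A,\alpha_{A'})$ for $\Gamma\colon A\nrightarrow A'$, with $\alpha_\Gamma\circ(F\theta)=G\theta\circ(\alpha_{\Gamma_1},\dots,\alpha_{\Gamma_n})$ for each multicell $\theta\colon(\Gamma_1,\dots,\Gamma_n)\Rightarrow\Gamma$ (for $n=0$ the right side is $G\theta\circ(\alpha_{A_0})$). Large virtual double categories, virtual double functors and vertical transformations form the 2-category $\mathbf{VDBL}$; $1$ is its terminal object. Enrichment. An $\mathbb A$-category $\mathsf C$ has: a set $\mathrm{ob}(\mathsf C)$; for each $c$ an object $|c|$ of $\mathbb A$ (its extent); horizontal morphisms $\mathsf C(c,c')\colon|c|\nrightarrow|c'|$; multicells $\eta_c\colon()\Rightarrow\mathsf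 C(c,c)$ and $\mu_{c_0,c_1,c_2}\colon(\mathsf C(c_0,c_1),\mathsf C(c_1,c_2))\Rightarrow\mathsf C(c_0,c_2)$ over identities, satisfying the unit laws $\mu\circ(\eta_c,\mathrm{id})=\mathrm{id}=\mu\circ(\mathrm{id},\eta_{c'})$ and the associativity law $\mu\circ(\mu,\mathrm{id})=\mu\circ(\mathrm{id},\mu)$; it is small if $\mathrm{ob}(\mathsf C)$ is. An $\mathbb A$-functor $f\colon\mathsf C\to\mathsf D$ has a function $\mathrm{ob}(\mathsf C)\to\mathrm{ob}(\mathsf D)$, $c\mapsto fc$, vertical morphisms $f_c\colon|c|\to|fc|$ and cells $\omega^f_{c,c'}\colon(\mathsf C(c,c'))\Rightarrow\mathsf D(fc,fc')$ over $(f_c,f_{c'})$ with $\omega^f_{c,c}\circ(\eta_c)=\eta_{fc}\circ(f_c)$ and $\omega^f_{c_0,c_2}\circ(\mu)=\mu\circ(\omega^f_{c_0,c_1},\omega^f_{c_1,c_2})$. An $\mathbb A$-natural transformation $\alpha\colon f\to f'$ is a family of multicells $\alpha_c\colon()\Rightarrow\mathsf D(fc,f'c)$ over $(f_c,f'_c)$ with $\mu\circ(\alpha_c,\omega^{f'}_{c,c'})=\mu\circ(\omega^f_{c,c'},\alpha_{c'})$. Composition: $(gf)_c=g_{fc}f_c$, $\omega^{gf}=\omega^g\circ(\omega^f)$; $(\beta\alpha)_c=\mu\circ(\alpha_c,\beta_c)$ with identities $\eta_{fc}\circ(f_c)$; whiskerings $(g\alpha)_c=\omega^g\circ(\alpha_c)$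 and $(\alpha h)_b=\alpha_{hb}\circ(h_b)$. Small $\mathbb A$-categories, $\mathbb A$-functors and $\mathbb A$-natural transformations form a 2-category $\mathbb A\text{-}\mathbf{Cat}$; $\mathbb A\mapsto\mathbb A\text{-}\mathbf{Cat}$ extends in the evident way (applying virtual double functors and vertical transformations to all data) to a 2-functor $\mathrm{Enr}\colon\mathbf{VDBL}\to2\text{-}\mathbf{CAT}$. $\mathrm{Enr}(1)=\mathbf{Set}_{\mathrm{lc}}$. The 2-functor $\mathrm{Enr}_1\colon\mathbf{VDBL}\to2\text{-}\mathbf{CAT}/\mathrm{Enr}(1)$ sends $\mathbb A$ to $\mathrm{Enr}(!_{\mathbb A})$, i.e. to $\mathrm{ob}\colon\mathbb A\text{-}\mathbf{Cat}\to\mathbf{Set}_{\mathrm{lc}}$. *)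

theory Defs
  imports Main "HOL-Library.FuncSet"
begin

section \<open>Ambient set theory and Grothendieck universes\<close>

text \<open>A type of class \<open>zf\<close> is a model of second-order ZF: its elements are the sets, and
  \<open>elts a\<close> is the extension of the set \<open>a\<close>. (Choice is inherited from HOL.)\<close>

class zf =
  fixes elts :: "'a \<Rightarrow> 'a set"
  assumes elts_inject: "elts a = elts b \<Longrightarrow> a = b"
    and zf_foundation: "wf {(x, y). x \<in> elts y}"
    and zf_separation: "X \<subseteq> elts a \<Longrightarrow> \<exists>b. elts b = X"
    and zf_pairing: "\<exists>c. elts c = {a, b}"
    and zf_union: "\<exists>b. elts b = \<Union> (elts ` elts a)"
    and zf_power: "\<exists>b. elts b = {c. elts c \<subseteq> elts a}"
    and zf_replacement: "\<exists>b. elts b = f ` elts a"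
    and zf_infinity: "\<exists>a. infinite (elts a)"

definition vset :: "'v::zf set \<Rightarrow> 'v" where
  "vset X = (THE a. elts a = X)"

text \<open>The requirement of an infinite member excludes the degenerate universes: the empty one and
  that of the hereditarily finite sets.\<close>

definition grothendieck_universe :: "'v::zf \<Rightarrow> bool" where
  "grothendieck_universe U \<longleftrightarrow>
     (\<forall>x \<in> elts U. elts x \<subseteq> elts U) \<and>
     (\<forall>x \<in> elts U. \<forall>y \<in> elts U. vset {x, y} \<in> elts U) \<and>
     (\<forall>x \<in> elts U. vset {y. elts y \<subseteq> elts x} \<in> elts U) \<and>
     (\<forall>i \<in> elts U. \<forall>f \<in> elts i \<rightarrow> elts U. vset (\<Union>j \<in> elts i. elts (f j)) \<in> elts U) \<and>
     (\<exists>x \<in> elts U. infinite (elts x))"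

definition set_in :: "'v::zf \<Rightarrow> 'v set \<Rightarrow> bool" where
  "set_in U X \<longleftrightarrow> (\<exists>a \<in> elts U. elts a = X)"

definition vempty :: "'v::zf" where
  "vempty = vset {}"

definition vpair :: "'v::zf \<Rightarrow> 'v \<Rightarrow> 'v" where
  "vpair x y = vset {vset {x}, vset {x, y}}"

definition vfst :: "'v::zf \<Rightarrow> 'v" where
  "vfst p = (THE x. \<exists>y. p = vpair x y)"

definition vsnd :: "'v::zf \<Rightarrow> 'v" where
  "vsnd p = (THE y. \<exists>x. p = vpair x y)"

definition vlam :: "'v::zf set \<Rightarrow> ('v \<Rightarrow> 'v) \<Rightarrow> 'v" where
  "vlam D f = vset ((\<lambda>x. vpair x (f x)) ` D)"

definition vapp :: "'v::zf \<Rightarrow> 'v \<Rightarrow> 'v" where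
  "vapp g x = (THE y. vpair x y \<in> elts g)"


section \<open>2-categories\<close>

text \<open>Hom-sets are indexed families that need not be disjoint, so operations take the boundary as
  arguments. \<open>Cmp1 K A B C g f\<close> is \<open>gf\<close> for \<open>f: A \<rightarrow> B\<close> and \<open>g: B \<rightarrow> C\<close>.
  \<open>Vc K A B f g h \<beta> \<alpha>\<close> is the vertical composite of \<open>\<alpha>: f \<rightarrow> g\<close> and \<open>\<beta>: g \<rightarrow> h\<close>.
  \<open>Hc K A B C f f' g g' \<beta> \<alpha>: gf \<rightarrow> g'f'\<close> is the horizontal composite of \<open>\<alpha>: f \<rightarrow> f'\<close> (from A to B)
  and \<open>\<beta>: g \<rightarrow> g'\<close> (from B to C). Values outside the carriers are irrelevant.\<close>

record ('o, 'a, 'c) two_cat =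
  Ob :: "'o set"
  Hom1 :: "'o \<Rightarrow> 'o \<Rightarrow> 'a set"
  Hom2 :: "'o \<Rightarrow> 'o \<Rightarrow> 'a \<Rightarrow> 'a \<Rightarrow> 'c set"
  Id1 :: "'o \<Rightarrow> 'a"
  Cmp1 :: "'o \<Rightarrow> 'o \<Rightarrow> 'o \<Rightarrow> 'a \<Rightarrow> 'a \<Rightarrow> 'a"
  Id2 :: "'o \<Rightarrow> 'o \<Rightarrow> 'a \<Rightarrow> 'c"
  Vc :: "'o \<Rightarrow> 'o \<Rightarrow> 'a \<Rightarrow> 'a \<Rightarrow> 'a \<Rightarrow> 'c \<Rightarrow> 'c \<Rightarrow> 'c"
  Hc :: "'o \<Rightarrow> 'o \<Rightarrow> 'o \<Rightarrow> 'a \<Rightarrow> 'a \<Rightarrow> 'a \<Rightarrow> 'a \<Rightarrow> 'c \<Rightarrow> 'c \<Rightarrow> 'c"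

locale two_category =
  fixes K :: "('o, 'a, 'c) two_cat"
  assumes id1: "A \<in> Ob K \<Longrightarrow> Id1 K A \<in> Hom1 K A A"
    and cmp1: "\<lbrakk>A \<in> Ob K; B \<in> Ob K; C \<in> Ob K; f \<in> Hom1 K A B; g \<in> Hom1 K B C\<rbrakk>
      \<Longrightarrow> Cmp1 K A B C g f \<in> Hom1 K A C"
    and cmp1_id_right: "\<lbrakk>A \<in> Ob K; B \<in> Ob K; f \<in> Hom1 K A B\<rbrakk>
      \<Longrightarrow> Cmp1 K A A B f (Id1 K A) = f"
    and cmp1_id_left: "\<lbrakk>A \<in> Ob K; B \<in> Ob K; f \<in> Hom1 K A B\<rbrakk>
      \<Longrightarrow> Cmp1 K A B B (Id1 K B) f = f"
    and cmp1_assoc: "\<lbrakk>A \<in> Ob K; B \<in> Ob K; C \<in> Ob K; D \<in> Ob K;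
        f \<in> Hom1 K A B; g \<in> Hom1 K B C; h \<in> Hom1 K C D\<rbrakk>
      \<Longrightarrow> Cmp1 K A B D (Cmp1 K B C D h g) f = Cmp1 K A C D h (Cmp1 K A B C g f)"
    and id2: "\<lbrakk>A \<in> Ob K; B \<in> Ob K; f \<in> Hom1 K A B\<rbrakk> \<Longrightarrow> Id2 K A B f \<in> Hom2 K A B f f"
    and vc: "\<lbrakk>A \<in> Ob K; B \<in> Ob K; f \<in> Hom1 K A B; g \<in> Hom1 K A B; h \<in> Hom1 K A B;
        \<alpha> \<in> Hom2 K A B f g; \<beta> \<in> Hom2 K A B g h\<rbrakk>
      \<Longrightarrow> Vc K A B f g h \<beta> \<alpha> \<in> Hom2 K A B f h"
    and vc_id_right: "\<lbrakk>A \<in> Ob K; B \<in> Ob K; f \<in> Hom1 K A B; g \<in> Hom1 K A B; \<alpha> \<in> Hom2 K A B f g\<rbrakk>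
      \<Longrightarrow> Vc K A B f f g \<alpha> (Id2 K A B f) = \<alpha>"
    and vc_id_left: "\<lbrakk>A \<in> Ob K; B \<in> Ob K; f \<in> Hom1 K A B; g \<in> Hom1 K A B; \<alpha> \<in> Hom2 K A B f g\<rbrakk>
      \<Longrightarrow> Vc K A B f g g (Id2 K A B g) \<alpha> = \<alpha>"
    and vc_assoc: "\<lbrakk>A \<in> Ob K; B \<in> Ob K;
        f \<in> Hom1 K A B; g \<in> Hom1 K A B; h \<in> Hom1 K A B; k \<in> Hom1 K A B;
        \<alpha> \<in> Hom2 K A B f g; \<beta> \<in> Hom2 K A B g h; \<gamma> \<in> Hom2 K A B h k\<rbrakk>
      \<Longrightarrow> Vc K A B f g k (Vc K A B g h k \<gamma> \<beta>) \<alpha> = Vc K A B f h k \<gamma> (Vc K A B f g h \<beta> \<alpha>)"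
    and hc: "\<lbrakk>A \<in> Ob K; B \<in> Ob K; C \<in> Ob K;
        f \<in> Hom1 K A B; f' \<in> Hom1 K A B; g \<in> Hom1 K B C; g' \<in> Hom1 K B C;
        \<alpha> \<in> Hom2 K A B f f'; \<beta> \<in> Hom2 K B C g g'\<rbrakk>
      \<Longrightarrow> Hc K A B C f f' g g' \<beta> \<alpha> \<in> Hom2 K A C (Cmp1 K A B C g f) (Cmp1 K A B C g' f')"
    and hc_id2: "\<lbrakk>A \<in> Ob K; B \<in> Ob K; C \<in> Ob K; f \<in> Hom1 K A B; g \<in> Hom1 K B C\<rbrakk>
      \<Longrightarrow> Hc K A B C f f g g (Id2 K B C g) (Id2 K A B f) = Id2 K A C (Cmp1 K A B C g f)"
    and interchange: "\<lbrakk>A \<in> Ob K; B \<in> Ob K; C \<in> Ob K;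
        f \<in> Hom1 K A B; f' \<in> Hom1 K A B; f'' \<in> Hom1 K A B;
        g \<in> Hom1 K B C; g' \<in> Hom1 K B C; g'' \<in> Hom1 K B C;
        \<alpha> \<in> Hom2 K A B f f'; \<alpha>' \<in> Hom2 K A B f' f'';
        \<beta> \<in> Hom2 K B C g g'; \<beta>' \<in> Hom2 K B C g' g''\<rbrakk>
      \<Longrightarrow> Hc K A B C f f'' g g'' (Vc K B C g g' g'' \<beta>' \<beta>) (Vc K A B f f' f'' \<alpha>' \<alpha>)
        = Vc K A C (Cmp1 K A B C g f) (Cmp1 K A B C g' f') (Cmp1 K A B C g'' f'')
            (Hc K A B C f' f'' g' g'' \<beta>' \<alpha>') (Hc K A B C f f' g g' \<beta> \<alpha>)"
    and hc_id_right: "\<lbrakk>A \<in> Ob K; B \<in> Ob K; f \<in> Hom1 K A B; g \<in> Hom1 K A B; \<alpha> \<in> Hom2 K A B f g\<rbrakk>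
      \<Longrightarrow> Hc K A A B (Id1 K A) (Id1 K A) f g \<alpha> (Id2 K A A (Id1 K A)) = \<alpha>"
    and hc_id_left: "\<lbrakk>A \<in> Ob K; B \<in> Ob K; f \<in> Hom1 K A B; g \<in> Hom1 K A B; \<alpha> \<in> Hom2 K A B f g\<rbrakk>
      \<Longrightarrow> Hc K A B B f g (Id1 K B) (Id1 K B) (Id2 K B B (Id1 K B)) \<alpha> = \<alpha>"
    and hc_assoc: "\<lbrakk>A \<in> Ob K; B \<in> Ob K; C \<in> Ob K; D \<in> Ob K;
        f \<in> Hom1 K A B; f' \<in> Hom1 K A B; g \<in> Hom1 K B C; g' \<in> Hom1 K B C;
        h \<in> Hom1 K C D; h' \<in> Hom1 K C D;
        \<alpha> \<in> Hom2 K A B f f'; \<beta> \<in> Hom2 K B C g g'; \<gamma> \<in> Hom2 K C D h h'\<rbrakk>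
      \<Longrightarrow> Hc K A B D f f' (Cmp1 K B C D h g) (Cmp1 K B C D h' g') (Hc K B C D g g' h h' \<gamma> \<beta>) \<alpha>
        = Hc K A C D (Cmp1 K A B C g f) (Cmp1 K A B C g' f') h h' \<gamma> (Hc K A B C f f' g g' \<beta> \<alpha>)"

record ('o, 'a, 'c, 'p, 'b, 'd) two_fun =
  Fo :: "'o \<Rightarrow> 'p"
  F1 :: "'o \<Rightarrow> 'o \<Rightarrow> 'a \<Rightarrow> 'b"
  F2 :: "'o \<Rightarrow> 'o \<Rightarrow> 'a \<Rightarrow> 'a \<Rightarrow> 'c \<Rightarrow> 'd"

text \<open>Morphisms are normalised to \<open>undefined\<close> outside their domain, so that equality in HOL is
  equality of 2-functors; likewise for all morphisms below.\<close>

definition mk_two_fun :: "('o, 'a, 'c) two_cat \<Rightarrow> ('o \<Rightarrow> 'p) \<Rightarrow> ('o \<Rightarrow> 'o \<Rightarrow> 'a \<Rightarrow> 'b) \<Rightarrow>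
    ('o \<Rightarrow> 'o \<Rightarrow> 'a \<Rightarrow> 'a \<Rightarrow> 'c \<Rightarrow> 'd) \<Rightarrow> ('o, 'a, 'c, 'p, 'b, 'd) two_fun" where
  "mk_two_fun K fo f1 f2 = \<lparr>
     Fo = (\<lambda>A. if A \<in> Ob K then fo A else undefined),
     F1 = (\<lambda>A B f. if A \<in> Ob K \<and> B \<in> Ob K \<and> f \<in> Hom1 K A B then f1 A B f else undefined),
     F2 = (\<lambda>A B f g \<alpha>. if A \<in> Ob K \<and> B \<in> Ob K \<and> f \<in> Hom1 K A B \<and> g \<in> Hom1 K A B \<and>
                \<alpha> \<in> Hom2 K A B f g then f2 A B f g \<alpha> else undefined) \<rparr>"

locale two_functor =
  fixes K :: "('o, 'a, 'c) two_cat" and L :: "('p, 'b, 'd) two_cat"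
    and F :: "('o, 'a, 'c, 'p, 'b, 'd) two_fun"
  assumes normal: "F = mk_two_fun K (Fo F) (F1 F) (F2 F)"
    and fo: "A \<in> Ob K \<Longrightarrow> Fo F A \<in> Ob L"
    and f1: "\<lbrakk>A \<in> Ob K; B \<in> Ob K; f \<in> Hom1 K A B\<rbrakk> \<Longrightarrow> F1 F A B f \<in> Hom1 L (Fo F A) (Fo F B)"
    and f1_id: "A \<in> Ob K \<Longrightarrow> F1 F A A (Id1 K A) = Id1 L (Fo F A)"
    and f1_cmp: "\<lbrakk>A \<in> Ob K; B \<in> Ob K; C \<in> Ob K; f \<in> Hom1 K A B; g \<in> Hom1 K B C\<rbrakk>
      \<Longrightarrow> F1 F A C (Cmp1 K A B C g f)
        = Cmp1 L (Fo F A) (Fo F B) (Fo F C) (F1 F B C g) (F1 F A B f)"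
    and f2: "\<lbrakk>A \<in> Ob K; B \<in> Ob K; f \<in> Hom1 K A B; g \<in> Hom1 K A B; \<alpha> \<in> Hom2 K A B f g\<rbrakk>
      \<Longrightarrow> F2 F A B f g \<alpha> \<in> Hom2 L (Fo F A) (Fo F B) (F1 F A B f) (F1 F A B g)"
    and f2_id: "\<lbrakk>A \<in> Ob K; B \<in> Ob K; f \<in> Hom1 K A B\<rbrakk>
      \<Longrightarrow> F2 F A B f f (Id2 K A B f) = Id2 L (Fo F A) (Fo F B) (F1 F A B f)"
    and f2_vc: "\<lbrakk>A \<in> Ob K; B \<in> Ob K; f \<in> Hom1 K A B; g \<in> Hom1 K A B; h \<in> Hom1 K A B;
        \<alpha> \<in> Hom2 K A B f g; \<beta> \<in> Hom2 K A B g h\<rbrakk>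
      \<Longrightarrow> F2 F A B f h (Vc K A B f g h \<beta> \<alpha>)
        = Vc L (Fo F A) (Fo F B) (F1 F A B f) (F1 F A B g) (F1 F A B h)
            (F2 F A B g h \<beta>) (F2 F A B f g \<alpha>)"
    and f2_hc: "\<lbrakk>A \<in> Ob K; B \<in> Ob K; C \<in> Ob K;
        f \<in> Hom1 K A B; f' \<in> Hom1 K A B; g \<in> Hom1 K B C; g' \<in> Hom1 K B C;
        \<alpha> \<in> Hom2 K A B f f'; \<beta> \<in> Hom2 K B C g g'\<rbrakk>
      \<Longrightarrow> F2 F A C (Cmp1 K A B C g f) (Cmp1 K A B C g' f') (Hc K A B C f f' g g' \<beta> \<alpha>)
        = Hc L (Fo F A) (Fo F B) (Fo F C) (F1 F A B f) (F1 F A B f') (F1 F B C g) (F1 F B C g')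
            (F2 F B C g g' \<beta>) (F2 F A B f f' \<alpha>)"

definition id_two_fun :: "('o, 'a, 'c) two_cat \<Rightarrow> ('o, 'a, 'c, 'o, 'a, 'c) two_fun" where
  "id_two_fun K = mk_two_fun K (\<lambda>A. A) (\<lambda>A B f. f) (\<lambda>A B f g \<alpha>. \<alpha>)"

definition cmp_two_fun :: "('o, 'a, 'c) two_cat \<Rightarrow> ('p, 'b, 'd, 'q, 'e, 'f) two_fun \<Rightarrow>
    ('o, 'a, 'c, 'p, 'b, 'd) two_fun \<Rightarrow> ('o, 'a, 'c, 'q, 'e, 'f) two_fun" where
  "cmp_two_fun K G F = mk_two_fun K
     (\<lambda>A. Fo G (Fo F A))
     (\<lambda>A B f. F1 G (Fo F A) (Fo F B) (F1 F A B f))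
     (\<lambda>A B f g \<alpha>. F2 G (Fo F A) (Fo F B) (F1 F A B f) (F1 F A B g) (F2 F A B f g \<alpha>))"

locale two_nat =
  fixes K :: "('o, 'a, 'c) two_cat" and L :: "('p, 'b, 'd) two_cat"
    and F G :: "('o, 'a, 'c, 'p, 'b, 'd) two_fun" and \<sigma> :: "'o \<Rightarrow> 'b"
  assumes normal: "\<sigma> \<in> extensional (Ob K)"
    and comp: "A \<in> Ob K \<Longrightarrow> \<sigma> A \<in> Hom1 L (Fo F A) (Fo G A)"
    and nat1: "\<lbrakk>A \<in> Ob K; B \<in> Ob K; f \<in> Hom1 K A B\<rbrakk>
      \<Longrightarrow> Cmp1 L (Fo F A) (Fo F B) (Fo G B) (\<sigma> B) (F1 F A B f)
        = Cmp1 L (Fo F A) (Fo G A) (Fo G B) (F1 G A B f) (\<sigma> A)"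
    and nat2: "\<lbrakk>A \<in> Ob K; B \<in> Ob K; f \<in> Hom1 K A B; g \<in> Hom1 K A B; \<alpha> \<in> Hom2 K A B f g\<rbrakk>
      \<Longrightarrow> Hc L (Fo F A) (Fo F B) (Fo G B) (F1 F A B f) (F1 F A B g) (\<sigma> B) (\<sigma> B)
            (Id2 L (Fo F B) (Fo G B) (\<sigma> B)) (F2 F A B f g \<alpha>)
        = Hc L (Fo F A) (Fo G A) (Fo G B) (\<sigma> A) (\<sigma> A) (F1 G A B f) (F1 G A B g)
            (F2 G A B f g \<alpha>) (Id2 L (Fo F A) (Fo G A) (\<sigma> A))"

definition large_two_cat :: "'v::zf \<Rightarrow> ('v, 'v, 'v) two_cat \<Rightarrow> bool" where
  "large_two_cat U K \<longleftrightarrow> set_in U (Ob K) \<and>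
     (\<forall>A \<in> Ob K. \<forall>B \<in> Ob K. set_in U (Hom1 K A B) \<and>
       (\<forall>f \<in> Hom1 K A B. \<forall>g \<in> Hom1 K A B. set_in U (Hom2 K A B f g)))"

definition two_CAT :: "'v::zf \<Rightarrow>
    (('v, 'v, 'v) two_cat, ('v, 'v, 'v, 'v, 'v, 'v) two_fun, 'v \<Rightarrow> 'v) two_cat" where
  "two_CAT U = \<lparr>
     Ob = {K. two_category K \<and> large_two_cat U K},
     Hom1 = (\<lambda>K L. {F. two_functor K L F}),
     Hom2 = (\<lambda>K L F G. {\<sigma>. two_nat K L F G \<sigma>}),
     Id1 = id_two_fun,
     Cmp1 = (\<lambda>K L M G F. cmp_two_fun K G F),
     Id2 = (\<lambda>K L F. \<lambda>A \<in> Ob K. Id1 L (Fo F A)),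
     Vc = (\<lambda>K L F G H \<tau> \<sigma>. \<lambda>A \<in> Ob K. Cmp1 L (Fo F A) (Fo G A) (Fo H A) (\<tau> A) (\<sigma> A)),
     Hc = (\<lambda>K L M F F' G G' \<tau> \<sigma>. \<lambda>A \<in> Ob K.
       Cmp1 M (Fo G (Fo F A)) (Fo G (Fo F' A)) (Fo G' (Fo F' A))
         (\<tau> (Fo F' A)) (F1 G (Fo F A) (Fo F' A) (\<sigma> A))) \<rparr>"

text \<open>The strict slice of a 2-category over an object: triangles commute on the nose, and 2-cells
  become identities after whiskering with the projection.\<close>

definition slice :: "('o, 'a, 'c) two_cat \<Rightarrow> 'o \<Rightarrow> ('o \<times> 'a, 'a, 'c) two_cat" where
  "slice C X = \<lparr>
     Ob = {(A, p). A \<in> Ob C \<and> p \<in> Hom1 C A X},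
     Hom1 = (\<lambda>(A, p) (B, q). {f \<in> Hom1 C A B. Cmp1 C A B X q f = p}),
     Hom2 = (\<lambda>(A, p) (B, q) f g.
       {\<alpha> \<in> Hom2 C A B f g. Hc C A B X f g q q (Id2 C B X q) \<alpha> = Id2 C A X p}),
     Id1 = (\<lambda>(A, p). Id1 C A),
     Cmp1 = (\<lambda>(A, p) (B, q) (D, r) g f. Cmp1 C A B D g f),
     Id2 = (\<lambda>(A, p) (B, q) f. Id2 C A B f),
     Vc = (\<lambda>(A, p) (B, q) f g h \<beta> \<alpha>. Vc C A B f g h \<beta> \<alpha>),
     Hc = (\<lambda>(A, p) (B, q) (D, r) f f' g g' \<beta> \<alpha>. Hc C A B D f f' g g' \<beta> \<alpha>) \<rparr>"

text \<open>\<open>L\<close> is left 2-adjoint to \<open>R\<close>: there are 2-natural \<open>\<eta>: 1 \<rightarrow> RL\<close> and \<open>\<epsilon>: LR \<rightarrow> 1\<close>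
  satisfying the triangle identities.\<close>

definition left_two_adjoint :: "('o, 'a, 'c) two_cat \<Rightarrow> ('p, 'b, 'd) two_cat \<Rightarrow>
    ('o, 'a, 'c, 'p, 'b, 'd) two_fun \<Rightarrow> ('p, 'b, 'd, 'o, 'a, 'c) two_fun \<Rightarrow> bool" where
  "left_two_adjoint C D L R \<longleftrightarrow>
     two_category C \<and> two_category D \<and> two_functor C D L \<and> two_functor D C R \<and>
     (\<exists>\<eta> \<epsilon>.
        two_nat C C (id_two_fun C) (cmp_two_fun C R L) \<eta> \<and>
        two_nat D D (cmp_two_fun D L R) (id_two_fun D) \<epsilon> \<and>
        (\<forall>X \<in> Ob C. Cmp1 D (Fo L X) (Fo L (Fo R (Fo L X))) (Fo L X)
           (\<epsilon> (Fo L X)) (F1 L X (Fo R (Fo L X)) (\<eta> X)) = Id1 D (Fo L X)) \<and>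
        (\<forall>Y \<in> Ob D. Cmp1 C (Fo R Y) (Fo R (Fo L (Fo R Y))) (Fo R Y)
           (F1 R (Fo L (Fo R Y)) Y (\<epsilon> Y)) (\<eta> (Fo R Y)) = Id1 C (Fo R Y)))"

text \<open>The locally chaotic 2-category of small sets; functions are given by their graphs.\<close>

definition Set_lc :: "'v::zf \<Rightarrow> ('v, 'v, 'v) two_cat" where
  "Set_lc U = \<lparr>
     Ob = elts U,
     Hom1 = (\<lambda>X Y. {vlam (elts X) f | f. f \<in> elts X \<rightarrow> elts Y}),
     Hom2 = (\<lambda>X Y f g. {vempty}),
     Id1 = (\<lambda>X. vlam (elts X) (\<lambda>x. x)),
     Cmp1 = (\<lambda>X Y Z g f. vlam (elts X) (\<lambda>x. vapp g (vapp f x))),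
     Id2 = (\<lambda>X Y f. vempty),
     Vc = (\<lambda>X Y f g h \<beta> \<alpha>. vempty),
     Hc = (\<lambda>X Y Z f f' g g' \<beta> \<alpha>. vempty) \<rparr>"


section \<open>Virtual double categories\<close>

text \<open>A horizontal morphism together with its boundary.\<close>

datatype ('o, 'h) hmor = HMor (hsrc: 'o) (hlab: 'h) (htgt: 'o)

text \<open>A multicell \<open>bcell\<close> with top path \<open>btop\<close>, bottom \<open>bbot\<close> and right-hand vertical morphism
  \<open>bvert\<close>. A composable row \<open>(\<theta>\<^sub>1, \<dots>, \<theta>\<^sub>m)\<close> over \<open>(u\<^sub>0, \<dots>, u\<^sub>m)\<close> is given by the leftmost vertical
  morphism \<open>u\<^sub>0: a \<rightarrow> b\<close> and a list of \<open>m\<close> blocks; for \<open>m = 0\<close> it is just \<open>u\<^sub>0\<close>.\<close>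

datatype ('o, 'v, 'h, 'm) block =
  Block (btop: "('o, 'h) hmor list") (bcell: 'm) (bbot: "('o, 'h) hmor") (bvert: 'v)

text \<open>A path is given by its starting object and the list of its horizontal morphisms.
  \<open>MCell A a \<Gamma>s \<Delta> u u'\<close> is the set of multicells from the path \<open>\<Gamma>s\<close> starting at \<open>a\<close> to \<open>\<Delta>\<close>
  over \<open>(u, u')\<close>. \<open>MCmp A a b u bs \<Lambda> v v' \<kappa>\<close> is \<open>\<kappa> \<circ> (\<theta>\<^sub>1, \<dots>, \<theta>\<^sub>m)\<close> for the row
  \<open>(u: a \<rightarrow> b, bs)\<close> and a multicell \<open>\<kappa>\<close> to \<open>\<Lambda>\<close> over \<open>(v, v')\<close>; for \<open>bs = []\<close> it is \<open>\<kappa> \<circ> (u)\<close>.\<close>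

record ('o, 'v, 'h, 'm) vdc =
  VOb :: "'o set"
  VHom :: "'o \<Rightarrow> 'o \<Rightarrow> 'v set"
  HHom :: "'o \<Rightarrow> 'o \<Rightarrow> 'h set"
  MCell :: "'o \<Rightarrow> ('o, 'h) hmor list \<Rightarrow> ('o, 'h) hmor \<Rightarrow> 'v \<Rightarrow> 'v \<Rightarrow> 'm set"
  VId :: "'o \<Rightarrow> 'v"
  VCmp :: "'o \<Rightarrow> 'o \<Rightarrow> 'o \<Rightarrow> 'v \<Rightarrow> 'v \<Rightarrow> 'v"
  MId :: "('o, 'h) hmor \<Rightarrow> 'm"
  MCmp :: "'o \<Rightarrow> 'o \<Rightarrow> 'v \<Rightarrow> ('o, 'v, 'h, 'm) block list \<Rightarrow> ('o, 'h) hmor \<Rightarrow> 'v \<Rightarrow> 'v \<Rightarrow> 'm \<Rightarrow> 'm"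

definition is_hmor :: "('o, 'v, 'h, 'm) vdc \<Rightarrow> ('o, 'h) hmor \<Rightarrow> bool" where
  "is_hmor A \<Gamma> \<longleftrightarrow> hsrc \<Gamma> \<in> VOb A \<and> htgt \<Gamma> \<in> VOb A \<and> hlab \<Gamma> \<in> HHom A (hsrc \<Gamma>) (htgt \<Gamma>)"

fun hpath :: "('o, 'v, 'h, 'm) vdc \<Rightarrow> 'o \<Rightarrow> ('o, 'h) hmor list \<Rightarrow> bool" where
  "hpath A a [] \<longleftrightarrow> a \<in> VOb A"
| "hpath A a (\<Gamma> # \<Gamma>s) \<longleftrightarrow> is_hmor A \<Gamma> \<and> hsrc \<Gamma> = a \<and> hpath A (htgt \<Gamma>) \<Gamma>s"

definition hend :: "'o \<Rightarrow> ('o, 'h) hmor list \<Rightarrow> 'o" where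
  "hend a \<Gamma>s = (if \<Gamma>s = [] then a else htgt (last \<Gamma>s))"

definition rvert :: "'v \<Rightarrow> ('o, 'v, 'h, 'm) block list \<Rightarrow> 'v" where
  "rvert u bs = (if bs = [] then u else bvert (last bs))"

abbreviation tops :: "('o, 'v, 'h, 'm) block list \<Rightarrow> ('o, 'h) hmor list" where
  "tops bs \<equiv> concat (map btop bs)"

abbreviation bots :: "('o, 'v, 'h, 'm) block list \<Rightarrow> ('o, 'h) hmor list" where
  "bots bs \<equiv> map bbot bs"

definition is_bdry :: "('o, 'v, 'h, 'm) vdc \<Rightarrow> 'o \<Rightarrow> ('o, 'h) hmor list \<Rightarrow> ('o, 'h) hmor \<Rightarrow>
    'v \<Rightarrow> 'v \<Rightarrow> bool" where
  "is_bdry A a \<Gamma>s \<Delta> u u' \<longleftrightarrow>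
     hpath A a \<Gamma>s \<and> is_hmor A \<Delta> \<and> u \<in> VHom A a (hsrc \<Delta>) \<and> u' \<in> VHom A (hend a \<Gamma>s) (htgt \<Delta>)"

fun row :: "('o, 'v, 'h, 'm) vdc \<Rightarrow> 'o \<Rightarrow> 'o \<Rightarrow> 'v \<Rightarrow> ('o, 'v, 'h, 'm) block list \<Rightarrow> bool" where
  "row A a b u [] \<longleftrightarrow> a \<in> VOb A \<and> b \<in> VOb A \<and> u \<in> VHom A a b"
| "row A a b u (Block \<Gamma>s \<theta> \<Delta> u' # bs) \<longleftrightarrow>
     is_bdry A a \<Gamma>s \<Delta> u u' \<and> hsrc \<Delta> = b \<and> \<theta> \<in> MCell A a \<Gamma>s \<Delta> u u' \<and>
     row A (hend a \<Gamma>s) (htgt \<Delta>) u' bs"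

text \<open>Used for associativity: a row \<open>(\<theta>\<^sub>i)\<close> from \<open>u: a \<rightarrow> b\<close>, where each \<open>\<theta>\<^sub>i\<close> is paired with the
  segment \<open>\<psi>s\<^sub>i\<close> of a row (from \<open>w: z \<rightarrow> a\<close>) composable with it, yields the row \<open>(\<theta>\<^sub>i \<circ> \<psi>s\<^sub>i)\<close>.\<close>

fun cmp_row :: "('o, 'v, 'h, 'm) vdc \<Rightarrow> 'o \<Rightarrow> 'o \<Rightarrow> 'o \<Rightarrow> 'v \<Rightarrow> 'v \<Rightarrow>
    (('o, 'v, 'h, 'm) block \<times> ('o, 'v, 'h, 'm) block list) list \<Rightarrow>
    ('o, 'v, 'h, 'm) block list" where
  "cmp_row A z a b w u [] = []"
| "cmp_row A z a b w u ((Block \<Gamma>s \<theta> \<Delta> u', \<psi>s) # gs) =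
     (let z' = hend z (tops \<psi>s); a' = hend a \<Gamma>s; w' = rvert w \<psi>s in
      Block (tops \<psi>s) (MCmp A z a w \<psi>s \<Delta> u u' \<theta>) \<Delta> (VCmp A z' a' (htgt \<Delta>) u' w')
        # cmp_row A z' a' (htgt \<Delta>) w' u' gs)"

locale virtual_double_category =
  fixes A :: "('o, 'v, 'h, 'm) vdc"
  assumes vid: "a \<in> VOb A \<Longrightarrow> VId A a \<in> VHom A a a"
    and vcmp: "\<lbrakk>a \<in> VOb A; b \<in> VOb A; c \<in> VOb A; u \<in> VHom A a b; v \<in> VHom A b c\<rbrakk>
      \<Longrightarrow> VCmp A a b c v u \<in> VHom A a c"
    and vcmp_id_right: "\<lbrakk>a \<in> VOb A; b \<in> VOb A; u \<in> VHom A a b\<rbrakk>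
      \<Longrightarrow> VCmp A a a b u (VId A a) = u"
    and vcmp_id_left: "\<lbrakk>a \<in> VOb A; b \<in> VOb A; u \<in> VHom A a b\<rbrakk>
      \<Longrightarrow> VCmp A a b b (VId A b) u = u"
    and vcmp_assoc: "\<lbrakk>a \<in> VOb A; b \<in> VOb A; c \<in> VOb A; d \<in> VOb A;
        u \<in> VHom A a b; v \<in> VHom A b c; w \<in> VHom A c d\<rbrakk>
      \<Longrightarrow> VCmp A a b d (VCmp A b c d w v) u = VCmp A a c d w (VCmp A a b c v u)"
    and mid: "is_hmor A \<Gamma>
      \<Longrightarrow> MId A \<Gamma> \<in> MCell A (hsrc \<Gamma>) [\<Gamma>] \<Gamma> (VId A (hsrc \<Gamma>)) (VId A (htgt \<Gamma>))"
    and mcmp: "\<lbrakk>row A a b u bs; is_bdry A b (bots bs) \<Lambda> v v'; \<kappa> \<in> MCell A b (bots bs) \<Lambda> v v'\<rbrakk>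
      \<Longrightarrow> MCmp A a b u bs \<Lambda> v v' \<kappa> \<in> MCell A a (tops bs) \<Lambda>
            (VCmp A a b (hsrc \<Lambda>) v u)
            (VCmp A (hend a (tops bs)) (hend b (bots bs)) (htgt \<Lambda>) v' (rvert u bs))"
    and mcmp_id_right: "\<lbrakk>is_bdry A b \<Delta>s \<Lambda> v v'; \<kappa> \<in> MCell A b \<Delta>s \<Lambda> v v'\<rbrakk>
      \<Longrightarrow> MCmp A b b (VId A b) (map (\<lambda>\<Delta>. Block [\<Delta>] (MId A \<Delta>) \<Delta> (VId A (htgt \<Delta>))) \<Delta>s) \<Lambda> v v' \<kappa> = \<kappa>"
    and mcmp_id_left: "\<lbrakk>is_bdry A a \<Gamma>s \<Delta> u u'; \<theta> \<in> MCell A a \<Gamma>s \<Delta> u u'\<rbrakk>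
      \<Longrightarrow> MCmp A a (hsrc \<Delta>) u [Block \<Gamma>s \<theta> \<Delta> u'] \<Delta> (VId A (hsrc \<Delta>)) (VId A (htgt \<Delta>)) (MId A \<Delta>) = \<theta>"
    and mcmp_assoc: "\<lbrakk>row A z a w (concat (map snd gs)); row A a b u (map fst gs);
        \<forall>(\<theta>, \<psi>s) \<in> set gs. bots \<psi>s = btop \<theta>;
        is_bdry A b (bots (map fst gs)) \<Lambda> v v'; \<kappa> \<in> MCell A b (bots (map fst gs)) \<Lambda> v v'\<rbrakk>
      \<Longrightarrow> MCmp A z b (VCmp A z a b u w) (cmp_row A z a b w u gs) \<Lambda> v v' \<kappa>
        = MCmp A z a w (concat (map snd gs)) \<Lambda>
            (VCmp A a b (hsrc \<Lambda>) v u)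
            (VCmp A (hend a (tops (map fst gs))) (hend b (bots (map fst gs))) (htgt \<Lambda>)
              v' (rvert u (map fst gs)))
            (MCmp A a b u (map fst gs) \<Lambda> v v' \<kappa>)"

record ('o, 'v, 'h, 'm, 'p, 'w, 'k, 'n) vd_fun =
  Go :: "'o \<Rightarrow> 'p"
  GV :: "'o \<Rightarrow> 'o \<Rightarrow> 'v \<Rightarrow> 'w"
  GH :: "'o \<Rightarrow> 'o \<Rightarrow> 'h \<Rightarrow> 'k"
  GM :: "'o \<Rightarrow> ('o, 'h) hmor list \<Rightarrow> ('o, 'h) hmor \<Rightarrow> 'v \<Rightarrow> 'v \<Rightarrow> 'm \<Rightarrow> 'n"

definition mk_vd_fun :: "('o, 'v, 'h, 'm) vdc \<Rightarrow> ('o \<Rightarrow> 'p) \<Rightarrow> ('o \<Rightarrow> 'o \<Rightarrow> 'v \<Rightarrow> 'w) \<Rightarrow>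
    ('o \<Rightarrow> 'o \<Rightarrow> 'h \<Rightarrow> 'k) \<Rightarrow>
    ('o \<Rightarrow> ('o, 'h) hmor list \<Rightarrow> ('o, 'h) hmor \<Rightarrow> 'v \<Rightarrow> 'v \<Rightarrow> 'm \<Rightarrow> 'n) \<Rightarrow>
    ('o, 'v, 'h, 'm, 'p, 'w, 'k, 'n) vd_fun" where
  "mk_vd_fun A go gv gh gm = \<lparr>
     Go = (\<lambda>a. if a \<in> VOb A then go a else undefined),
     GV = (\<lambda>a b u. if a \<in> VOb A \<and> b \<in> VOb A \<and> u \<in> VHom A a b then gv a b u else undefined),
     GH = (\<lambda>a b \<gamma>. if a \<in> VOb A \<and> b \<in> VOb A \<and> \<gamma> \<in> HHom A a b then gh a b \<gamma> else undefined),
     GM = (\<lambda>a \<Gamma>s \<Delta> u u' \<theta>. if is_bdry A a \<Gamma>s \<Delta> u u' \<and> \<theta> \<in> MCell A a \<Gamma>s \<Delta> u u'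
                then gm a \<Gamma>s \<Delta> u u' \<theta> else undefined) \<rparr>"

definition hmap :: "('o, 'v, 'h, 'm, 'p, 'w, 'k, 'n) vd_fun \<Rightarrow> ('o, 'h) hmor \<Rightarrow> ('p, 'k) hmor" where
  "hmap G \<Gamma> = HMor (Go G (hsrc \<Gamma>)) (GH G (hsrc \<Gamma>) (htgt \<Gamma>) (hlab \<Gamma>)) (Go G (htgt \<Gamma>))"

fun map_row :: "('o, 'v, 'h, 'm, 'p, 'w, 'k, 'n) vd_fun \<Rightarrow> 'o \<Rightarrow> 'v \<Rightarrow>
    ('o, 'v, 'h, 'm) block list \<Rightarrow> ('p, 'w, 'k, 'n) block list" where
  "map_row G a u [] = []"
| "map_row G a u (Block \<Gamma>s \<theta> \<Delta> u' # bs) =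
     Block (map (hmap G) \<Gamma>s) (GM G a \<Gamma>s \<Delta> u u' \<theta>) (hmap G \<Delta>) (GV G (hend a \<Gamma>s) (htgt \<Delta>) u')
       # map_row G (hend a \<Gamma>s) u' bs"

locale virtual_double_functor =
  fixes A :: "('o, 'v, 'h, 'm) vdc" and B :: "('p, 'w, 'k, 'n) vdc"
    and G :: "('o, 'v, 'h, 'm, 'p, 'w, 'k, 'n) vd_fun"
  assumes normal: "G = mk_vd_fun A (Go G) (GV G) (GH G) (GM G)"
    and go: "a \<in> VOb A \<Longrightarrow> Go G a \<in> VOb B"
    and gv: "\<lbrakk>a \<in> VOb A; b \<in> VOb A; u \<in> VHom A a b\<rbrakk> \<Longrightarrow> GV G a b u \<in> VHom B (Go G a) (Go G b)"
    and gv_id: "a \<in> VOb A \<Longrightarrow> GV G a a (VId A a) = VId B (Go G a)"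
    and gv_cmp: "\<lbrakk>a \<in> VOb A; b \<in> VOb A; c \<in> VOb A; u \<in> VHom A a b; v \<in> VHom A b c\<rbrakk>
      \<Longrightarrow> GV G a c (VCmp A a b c v u) = VCmp B (Go G a) (Go G b) (Go G c) (GV G b c v) (GV G a b u)"
    and gh: "\<lbrakk>a \<in> VOb A; b \<in> VOb A; \<gamma> \<in> HHom A a b\<rbrakk> \<Longrightarrow> GH G a b \<gamma> \<in> HHom B (Go G a) (Go G b)"
    and gm: "\<lbrakk>is_bdry A a \<Gamma>s \<Delta> u u'; \<theta> \<in> MCell A a \<Gamma>s \<Delta> u u'\<rbrakk>
      \<Longrightarrow> GM G a \<Gamma>s \<Delta> u u' \<theta> \<in> MCell B (Go G a) (map (hmap G) \<Gamma>s) (hmap G \<Delta>)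
            (GV G a (hsrc \<Delta>) u) (GV G (hend a \<Gamma>s) (htgt \<Delta>) u')"
    and gm_id: "is_hmor A \<Gamma>
      \<Longrightarrow> GM G (hsrc \<Gamma>) [\<Gamma>] \<Gamma> (VId A (hsrc \<Gamma>)) (VId A (htgt \<Gamma>)) (MId A \<Gamma>) = MId B (hmap G \<Gamma>)"
    and gm_cmp: "\<lbrakk>row A a b u bs; is_bdry A b (bots bs) \<Lambda> v v'; \<kappa> \<in> MCell A b (bots bs) \<Lambda> v v'\<rbrakk>
      \<Longrightarrow> GM G a (tops bs) \<Lambda> (VCmp A a b (hsrc \<Lambda>) v u)
            (VCmp A (hend a (tops bs)) (hend b (bots bs)) (htgt \<Lambda>) v' (rvert u bs))
            (MCmp A a b u bs \<Lambda> v v' \<kappa>)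
        = MCmp B (Go G a) (Go G b) (GV G a b u) (map_row G a u bs) (hmap G \<Lambda>)
            (GV G b (hsrc \<Lambda>) v) (GV G (hend b (bots bs)) (htgt \<Lambda>) v')
            (GM G b (bots bs) \<Lambda> v v' \<kappa>)"

definition id_vd_fun :: "('o, 'v, 'h, 'm) vdc \<Rightarrow> ('o, 'v, 'h, 'm, 'o, 'v, 'h, 'm) vd_fun" where
  "id_vd_fun A = mk_vd_fun A (\<lambda>a. a) (\<lambda>a b u. u) (\<lambda>a b \<gamma>. \<gamma>) (\<lambda>a \<Gamma>s \<Delta> u u' \<theta>. \<theta>)"

definition cmp_vd_fun :: "('o, 'v, 'h, 'm) vdc \<Rightarrow> ('p, 'w, 'k, 'n, 'q, 'x, 'l, 'i) vd_fun \<Rightarrow>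
    ('o, 'v, 'h, 'm, 'p, 'w, 'k, 'n) vd_fun \<Rightarrow> ('o, 'v, 'h, 'm, 'q, 'x, 'l, 'i) vd_fun" where
  "cmp_vd_fun A H G = mk_vd_fun A
     (\<lambda>a. Go H (Go G a))
     (\<lambda>a b u. GV H (Go G a) (Go G b) (GV G a b u))
     (\<lambda>a b \<gamma>. GH H (Go G a) (Go G b) (GH G a b \<gamma>))
     (\<lambda>a \<Gamma>s \<Delta> u u' \<theta>. GM H (Go G a) (map (hmap G) \<Gamma>s) (hmap G \<Delta>)
        (GV G a (hsrc \<Delta>) u) (GV G (hend a \<Gamma>s) (htgt \<Delta>) u') (GM G a \<Gamma>s \<Delta> u u' \<theta>))"

record ('o, 'h, 'w, 'n) vtrans =
  TV :: "'o \<Rightarrow> 'w"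
  TC :: "('o, 'h) hmor \<Rightarrow> 'n"

definition mk_vtrans :: "('o, 'v, 'h, 'm) vdc \<Rightarrow> ('o \<Rightarrow> 'w) \<Rightarrow> (('o, 'h) hmor \<Rightarrow> 'n) \<Rightarrow>
    ('o, 'h, 'w, 'n) vtrans" where
  "mk_vtrans A tv tc = \<lparr>
     TV = (\<lambda>a. if a \<in> VOb A then tv a else undefined),
     TC = (\<lambda>\<Gamma>. if is_hmor A \<Gamma> then tc \<Gamma> else undefined) \<rparr>"

locale vertical_transformation =
  fixes A :: "('o, 'v, 'h, 'm) vdc" and B :: "('p, 'w, 'k, 'n) vdc"
    and F G :: "('o, 'v, 'h, 'm, 'p, 'w, 'k, 'n) vd_fun"
    and \<sigma> :: "('o, 'h, 'w, 'n) vtrans"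
  assumes normal: "\<sigma> = mk_vtrans A (TV \<sigma>) (TC \<sigma>)"
    and tv: "a \<in> VOb A \<Longrightarrow> TV \<sigma> a \<in> VHom B (Go F a) (Go G a)"
    and tv_nat: "\<lbrakk>a \<in> VOb A; b \<in> VOb A; u \<in> VHom A a b\<rbrakk>
      \<Longrightarrow> VCmp B (Go F a) (Go F b) (Go G b) (TV \<sigma> b) (GV F a b u)
        = VCmp B (Go F a) (Go G a) (Go G b) (GV G a b u) (TV \<sigma> a)"
    and tc: "is_hmor A \<Gamma> \<Longrightarrow> TC \<sigma> \<Gamma> \<in> MCell B (Go F (hsrc \<Gamma>)) [hmap F \<Gamma>] (hmap G \<Gamma>)
                (TV \<sigma> (hsrc \<Gamma>)) (TV \<sigma> (htgt \<Gamma>))"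
    and tc_nat: "\<lbrakk>is_bdry A a \<Gamma>s \<Delta> u u'; \<theta> \<in> MCell A a \<Gamma>s \<Delta> u u'\<rbrakk>
      \<Longrightarrow> MCmp B (Go F a) (Go F (hsrc \<Delta>)) (GV F a (hsrc \<Delta>) u)
            [Block (map (hmap F) \<Gamma>s) (GM F a \<Gamma>s \<Delta> u u' \<theta>) (hmap F \<Delta>)
               (GV F (hend a \<Gamma>s) (htgt \<Delta>) u')]
            (hmap G \<Delta>) (TV \<sigma> (hsrc \<Delta>)) (TV \<sigma> (htgt \<Delta>)) (TC \<sigma> \<Delta>)
        = MCmp B (Go F a) (Go G a) (TV \<sigma> a)
            (map (\<lambda>\<Gamma>. Block [hmap F \<Gamma>] (TC \<sigma> \<Gamma>) (hmap G \<Gamma>) (TV \<sigma> (htgt \<Gamma>))) \<Gamma>s)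
            (hmap G \<Delta>) (GV G a (hsrc \<Delta>) u) (GV G (hend a \<Gamma>s) (htgt \<Delta>) u')
            (GM G a \<Gamma>s \<Delta> u u' \<theta>)"

type_synonym 'v vdcv = "('v, 'v, 'v, 'v) vdc"
type_synonym 'v vd_funv = "('v, 'v, 'v, 'v, 'v, 'v, 'v, 'v) vd_fun"
type_synonym 'v vtransv = "('v, 'v, 'v, 'v) vtrans"

definition large_vdc :: "'v::zf \<Rightarrow> 'v vdcv \<Rightarrow> bool" where
  "large_vdc U A \<longleftrightarrow> set_in U (VOb A) \<and>
     (\<forall>a \<in> VOb A. \<forall>b \<in> VOb A. set_in U (VHom A a b) \<and> set_in U (HHom A a b)) \<and>
     (\<forall>a \<Gamma>s \<Delta> u u'. is_bdry A a \<Gamma>s \<Delta> u u' \<longrightarrow> set_in U (MCell A a \<Gamma>s \<Delta> u u'))"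

definition VDBL :: "'v::zf \<Rightarrow> ('v vdcv, 'v vd_funv, 'v vtransv) two_cat" where
  "VDBL U = \<lparr>
     Ob = {A. virtual_double_category A \<and> large_vdc U A},
     Hom1 = (\<lambda>A B. {G. virtual_double_functor A B G}),
     Hom2 = (\<lambda>A B F G. {\<sigma>. vertical_transformation A B F G \<sigma>}),
     Id1 = id_vd_fun,
     Cmp1 = (\<lambda>A B C G F. cmp_vd_fun A G F),
     Id2 = (\<lambda>A B F. mk_vtrans A (\<lambda>a. VId B (Go F a)) (\<lambda>\<Gamma>. MId B (hmap F \<Gamma>))),
     Vc = (\<lambda>A B F G H \<tau> \<sigma>. mk_vtrans A
       (\<lambda>a. VCmp B (Go F a) (Go G a) (Go H a) (TV \<tau> a) (TV \<sigma> a))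
       (\<lambda>\<Gamma>. MCmp B (Go F (hsrc \<Gamma>)) (Go G (hsrc \<Gamma>)) (TV \<sigma> (hsrc \<Gamma>))
          [Block [hmap F \<Gamma>] (TC \<sigma> \<Gamma>) (hmap G \<Gamma>) (TV \<sigma> (htgt \<Gamma>))]
          (hmap H \<Gamma>) (TV \<tau> (hsrc \<Gamma>)) (TV \<tau> (htgt \<Gamma>)) (TC \<tau> \<Gamma>))),
     Hc = (\<lambda>A B C F F' G G' \<tau> \<sigma>. mk_vtrans A
       (\<lambda>a. VCmp C (Go G (Go F a)) (Go G (Go F' a)) (Go G' (Go F' a))
          (TV \<tau> (Go F' a)) (GV G (Go F a) (Go F' a) (TV \<sigma> a)))
       (\<lambda>\<Gamma>. MCmp C (Go G (Go F (hsrc \<Gamma>))) (Go G (Go F' (hsrc \<Gamma>)))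
          (GV G (Go F (hsrc \<Gamma>)) (Go F' (hsrc \<Gamma>)) (TV \<sigma> (hsrc \<Gamma>)))
          [Block [hmap G (hmap F \<Gamma>)]
             (GM G (Go F (hsrc \<Gamma>)) [hmap F \<Gamma>] (hmap F' \<Gamma>)
                (TV \<sigma> (hsrc \<Gamma>)) (TV \<sigma> (htgt \<Gamma>)) (TC \<sigma> \<Gamma>))
             (hmap G (hmap F' \<Gamma>))
             (GV G (Go F (htgt \<Gamma>)) (Go F' (htgt \<Gamma>)) (TV \<sigma> (htgt \<Gamma>)))]
          (hmap G' (hmap F' \<Gamma>)) (TV \<tau> (Go F' (hsrc \<Gamma>))) (TV \<tau> (Go F' (htgt \<Gamma>)))
          (TC \<tau> (hmap F' \<Gamma>)))) \<rparr>"


section \<open>Enrichment in a virtual double category\<close>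

text \<open>Enriched categories and functors are coded as tuples of graphs, so that they are sets of the
  ambient model (curried graphs for several arguments). An enriched category is \<open>(ob, c \<mapsto> |c|, (c, c') \<mapsto> C(c, c'), \<eta>, \<mu>)\<close>.\<close>

definition mk_cat :: "'v::zf \<Rightarrow> ('v \<Rightarrow> 'v) \<Rightarrow> ('v \<Rightarrow> 'v \<Rightarrow> 'v) \<Rightarrow> ('v \<Rightarrow> 'v) \<Rightarrow> ('v \<Rightarrow> 'v \<Rightarrow> 'v \<Rightarrow> 'v) \<Rightarrow> 'v"
  where
  "mk_cat X e h n m = vpair X
     (vpair (vlam (elts X) e)
     (vpair (vlam (elts X) (\<lambda>c. vlam (elts X) (\<lambda>c'. h c c')))
     (vpair (vlam (elts X) n)
            (vlam (elts X) (\<lambda>c. vlam (elts X) (\<lambda>c'. vlam (elts X) (\<lambda>c''. m c c' c'')))))))"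

definition cat_obset :: "'v::zf \<Rightarrow> 'v" where
  "cat_obset C = vfst C"

abbreviation cat_ob :: "'v::zf \<Rightarrow> 'v set" where
  "cat_ob C \<equiv> elts (cat_obset C)"

definition ext :: "'v::zf \<Rightarrow> 'v \<Rightarrow> 'v" where
  "ext C c = vapp (vfst (vsnd C)) c"

definition cat_hom :: "'v::zf \<Rightarrow> 'v \<Rightarrow> 'v \<Rightarrow> 'v" where
  "cat_hom C c c' = vapp (vapp (vfst (vsnd (vsnd C))) c) c'"

definition cat_unit :: "'v::zf \<Rightarrow> 'v \<Rightarrow> 'v" where
  "cat_unit C c = vapp (vfst (vsnd (vsnd (vsnd C)))) c"

definition cat_mult :: "'v::zf \<Rightarrow> 'v \<Rightarrow> 'v \<Rightarrow> 'v \<Rightarrow> 'v" where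
  "cat_mult C c c' c'' = vapp (vapp (vapp (vsnd (vsnd (vsnd (vsnd C)))) c) c') c''"

abbreviation chom :: "'v::zf \<Rightarrow> 'v \<Rightarrow> 'v \<Rightarrow> ('v, 'v) hmor" where
  "chom C c c' \<equiv> HMor (ext C c) (cat_hom C c c') (ext C c')"

definition enr_cats :: "'v::zf \<Rightarrow> 'v vdcv \<Rightarrow> 'v set" where
  "enr_cats U A = {C.
     (\<exists>X \<in> elts U. \<exists>e h n m. C = mk_cat X e h n m) \<and>
     (\<forall>c \<in> cat_ob C. ext C c \<in> VOb A) \<and>
     (\<forall>c \<in> cat_ob C. \<forall>c' \<in> cat_ob C. cat_hom C c c' \<in> HHom A (ext C c) (ext C c')) \<and>
     (\<forall>c \<in> cat_ob C. cat_unit C c \<in>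
        MCell A (ext C c) [] (chom C c c) (VId A (ext C c)) (VId A (ext C c))) \<and>
     (\<forall>c\<^sub>0 \<in> cat_ob C. \<forall>c\<^sub>1 \<in> cat_ob C. \<forall>c\<^sub>2 \<in> cat_ob C. cat_mult C c\<^sub>0 c\<^sub>1 c\<^sub>2 \<in>
        MCell A (ext C c\<^sub>0) [chom C c\<^sub>0 c\<^sub>1, chom C c\<^sub>1 c\<^sub>2] (chom C c\<^sub>0 c\<^sub>2)
          (VId A (ext C c\<^sub>0)) (VId A (ext C c\<^sub>2))) \<and>
     (\<forall>c \<in> cat_ob C. \<forall>c' \<in> cat_ob C.
        MCmp A (ext C c) (ext C c) (VId A (ext C c))
          [Block [] (cat_unit C c) (chom C c c) (VId A (ext C c)),
           Block [chom C c c'] (MId A (chom C c c')) (chom C c c') (VId A (ext C c'))]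
          (chom C c c') (VId A (ext C c)) (VId A (ext C c')) (cat_mult C c c c')
        = MId A (chom C c c')) \<and>
     (\<forall>c \<in> cat_ob C. \<forall>c' \<in> cat_ob C.
        MCmp A (ext C c) (ext C c) (VId A (ext C c))
          [Block [chom C c c'] (MId A (chom C c c')) (chom C c c') (VId A (ext C c')),
           Block [] (cat_unit C c') (chom C c' c') (VId A (ext C c'))]
          (chom C c c') (VId A (ext C c)) (VId A (ext C c')) (cat_mult C c c' c')
        = MId A (chom C c c')) \<and>
     (\<forall>c\<^sub>0 \<in> cat_ob C. \<forall>c\<^sub>1 \<in> cat_ob C. \<forall>c\<^sub>2 \<in> cat_ob C. \<forall>c\<^sub>3 \<in> cat_ob C.
        MCmp A (ext C c\<^sub>0) (ext C c\<^sub>0) (VId A (ext C c\<^sub>0))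
          [Block [chom C c\<^sub>0 c\<^sub>1, chom C c\<^sub>1 c\<^sub>2] (cat_mult C c\<^sub>0 c\<^sub>1 c\<^sub>2) (chom C c\<^sub>0 c\<^sub>2) (VId A (ext C c\<^sub>2)),
           Block [chom C c\<^sub>2 c\<^sub>3] (MId A (chom C c\<^sub>2 c\<^sub>3)) (chom C c\<^sub>2 c\<^sub>3) (VId A (ext C c\<^sub>3))]
          (chom C c\<^sub>0 c\<^sub>3) (VId A (ext C c\<^sub>0)) (VId A (ext C c\<^sub>3)) (cat_mult C c\<^sub>0 c\<^sub>2 c\<^sub>3)
        = MCmp A (ext C c\<^sub>0) (ext C c\<^sub>0) (VId A (ext C c\<^sub>0))
          [Block [chom C c\<^sub>0 c\<^sub>1] (MId A (chom C c\<^sub>0 c\<^sub>1)) (chom C c\<^sub>0 c\<^sub>1) (VId A (ext C c\<^sub>1)),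
           Block [chom C c\<^sub>1 c\<^sub>2, chom C c\<^sub>2 c\<^sub>3] (cat_mult C c\<^sub>1 c\<^sub>2 c\<^sub>3) (chom C c\<^sub>1 c\<^sub>3) (VId A (ext C c\<^sub>3))]
          (chom C c\<^sub>0 c\<^sub>3) (VId A (ext C c\<^sub>0)) (VId A (ext C c\<^sub>3)) (cat_mult C c\<^sub>0 c\<^sub>1 c\<^sub>3))}"

text \<open>An enriched functor is \<open>(graph of c \<mapsto> fc, c \<mapsto> f\<^sub>c, (c, c') \<mapsto> \<omega>)\<close>.\<close>

definition mk_fun :: "'v::zf \<Rightarrow> ('v \<Rightarrow> 'v) \<Rightarrow> ('v \<Rightarrow> 'v) \<Rightarrow> ('v \<Rightarrow> 'v \<Rightarrow> 'v) \<Rightarrow> 'v" where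
  "mk_fun X fo fv fw = vpair (vlam (elts X) fo)
     (vpair (vlam (elts X) fv) (vlam (elts X) (\<lambda>c. vlam (elts X) (\<lambda>c'. fw c c'))))"

definition fun_obmap :: "'v::zf \<Rightarrow> 'v" where
  "fun_obmap f = vfst f"

abbreviation fun_ob :: "'v::zf \<Rightarrow> 'v \<Rightarrow> 'v" where
  "fun_ob f c \<equiv> vapp (fun_obmap f) c"

definition fun_vert :: "'v::zf \<Rightarrow> 'v \<Rightarrow> 'v" where
  "fun_vert f c = vapp (vfst (vsnd f)) c"

definition fun_cell :: "'v::zf \<Rightarrow> 'v \<Rightarrow> 'v \<Rightarrow> 'v" where
  "fun_cell f c c' = vapp (vapp (vsnd (vsnd f)) c) c'"

definition enr_funs :: "'v::zf vdcv \<Rightarrow> 'v \<Rightarrow> 'v \<Rightarrow> 'v set" where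
  "enr_funs A C D = {f.
     (\<exists>fo fv fw. f = mk_fun (cat_obset C) fo fv fw) \<and>
     (\<forall>c \<in> cat_ob C. fun_ob f c \<in> cat_ob D) \<and>
     (\<forall>c \<in> cat_ob C. fun_vert f c \<in> VHom A (ext C c) (ext D (fun_ob f c))) \<and>
     (\<forall>c \<in> cat_ob C. \<forall>c' \<in> cat_ob C. fun_cell f c c' \<in>
        MCell A (ext C c) [chom C c c'] (chom D (fun_ob f c) (fun_ob f c'))
          (fun_vert f c) (fun_vert f c')) \<and>
     (\<forall>c \<in> cat_ob C.
        MCmp A (ext C c) (ext C c) (VId A (ext C c))
          [Block [] (cat_unit C c) (chom C c c) (VId A (ext C c))]
          (chom D (fun_ob f c) (fun_ob f c)) (fun_vert f c) (fun_vert f c) (fun_cell f c c)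
        = MCmp A (ext C c) (ext D (fun_ob f c)) (fun_vert f c) []
          (chom D (fun_ob f c) (fun_ob f c))
          (VId A (ext D (fun_ob f c))) (VId A (ext D (fun_ob f c))) (cat_unit D (fun_ob f c))) \<and>
     (\<forall>c\<^sub>0 \<in> cat_ob C. \<forall>c\<^sub>1 \<in> cat_ob C. \<forall>c\<^sub>2 \<in> cat_ob C.
        MCmp A (ext C c\<^sub>0) (ext C c\<^sub>0) (VId A (ext C c\<^sub>0))
          [Block [chom C c\<^sub>0 c\<^sub>1, chom C c\<^sub>1 c\<^sub>2] (cat_mult C c\<^sub>0 c\<^sub>1 c\<^sub>2) (chom C c\<^sub>0 c\<^sub>2) (VId A (ext C c\<^sub>2))]
          (chom D (fun_ob f c\<^sub>0) (fun_ob f c\<^sub>2)) (fun_vert f c\<^sub>0) (fun_vert f c\<^sub>2) (fun_cell f c\<^sub>0 c\<^sub>2)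
        = MCmp A (ext C c\<^sub>0) (ext D (fun_ob f c\<^sub>0)) (fun_vert f c\<^sub>0)
          [Block [chom C c\<^sub>0 c\<^sub>1] (fun_cell f c\<^sub>0 c\<^sub>1) (chom D (fun_ob f c\<^sub>0) (fun_ob f c\<^sub>1)) (fun_vert f c\<^sub>1),
           Block [chom C c\<^sub>1 c\<^sub>2] (fun_cell f c\<^sub>1 c\<^sub>2) (chom D (fun_ob f c\<^sub>1) (fun_ob f c\<^sub>2)) (fun_vert f c\<^sub>2)]
          (chom D (fun_ob f c\<^sub>0) (fun_ob f c\<^sub>2))
          (VId A (ext D (fun_ob f c\<^sub>0))) (VId A (ext D (fun_ob f c\<^sub>2)))
          (cat_mult D (fun_ob f c\<^sub>0) (fun_ob f c\<^sub>1) (fun_ob f c\<^sub>2)))}"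

text \<open>An enriched natural transformation is the graph of \<open>c \<mapsto> \<alpha>\<^sub>c\<close>.\<close>

definition enr_nats :: "'v::zf vdcv \<Rightarrow> 'v \<Rightarrow> 'v \<Rightarrow> 'v \<Rightarrow> 'v \<Rightarrow> 'v set" where
  "enr_nats A C D f f' = {\<alpha>.
     (\<exists>t. \<alpha> = vlam (cat_ob C) t) \<and>
     (\<forall>c \<in> cat_ob C. vapp \<alpha> c \<in>
        MCell A (ext C c) [] (chom D (fun_ob f c) (fun_ob f' c)) (fun_vert f c) (fun_vert f' c)) \<and>
     (\<forall>c \<in> cat_ob C. \<forall>c' \<in> cat_ob C.
        MCmp A (ext C c) (ext D (fun_ob f c)) (fun_vert f c)
          [Block [] (vapp \<alpha> c) (chom D (fun_ob f c) (fun_ob f' c)) (fun_vert f' c),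
           Block [chom C c c'] (fun_cell f' c c') (chom D (fun_ob f' c) (fun_ob f' c')) (fun_vert f' c')]
          (chom D (fun_ob f c) (fun_ob f' c'))
          (VId A (ext D (fun_ob f c))) (VId A (ext D (fun_ob f' c')))
          (cat_mult D (fun_ob f c) (fun_ob f' c) (fun_ob f' c'))
        = MCmp A (ext C c) (ext D (fun_ob f c)) (fun_vert f c)
          [Block [chom C c c'] (fun_cell f c c') (chom D (fun_ob f c) (fun_ob f c')) (fun_vert f c'),
           Block [] (vapp \<alpha> c') (chom D (fun_ob f c') (fun_ob f' c')) (fun_vert f' c')]
          (chom D (fun_ob f c) (fun_ob f' c'))
          (VId A (ext D (fun_ob f c))) (VId A (ext D (fun_ob f' c')))
          (cat_mult D (fun_ob f c) (fun_ob f c') (fun_ob f' c')))}"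

definition id_fun :: "'v::zf vdcv \<Rightarrow> 'v \<Rightarrow> 'v" where
  "id_fun A C = mk_fun (cat_obset C) (\<lambda>c. c) (\<lambda>c. VId A (ext C c)) (\<lambda>c c'. MId A (chom C c c'))"

definition cmp_fun :: "'v::zf vdcv \<Rightarrow> 'v \<Rightarrow> 'v \<Rightarrow> 'v \<Rightarrow> 'v \<Rightarrow> 'v \<Rightarrow> 'v" where
  "cmp_fun A C D E g f = mk_fun (cat_obset C)
     (\<lambda>c. fun_ob g (fun_ob f c))
     (\<lambda>c. VCmp A (ext C c) (ext D (fun_ob f c)) (ext E (fun_ob g (fun_ob f c)))
        (fun_vert g (fun_ob f c)) (fun_vert f c))
     (\<lambda>c c'. MCmp A (ext C c) (ext D (fun_ob f c)) (fun_vert f c)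
        [Block [chom C c c'] (fun_cell f c c') (chom D (fun_ob f c) (fun_ob f c')) (fun_vert f c')]
        (chom E (fun_ob g (fun_ob f c)) (fun_ob g (fun_ob f c')))
        (fun_vert g (fun_ob f c)) (fun_vert g (fun_ob f c'))
        (fun_cell g (fun_ob f c) (fun_ob f c')))"

definition id_nat :: "'v::zf vdcv \<Rightarrow> 'v \<Rightarrow> 'v \<Rightarrow> 'v \<Rightarrow> 'v" where
  "id_nat A C D f = vlam (cat_ob C) (\<lambda>c.
     MCmp A (ext C c) (ext D (fun_ob f c)) (fun_vert f c) [] (chom D (fun_ob f c) (fun_ob f c))
       (VId A (ext D (fun_ob f c))) (VId A (ext D (fun_ob f c))) (cat_unit D (fun_ob f c)))"

definition vcmp_nat :: "'v::zf vdcv \<Rightarrow> 'v \<Rightarrow> 'v \<Rightarrow> 'v \<Rightarrow> 'v \<Rightarrow> 'v \<Rightarrow> 'v \<Rightarrow> 'v \<Rightarrow> 'v" where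
  "vcmp_nat A C D f f' f'' \<beta> \<alpha> = vlam (cat_ob C) (\<lambda>c.
     MCmp A (ext C c) (ext D (fun_ob f c)) (fun_vert f c)
       [Block [] (vapp \<alpha> c) (chom D (fun_ob f c) (fun_ob f' c)) (fun_vert f' c),
        Block [] (vapp \<beta> c) (chom D (fun_ob f' c) (fun_ob f'' c)) (fun_vert f'' c)]
       (chom D (fun_ob f c) (fun_ob f'' c))
       (VId A (ext D (fun_ob f c))) (VId A (ext D (fun_ob f'' c)))
       (cat_mult D (fun_ob f c) (fun_ob f' c) (fun_ob f'' c)))"

text \<open>Whiskerings: \<open>lwhisker\<close> is \<open>g\<alpha>\<close> for \<open>\<alpha>: f \<rightarrow> f': C \<rightarrow> D\<close> and \<open>g: D \<rightarrow> E\<close>, and \<open>rwhisker\<close> is \<open>\<beta>h\<close>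
  for \<open>h: C \<rightarrow> D\<close> and \<open>\<beta>: g \<rightarrow> g': D \<rightarrow> E\<close>.\<close>

definition lwhisker :: "'v::zf vdcv \<Rightarrow> 'v \<Rightarrow> 'v \<Rightarrow> 'v \<Rightarrow> 'v \<Rightarrow> 'v \<Rightarrow> 'v \<Rightarrow> 'v \<Rightarrow> 'v" where
  "lwhisker A C D E f f' g \<alpha> = vlam (cat_ob C) (\<lambda>c.
     MCmp A (ext C c) (ext D (fun_ob f c)) (fun_vert f c)
       [Block [] (vapp \<alpha> c) (chom D (fun_ob f c) (fun_ob f' c)) (fun_vert f' c)]
       (chom E (fun_ob g (fun_ob f c)) (fun_ob g (fun_ob f' c)))
       (fun_vert g (fun_ob f c)) (fun_vert g (fun_ob f' c))
       (fun_cell g (fun_ob f c) (fun_ob f' c)))"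

definition rwhisker :: "'v::zf vdcv \<Rightarrow> 'v \<Rightarrow> 'v \<Rightarrow> 'v \<Rightarrow> 'v \<Rightarrow> 'v \<Rightarrow> 'v \<Rightarrow> 'v \<Rightarrow> 'v" where
  "rwhisker A C D E h g g' \<beta> = vlam (cat_ob C) (\<lambda>c.
     MCmp A (ext C c) (ext D (fun_ob h c)) (fun_vert h c) []
       (chom E (fun_ob g (fun_ob h c)) (fun_ob g' (fun_ob h c)))
       (fun_vert g (fun_ob h c)) (fun_vert g' (fun_ob h c))
       (vapp \<beta> (fun_ob h c)))"

text \<open>The 2-category of small A-categories. The horizontal composite of \<open>\<alpha>: f \<rightarrow> f'\<close> and
  \<open>\<beta>: g \<rightarrow> g'\<close> is the vertical composite of \<open>g\<alpha>\<close> and \<open>\<beta>f'\<close>.\<close>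

definition ACat :: "'v::zf \<Rightarrow> 'v vdcv \<Rightarrow> ('v, 'v, 'v) two_cat" where
  "ACat U A = \<lparr>
     Ob = enr_cats U A,
     Hom1 = enr_funs A,
     Hom2 = enr_nats A,
     Id1 = id_fun A,
     Cmp1 = cmp_fun A,
     Id2 = id_nat A,
     Vc = vcmp_nat A,
     Hc = (\<lambda>C D E f f' g g' \<beta> \<alpha>.
       vcmp_nat A C E (cmp_fun A C D E g f) (cmp_fun A C D E g f') (cmp_fun A C D E g' f')
         (rwhisker A C D E f' g g' \<beta>) (lwhisker A C D E f f' g \<alpha>)) \<rparr>"

definition push_cat :: "'v::zf vdcv \<Rightarrow> 'v vd_funv \<Rightarrow> 'v \<Rightarrow> 'v" where
  "push_cat A G C = mk_cat (cat_obset C)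
     (\<lambda>c. Go G (ext C c))
     (\<lambda>c c'. GH G (ext C c) (ext C c') (cat_hom C c c'))
     (\<lambda>c. GM G (ext C c) [] (chom C c c) (VId A (ext C c)) (VId A (ext C c)) (cat_unit C c))
     (\<lambda>c c' c''. GM G (ext C c) [chom C c c', chom C c' c''] (chom C c c'')
        (VId A (ext C c)) (VId A (ext C c'')) (cat_mult C c c' c''))"

definition push_fun :: "'v::zf vd_funv \<Rightarrow> 'v \<Rightarrow> 'v \<Rightarrow> 'v \<Rightarrow> 'v" where
  "push_fun G C D f = mk_fun (cat_obset C)
     (\<lambda>c. fun_ob f c)
     (\<lambda>c. GV G (ext C c) (ext D (fun_ob f c)) (fun_vert f c))
     (\<lambda>c c'. GM G (ext C c) [chom C c c'] (chom D (fun_ob f c) (fun_ob f c'))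
        (fun_vert f c) (fun_vert f c') (fun_cell f c c'))"

definition push_nat :: "'v::zf vd_funv \<Rightarrow> 'v \<Rightarrow> 'v \<Rightarrow> 'v \<Rightarrow> 'v \<Rightarrow> 'v \<Rightarrow> 'v" where
  "push_nat G C D f f' \<alpha> = vlam (cat_ob C) (\<lambda>c.
     GM G (ext C c) [] (chom D (fun_ob f c) (fun_ob f' c)) (fun_vert f c) (fun_vert f' c)
       (vapp \<alpha> c))"

text \<open>The 2-functor from \<open>VDBL\<close> to \<open>2-CAT\<close>. The component at an A-category \<open>C\<close> of the 2-natural
  transformation induced by \<open>\<sigma>\<close> is the identity on objects.\<close>

definition Enr :: "'v::zf \<Rightarrow> 'v \<Rightarrow>
    ('v vdcv, 'v vd_funv, 'v vtransv,
     ('v, 'v, 'v) two_cat, ('v, 'v, 'v, 'v, 'v, 'v) two_fun, 'v \<Rightarrow> 'v) two_fun" where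
  "Enr U1 U2 = mk_two_fun (VDBL U2)
     (ACat U1)
     (\<lambda>A B G. mk_two_fun (ACat U1 A) (push_cat A G) (push_fun G) (push_nat G))
     (\<lambda>A B F G \<sigma>. \<lambda>C \<in> Ob (ACat U1 A).
        mk_fun (cat_obset C) (\<lambda>c. c) (\<lambda>c. TV \<sigma> (ext C c)) (\<lambda>c c'. TC \<sigma> (chom C c c')))"

definition ob_functor :: "'v::zf \<Rightarrow> 'v vdcv \<Rightarrow> ('v, 'v, 'v, 'v, 'v, 'v) two_fun" where
  "ob_functor U A = mk_two_fun (ACat U A)
     (\<lambda>C. cat_obset C) (\<lambda>C D f. fun_obmap f) (\<lambda>C D f g \<alpha>. vempty)"

text \<open>\<open>Enr 1\<close> is identified with \<open>Set_lc\<close>, under which the image of the unique functor to the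
  terminal virtual double category is \<open>ob\<close>.\<close>

definition Enr1 :: "'v::zf \<Rightarrow> 'v \<Rightarrow>
    ('v vdcv, 'v vd_funv, 'v vtransv,
     ('v, 'v, 'v) two_cat \<times> ('v, 'v, 'v, 'v, 'v, 'v) two_fun,
     ('v, 'v, 'v, 'v, 'v, 'v) two_fun, 'v \<Rightarrow> 'v) two_fun" where
  "Enr1 U1 U2 = mk_two_fun (VDBL U2)
     (\<lambda>A. (Fo (Enr U1 U2) A, ob_functor U1 A))
     (F1 (Enr U1 U2)) (F2 (Enr U1 U2))"


section \<open>The construction L\<close>

text \<open>\<open>pasted K a b f bs\<close> is the vertical composite \<open>\<theta>\<^sub>m \<cdots> \<theta>\<^sub>1: f\<^sub>0 \<rightarrow> f\<^sub>m\<close> (the identity of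
  \<open>f = f\<^sub>0\<close> if \<open>m = 0\<close>).\<close>

fun pasted :: "('o, 'a, 'c) two_cat \<Rightarrow> 'o \<Rightarrow> 'o \<Rightarrow> 'a \<Rightarrow> ('p, 'a, 'h, 'c) block list \<Rightarrow> 'c" where
  "pasted K a b f [] = Id2 K a b f"
| "pasted K a b f (Block \<Gamma>s \<theta> \<Delta> f' # bs) =
     Vc K a b f f' (rvert f' bs) (pasted K a b f' bs) \<theta>"

text \<open>An object is a pair \<open>p = (K, x)\<close>, with \<open>vfst p = K\<close> and \<open>vsnd p = x\<close>. The unique horizontal
  morphism between objects with the same first component is \<open>vempty\<close>.\<close>

definition LL :: "('v::zf, 'v, 'v) two_cat \<Rightarrow> ('v, 'v, 'v, 'v, 'v, 'v) two_fun \<Rightarrow> 'v vdcv" where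
  "LL \<K> F = \<lparr>
     VOb = {vpair K x | K x. K \<in> Ob \<K> \<and> x \<in> elts (Fo F K)},
     VHom = (\<lambda>p q. {f \<in> Hom1 \<K> (vfst p) (vfst q).
                        vapp (F1 F (vfst p) (vfst q) f) (vsnd p) = vsnd q}),
     HHom = (\<lambda>p p'. if vfst p = vfst p' then {vempty} else {}),
     MCell = (\<lambda>p \<Gamma>s \<Delta> f f'. Hom2 \<K> (vfst p) (vfst (hsrc \<Delta>)) f f'),
     VId = (\<lambda>p. Id1 \<K> (vfst p)),
     VCmp = (\<lambda>p q r g f. Cmp1 \<K> (vfst p) (vfst q) (vfst r) g f),
     MId = (\<lambda>\<Gamma>. Id2 \<K> (vfst (hsrc \<Gamma>)) (vfst (hsrc \<Gamma>)) (Id1 \<K> (vfst (hsrc \<Gamma>)))),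
     MCmp = (\<lambda>p q f bs \<Lambda> g g' \<kappa>.
       Hc \<K> (vfst p) (vfst q) (vfst (hsrc \<Lambda>)) f (rvert f bs) g g' \<kappa>
         (pasted \<K> (vfst p) (vfst q) f bs)) \<rparr>"

end

theory Submission
  imports Defs
begin

text \<open>The adjunction is given by an explicit unit and counit.

  The virtual double category \<open>LL K F\<close> has just enough cells to make every object \<open>A\<close> of \<open>K\<close> into a
  category enriched in it: its objects are the elements \<open>x\<close> of the set \<open>FA\<close>, the extent of \<open>x\<close> is
  \<open>(A, x)\<close>, all hom-objects are the unique horizontal morphism, and units and compositions are the
  identity 2-cell of the identity of \<open>A\<close>. A 1-cell \<open>f\<close> becomes the enriched functor all of whose
  components are \<open>f\<close>, and a 2-cell becomes a constant family. This is the unit \<open>eta K F\<close>.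

  In the other direction, \<open>LL (ACat U A) (ob_functor U A)\<close> is the virtual double category of pointed
  \<open>A\<close>-categories. The counit \<open>epsilon U A\<close> sends \<open>(C, c)\<close> to the extent of \<open>c\<close>, the horizontal morphism
  from \<open>(C, c)\<close> to \<open>(C, c')\<close> to the hom-object \<open>C(c, c')\<close>, and a functor \<open>f\<close> to its component at the
  point. A multicell is a transformation \<open>\<alpha>: f \<rightarrow> f'\<close> from \<open>C\<close> to \<open>D\<close> together with a path of objects
  \<open>c\<^sub>0, \<dots>, c\<^sub>n\<close>; it goes to the multicell from \<open>(C(c\<^sub>0, c\<^sub>1), \<dots>, C(c\<^sub>n\<^sub>-\<^sub>1, c\<^sub>n))\<close> to \<open>D(fc\<^sub>0, f'c\<^sub>n)\<close>
  which multiplies, in \<open>D\<close>, the component of \<open>\<alpha>\<close> at \<open>c\<^sub>0\<close> with the actions of \<open>f'\<close> on the hom-objects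
  along the path. By naturality \<open>\<alpha>\<close> may be inserted at any other position of the product
  (\<open>fpath_natural\<close>), and this freedom is what makes the counit compatible with substitution of
  multicells (\<open>ecmp_fpath_row\<close>, \<open>virtual_double_functor_epsilon\<close>).

  The triangle identities are then immediate. In the enriched category of the unit all units,
  compositions and hom-actions are identity 2-cells, so that the product above collapses to \<open>\<alpha>\<close>
  (\<open>epsilon_eta\<close>). Conversely, on paths of length 0, 1 and 2 the counit sends the identity
  transformation of the identity functor to the unit, the identity cell and the composition of \<open>C\<close>
  (\<open>eta_epsilon\<close>).

  To keep the calculations equational, a multicell from a path to a hom-object \<open>D(d, d')\<close> is regarded
  as a generalised element of \<open>D(d, d')\<close>. Such elements can be multiplied, precomposed with rows of
  multicells, acted on by enriched functors and transported along virtual double functors; the axioms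
  for enriched categories, functors and transformations become the laws of a category, a functor and a
  natural transformation for them (\<open>emul_assoc\<close>, \<open>eapp_emul\<close>, \<open>natD\<close>).

  It remains to see that \<open>two_CAT U\<close>, hence its slice, \<open>VDBL U\<close> and \<open>ACat U A\<close> are 2-categories, and
  that enrichment and \<open>L\<close> are 2-functors. The horizontal composition of each of the three is determined
  by whiskerings, so that the 2-category axioms follow from a criterion in terms of whiskerings
  (\<open>whiskered\<close>).\<close>

section \<open>Coding in the ambient set theory\<close>

text \<open>\<open>vset\<close> is a definite description, hence meaningful only for collections that form a set. The existence
  axioms of \<open>zf\<close> provide instances.\<close>

lemma elts_vset_ex: "\<exists>b::'v::zf. elts b = X \<Longrightarrow> elts (vset X) = X"
  unfolding vset_def by (metis (mono_tags, lifting) elts_inject theI)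

lemma elts_vset_subset: "X \<subseteq> elts a \<Longrightarrow> elts (vset X) = X"
  by (rule elts_vset_ex[OF zf_separation])

lemma elts_vset_image [simp]: "elts (vset (f ` elts a)) = f ` elts a" for f :: "'v::zf \<Rightarrow> 'v::zf"
  by (rule elts_vset_ex[OF zf_replacement])

lemma elts_vset_pair [simp]: "elts (vset {x, y}) = {x, y}"
  by (rule elts_vset_ex[OF zf_pairing])

lemma elts_vset_singleton [simp]: "elts (vset {x}) = {x}"
  using elts_vset_pair[of x x] by simp

lemma vset_elts [simp]: "vset (elts a) = a"
  by (rule elts_inject, rule elts_vset_ex) blast

lemma elts_vempty [simp]: "elts vempty = {}"
  unfolding vempty_def by (rule elts_vset_subset[of _ undefined]) simp

lemma vset_eq_iff: "elts (vset X) = X \<Longrightarrow> elts (vset Y) = Y \<Longrightarrow> vset X = vset Y \<longleftrightarrow> X = Y"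
  by metis

lemma vpair_eq_iff [simp]: "vpair a b = vpair c d \<longleftrightarrow> a = c \<and> b = d"
  unfolding vpair_def by (auto simp: vset_eq_iff doubleton_eq_iff)

lemma vfst_vpair [simp]: "vfst (vpair a b) = a"
  and vsnd_vpair [simp]: "vsnd (vpair a b) = b"
  unfolding vfst_def vsnd_def by auto

lemma elts_vlam: "elts (vlam (elts X) f) = (\<lambda>x. vpair x (f x)) ` elts X"
  unfolding vlam_def by simp

lemma vapp_vlam [simp]: "x \<in> elts X \<Longrightarrow> vapp (vlam (elts X) f) x = f x"
  unfolding vapp_def by (auto simp: elts_vlam)

lemma vlam_cong: "(\<And>x. x \<in> elts X \<Longrightarrow> f x = g x) \<Longrightarrow> vlam (elts X) f = vlam (elts X) g"
  unfolding vlam_def by (metis (no_types, lifting) image_cong)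

lemma vlam_eq_iff: "vlam (elts X) f = vlam (elts X) g \<longleftrightarrow> (\<forall>x \<in> elts X. f x = g x)"
  by (metis vapp_vlam vlam_cong)

lemma vlam_vapp: "\<exists>f. g = vlam (elts X) f \<Longrightarrow> vlam (elts X) (vapp g) = g"
  by (auto intro: vlam_cong)

lemma vlam_extend: "\<exists>f. g = vlam (elts X) f \<Longrightarrow> \<exists>f. h = vlam (elts X) f \<Longrightarrow>
    (\<And>x. x \<in> elts X \<Longrightarrow> vapp g x = vapp h x) \<Longrightarrow> g = h"
  by (auto intro!: vlam_cong)

lemma mk_cat_sel [simp]:
  "cat_obset (mk_cat X e h n m) = X"
  "c \<in> elts X \<Longrightarrow> ext (mk_cat X e h n m) c = e c"
  "c \<in> elts X \<Longrightarrow> c' \<in> elts X \<Longrightarrow> cat_hom (mk_cat X e h n m) c c' = h c c'"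
  "c \<in> elts X \<Longrightarrow> cat_unit (mk_cat X e h n m) c = n c"
  "c \<in> elts X \<Longrightarrow> c' \<in> elts X \<Longrightarrow> c'' \<in> elts X \<Longrightarrow> cat_mult (mk_cat X e h n m) c c' c'' = m c c' c''"
  unfolding mk_cat_def cat_obset_def ext_def cat_hom_def cat_unit_def cat_mult_def by simp_all

lemma mk_cat_cong:
  assumes "X = X'" "\<And>c. c \<in> elts X \<Longrightarrow> e c = e' c"
    "\<And>c c'. c \<in> elts X \<Longrightarrow> c' \<in> elts X \<Longrightarrow> h c c' = h' c c'"
    "\<And>c. c \<in> elts X \<Longrightarrow> n c = n' c"
    "\<And>c c' c''. c \<in> elts X \<Longrightarrow> c' \<in> elts X \<Longrightarrow> c'' \<in> elts X \<Longrightarrow> m c c' c'' = m' c c' c''"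
  shows "mk_cat X e h n m = mk_cat X' e' h' n' m'"
  unfolding mk_cat_def using assms by (auto intro!: vlam_cong)

lemma mk_fun_sel [simp]:
  "c \<in> elts X \<Longrightarrow> fun_ob (mk_fun X fo fv fw) c = fo c"
  "c \<in> elts X \<Longrightarrow> fun_vert (mk_fun X fo fv fw) c = fv c"
  "c \<in> elts X \<Longrightarrow> c' \<in> elts X \<Longrightarrow> fun_cell (mk_fun X fo fv fw) c c' = fw c c'"
  "fun_obmap (mk_fun X fo fv fw) = vlam (elts X) fo"
  unfolding mk_fun_def fun_obmap_def fun_vert_def fun_cell_def by simp_all

lemma mk_fun_cong:
  assumes "\<And>c. c \<in> elts X \<Longrightarrow> fo c = fo' c" "\<And>c. c \<in> elts X \<Longrightarrow> fv c = fv' c"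
    "\<And>c c'. c \<in> elts X \<Longrightarrow> c' \<in> elts X \<Longrightarrow> fw c c' = fw' c c'"
  shows "mk_fun X fo fv fw = mk_fun X fo' fv' fw'"
  unfolding mk_fun_def using assms by (auto intro!: vlam_cong)

section \<open>Closure properties of universes\<close>

context
  fixes U :: "'v::zf"
  assumes U: "grothendieck_universe U"
begin

lemma universe_transitive: "x \<in> elts U \<Longrightarrow> y \<in> elts x \<Longrightarrow> y \<in> elts U"
  using U unfolding grothendieck_universe_def by blast

lemma universe_power: "x \<in> elts U \<Longrightarrow> vset {y. elts y \<subseteq> elts x} \<in> elts U"
  using U unfolding grothendieck_universe_def by simp

text \<open>A subset of \<open>x\<close> is an element of the power set of \<open>x\<close>, and a universe is transitive.\<close>

lemma universe_subset: "x \<in> elts U \<Longrightarrow> elts y \<subseteq> elts x \<Longrightarrow> y \<in> elts U"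
proof -
  assume x: "x \<in> elts U" and y: "elts y \<subseteq> elts x"
  have "y \<in> elts (vset {y. elts y \<subseteq> elts x})"
    using y by (subst elts_vset_ex) (auto intro: zf_power)
  then show ?thesis using universe_power[OF x] universe_transitive by blast
qed

lemma set_in_subset: "set_in U X \<Longrightarrow> Y \<subseteq> X \<Longrightarrow> set_in U Y"
  unfolding set_in_def by (metis universe_subset zf_separation)

lemma set_in_elts: "x \<in> elts U \<Longrightarrow> set_in U (elts x)"
  unfolding set_in_def by blast

lemma vset_in_universe: "set_in U X \<Longrightarrow> vset X \<in> elts U"
  unfolding set_in_def by auto

lemma set_in_member: "set_in U X \<Longrightarrow> x \<in> X \<Longrightarrow> x \<in> elts U"
  unfolding set_in_def using universe_transitive by blast

lemma set_in_elts_vset: "set_in U X \<Longrightarrow> elts (vset X) = X"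
  unfolding set_in_def by auto

lemma doubleton_in_universe: "x \<in> elts U \<Longrightarrow> y \<in> elts U \<Longrightarrow> vset {x, y} \<in> elts U"
  using U unfolding grothendieck_universe_def by simp

lemma singleton_in_universe: "x \<in> elts U \<Longrightarrow> vset {x} \<in> elts U"
  using doubleton_in_universe[of x x] by simp

lemma set_in_singleton: "x \<in> elts U \<Longrightarrow> set_in U {x}"
  using singleton_in_universe set_in_elts by fastforce

lemma vpair_in_universe: "x \<in> elts U \<Longrightarrow> y \<in> elts U \<Longrightarrow> vpair x y \<in> elts U"
  unfolding vpair_def by (intro doubleton_in_universe singleton_in_universe)

lemma vempty_in_universe: "vempty \<in> elts U"
proof -
  obtain x where "x \<in> elts U" using U unfolding grothendieck_universe_def by blast
  then show ?thesis by (rule universe_subset) simp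
qed

text \<open>The union axiom of a universe concerns families of elements; the union is a set by replacement
  followed by union in the ambient set theory.\<close>

lemma set_in_UN:
  assumes I: "set_in U I" and B: "\<And>i. i \<in> I \<Longrightarrow> set_in U (B i)"
  shows "set_in U (\<Union>i\<in>I. B i)"
proof -
  obtain i where i: "i \<in> elts U" "elts i = I" using I unfolding set_in_def by blast
  have "(\<lambda>j. vset (B j)) \<in> elts i \<rightarrow> elts U" using B i by (auto intro: vset_in_universe)
  moreover have "\<forall>i \<in> elts U. \<forall>f \<in> elts i \<rightarrow> elts U. vset (\<Union>j \<in> elts i. elts (f j)) \<in> elts U"
    using U unfolding grothendieck_universe_def by simp
  ultimately have *: "vset (\<Union>j \<in> elts i. elts (vset (B j))) \<in> elts U"
    using i(1) by fast
  have "elts (vset (\<Union>j \<in> elts i. elts (vset (B j)))) = (\<Union>j \<in> elts i. elts (vset (B j)))"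
  proof (rule elts_vset_ex)
    show "\<exists>b. elts b = (\<Union>j \<in> elts i. elts (vset (B j)))"
      using zf_union[of "vset ((\<lambda>j. vset (B j)) ` elts i)"] by auto
  qed
  also have "\<dots> = (\<Union>i\<in>I. B i)"
    using B i set_in_elts_vset by auto
  finally show ?thesis using * set_in_elts by metis
qed

lemma set_in_image: "set_in U X \<Longrightarrow> f ` X \<subseteq> elts U \<Longrightarrow> set_in U (f ` X)"
  using set_in_UN[of X "\<lambda>x. {f x}"] set_in_singleton
  by (auto simp: UNION_singleton_eq_range)

lemma set_in_power: "set_in U X \<Longrightarrow> set_in U {y. elts y \<subseteq> X}"
proof -
  assume X: "set_in U X"
  then obtain x where x: "x \<in> elts U" "elts x = X" unfolding set_in_def by blast
  have "elts (vset {y. elts y \<subseteq> X}) = {y. elts y \<subseteq> X}"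
    using zf_power[of x] x by (intro elts_vset_ex) simp
  then show ?thesis using universe_power[OF x(1)] x set_in_elts by metis
qed

lemma set_in_Sigma:
  assumes A: "set_in U A" and B: "\<And>a. a \<in> A \<Longrightarrow> set_in U (B a)"
  shows "set_in U {vpair a b | a b. a \<in> A \<and> b \<in> B a}"
proof -
  have "set_in U (\<Union>a\<in>A. (\<lambda>b. vpair a b) ` B a)"
  proof (intro set_in_UN set_in_image A B)
    fix a assume a: "a \<in> A"
    show "vpair a ` B a \<subseteq> elts U"
      using vpair_in_universe set_in_member[OF A a] set_in_member[OF B[OF a]] by blast
  qed
  also have "(\<Union>a\<in>A. (\<lambda>b. vpair a b) ` B a) = {vpair a b | a b. a \<in> A \<and> b \<in> B a}" by auto
  finally show ?thesis .
qed

text \<open>A graph is a set of pairs, so it belongs to the power set of the dependent sum.\<close>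

lemma set_in_Pi:
  assumes D: "D \<in> elts U" and B: "\<And>a. a \<in> elts D \<Longrightarrow> set_in U (B a)"
  shows "set_in U {vlam (elts D) f | f. \<forall>a \<in> elts D. f a \<in> B a}"
proof (rule set_in_subset[OF set_in_power[OF set_in_Sigma]])
  show "set_in U (elts D)" using D by (rule set_in_elts)
qed (use B in \<open>auto simp: elts_vlam\<close>)

end

section \<open>2-categories by whiskering\<close>

text \<open>In a 2-category the horizontal composition is determined by the two whiskerings: \<open>lw\<close> by a 1-cell on
  the left, \<open>rw\<close> by a 1-cell on the right. Conversely, functorial whiskerings that are compatible with
  composition of 1-cells define a 2-category as soon as the two ways of composing a pair of horizontally
  adjacent 2-cells agree.\<close>

locale whiskered =
  fixes K :: "('o, 'a, 'c) two_cat"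
    and lw :: "'o \<Rightarrow> 'o \<Rightarrow> 'o \<Rightarrow> 'a \<Rightarrow> 'a \<Rightarrow> 'a \<Rightarrow> 'c \<Rightarrow> 'c"
    and rw :: "'o \<Rightarrow> 'o \<Rightarrow> 'o \<Rightarrow> 'a \<Rightarrow> 'a \<Rightarrow> 'a \<Rightarrow> 'c \<Rightarrow> 'c"
  assumes id1: "A \<in> Ob K \<Longrightarrow> Id1 K A \<in> Hom1 K A A"
    and cmp1: "\<lbrakk>A \<in> Ob K; B \<in> Ob K; C \<in> Ob K; f \<in> Hom1 K A B; g \<in> Hom1 K B C\<rbrakk>
      \<Longrightarrow> Cmp1 K A B C g f \<in> Hom1 K A C"
    and cmp1_id_right: "\<lbrakk>A \<in> Ob K; B \<in> Ob K; f \<in> Hom1 K A B\<rbrakk>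
      \<Longrightarrow> Cmp1 K A A B f (Id1 K A) = f"
    and cmp1_id_left: "\<lbrakk>A \<in> Ob K; B \<in> Ob K; f \<in> Hom1 K A B\<rbrakk>
      \<Longrightarrow> Cmp1 K A B B (Id1 K B) f = f"
    and cmp1_assoc: "\<lbrakk>A \<in> Ob K; B \<in> Ob K; C \<in> Ob K; D \<in> Ob K;
        f \<in> Hom1 K A B; g \<in> Hom1 K B C; h \<in> Hom1 K C D\<rbrakk>
      \<Longrightarrow> Cmp1 K A B D (Cmp1 K B C D h g) f = Cmp1 K A C D h (Cmp1 K A B C g f)"
    and id2: "\<lbrakk>A \<in> Ob K; B \<in> Ob K; f \<in> Hom1 K A B\<rbrakk> \<Longrightarrow> Id2 K A B f \<in> Hom2 K A B f f"
    and vc: "\<lbrakk>A \<in> Ob K; B \<in> Ob K; f \<in> Hom1 K A B; g \<in> Hom1 K A B; h \<in> Hom1 K A B;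
        \<alpha> \<in> Hom2 K A B f g; \<beta> \<in> Hom2 K A B g h\<rbrakk>
      \<Longrightarrow> Vc K A B f g h \<beta> \<alpha> \<in> Hom2 K A B f h"
    and vc_id_right: "\<lbrakk>A \<in> Ob K; B \<in> Ob K; f \<in> Hom1 K A B; g \<in> Hom1 K A B; \<alpha> \<in> Hom2 K A B f g\<rbrakk>
      \<Longrightarrow> Vc K A B f f g \<alpha> (Id2 K A B f) = \<alpha>"
    and vc_id_left: "\<lbrakk>A \<in> Ob K; B \<in> Ob K; f \<in> Hom1 K A B; g \<in> Hom1 K A B; \<alpha> \<in> Hom2 K A B f g\<rbrakk>
      \<Longrightarrow> Vc K A B f g g (Id2 K A B g) \<alpha> = \<alpha>"
    and vc_assoc: "\<lbrakk>A \<in> Ob K; B \<in> Ob K;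
        f \<in> Hom1 K A B; g \<in> Hom1 K A B; h \<in> Hom1 K A B; k \<in> Hom1 K A B;
        \<alpha> \<in> Hom2 K A B f g; \<beta> \<in> Hom2 K A B g h; \<gamma> \<in> Hom2 K A B h k\<rbrakk>
      \<Longrightarrow> Vc K A B f g k (Vc K A B g h k \<gamma> \<beta>) \<alpha> = Vc K A B f h k \<gamma> (Vc K A B f g h \<beta> \<alpha>)"
    and hc_whiskers: "\<lbrakk>A \<in> Ob K; B \<in> Ob K; C \<in> Ob K;
        f \<in> Hom1 K A B; f' \<in> Hom1 K A B; g \<in> Hom1 K B C; g' \<in> Hom1 K B C;
        \<alpha> \<in> Hom2 K A B f f'; \<beta> \<in> Hom2 K B C g g'\<rbrakk>
      \<Longrightarrow> Hc K A B C f f' g g' \<beta> \<alpha>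
        = Vc K A C (Cmp1 K A B C g f) (Cmp1 K A B C g f') (Cmp1 K A B C g' f')
            (rw A B C f' g g' \<beta>) (lw A B C f f' g \<alpha>)"
    and lw: "\<lbrakk>A \<in> Ob K; B \<in> Ob K; C \<in> Ob K; f \<in> Hom1 K A B; f' \<in> Hom1 K A B; g \<in> Hom1 K B C;
        \<alpha> \<in> Hom2 K A B f f'\<rbrakk>
      \<Longrightarrow> lw A B C f f' g \<alpha> \<in> Hom2 K A C (Cmp1 K A B C g f) (Cmp1 K A B C g f')"
    and rw: "\<lbrakk>A \<in> Ob K; B \<in> Ob K; C \<in> Ob K; f \<in> Hom1 K A B; g \<in> Hom1 K B C; g' \<in> Hom1 K B C;
        \<beta> \<in> Hom2 K B C g g'\<rbrakk>
      \<Longrightarrow> rw A B C f g g' \<beta> \<in> Hom2 K A C (Cmp1 K A B C g f) (Cmp1 K A B C g' f)"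
    and lw_id2: "\<lbrakk>A \<in> Ob K; B \<in> Ob K; C \<in> Ob K; f \<in> Hom1 K A B; g \<in> Hom1 K B C\<rbrakk>
      \<Longrightarrow> lw A B C f f g (Id2 K A B f) = Id2 K A C (Cmp1 K A B C g f)"
    and rw_id2: "\<lbrakk>A \<in> Ob K; B \<in> Ob K; C \<in> Ob K; f \<in> Hom1 K A B; g \<in> Hom1 K B C\<rbrakk>
      \<Longrightarrow> rw A B C f g g (Id2 K B C g) = Id2 K A C (Cmp1 K A B C g f)"
    and lw_vc: "\<lbrakk>A \<in> Ob K; B \<in> Ob K; C \<in> Ob K;
        f \<in> Hom1 K A B; f' \<in> Hom1 K A B; f'' \<in> Hom1 K A B; g \<in> Hom1 K B C;
        \<alpha> \<in> Hom2 K A B f f'; \<alpha>' \<in> Hom2 K A B f' f''\<rbrakk>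
      \<Longrightarrow> lw A B C f f'' g (Vc K A B f f' f'' \<alpha>' \<alpha>)
        = Vc K A C (Cmp1 K A B C g f) (Cmp1 K A B C g f') (Cmp1 K A B C g f'')
            (lw A B C f' f'' g \<alpha>') (lw A B C f f' g \<alpha>)"
    and rw_vc: "\<lbrakk>A \<in> Ob K; B \<in> Ob K; C \<in> Ob K;
        f \<in> Hom1 K A B; g \<in> Hom1 K B C; g' \<in> Hom1 K B C; g'' \<in> Hom1 K B C;
        \<beta> \<in> Hom2 K B C g g'; \<beta>' \<in> Hom2 K B C g' g''\<rbrakk>
      \<Longrightarrow> rw A B C f g g'' (Vc K B C g g' g'' \<beta>' \<beta>)
        = Vc K A C (Cmp1 K A B C g f) (Cmp1 K A B C g' f) (Cmp1 K A B C g'' f)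
            (rw A B C f g' g'' \<beta>') (rw A B C f g g' \<beta>)"
    and lw_id1: "\<lbrakk>A \<in> Ob K; B \<in> Ob K; f \<in> Hom1 K A B; f' \<in> Hom1 K A B; \<alpha> \<in> Hom2 K A B f f'\<rbrakk>
      \<Longrightarrow> lw A B B f f' (Id1 K B) \<alpha> = \<alpha>"
    and rw_id1: "\<lbrakk>A \<in> Ob K; B \<in> Ob K; g \<in> Hom1 K A B; g' \<in> Hom1 K A B; \<beta> \<in> Hom2 K A B g g'\<rbrakk>
      \<Longrightarrow> rw A A B (Id1 K A) g g' \<beta> = \<beta>"
    and lw_lw: "\<lbrakk>A \<in> Ob K; B \<in> Ob K; C \<in> Ob K; D \<in> Ob K;
        f \<in> Hom1 K A B; f' \<in> Hom1 K A B; g \<in> Hom1 K B C; h \<in> Hom1 K C D; \<alpha> \<in> Hom2 K A B f f'\<rbrakk>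
      \<Longrightarrow> lw A C D (Cmp1 K A B C g f) (Cmp1 K A B C g f') h (lw A B C f f' g \<alpha>)
        = lw A B D f f' (Cmp1 K B C D h g) \<alpha>"
    and rw_rw: "\<lbrakk>A \<in> Ob K; B \<in> Ob K; C \<in> Ob K; D \<in> Ob K;
        f \<in> Hom1 K A B; g \<in> Hom1 K B C; h \<in> Hom1 K C D; h' \<in> Hom1 K C D; \<gamma> \<in> Hom2 K C D h h'\<rbrakk>
      \<Longrightarrow> rw A B D f (Cmp1 K B C D h g) (Cmp1 K B C D h' g) (rw B C D g h h' \<gamma>)
        = rw A C D (Cmp1 K A B C g f) h h' \<gamma>"
    and rw_lw: "\<lbrakk>A \<in> Ob K; B \<in> Ob K; C \<in> Ob K; D \<in> Ob K;
        f \<in> Hom1 K A B; g \<in> Hom1 K B C; g' \<in> Hom1 K B C; h \<in> Hom1 K C D; \<beta> \<in> Hom2 K B C g g'\<rbrakk>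
      \<Longrightarrow> rw A B D f (Cmp1 K B C D h g) (Cmp1 K B C D h g') (lw B C D g g' h \<beta>)
        = lw A C D (Cmp1 K A B C g f) (Cmp1 K A B C g' f) h (rw A B C f g g' \<beta>)"
    and exchange: "\<lbrakk>A \<in> Ob K; B \<in> Ob K; C \<in> Ob K;
        f \<in> Hom1 K A B; f' \<in> Hom1 K A B; g \<in> Hom1 K B C; g' \<in> Hom1 K B C;
        \<alpha> \<in> Hom2 K A B f f'; \<beta> \<in> Hom2 K B C g g'\<rbrakk>
      \<Longrightarrow> Vc K A C (Cmp1 K A B C g f) (Cmp1 K A B C g f') (Cmp1 K A B C g' f')
            (rw A B C f' g g' \<beta>) (lw A B C f f' g \<alpha>)
        = Vc K A C (Cmp1 K A B C g f) (Cmp1 K A B C g' f) (Cmp1 K A B C g' f')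
            (lw A B C f f' g' \<alpha>) (rw A B C f g g' \<beta>)"
begin

text \<open>The interchange law amounts to moving \<open>lw\<close> of the second 2-cell \<open>\<alpha>'\<close> past \<open>rw\<close> of the first 2-cell
  \<open>\<beta>\<close>, which is one use of the exchange law.\<close>

lemma two_category: "two_category K"
proof
  fix A B C D f f' g g' h h' \<alpha> \<beta> \<gamma>
  assume *: "A \<in> Ob K" "B \<in> Ob K" "C \<in> Ob K" "D \<in> Ob K" "f \<in> Hom1 K A B" "f' \<in> Hom1 K A B"
    "g \<in> Hom1 K B C" "g' \<in> Hom1 K B C" "h \<in> Hom1 K C D" "h' \<in> Hom1 K C D"
    "\<alpha> \<in> Hom2 K A B f f'" "\<beta> \<in> Hom2 K B C g g'" "\<gamma> \<in> Hom2 K C D h h'"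
  note [simp] = * id1 cmp1 lw rw vc
  have [simp]: "lw A B D f f' (Cmp1 K B C D h g) \<alpha>
      \<in> Hom2 K A D (Cmp1 K A C D h (Cmp1 K A B C g f)) (Cmp1 K A C D h (Cmp1 K A B C g f'))"
    using lw[of A B D f f' "Cmp1 K B C D h g" \<alpha>] by (simp add: cmp1_assoc)
  show "Hc K A B D f f' (Cmp1 K B C D h g) (Cmp1 K B C D h' g') (Hc K B C D g g' h h' \<gamma> \<beta>) \<alpha>
      = Hc K A C D (Cmp1 K A B C g f) (Cmp1 K A B C g' f') h h' \<gamma> (Hc K A B C f f' g g' \<beta> \<alpha>)"
    by (simp add: hc_whiskers lw_vc rw_vc rw_rw rw_lw lw_lw cmp1_assoc vc_assoc)
next
  note [simp] = id1 cmp1 cmp1_id_right cmp1_id_left cmp1_assoc id2 vc vc_id_right vc_id_left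
    lw rw lw_id2 rw_id2 lw_id1 rw_id1
  fix A B C f f' f'' g g' g'' \<alpha> \<alpha>' \<beta> \<beta>'
  assume [simp]: "A \<in> Ob K" "B \<in> Ob K" "C \<in> Ob K"
    "f \<in> Hom1 K A B" "f' \<in> Hom1 K A B" "f'' \<in> Hom1 K A B"
    "g \<in> Hom1 K B C" "g' \<in> Hom1 K B C" "g'' \<in> Hom1 K B C"
    "\<alpha> \<in> Hom2 K A B f f'" "\<alpha>' \<in> Hom2 K A B f' f''" "\<beta> \<in> Hom2 K B C g g'" "\<beta>' \<in> Hom2 K B C g' g''"
  have "Hc K A B C f f'' g g'' (Vc K B C g g' g'' \<beta>' \<beta>) (Vc K A B f f' f'' \<alpha>' \<alpha>)
      = Vc K A C (Cmp1 K A B C g f) (Cmp1 K A B C g f') (Cmp1 K A B C g'' f'')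
          (Vc K A C (Cmp1 K A B C g f') (Cmp1 K A B C g' f'') (Cmp1 K A B C g'' f'')
            (rw A B C f'' g' g'' \<beta>')
            (Vc K A C (Cmp1 K A B C g f') (Cmp1 K A B C g f'') (Cmp1 K A B C g' f'')
               (rw A B C f'' g g' \<beta>) (lw A B C f' f'' g \<alpha>')))
          (lw A B C f f' g \<alpha>)"
    by (simp add: hc_whiskers rw_vc lw_vc vc_assoc)
  also have "\<dots> = Vc K A C (Cmp1 K A B C g f) (Cmp1 K A B C g' f') (Cmp1 K A B C g'' f'')
            (Hc K A B C f' f'' g' g'' \<beta>' \<alpha>') (Hc K A B C f f' g g' \<beta> \<alpha>)"
    by (simp add: hc_whiskers exchange[of A B C f' f'' g g' \<alpha>' \<beta>] vc_assoc)
  finally show "Hc K A B C f f'' g g'' (Vc K B C g g' g'' \<beta>' \<beta>) (Vc K A B f f' f'' \<alpha>' \<alpha>)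
        = Vc K A C (Cmp1 K A B C g f) (Cmp1 K A B C g' f') (Cmp1 K A B C g'' f'')
            (Hc K A B C f' f'' g' g'' \<beta>' \<alpha>') (Hc K A B C f f' g g' \<beta> \<alpha>)" .
qed (use hc_whiskers in \<open>auto intro!: id1 cmp1 id2 vc lw rw
      simp: cmp1_id_right cmp1_id_left cmp1_assoc vc_id_right vc_id_left vc_assoc lw_id2 rw_id2
        lw_id1 rw_id1 lw_vc rw_vc lw_lw rw_rw rw_lw id1 cmp1 id2 vc lw rw\<close>)

end

section \<open>The 2-category of 2-categories\<close>

lemma mk_two_fun_sel [simp]:
  "A \<in> Ob K \<Longrightarrow> Fo (mk_two_fun K fo f1 f2) A = fo A"
  "A \<in> Ob K \<Longrightarrow> B \<in> Ob K \<Longrightarrow> f \<in> Hom1 K A B \<Longrightarrow> F1 (mk_two_fun K fo f1 f2) A B f = f1 A B f"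
  "A \<in> Ob K \<Longrightarrow> B \<in> Ob K \<Longrightarrow> f \<in> Hom1 K A B \<Longrightarrow> g \<in> Hom1 K A B \<Longrightarrow> \<alpha> \<in> Hom2 K A B f g \<Longrightarrow>
    F2 (mk_two_fun K fo f1 f2) A B f g \<alpha> = f2 A B f g \<alpha>"
  by (simp_all add: mk_two_fun_def)

lemma mk_two_fun_idem [simp]:
  "mk_two_fun K (Fo (mk_two_fun K fo f1 f2)) (F1 (mk_two_fun K fo f1 f2)) (F2 (mk_two_fun K fo f1 f2))
    = mk_two_fun K fo f1 f2"
  by (simp add: mk_two_fun_def fun_eq_iff)

lemma mk_two_fun_cong:
  assumes "\<And>A. A \<in> Ob K \<Longrightarrow> fo A = fo' A"
    "\<And>A B f. A \<in> Ob K \<Longrightarrow> B \<in> Ob K \<Longrightarrow> f \<in> Hom1 K A B \<Longrightarrow> f1 A B f = f1' A B f"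
    "\<And>A B f g \<alpha>. A \<in> Ob K \<Longrightarrow> B \<in> Ob K \<Longrightarrow> f \<in> Hom1 K A B \<Longrightarrow> g \<in> Hom1 K A B \<Longrightarrow>
      \<alpha> \<in> Hom2 K A B f g \<Longrightarrow> f2 A B f g \<alpha> = f2' A B f g \<alpha>"
  shows "mk_two_fun K fo f1 f2 = mk_two_fun K fo' f1' f2'"
  using assms by (auto simp: mk_two_fun_def fun_eq_iff)

lemma two_functor_id: "two_category K \<Longrightarrow> two_functor K K (id_two_fun K)"
  by standard (simp_all add: id_two_fun_def two_category.id1 two_category.cmp1 two_category.id2
      two_category.vc two_category.hc)

lemma cmp_two_fun_sel [simp]:
  "A \<in> Ob K \<Longrightarrow> Fo (cmp_two_fun K G F) A = Fo G (Fo F A)"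
  "A \<in> Ob K \<Longrightarrow> B \<in> Ob K \<Longrightarrow> f \<in> Hom1 K A B \<Longrightarrow>
    F1 (cmp_two_fun K G F) A B f = F1 G (Fo F A) (Fo F B) (F1 F A B f)"
  "A \<in> Ob K \<Longrightarrow> B \<in> Ob K \<Longrightarrow> f \<in> Hom1 K A B \<Longrightarrow> g \<in> Hom1 K A B \<Longrightarrow> \<alpha> \<in> Hom2 K A B f g \<Longrightarrow>
    F2 (cmp_two_fun K G F) A B f g \<alpha>
      = F2 G (Fo F A) (Fo F B) (F1 F A B f) (F1 F A B g) (F2 F A B f g \<alpha>)"
  by (simp_all add: cmp_two_fun_def)

lemma id_two_fun_sel [simp]:
  "A \<in> Ob K \<Longrightarrow> Fo (id_two_fun K) A = A"
  "A \<in> Ob K \<Longrightarrow> B \<in> Ob K \<Longrightarrow> f \<in> Hom1 K A B \<Longrightarrow> F1 (id_two_fun K) A B f = f"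
  "A \<in> Ob K \<Longrightarrow> B \<in> Ob K \<Longrightarrow> f \<in> Hom1 K A B \<Longrightarrow> g \<in> Hom1 K A B \<Longrightarrow> \<alpha> \<in> Hom2 K A B f g \<Longrightarrow>
    F2 (id_two_fun K) A B f g \<alpha> = \<alpha>"
  by (simp_all add: id_two_fun_def)

lemma two_functor_cmp:
  assumes K: "two_category K" and F: "two_functor K L F" and G: "two_functor L M G"
  shows "two_functor K M (cmp_two_fun K G F)"
proof -
  interpret K: two_category K by fact
  interpret F: two_functor K L F by fact
  interpret G: two_functor L M G by fact
  note [simp] = K.id1 K.cmp1 K.id2 K.vc K.hc F.fo F.f1 F.f1_id F.f1_cmp F.f2 F.f2_id F.f2_vc F.f2_hc
    G.fo G.f1 G.f1_id G.f1_cmp G.f2 G.f2_id G.f2_vc G.f2_hc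
  show ?thesis by standard (simp_all, simp add: cmp_two_fun_def)
qed

lemma two_nat_id:
  assumes L: "two_category L" and F: "two_functor K L F"
  shows "two_nat K L F F (\<lambda>A\<in>Ob K. Id1 L (Fo F A))"
proof -
  interpret L: two_category L by fact
  interpret F: two_functor K L F by fact
  show ?thesis
    by standard (simp_all add: L.id1 F.fo F.f1 F.f2 L.cmp1_id_left L.cmp1_id_right
        L.hc_id_left L.hc_id_right)
qed

lemma two_nat_vc:
  assumes L: "two_category L" and F: "two_functor K L F" and G: "two_functor K L G"
    and H: "two_functor K L H" and \<sigma>: "two_nat K L F G \<sigma>" and \<tau>: "two_nat K L G H \<tau>"
  shows "two_nat K L F H (\<lambda>A\<in>Ob K. Cmp1 L (Fo F A) (Fo G A) (Fo H A) (\<tau> A) (\<sigma> A))"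
proof -
  interpret L: two_category L by fact
  interpret F: two_functor K L F by fact
  interpret G: two_functor K L G by fact
  interpret H: two_functor K L H by fact
  interpret \<sigma>: two_nat K L F G \<sigma> by fact
  interpret \<tau>: two_nat K L G H \<tau> by fact
  note [simp] = F.fo F.f1 F.f2 G.fo G.f1 G.f2 H.fo H.f1 H.f2 \<sigma>.comp \<tau>.comp
    L.cmp1 L.id1 L.id2 L.hc
  show ?thesis
  proof
    fix A B f assume [simp]: "A \<in> Ob K" "B \<in> Ob K" "f \<in> Hom1 K A B"
    show "Cmp1 L (Fo F A) (Fo F B) (Fo H B) ((\<lambda>A\<in>Ob K. Cmp1 L (Fo F A) (Fo G A) (Fo H A) (\<tau> A) (\<sigma> A)) B) (F1 F A B f)
        = Cmp1 L (Fo F A) (Fo H A) (Fo H B) (F1 H A B f) ((\<lambda>A\<in>Ob K. Cmp1 L (Fo F A) (Fo G A) (Fo H A) (\<tau> A) (\<sigma> A)) A)"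
      by (simp add: L.cmp1_assoc \<sigma>.nat1)
        (simp add: L.cmp1_assoc[symmetric] \<tau>.nat1)
    fix g \<alpha> assume [simp]: "g \<in> Hom1 K A B" "\<alpha> \<in> Hom2 K A B f g"
    show "Hc L (Fo F A) (Fo F B) (Fo H B) (F1 F A B f) (F1 F A B g)
            ((\<lambda>A\<in>Ob K. Cmp1 L (Fo F A) (Fo G A) (Fo H A) (\<tau> A) (\<sigma> A)) B)
            ((\<lambda>A\<in>Ob K. Cmp1 L (Fo F A) (Fo G A) (Fo H A) (\<tau> A) (\<sigma> A)) B)
            (Id2 L (Fo F B) (Fo H B) ((\<lambda>A\<in>Ob K. Cmp1 L (Fo F A) (Fo G A) (Fo H A) (\<tau> A) (\<sigma> A)) B))
            (F2 F A B f g \<alpha>)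
        = Hc L (Fo F A) (Fo H A) (Fo H B)
            ((\<lambda>A\<in>Ob K. Cmp1 L (Fo F A) (Fo G A) (Fo H A) (\<tau> A) (\<sigma> A)) A)
            ((\<lambda>A\<in>Ob K. Cmp1 L (Fo F A) (Fo G A) (Fo H A) (\<tau> A) (\<sigma> A)) A)
            (F1 H A B f) (F1 H A B g) (F2 H A B f g \<alpha>)
            (Id2 L (Fo F A) (Fo H A) ((\<lambda>A\<in>Ob K. Cmp1 L (Fo F A) (Fo G A) (Fo H A) (\<tau> A) (\<sigma> A)) A))"
      by (simp add: L.hc_id2[symmetric] L.hc_assoc \<sigma>.nat1 \<sigma>.nat2)
        (simp add: L.hc_assoc[symmetric] \<tau>.nat1 \<tau>.nat2)
  qed simp_all
qed

lemma two_nat_lwhisker: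
  assumes L: "two_category L" and F: "two_functor K L F" and F': "two_functor K L F'"
    and G: "two_functor L M G" and \<sigma>: "two_nat K L F F' \<sigma>"
  shows "two_nat K M (cmp_two_fun K G F) (cmp_two_fun K G F')
    (\<lambda>A\<in>Ob K. F1 G (Fo F A) (Fo F' A) (\<sigma> A))"
proof -
  interpret L: two_category L by fact
  interpret F: two_functor K L F by fact
  interpret F': two_functor K L F' by fact
  interpret G: two_functor L M G by fact
  interpret \<sigma>: two_nat K L F F' \<sigma> by fact
  note [simp] = F.fo F.f1 F.f2 G.fo G.f1 G.f2 F'.fo F'.f1 F'.f2 \<sigma>.comp L.id2
  show ?thesis
    by standard (simp_all add: G.f1_cmp[symmetric] \<sigma>.nat1 G.f2_id[symmetric] G.f2_hc[symmetric]
        \<sigma>.nat2)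
qed

lemma two_nat_rwhisker:
  assumes F: "two_functor K L F" and \<tau>: "two_nat L M G G' \<tau>"
  shows "two_nat K M (cmp_two_fun K G F) (cmp_two_fun K G' F) (\<lambda>A\<in>Ob K. \<tau> (Fo F A))"
proof -
  interpret F: two_functor K L F by fact
  interpret \<tau>: two_nat L M G G' \<tau> by fact
  note [simp] = F.fo F.f1 F.f2 \<tau>.comp
  show ?thesis by standard (simp_all add: \<tau>.nat1 \<tau>.nat2)
qed

lemma two_CAT_sel [simp]:
  "Ob (two_CAT U) = {K. two_category K \<and> large_two_cat U K}"
  "Hom1 (two_CAT U) K L = {F. two_functor K L F}"
  "Hom2 (two_CAT U) K L F G = {\<sigma>. two_nat K L F G \<sigma>}"
  "Id1 (two_CAT U) K = id_two_fun K"
  "Cmp1 (two_CAT U) K L M G F = cmp_two_fun K G F"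
  "Id2 (two_CAT U) K L F = (\<lambda>A \<in> Ob K. Id1 L (Fo F A))"
  "Vc (two_CAT U) K L F G H \<tau> \<sigma> = (\<lambda>A \<in> Ob K. Cmp1 L (Fo F A) (Fo G A) (Fo H A) (\<tau> A) (\<sigma> A))"
  "Hc (two_CAT U) K L M F F' G G' \<tau> \<sigma> = (\<lambda>A \<in> Ob K.
       Cmp1 M (Fo G (Fo F A)) (Fo G (Fo F' A)) (Fo G' (Fo F' A))
         (\<tau> (Fo F' A)) (F1 G (Fo F A) (Fo F' A) (\<sigma> A)))"
  by (simp_all add: two_CAT_def)

lemma cmp_two_fun_id:
  assumes "two_functor K L F"
  shows "cmp_two_fun K F (id_two_fun K) = F" and "cmp_two_fun K (id_two_fun L) F = F"
proof -
  interpret F: two_functor K L F by fact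
  show "cmp_two_fun K F (id_two_fun K) = F" "cmp_two_fun K (id_two_fun L) F = F"
    unfolding cmp_two_fun_def
    by (rule trans[OF mk_two_fun_cong F.normal[symmetric]]; simp add: F.fo F.f1 F.f2)+
qed

lemma cmp_two_fun_assoc:
  assumes "two_functor K L F"
  shows "cmp_two_fun K (cmp_two_fun L H G) F = cmp_two_fun K H (cmp_two_fun K G F)"
proof -
  interpret F: two_functor K L F by fact
  show ?thesis
    unfolding cmp_two_fun_def[of K] by (rule mk_two_fun_cong; simp add: F.fo F.f1 F.f2)
qed

lemma two_category_two_CAT: "two_category (two_CAT U)"
proof (rule whiskered.two_category[where lw = "\<lambda>K L M F F' G \<sigma>. \<lambda>A\<in>Ob K. F1 G (Fo F A) (Fo F' A) (\<sigma> A)"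
      and rw = "\<lambda>K L M F G G' \<tau>. \<lambda>A\<in>Ob K. \<tau> (Fo F A)"], unfold_locales;
    unfold two_CAT_sel mem_Collect_eq;
    (elim conjE)?; (simp add: two_functor_id two_functor_cmp cmp_two_fun_id cmp_two_fun_assoc
      two_nat_id two_nat_vc two_nat_lwhisker two_nat_rwhisker two_functor.fo cong: restrict_cong; fail)?)
  fix A B f g \<alpha> assume [simp]: "two_functor A B f" "two_functor A B g" "two_nat A B f g \<alpha>"
    "two_category A" "two_category B"
  interpret f: two_functor A B f by fact
  interpret g: two_functor A B g by fact
  interpret B: two_category B by fact
  interpret \<alpha>: two_nat A B f g \<alpha> by fact
  note [simp] = f.fo g.fo \<alpha>.comp
  show "(\<lambda>Aa\<in>Ob A. Cmp1 B (Fo f Aa) (Fo f Aa) (Fo g Aa) (\<alpha> Aa)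
          ((\<lambda>A\<in>Ob A. Id1 B (Fo f A)) Aa)) = \<alpha>"
    "(\<lambda>Aa\<in>Ob A. Cmp1 B (Fo f Aa) (Fo g Aa) (Fo g Aa)
          ((\<lambda>A\<in>Ob A. Id1 B (Fo g A)) Aa) (\<alpha> Aa)) = \<alpha>"
    "(\<lambda>A\<in>Ob A. F1 (id_two_fun B) (Fo f A) (Fo g A) (\<alpha> A)) = \<alpha>"
    "(\<lambda>Aa\<in>Ob A. \<alpha> (Fo (id_two_fun A) Aa)) = \<alpha>"
    by (rule extensionalityI[OF restrict_extensional \<alpha>.normal];
        simp add: B.cmp1_id_left B.cmp1_id_right)+
next
  fix A B f g h k \<alpha> \<beta> \<gamma>
  assume "two_functor A B f" "two_functor A B g" "two_functor A B h" "two_functor A B k"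
    "two_nat A B f g \<alpha>" "two_nat A B g h \<beta>" "two_nat A B h k \<gamma>" "two_category B"
  then interpret f: two_functor A B f + g: two_functor A B g + h: two_functor A B h + k: two_functor A B k
    + \<alpha>: two_nat A B f g \<alpha> + \<beta>: two_nat A B g h \<beta> + \<gamma>: two_nat A B h k \<gamma> + B: two_category B by simp_all
  note [simp] = f.fo g.fo h.fo k.fo \<alpha>.comp \<beta>.comp \<gamma>.comp
  show "(\<lambda>Aa\<in>Ob A. Cmp1 B (Fo f Aa) (Fo g Aa) (Fo k Aa)
                ((\<lambda>Aa\<in>Ob A. Cmp1 B (Fo g Aa) (Fo h Aa) (Fo k Aa) (\<gamma> Aa) (\<beta> Aa)) Aa) (\<alpha> Aa)) =
           (\<lambda>Aa\<in>Ob A. Cmp1 B (Fo f Aa) (Fo h Aa) (Fo k Aa) (\<gamma> Aa)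
                ((\<lambda>Aa\<in>Ob A. Cmp1 B (Fo f Aa) (Fo g Aa) (Fo h Aa) (\<beta> Aa) (\<alpha> Aa)) Aa))"
    by (rule restrict_ext) (simp add: B.cmp1_assoc)
next
  fix A B C f g assume "two_functor A B f" "two_functor B C g"
  then interpret f: two_functor A B f + g: two_functor B C g by simp_all
  show "(\<lambda>Aa\<in>Ob A. F1 g (Fo f Aa) (Fo f Aa) ((\<lambda>A\<in>Ob A. Id1 B (Fo f A)) Aa))
      = (\<lambda>Aa\<in>Ob A. Id1 C (Fo (cmp_two_fun A g f) Aa))"
    by (rule restrict_ext) (simp add: f.fo g.f1_id)
next
  fix A B C f f' f'' g \<alpha> \<alpha>'
  assume "two_functor A B f" "two_functor A B f'" "two_functor A B f''"
         "two_functor B C g" "two_nat A B f f' \<alpha>" "two_nat A B f' f'' \<alpha>'"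
  then interpret f: two_functor A B f + f': two_functor A B f' + f'': two_functor A B f''
    + g: two_functor B C g + \<alpha>: two_nat A B f f' \<alpha> + \<alpha>': two_nat A B f' f'' \<alpha>' by simp_all
  show "(\<lambda>Aa\<in>Ob A. F1 g (Fo f Aa) (Fo f'' Aa)
          ((\<lambda>Aa\<in>Ob A. Cmp1 B (Fo f Aa) (Fo f' Aa) (Fo f'' Aa) (\<alpha>' Aa) (\<alpha> Aa)) Aa))
      = (\<lambda>Aa\<in>Ob A. Cmp1 C (Fo (cmp_two_fun A g f) Aa) (Fo (cmp_two_fun A g f') Aa)
            (Fo (cmp_two_fun A g f'') Aa)
            ((\<lambda>Aa\<in>Ob A. F1 g (Fo f' Aa) (Fo f'' Aa) (\<alpha>' Aa)) Aa)
            ((\<lambda>Aa\<in>Ob A. F1 g (Fo f Aa) (Fo f' Aa) (\<alpha> Aa)) Aa))"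
    by (rule restrict_ext) (simp add: f.fo f'.fo f''.fo \<alpha>.comp \<alpha>'.comp g.f1_cmp)
next
  fix A B C D f f' g h \<alpha>
  assume "two_functor A B f" "two_functor A B f'" "two_nat A B f f' \<alpha>"
  then interpret f: two_functor A B f + f': two_functor A B f' + \<alpha>: two_nat A B f f' \<alpha> by simp_all
  show "(\<lambda>Aa\<in>Ob A. F1 h (Fo (cmp_two_fun A g f) Aa) (Fo (cmp_two_fun A g f') Aa)
            ((\<lambda>Aa\<in>Ob A. F1 g (Fo f Aa) (Fo f' Aa) (\<alpha> Aa)) Aa))
      = (\<lambda>A\<in>Ob A. F1 (cmp_two_fun B h g) (Fo f A) (Fo f' A) (\<alpha> A))"
    by (rule restrict_ext) (simp add: f.fo f'.fo \<alpha>.comp)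
next
  fix A B C f f' g g' \<alpha> \<beta>
  assume "two_functor A B f" "two_functor A B f'" "two_functor B C g" "two_functor B C g'"
    "two_nat A B f f' \<alpha>" "two_nat B C g g' \<beta>"
  then interpret f: two_functor A B f + f': two_functor A B f' + g: two_functor B C g
    + g': two_functor B C g' + \<alpha>: two_nat A B f f' \<alpha> + \<beta>: two_nat B C g g' \<beta> by simp_all
  show "(\<lambda>Aa\<in>Ob A. Cmp1 C (Fo (cmp_two_fun A g f) Aa) (Fo (cmp_two_fun A g f') Aa)
            (Fo (cmp_two_fun A g' f') Aa) ((\<lambda>A\<in>Ob A. \<beta> (Fo f' A)) Aa)
            ((\<lambda>Aa\<in>Ob A. F1 g (Fo f Aa) (Fo f' Aa) (\<alpha> Aa)) Aa))
      = (\<lambda>Aa\<in>Ob A. Cmp1 C (Fo (cmp_two_fun A g f) Aa) (Fo (cmp_two_fun A g' f) Aa)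
            (Fo (cmp_two_fun A g' f') Aa)
            ((\<lambda>Aa\<in>Ob A. F1 g' (Fo f Aa) (Fo f' Aa) (\<alpha> Aa)) Aa) ((\<lambda>A\<in>Ob A. \<beta> (Fo f A)) Aa))"
    by (rule restrict_ext) (simp add: f.fo f'.fo \<alpha>.comp \<beta>.nat1)
qed

section \<open>Strict slices\<close>

lemma slice_sel [simp]:
  "(A, p) \<in> Ob (slice C X) \<longleftrightarrow> A \<in> Ob C \<and> p \<in> Hom1 C A X"
  "f \<in> Hom1 (slice C X) (A, p) (B, q) \<longleftrightarrow> f \<in> Hom1 C A B \<and> Cmp1 C A B X q f = p"
  "\<alpha> \<in> Hom2 (slice C X) (A, p) (B, q) f g \<longleftrightarrow>
    \<alpha> \<in> Hom2 C A B f g \<and> Hc C A B X f g q q (Id2 C B X q) \<alpha> = Id2 C A X p"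
  "Id1 (slice C X) (A, p) = Id1 C A"
  "Cmp1 (slice C X) (A, p) (B, q) (D, r) g f = Cmp1 C A B D g f"
  "Id2 (slice C X) (A, p) (B, q) f = Id2 C A B f"
  "Vc (slice C X) (A, p) (B, q) f g h \<beta> \<alpha> = Vc C A B f g h \<beta> \<alpha>"
  "Hc (slice C X) (A, p) (B, q) (D, r) f f' g g' \<beta> \<alpha> = Hc C A B D f f' g g' \<beta> \<alpha>"
  by (simp_all add: slice_def)

text \<open>Since the conditions on 2-cells say that a whiskering with the projection is an identity, they are
  closed under vertical composition by interchange and under horizontal composition by associativity.\<close>

lemma two_category_slice:
  assumes "two_category C" and X: "X \<in> Ob C"
  shows "two_category (slice C X)"
proof -
  interpret C: two_category C by fact
  note [simp] = X C.id1 C.cmp1 C.cmp1_id_left C.cmp1_id_right C.id2 C.vc C.hc C.vc_id_left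
    C.vc_id_right C.hc_id2 C.hc_id_right C.hc_id_left
  have vc: "Hc C A B X f h q q (Id2 C B X q) (Vc C A B f g h \<beta> \<alpha>) = Id2 C A X p"
    if "A \<in> Ob C" "B \<in> Ob C" "f \<in> Hom1 C A B" "g \<in> Hom1 C A B" "h \<in> Hom1 C A B"
      "q \<in> Hom1 C B X" "Cmp1 C A B X q f = p" "Cmp1 C A B X q g = p" "Cmp1 C A B X q h = p"
      "\<alpha> \<in> Hom2 C A B f g" "\<beta> \<in> Hom2 C A B g h"
      "Hc C A B X f g q q (Id2 C B X q) \<alpha> = Id2 C A X p"
      "Hc C A B X g h q q (Id2 C B X q) \<beta> = Id2 C A X p"
    for A B f g h p q \<alpha> \<beta>
  proof -
    have p: "p \<in> Hom1 C A X" using C.cmp1[of A B X f q] that by simp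
    then show ?thesis
      using C.interchange[of A B X f g h q q q \<alpha> \<beta> "Id2 C B X q" "Id2 C B X q"] that by simp
  qed
  have hc: "Hc C A D X (Cmp1 C A B D g f) (Cmp1 C A B D g' f') r r (Id2 C D X r)
        (Hc C A B D f f' g g' \<beta> \<alpha>) = Id2 C A X (Cmp1 C A D X r (Cmp1 C A B D g f))"
    if "A \<in> Ob C" "B \<in> Ob C" "D \<in> Ob C" "f \<in> Hom1 C A B" "f' \<in> Hom1 C A B"
      "g \<in> Hom1 C B D" "g' \<in> Hom1 C B D"
      "r \<in> Hom1 C D X"
      "Cmp1 C A D X r (Cmp1 C A B D g f') = Cmp1 C A D X r (Cmp1 C A B D g f)"
      "Cmp1 C B D X r g' = Cmp1 C B D X r g"
      "\<alpha> \<in> Hom2 C A B f f'" "\<beta> \<in> Hom2 C B D g g'"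
      "Hc C A B X f f' (Cmp1 C B D X r g) (Cmp1 C B D X r g) (Id2 C B X (Cmp1 C B D X r g)) \<alpha>
        = Id2 C A X (Cmp1 C A D X r (Cmp1 C A B D g f))"
      "Hc C B D X g g' r r (Id2 C D X r) \<beta> = Id2 C B X (Cmp1 C B D X r g)"
    for A B D f f' g g' r \<alpha> \<beta>
    using C.hc_assoc[of A B D X f f' g g' r r \<alpha> \<beta> "Id2 C D X r"] that by simp
  show ?thesis
    by (standard; clarsimp simp only: split_paired_all slice_sel)
      (auto simp: C.cmp1_assoc C.vc_assoc C.interchange C.hc_assoc intro: vc hc)
qed

section \<open>The locally chaotic 2-category of small sets\<close>

lemma Set_lc_sel [simp]:
  "Ob (Set_lc U) = elts U"
  "Hom1 (Set_lc U) X Y = {vlam (elts X) f | f. f \<in> elts X \<rightarrow> elts Y}"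
  "Hom2 (Set_lc U) X Y f g = {vempty}"
  "Id1 (Set_lc U) X = vlam (elts X) (\<lambda>x. x)"
  "Cmp1 (Set_lc U) X Y Z g f = vlam (elts X) (\<lambda>x. vapp g (vapp f x))"
  "Id2 (Set_lc U) X Y f = vempty"
  "Vc (Set_lc U) X Y f g h \<beta> \<alpha> = vempty"
  "Hc (Set_lc U) X Y Z f f' g g' \<beta> \<alpha> = vempty"
  by (simp_all add: Set_lc_def)

lemma two_category_Set_lc: "two_category (Set_lc U)"
  by standard (auto intro!: vlam_cong exI simp: Pi_iff)

lemma large_Set_lc:
  assumes U2: "grothendieck_universe U2" and U1: "U1 \<in> elts U2"
  shows "large_two_cat U2 (Set_lc U1)"
  unfolding large_two_cat_def Set_lc_sel
proof (intro conjI ballI)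
  show "set_in U2 (elts U1)" using U1 by (rule set_in_elts[OF U2])
  fix X Y assume XY: "X \<in> elts U1" "Y \<in> elts U1"
  then have "set_in U2 {vlam (elts X) f | f. \<forall>x\<in>elts X. f x \<in> elts Y}"
    using universe_transitive[OF U2 U1] by (intro set_in_Pi U2 set_in_elts[OF U2]) auto
  then show "set_in U2 {vlam (elts X) f | f. f \<in> elts X \<rightarrow> elts Y}"
    by (rule set_in_subset[OF U2]) auto
  show "set_in U2 {vempty}" by (intro set_in_singleton vempty_in_universe U2)
qed

lemma Set_lc_in_two_CAT:
  "grothendieck_universe U2 \<Longrightarrow> U1 \<in> elts U2 \<Longrightarrow> Set_lc U1 \<in> Ob (two_CAT U2)"
  by (simp add: two_category_Set_lc large_Set_lc)

text \<open>All 2-cells of \<open>Set_lc\<close> are equal to \<open>vempty\<close>, but the 2-natural transformations with values in it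
  have functions as components. The slice condition on 2-cells is thus an equation between functions
  for each object: the components of \<open>\<sigma>\<close> lie over identities.\<close>

lemma two_nat_over_Set_lc_iff:
  assumes F: "two_functor K L F" and F': "two_functor K L F'" and \<sigma>: "two_nat K L F F' \<sigma>"
    and Q: "two_functor L (Set_lc U) Q"
    and P: "cmp_two_fun K Q F = P" "cmp_two_fun K Q F' = P"
  shows "Hc (two_CAT V) K L (Set_lc U) F F' Q Q (Id2 (two_CAT V) L (Set_lc U) Q) \<sigma>
      = Id2 (two_CAT V) K (Set_lc U) P
    \<longleftrightarrow> (\<forall>A \<in> Ob K. \<forall>x \<in> elts (Fo P A). vapp (F1 Q (Fo F A) (Fo F' A) (\<sigma> A)) x = x)"
    (is "?L \<longleftrightarrow> ?R")
proof -
  interpret F: two_functor K L F by fact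
  interpret F': two_functor K L F' by fact
  interpret \<sigma>: two_nat K L F F' \<sigma> by fact
  interpret Q: two_functor L "Set_lc U" Q by fact
  have *: "vlam (elts (Fo Q (Fo F A)))
        (\<lambda>x. vapp (vlam (elts (Fo Q (Fo F' A))) (\<lambda>x. x)) (vapp (F1 Q (Fo F A) (Fo F' A) (\<sigma> A)) x))
      = vlam (elts (Fo P A)) (\<lambda>x. x) \<longleftrightarrow>
      (\<forall>x \<in> elts (Fo P A). vapp (F1 Q (Fo F A) (Fo F' A) (\<sigma> A)) x = x)" if A: "A \<in> Ob K" for A
  proof -
    have "Fo P A = Fo Q (Fo F A)" "Fo P A = Fo Q (Fo F' A)"
      using A cmp_two_fun_sel(1)[OF A, of Q F] cmp_two_fun_sel(1)[OF A, of Q F'] P by simp_all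
    moreover have "F1 Q (Fo F A) (Fo F' A) (\<sigma> A) \<in> Hom1 (Set_lc U) (Fo Q (Fo F A)) (Fo Q (Fo F' A))"
      using A by (intro Q.f1 F.fo F'.fo \<sigma>.comp)
    then have "\<And>x. x \<in> elts (Fo Q (Fo F A)) \<Longrightarrow>
        vapp (F1 Q (Fo F A) (Fo F' A) (\<sigma> A)) x \<in> elts (Fo Q (Fo F' A))"
      by auto
    ultimately show ?thesis by (simp add: vlam_eq_iff)
  qed
  have restrict_eq_iff: "restrict s S = restrict t S \<longleftrightarrow> (\<forall>A\<in>S. s A = t A)"
    for s t :: "'a \<Rightarrow> 'b" and S
    by (metis restrict_apply' restrict_ext)
  show ?thesis
    unfolding two_CAT_sel restrict_eq_iff using * by (simp add: F'.fo)
qed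

section \<open>Paths and rows of multicells\<close>

lemma hend_simps [simp]:
  "hend a [] = a" "hend a (\<Gamma> # \<Gamma>s) = hend (htgt \<Gamma>) \<Gamma>s" "hend a (\<Gamma>s @ \<Gamma>s') = hend (hend a \<Gamma>s) \<Gamma>s'"
  by (auto simp: hend_def)

lemma rvert_simps [simp]:
  "rvert u [] = u" "rvert u (B # bs) = rvert (bvert B) bs" "rvert u (bs @ bs') = rvert (rvert u bs) bs'"
  by (auto simp: rvert_def)

lemma hpath_append [simp]: "hpath A a (\<Gamma>s @ \<Gamma>s') \<longleftrightarrow> hpath A a \<Gamma>s \<and> hpath A (hend a \<Gamma>s) \<Gamma>s'"
proof (induction \<Gamma>s arbitrary: a)
  case Nil
  have "hpath A a \<Gamma>s' \<Longrightarrow> a \<in> VOb A" by (cases \<Gamma>s') (auto simp: is_hmor_def)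
  then show ?case by auto
qed auto

lemma hpath_start [intro]: "hpath A a \<Gamma>s \<Longrightarrow> a \<in> VOb A"
  by (cases \<Gamma>s) (auto simp: is_hmor_def)

lemma hpath_hend [intro]: "hpath A a \<Gamma>s \<Longrightarrow> hend a \<Gamma>s \<in> VOb A"
  by (induction \<Gamma>s arbitrary: a) auto

lemma is_hmorD: "is_hmor A \<Gamma> \<Longrightarrow> hsrc \<Gamma> \<in> VOb A" "is_hmor A \<Gamma> \<Longrightarrow> htgt \<Gamma> \<in> VOb A"
  "is_hmor A \<Gamma> \<Longrightarrow> hlab \<Gamma> \<in> HHom A (hsrc \<Gamma>) (htgt \<Gamma>)"
  by (auto simp: is_hmor_def)

lemma is_bdryD:
  assumes "is_bdry A a \<Gamma>s \<Delta> u u'"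
  shows "hpath A a \<Gamma>s" "is_hmor A \<Delta>" "u \<in> VHom A a (hsrc \<Delta>)" "u' \<in> VHom A (hend a \<Gamma>s) (htgt \<Delta>)"
    "a \<in> VOb A" "hend a \<Gamma>s \<in> VOb A" "hsrc \<Delta> \<in> VOb A" "htgt \<Delta> \<in> VOb A"
  using assms by (auto simp: is_bdry_def is_hmor_def)

lemma row_simps [simp]:
  "row A a b u (B # bs) \<longleftrightarrow> is_bdry A a (btop B) (bbot B) u (bvert B) \<and> hsrc (bbot B) = b \<and>
     bcell B \<in> MCell A a (btop B) (bbot B) u (bvert B) \<and>
     row A (hend a (btop B)) (htgt (bbot B)) (bvert B) bs"
  by (cases B) simp

lemma row_start: "row A a b u bs \<Longrightarrow> a \<in> VOb A \<and> b \<in> VOb A \<and> u \<in> VHom A a b"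
  by (cases bs) (auto dest: is_bdryD)

lemma row_append [simp]:
  "row A a b u (bs @ bs') \<longleftrightarrow> row A a b u bs \<and> row A (hend a (tops bs)) (hend b (bots bs)) (rvert u bs) bs'"
proof (induction bs arbitrary: a b u)
  case Nil then show ?case by (auto dest: row_start)
qed auto

lemma row_paths:
  "row A a b u bs \<Longrightarrow> hpath A a (tops bs) \<and> hpath A b (bots bs) \<and>
     rvert u bs \<in> VHom A (hend a (tops bs)) (hend b (bots bs))"
  by (induction bs arbitrary: a b u) (auto dest: is_bdryD)

context virtual_double_category
begin

lemma bdry_cmp:
  assumes "row A a b u bs" "is_bdry A b (bots bs) \<Lambda> v v'"
  shows "is_bdry A a (tops bs) \<Lambda> (VCmp A a b (hsrc \<Lambda>) v u)
    (VCmp A (hend a (tops bs)) (hend b (bots bs)) (htgt \<Lambda>) v' (rvert u bs))"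
  using assms by (auto simp: is_bdry_def dest: row_start row_paths is_hmorD intro!: vcmp)

text \<open>The general associativity law is formulated with nested rows. This and the next lemma free it of nested
  lists in the case that the middle row is a single multicell.\<close>

lemma mcmp_assoc1:
  assumes "row A z a w \<psi>s" "bots \<psi>s = \<Gamma>s" "is_bdry A a \<Gamma>s \<Delta> u u'" "\<theta> \<in> MCell A a \<Gamma>s \<Delta> u u'"
    "is_hmor A \<Lambda>" "v \<in> VHom A (hsrc \<Delta>) (hsrc \<Lambda>)" "v' \<in> VHom A (htgt \<Delta>) (htgt \<Lambda>)"
    "\<kappa> \<in> MCell A (hsrc \<Delta>) [\<Delta>] \<Lambda> v v'" "b = hsrc \<Delta>"
  shows "MCmp A z b (VCmp A z a b u w)
       [Block (tops \<psi>s) (MCmp A z a w \<psi>s \<Delta> u u' \<theta>) \<Delta>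
         (VCmp A (hend z (tops \<psi>s)) (hend a \<Gamma>s) (htgt \<Delta>) u' (rvert w \<psi>s))] \<Lambda> v v' \<kappa>
    = MCmp A z a w \<psi>s \<Lambda> (VCmp A a b (hsrc \<Lambda>) v u)
       (VCmp A (hend a \<Gamma>s) (htgt \<Delta>) (htgt \<Lambda>) v' u')
       (MCmp A a b u [Block \<Gamma>s \<theta> \<Delta> u'] \<Lambda> v v' \<kappa>)"
proof -
  have "is_bdry A (hsrc \<Delta>) [\<Delta>] \<Lambda> v v'"
    using assms by (auto simp: is_bdry_def dest: is_hmorD)
  with assms mcmp_assoc[of z a w "[(Block \<Gamma>s \<theta> \<Delta> u', \<psi>s)]" b u \<Lambda> v v' \<kappa>]
  show ?thesis by (auto dest: is_bdryD)
qed

lemma mcmp_assoc11: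
  assumes "is_bdry A z \<Theta>s \<Gamma> w w'" "\<psi> \<in> MCell A z \<Theta>s \<Gamma> w w'"
    "is_bdry A (hsrc \<Gamma>) [\<Gamma>] \<Delta> u u'" "\<theta> \<in> MCell A (hsrc \<Gamma>) [\<Gamma>] \<Delta> u u'"
    "is_bdry A (hsrc \<Delta>) [\<Delta>] \<Lambda> v v'" "\<kappa> \<in> MCell A (hsrc \<Delta>) [\<Delta>] \<Lambda> v v'"
  shows "MCmp A z (hsrc \<Delta>) (VCmp A z (hsrc \<Gamma>) (hsrc \<Delta>) u w)
      [Block \<Theta>s (MCmp A z (hsrc \<Gamma>) w [Block \<Theta>s \<psi> \<Gamma> w'] \<Delta> u u' \<theta>) \<Delta>
        (VCmp A (hend z \<Theta>s) (htgt \<Gamma>) (htgt \<Delta>) u' w')] \<Lambda> v v' \<kappa>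
    = MCmp A z (hsrc \<Gamma>) w [Block \<Theta>s \<psi> \<Gamma> w'] \<Lambda>
        (VCmp A (hsrc \<Gamma>) (hsrc \<Delta>) (hsrc \<Lambda>) v u) (VCmp A (htgt \<Gamma>) (htgt \<Delta>) (htgt \<Lambda>) v' u')
        (MCmp A (hsrc \<Gamma>) (hsrc \<Delta>) u [Block [\<Gamma>] \<theta> \<Delta> u'] \<Lambda> v v' \<kappa>)"
  using mcmp_assoc1[of z "hsrc \<Gamma>" w "[Block \<Theta>s \<psi> \<Gamma> w']" "[\<Gamma>]" \<Delta> u u' \<theta> \<Lambda> v v' \<kappa> "hsrc \<Delta>"]
    assms is_bdryD[OF assms(1)] is_bdryD[OF assms(3)] is_bdryD[OF assms(5)] by simp

end

section \<open>Virtual double functors\<close>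

lemma mk_vd_fun_sel [simp]:
  "a \<in> VOb A \<Longrightarrow> Go (mk_vd_fun A go gv gh gm) a = go a"
  "a \<in> VOb A \<Longrightarrow> b \<in> VOb A \<Longrightarrow> u \<in> VHom A a b \<Longrightarrow> GV (mk_vd_fun A go gv gh gm) a b u = gv a b u"
  "a \<in> VOb A \<Longrightarrow> b \<in> VOb A \<Longrightarrow> \<gamma> \<in> HHom A a b \<Longrightarrow> GH (mk_vd_fun A go gv gh gm) a b \<gamma> = gh a b \<gamma>"
  "is_bdry A a \<Gamma>s \<Delta> u u' \<Longrightarrow> \<theta> \<in> MCell A a \<Gamma>s \<Delta> u u' \<Longrightarrow>
    GM (mk_vd_fun A go gv gh gm) a \<Gamma>s \<Delta> u u' \<theta> = gm a \<Gamma>s \<Delta> u u' \<theta>"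
  by (simp_all add: mk_vd_fun_def)

lemma mk_vd_fun_idem [simp]:
  "mk_vd_fun A (Go (mk_vd_fun A go gv gh gm)) (GV (mk_vd_fun A go gv gh gm))
     (GH (mk_vd_fun A go gv gh gm)) (GM (mk_vd_fun A go gv gh gm)) = mk_vd_fun A go gv gh gm"
  by (simp add: mk_vd_fun_def fun_eq_iff)

lemma mk_vd_fun_cong:
  assumes "\<And>a. a \<in> VOb A \<Longrightarrow> go a = go' a"
    "\<And>a b u. a \<in> VOb A \<Longrightarrow> b \<in> VOb A \<Longrightarrow> u \<in> VHom A a b \<Longrightarrow> gv a b u = gv' a b u"
    "\<And>a b \<gamma>. a \<in> VOb A \<Longrightarrow> b \<in> VOb A \<Longrightarrow> \<gamma> \<in> HHom A a b \<Longrightarrow> gh a b \<gamma> = gh' a b \<gamma>"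
    "\<And>a \<Gamma>s \<Delta> u u' \<theta>. is_bdry A a \<Gamma>s \<Delta> u u' \<Longrightarrow> \<theta> \<in> MCell A a \<Gamma>s \<Delta> u u' \<Longrightarrow>
      gm a \<Gamma>s \<Delta> u u' \<theta> = gm' a \<Gamma>s \<Delta> u u' \<theta>"
  shows "mk_vd_fun A go gv gh gm = mk_vd_fun A go' gv' gh' gm'"
  using assms by (auto simp: mk_vd_fun_def fun_eq_iff)

lemma hmap_sel [simp]: "hsrc (hmap G \<Gamma>) = Go G (hsrc \<Gamma>)" "htgt (hmap G \<Gamma>) = Go G (htgt \<Gamma>)"
  "hlab (hmap G \<Gamma>) = GH G (hsrc \<Gamma>) (htgt \<Gamma>) (hlab \<Gamma>)"
  by (simp_all add: hmap_def)

lemma hend_map_hmap [simp]: "hend (Go G a) (map (hmap G) \<Gamma>s) = Go G (hend a \<Gamma>s)"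
  by (induction \<Gamma>s arbitrary: a) auto

lemma hend_map_hmap_comp [simp]: "hend (Go G a) (map (hmap G \<circ> f) xs) = Go G (hend a (map f xs))"
  using hend_map_hmap[of G a "map f xs"] by (simp del: hend_map_hmap)

lemma map_row_simps [simp]:
  "map_row G a u (B # bs) = Block (map (hmap G) (btop B)) (GM G a (btop B) (bbot B) u (bvert B) (bcell B))
     (hmap G (bbot B)) (GV G (hend a (btop B)) (htgt (bbot B)) (bvert B))
     # map_row G (hend a (btop B)) (bvert B) bs"
  by (cases B) simp

lemma tops_map_row [simp]: "tops (map_row G a u bs) = map (hmap G) (tops bs)"
  by (induction bs arbitrary: a u) auto

lemma bots_map_row [simp]: "bots (map_row G a u bs) = map (hmap G) (bots bs)"
  by (induction bs arbitrary: a u) auto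

lemma rvert_map_row:
  "row A a b u bs \<Longrightarrow>
    rvert (GV G a b u) (map_row G a u bs) = GV G (hend a (tops bs)) (hend b (bots bs)) (rvert u bs)"
  by (induction bs arbitrary: a b u) auto

context virtual_double_functor
begin

lemma hmor: "is_hmor A \<Gamma> \<Longrightarrow> is_hmor B (hmap G \<Gamma>)"
  by (simp add: is_hmor_def go gh)

lemma path: "hpath A a \<Gamma>s \<Longrightarrow> hpath B (Go G a) (map (hmap G) \<Gamma>s)"
  by (induction \<Gamma>s arbitrary: a) (auto simp: go hmor)

lemma bdry: "is_bdry A a \<Gamma>s \<Delta> u u' \<Longrightarrow> is_bdry B (Go G a) (map (hmap G) \<Gamma>s) (hmap G \<Delta>)
    (GV G a (hsrc \<Delta>) u) (GV G (hend a \<Gamma>s) (htgt \<Delta>) u')"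
  using is_bdryD[of A a \<Gamma>s \<Delta> u u'] by (simp add: is_bdry_def[of B] path hmor gv)

lemma row_map_row:
  "row A a b u bs \<Longrightarrow> row B (Go G a) (Go G b) (GV G a b u) (map_row G a u bs)"
  by (induction bs arbitrary: a b u) (auto simp: go gv bdry gm)

end

text \<open>Virtual double functors are normalised outside their domain, so they are equal if they agree on it.\<close>

lemma virtual_double_functor_eqI:
  assumes F: "virtual_double_functor A B F" and G: "virtual_double_functor A B G"
    and "\<And>a. a \<in> VOb A \<Longrightarrow> Go F a = Go G a"
    "\<And>a b u. a \<in> VOb A \<Longrightarrow> b \<in> VOb A \<Longrightarrow> u \<in> VHom A a b \<Longrightarrow> GV F a b u = GV G a b u"
    "\<And>a b \<gamma>. a \<in> VOb A \<Longrightarrow> b \<in> VOb A \<Longrightarrow> \<gamma> \<in> HHom A a b \<Longrightarrow> GH F a b \<gamma> = GH G a b \<gamma>"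
    "\<And>a \<Gamma>s \<Delta> u u' \<theta>. is_bdry A a \<Gamma>s \<Delta> u u' \<Longrightarrow> \<theta> \<in> MCell A a \<Gamma>s \<Delta> u u' \<Longrightarrow>
      GM F a \<Gamma>s \<Delta> u u' \<theta> = GM G a \<Gamma>s \<Delta> u u' \<theta>"
  shows "F = G"
  using assms(3-) by (subst virtual_double_functor.normal[OF F], subst virtual_double_functor.normal[OF G])
    (rule mk_vd_fun_cong)

lemma id_vd_fun_sel [simp]:
  "a \<in> VOb A \<Longrightarrow> Go (id_vd_fun A) a = a"
  "a \<in> VOb A \<Longrightarrow> b \<in> VOb A \<Longrightarrow> u \<in> VHom A a b \<Longrightarrow> GV (id_vd_fun A) a b u = u"
  "a \<in> VOb A \<Longrightarrow> b \<in> VOb A \<Longrightarrow> \<gamma> \<in> HHom A a b \<Longrightarrow> GH (id_vd_fun A) a b \<gamma> = \<gamma>"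
  "is_hmor A \<Gamma> \<Longrightarrow> hmap (id_vd_fun A) \<Gamma> = \<Gamma>"
  "is_bdry A a \<Gamma>s \<Delta> u u' \<Longrightarrow> \<theta> \<in> MCell A a \<Gamma>s \<Delta> u u' \<Longrightarrow> GM (id_vd_fun A) a \<Gamma>s \<Delta> u u' \<theta> = \<theta>"
  by (simp_all add: id_vd_fun_def hmap_def is_hmorD)

lemma map_hmap_id [simp]: "hpath A a \<Gamma>s \<Longrightarrow> map (hmap (id_vd_fun A)) \<Gamma>s = \<Gamma>s"
  by (induction \<Gamma>s arbitrary: a) auto

lemma map_row_id [simp]: "row A a b u bs \<Longrightarrow> map_row (id_vd_fun A) a u bs = bs"
proof (induction bs arbitrary: a b u)
  case (Cons B bs)
  then show ?case
    using is_bdryD[of A a "btop B" "bbot B" u "bvert B"] map_hmap_id[of A a "btop B"]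
    by (cases B) auto
qed simp

lemma cmp_vd_fun_sel [simp]:
  "a \<in> VOb A \<Longrightarrow> Go (cmp_vd_fun A H G) a = Go H (Go G a)"
  "a \<in> VOb A \<Longrightarrow> b \<in> VOb A \<Longrightarrow> u \<in> VHom A a b \<Longrightarrow>
    GV (cmp_vd_fun A H G) a b u = GV H (Go G a) (Go G b) (GV G a b u)"
  "a \<in> VOb A \<Longrightarrow> b \<in> VOb A \<Longrightarrow> \<gamma> \<in> HHom A a b \<Longrightarrow>
    GH (cmp_vd_fun A H G) a b \<gamma> = GH H (Go G a) (Go G b) (GH G a b \<gamma>)"
  "is_hmor A \<Gamma> \<Longrightarrow> hmap (cmp_vd_fun A H G) \<Gamma> = hmap H (hmap G \<Gamma>)"
  "is_bdry A a \<Gamma>s \<Delta> u u' \<Longrightarrow> \<theta> \<in> MCell A a \<Gamma>s \<Delta> u u' \<Longrightarrow>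
    GM (cmp_vd_fun A H G) a \<Gamma>s \<Delta> u u' \<theta> = GM H (Go G a) (map (hmap G) \<Gamma>s) (hmap G \<Delta>)
        (GV G a (hsrc \<Delta>) u) (GV G (hend a \<Gamma>s) (htgt \<Delta>) u') (GM G a \<Gamma>s \<Delta> u u' \<theta>)"
  by (simp_all add: cmp_vd_fun_def hmap_def is_hmorD)

lemma map_hmap_cmp [simp]:
  "hpath A a \<Gamma>s \<Longrightarrow> map (hmap (cmp_vd_fun A H G)) \<Gamma>s = map (hmap H) (map (hmap G) \<Gamma>s)"
  by (induction \<Gamma>s arbitrary: a) auto

lemma map_row_cmp [simp]:
  "row A a b u bs \<Longrightarrow>
    map_row (cmp_vd_fun A H G) a u bs = map_row H (Go G a) (GV G a b u) (map_row G a u bs)"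
proof (induction bs arbitrary: a b u)
  case (Cons B bs)
  then show ?case
    using is_bdryD[of A a "btop B" "bbot B" u "bvert B"] map_hmap_cmp[of A a "btop B" H G]
    by (cases B) auto
qed simp

lemma virtual_double_functor_id:
  assumes "virtual_double_category A"
  shows "virtual_double_functor A A (id_vd_fun A)"
proof -
  interpret A: virtual_double_category A by fact
  show ?thesis
  proof
    fix a b u bs \<Lambda> v v' \<kappa>
    assume *: "row A a b u bs" "is_bdry A b (bots bs) \<Lambda> v v'" "\<kappa> \<in> MCell A b (bots bs) \<Lambda> v v'"
    note b = A.bdry_cmp[OF *(1,2)]
    show "GM (id_vd_fun A) a (tops bs) \<Lambda> (VCmp A a b (hsrc \<Lambda>) v u)
        (VCmp A (hend a (tops bs)) (hend b (bots bs)) (htgt \<Lambda>) v' (rvert u bs))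
        (MCmp A a b u bs \<Lambda> v v' \<kappa>)
      = MCmp A (Go (id_vd_fun A) a) (Go (id_vd_fun A) b) (GV (id_vd_fun A) a b u)
         (map_row (id_vd_fun A) a u bs) (hmap (id_vd_fun A) \<Lambda>) (GV (id_vd_fun A) b (hsrc \<Lambda>) v)
         (GV (id_vd_fun A) (hend b (bots bs)) (htgt \<Lambda>) v') (GM (id_vd_fun A) b (bots bs) \<Lambda> v v' \<kappa>)"
      using * b A.mcmp[OF *] row_start[OF *(1)] is_bdryD[OF *(2)] by simp
  next
    fix \<Gamma> assume "is_hmor A \<Gamma>"
    then show "GM (id_vd_fun A) (hsrc \<Gamma>) [\<Gamma>] \<Gamma> (VId A (hsrc \<Gamma>)) (VId A (htgt \<Gamma>)) (MId A \<Gamma>)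
        = MId A (hmap (id_vd_fun A) \<Gamma>)"
      by (simp add: A.mid is_bdry_def is_hmorD A.vid)
  next
    show "id_vd_fun A = mk_vd_fun A (Go (id_vd_fun A)) (GV (id_vd_fun A)) (GH (id_vd_fun A))
      (GM (id_vd_fun A))"
      unfolding id_vd_fun_def by simp
  next
    fix a \<Gamma>s \<Delta> u u' \<theta> assume *: "is_bdry A a \<Gamma>s \<Delta> u u'" "\<theta> \<in> MCell A a \<Gamma>s \<Delta> u u'"
    then show "GM (id_vd_fun A) a \<Gamma>s \<Delta> u u' \<theta>
       \<in> MCell A (Go (id_vd_fun A) a) (map (hmap (id_vd_fun A)) \<Gamma>s)
           (hmap (id_vd_fun A) \<Delta>) (GV (id_vd_fun A) a (hsrc \<Delta>) u)
           (GV (id_vd_fun A) (hend a \<Gamma>s) (htgt \<Delta>) u')"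
      using is_bdryD[OF *(1)] map_hmap_id[of A a \<Gamma>s] by simp
  qed (simp_all add: A.vid A.vcmp)
qed

lemma virtual_double_functor_cmp:
  assumes "virtual_double_category A" "virtual_double_functor A B G" "virtual_double_functor B C H"
  shows "virtual_double_functor A C (cmp_vd_fun A H G)"
proof -
  interpret A: virtual_double_category A by fact
  interpret G: virtual_double_functor A B G by fact
  interpret H: virtual_double_functor B C H by fact
  show ?thesis
  proof
    fix a b u bs \<Lambda> v v' \<kappa>
    assume *: "row A a b u bs" "is_bdry A b (bots bs) \<Lambda> v v'" "\<kappa> \<in> MCell A b (bots bs) \<Lambda> v v'"
    note b = A.bdry_cmp[OF *(1,2)] and s = row_start[OF *(1)] and p = row_paths[OF *(1)]
      and d = is_bdryD[OF *(2)]
    have "row B (Go G a) (Go G b) (GV G a b u) (map_row G a u bs)"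
      by (rule G.row_map_row[OF *(1)])
    moreover have "is_bdry B (Go G b) (bots (map_row G a u bs)) (hmap G \<Lambda>)
        (GV G b (hsrc \<Lambda>) v) (GV G (hend b (bots bs)) (htgt \<Lambda>) v')"
      using G.bdry[OF *(2)] by simp
    moreover have "GM G b (bots bs) \<Lambda> v v' \<kappa> \<in> MCell B (Go G b) (bots (map_row G a u bs)) (hmap G \<Lambda>)
        (GV G b (hsrc \<Lambda>) v) (GV G (hend b (bots bs)) (htgt \<Lambda>) v')"
      using G.gm[OF *(2,3)] by simp
    ultimately show "GM (cmp_vd_fun A H G) a (tops bs) \<Lambda> (VCmp A a b (hsrc \<Lambda>) v u)
        (VCmp A (hend a (tops bs)) (hend b (bots bs)) (htgt \<Lambda>) v' (rvert u bs))
        (MCmp A a b u bs \<Lambda> v v' \<kappa>)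
      = MCmp C (Go (cmp_vd_fun A H G) a) (Go (cmp_vd_fun A H G) b) (GV (cmp_vd_fun A H G) a b u)
         (map_row (cmp_vd_fun A H G) a u bs) (hmap (cmp_vd_fun A H G) \<Lambda>)
         (GV (cmp_vd_fun A H G) b (hsrc \<Lambda>) v)
         (GV (cmp_vd_fun A H G) (hend b (bots bs)) (htgt \<Lambda>) v')
         (GM (cmp_vd_fun A H G) b (bots bs) \<Lambda> v v' \<kappa>)"
      using H.gm_cmp[of "Go G a" "Go G b" "GV G a b u" "map_row G a u bs" "hmap G \<Lambda>"
          "GV G b (hsrc \<Lambda>) v" "GV G (hend b (bots bs)) (htgt \<Lambda>) v'" "GM G b (bots bs) \<Lambda> v v' \<kappa>"]
        * b A.mcmp[OF *] s d p hpath_hend[of A a "tops bs"]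
      by (simp add: G.gv_cmp G.gm_cmp rvert_map_row)
  next
    fix \<Gamma> assume \<Gamma>: "is_hmor A \<Gamma>"
    then have "is_bdry A (hsrc \<Gamma>) [\<Gamma>] \<Gamma> (VId A (hsrc \<Gamma>)) (VId A (htgt \<Gamma>))"
      by (simp add: is_bdry_def is_hmorD A.vid)
    then show "GM (cmp_vd_fun A H G) (hsrc \<Gamma>) [\<Gamma>] \<Gamma> (VId A (hsrc \<Gamma>)) (VId A (htgt \<Gamma>)) (MId A \<Gamma>)
        = MId C (hmap (cmp_vd_fun A H G) \<Gamma>)"
      using \<Gamma> H.gm_id[of "hmap G \<Gamma>"] by (simp add: A.mid is_hmorD A.vid G.gm_id G.gv_id G.hmor)
  next
    fix a \<Gamma>s \<Delta> u u' \<theta> assume *: "is_bdry A a \<Gamma>s \<Delta> u u'" "\<theta> \<in> MCell A a \<Gamma>s \<Delta> u u'"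
    show "GM (cmp_vd_fun A H G) a \<Gamma>s \<Delta> u u' \<theta>
       \<in> MCell C (Go (cmp_vd_fun A H G) a) (map (hmap (cmp_vd_fun A H G)) \<Gamma>s)
           (hmap (cmp_vd_fun A H G) \<Delta>) (GV (cmp_vd_fun A H G) a (hsrc \<Delta>) u)
           (GV (cmp_vd_fun A H G) (hend a \<Gamma>s) (htgt \<Delta>) u')"
      using * H.gm[OF G.bdry G.gm, OF *(1) *] is_bdryD[OF *(1)] map_hmap_cmp[of A a \<Gamma>s H G]
      by simp
  next
    show "cmp_vd_fun A H G = mk_vd_fun A (Go (cmp_vd_fun A H G)) (GV (cmp_vd_fun A H G))
      (GH (cmp_vd_fun A H G)) (GM (cmp_vd_fun A H G))"
      unfolding cmp_vd_fun_def by simp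
  qed (simp_all add: A.vid A.vcmp G.go H.go G.gv H.gv G.gv_id H.gv_id G.gv_cmp H.gv_cmp
      G.gh H.gh)
qed

section \<open>Vertical transformations\<close>

lemma mk_vtrans_sel [simp]:
  "a \<in> VOb A \<Longrightarrow> TV (mk_vtrans A tv tc) a = tv a"
  "is_hmor A \<Gamma> \<Longrightarrow> TC (mk_vtrans A tv tc) \<Gamma> = tc \<Gamma>"
  by (simp_all add: mk_vtrans_def)

lemma mk_vtrans_idem [simp]:
  "mk_vtrans A (TV (mk_vtrans A tv tc)) (TC (mk_vtrans A tv tc)) = mk_vtrans A tv tc"
  by (simp add: mk_vtrans_def fun_eq_iff)

lemma mk_vtrans_cong:
  assumes "\<And>a. a \<in> VOb A \<Longrightarrow> tv a = tv' a" "\<And>\<Gamma>. is_hmor A \<Gamma> \<Longrightarrow> tc \<Gamma> = tc' \<Gamma>"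
  shows "mk_vtrans A tv tc = mk_vtrans A tv' tc'"
  using assms by (auto simp: mk_vtrans_def fun_eq_iff)

text \<open>The row of components of \<open>\<sigma>\<close> on the right hand side of the naturality law for multicells.\<close>

abbreviation trans_row :: "('o, 'v, 'h, 'm, 'p, 'w, 'k, 'n) vd_fun \<Rightarrow>
    ('o, 'v, 'h, 'm, 'p, 'w, 'k, 'n) vd_fun \<Rightarrow> ('o, 'h, 'w, 'n) vtrans \<Rightarrow> ('o, 'h) hmor list \<Rightarrow>
    ('p, 'w, 'k, 'n) block list" where
  "trans_row F G \<sigma> \<Gamma>s \<equiv> map (\<lambda>\<Gamma>. Block [hmap F \<Gamma>] (TC \<sigma> \<Gamma>) (hmap G \<Gamma>) (TV \<sigma> (htgt \<Gamma>))) \<Gamma>s"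

lemma tops_trans_row [simp]: "tops (trans_row F G \<sigma> \<Gamma>s) = map (hmap F) \<Gamma>s"
  by (induction \<Gamma>s) auto

lemma bots_trans_row [simp]: "bots (trans_row F G \<sigma> \<Gamma>s) = map (hmap G) \<Gamma>s"
  by simp

lemma rvert_trans_row [simp]: "rvert (TV \<sigma> a) (trans_row F G \<sigma> \<Gamma>s) = TV \<sigma> (hend a \<Gamma>s)"
  by (induction \<Gamma>s arbitrary: a) auto

lemma row_trans_row:
  assumes "virtual_double_functor A B F" "virtual_double_functor A B G"
    "vertical_transformation A B F G \<sigma>"
  shows "hpath A a \<Gamma>s \<Longrightarrow> row B (Go F a) (Go G a) (TV \<sigma> a) (trans_row F G \<sigma> \<Gamma>s)"
proof -
  interpret F: virtual_double_functor A B F by fact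
  interpret G: virtual_double_functor A B G by fact
  interpret \<sigma>: vertical_transformation A B F G \<sigma> by fact
  show "hpath A a \<Gamma>s \<Longrightarrow> row B (Go F a) (Go G a) (TV \<sigma> a) (trans_row F G \<sigma> \<Gamma>s)"
    by (induction \<Gamma>s arbitrary: a)
      (auto simp: is_bdry_def \<sigma>.tv \<sigma>.tc F.go G.go F.hmor G.hmor dest: is_hmorD)
qed

lemma vertical_transformation_id:
  assumes "virtual_double_category B" "virtual_double_functor A B F"
  shows "vertical_transformation A B F F (mk_vtrans A (\<lambda>a. VId B (Go F a)) (\<lambda>\<Gamma>. MId B (hmap F \<Gamma>)))"
proof -
  interpret B: virtual_double_category B by fact
  interpret F: virtual_double_functor A B F by fact
  let ?i = "mk_vtrans A (\<lambda>a. VId B (Go F a)) (\<lambda>\<Gamma>. MId B (hmap F \<Gamma>))"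
  show ?thesis
  proof
    fix a \<Gamma>s \<Delta> u u' \<theta> assume *: "is_bdry A a \<Gamma>s \<Delta> u u'" "\<theta> \<in> MCell A a \<Gamma>s \<Delta> u u'"
    have "trans_row F F ?i \<Gamma>s
      = map (\<lambda>\<Delta>. Block [\<Delta>] (MId B \<Delta>) \<Delta> (VId B (htgt \<Delta>))) (map (hmap F) \<Gamma>s)"
      if "hpath A a \<Gamma>s" for a
      using that by (induction \<Gamma>s arbitrary: a) (auto simp: is_hmorD)
    from this[OF is_bdryD(1)[OF *(1)]] * is_bdryD[OF *(1)] B.mcmp_id_left[OF F.bdry F.gm, OF *(1) *]
      B.mcmp_id_right[OF F.bdry F.gm, OF *(1) *]
    show "MCmp B (Go F a) (Go F (hsrc \<Delta>)) (GV F a (hsrc \<Delta>) u)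
            [Block (map (hmap F) \<Gamma>s) (GM F a \<Gamma>s \<Delta> u u' \<theta>) (hmap F \<Delta>)
               (GV F (hend a \<Gamma>s) (htgt \<Delta>) u')]
            (hmap F \<Delta>) (TV ?i (hsrc \<Delta>)) (TV ?i (htgt \<Delta>)) (TC ?i \<Delta>)
        = MCmp B (Go F a) (Go F a) (TV ?i a) (trans_row F F ?i \<Gamma>s)
            (hmap F \<Delta>) (GV F a (hsrc \<Delta>) u) (GV F (hend a \<Gamma>s) (htgt \<Delta>) u')
            (GM F a \<Gamma>s \<Delta> u u' \<theta>)"
      by (simp del: map_eq_conv)
  next
    fix \<Gamma> assume "is_hmor A \<Gamma>"
    then show "TC ?i \<Gamma> \<in> MCell B (Go F (hsrc \<Gamma>)) [hmap F \<Gamma>] (hmap F \<Gamma>) (TV ?i (hsrc \<Gamma>)) (TV ?i (htgt \<Gamma>))"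
      using B.mid[of "hmap F \<Gamma>"] by (simp add: F.hmor is_hmorD)
  qed (simp_all add: B.vid F.go F.gv B.vcmp_id_left B.vcmp_id_right)
qed

text \<open>A multicell is moved first through \<open>\<sigma>\<close> and then through \<open>\<tau>\<close>. The row of components of \<open>\<sigma>\<close> and that
  of \<open>\<tau>\<close> are then merged by associativity into the row of components of the composite.\<close>

lemma vertical_transformation_vc:
  assumes "virtual_double_category B" "virtual_double_functor A B F" "virtual_double_functor A B G"
    "virtual_double_functor A B H" "vertical_transformation A B F G \<sigma>"
    "vertical_transformation A B G H \<tau>"
  shows "vertical_transformation A B F H (Vc (VDBL U) A B F G H \<tau> \<sigma>)"
proof -
  interpret B: virtual_double_category B by fact
  interpret F: virtual_double_functor A B F by fact
  interpret G: virtual_double_functor A B G by fact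
  interpret H: virtual_double_functor A B H by fact
  interpret \<sigma>: vertical_transformation A B F G \<sigma> by fact
  interpret \<tau>: vertical_transformation A B G H \<tau> by fact
  let ?c = "Vc (VDBL U) A B F G H \<tau> \<sigma>"
  have TV [simp]: "TV ?c a = VCmp B (Go F a) (Go G a) (Go H a) (TV \<tau> a) (TV \<sigma> a)"
    if "a \<in> VOb A" for a
    using that by (simp add: VDBL_def)
  have TC [simp]: "TC ?c \<Gamma> = MCmp B (Go F (hsrc \<Gamma>)) (Go G (hsrc \<Gamma>)) (TV \<sigma> (hsrc \<Gamma>))
          (trans_row F G \<sigma> [\<Gamma>]) (hmap H \<Gamma>) (TV \<tau> (hsrc \<Gamma>)) (TV \<tau> (htgt \<Gamma>)) (TC \<tau> \<Gamma>)"
    if "is_hmor A \<Gamma>" for \<Gamma>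
    using that by (simp add: VDBL_def)
  note [simp] = F.go G.go H.go F.gv G.gv H.gv F.hmor G.hmor H.hmor \<sigma>.tv \<tau>.tv \<sigma>.tc \<tau>.tc B.vcmp
  have c1: "is_bdry B (Go G (hsrc \<Gamma>)) [hmap G \<Gamma>] (hmap H \<Gamma>) (TV \<tau> (hsrc \<Gamma>)) (TV \<tau> (htgt \<Gamma>))"
    if "is_hmor A \<Gamma>" for \<Gamma>
    using that by (simp add: is_bdry_def is_hmorD)
  show ?thesis
  proof
    fix a \<Gamma>s \<Delta> u u' \<theta> assume *: "is_bdry A a \<Gamma>s \<Delta> u u'" "\<theta> \<in> MCell A a \<Gamma>s \<Delta> u u'"
    note d [simp] = is_bdryD[OF *(1)]
    note rs = row_trans_row[OF F.virtual_double_functor_axioms G.virtual_double_functor_axioms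
        \<sigma>.vertical_transformation_axioms d(1)]
    have "MCmp B (Go F a) (Go F (hsrc \<Delta>)) (GV F a (hsrc \<Delta>) u)
            [Block (map (hmap F) \<Gamma>s) (GM F a \<Gamma>s \<Delta> u u' \<theta>) (hmap F \<Delta>)
               (GV F (hend a \<Gamma>s) (htgt \<Delta>) u')]
            (hmap H \<Delta>) (TV ?c (hsrc \<Delta>)) (TV ?c (htgt \<Delta>)) (TC ?c \<Delta>)
        = MCmp B (Go F a) (Go G (hsrc \<Delta>))
           (VCmp B (Go F a) (Go F (hsrc \<Delta>)) (Go G (hsrc \<Delta>)) (TV \<sigma> (hsrc \<Delta>)) (GV F a (hsrc \<Delta>) u))
           [Block (map (hmap F) \<Gamma>s)
              (MCmp B (Go F a) (Go F (hsrc \<Delta>)) (GV F a (hsrc \<Delta>) u)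
                [Block (map (hmap F) \<Gamma>s) (GM F a \<Gamma>s \<Delta> u u' \<theta>) (hmap F \<Delta>)
                   (GV F (hend a \<Gamma>s) (htgt \<Delta>) u')]
                (hmap G \<Delta>) (TV \<sigma> (hsrc \<Delta>)) (TV \<sigma> (htgt \<Delta>)) (TC \<sigma> \<Delta>)) (hmap G \<Delta>)
              (VCmp B (Go F (hend a \<Gamma>s)) (Go F (htgt \<Delta>)) (Go G (htgt \<Delta>))
                 (TV \<sigma> (htgt \<Delta>)) (GV F (hend a \<Gamma>s) (htgt \<Delta>) u'))]
           (hmap H \<Delta>) (TV \<tau> (hsrc \<Delta>)) (TV \<tau> (htgt \<Delta>)) (TC \<tau> \<Delta>)"
      using B.mcmp_assoc11[OF F.bdry F.gm, OF *(1) *, of "hmap G \<Delta>" "TV \<sigma> (hsrc \<Delta>)" "TV \<sigma> (htgt \<Delta>)"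
          "TC \<sigma> \<Delta>" "hmap H \<Delta>" "TV \<tau> (hsrc \<Delta>)" "TV \<tau> (htgt \<Delta>)" "TC \<tau> \<Delta>"]
        \<sigma>.tc[OF d(2)] \<tau>.tc[OF d(2)] c1[OF d(2)]
      unfolding TV[OF d(7)] TV[OF d(8)] TC[OF d(2)] list.map
      by (simp add: is_bdry_def[of B "Go F (hsrc \<Delta>)"] del: TV TC)
    also have "\<dots> = MCmp B (Go F a) (Go G (hsrc \<Delta>))
           (VCmp B (Go F a) (Go G a) (Go G (hsrc \<Delta>)) (GV G a (hsrc \<Delta>) u) (TV \<sigma> a))
           [Block (map (hmap F) \<Gamma>s)
              (MCmp B (Go F a) (Go G a) (TV \<sigma> a) (trans_row F G \<sigma> \<Gamma>s)
                (hmap G \<Delta>) (GV G a (hsrc \<Delta>) u) (GV G (hend a \<Gamma>s) (htgt \<Delta>) u')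
                (GM G a \<Gamma>s \<Delta> u u' \<theta>)) (hmap G \<Delta>)
              (VCmp B (Go F (hend a \<Gamma>s)) (Go G (hend a \<Gamma>s)) (Go G (htgt \<Delta>))
                 (GV G (hend a \<Gamma>s) (htgt \<Delta>) u') (TV \<sigma> (hend a \<Gamma>s)))]
           (hmap H \<Delta>) (TV \<tau> (hsrc \<Delta>)) (TV \<tau> (htgt \<Delta>)) (TC \<tau> \<Delta>)"
      by (simp only: \<sigma>.tc_nat[OF *] \<sigma>.tv_nat[of a "hsrc \<Delta>" u] \<sigma>.tv_nat[of "hend a \<Gamma>s" "htgt \<Delta>" u'] d)
    also have "\<dots> = MCmp B (Go F a) (Go G a) (TV \<sigma> a) (trans_row F G \<sigma> \<Gamma>s) (hmap H \<Delta>)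
         (VCmp B (Go G a) (Go G (hsrc \<Delta>)) (Go H (hsrc \<Delta>)) (TV \<tau> (hsrc \<Delta>)) (GV G a (hsrc \<Delta>) u))
         (VCmp B (Go G (hend a \<Gamma>s)) (Go G (htgt \<Delta>)) (Go H (htgt \<Delta>)) (TV \<tau> (htgt \<Delta>))
            (GV G (hend a \<Gamma>s) (htgt \<Delta>) u'))
         (MCmp B (Go G a) (Go G (hsrc \<Delta>)) (GV G a (hsrc \<Delta>) u)
            [Block (map (hmap G) \<Gamma>s) (GM G a \<Gamma>s \<Delta> u u' \<theta>) (hmap G \<Delta>)
               (GV G (hend a \<Gamma>s) (htgt \<Delta>) u')]
            (hmap H \<Delta>) (TV \<tau> (hsrc \<Delta>)) (TV \<tau> (htgt \<Delta>)) (TC \<tau> \<Delta>))"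
      using B.mcmp_assoc1[OF rs bots_trans_row G.bdry[OF *(1)] G.gm[OF *], of "hmap H \<Delta>"
          "TV \<tau> (hsrc \<Delta>)" "TV \<tau> (htgt \<Delta>)" "TC \<tau> \<Delta>" "Go G (hsrc \<Delta>)"] \<tau>.tc[OF d(2)]
      unfolding tops_trans_row hend_map_hmap rvert_trans_row hmap_sel by simp
    also have "\<dots> = MCmp B (Go F a) (Go G a) (TV \<sigma> a) (trans_row F G \<sigma> \<Gamma>s) (hmap H \<Delta>)
         (VCmp B (Go G a) (Go H a) (Go H (hsrc \<Delta>)) (GV H a (hsrc \<Delta>) u) (TV \<tau> a))
         (VCmp B (Go G (hend a \<Gamma>s)) (Go H (hend a \<Gamma>s)) (Go H (htgt \<Delta>))
            (GV H (hend a \<Gamma>s) (htgt \<Delta>) u') (TV \<tau> (hend a \<Gamma>s)))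
         (MCmp B (Go G a) (Go H a) (TV \<tau> a) (trans_row G H \<tau> \<Gamma>s)
           (hmap H \<Delta>) (GV H a (hsrc \<Delta>) u) (GV H (hend a \<Gamma>s) (htgt \<Delta>) u') (GM H a \<Gamma>s \<Delta> u u' \<theta>))"
      by (simp only: \<tau>.tc_nat[OF *] \<tau>.tv_nat[of a "hsrc \<Delta>" u] \<tau>.tv_nat[of "hend a \<Gamma>s" "htgt \<Delta>" u'] d)
    also have "\<dots> = MCmp B (Go F a) (Go H a) (TV ?c a) (trans_row F H ?c \<Gamma>s)
        (hmap H \<Delta>) (GV H a (hsrc \<Delta>) u) (GV H (hend a \<Gamma>s) (htgt \<Delta>) u') (GM H a \<Gamma>s \<Delta> u u' \<theta>)"
    proof -
      \<comment> \<open>each component of \<open>\<tau>\<close> receives exactly one component of \<open>\<sigma>\<close>\<close>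
      define gs where "gs = map (\<lambda>\<Gamma>. (Block [hmap G \<Gamma>] (TC \<tau> \<Gamma>) (hmap H \<Gamma>) (TV \<tau> (htgt \<Gamma>)),
        trans_row F G \<sigma> [\<Gamma>])) \<Gamma>s"
      have fst: "map fst gs = trans_row G H \<tau> \<Gamma>s" and snd: "concat (map snd gs) = trans_row F G \<sigma> \<Gamma>s"
        unfolding gs_def by (auto simp: comp_def)
      have cmp: "hpath A a \<Gamma>s \<Longrightarrow> cmp_row B (Go F a) (Go G a) (Go H a) (TV \<sigma> a) (TV \<tau> a)
          (map (\<lambda>\<Gamma>. (Block [hmap G \<Gamma>] (TC \<tau> \<Gamma>) (hmap H \<Gamma>) (TV \<tau> (htgt \<Gamma>)),
            trans_row F G \<sigma> [\<Gamma>])) \<Gamma>s)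
        = trans_row F H ?c \<Gamma>s" for a
        by (induction \<Gamma>s arbitrary: a) (auto simp: is_hmorD Let_def)
      have cmp': "cmp_row B (Go F a) (Go G a) (Go H a) (TV \<sigma> a) (TV \<tau> a) gs = trans_row F H ?c \<Gamma>s"
        unfolding gs_def by (rule cmp[OF d(1)])
      have r1: "row B (Go F a) (Go G a) (TV \<sigma> a) (concat (map snd gs))"
        unfolding snd by (rule rs)
      have r2: "row B (Go G a) (Go H a) (TV \<tau> a) (map fst gs)"
        unfolding fst by (rule row_trans_row[OF G.virtual_double_functor_axioms
              H.virtual_double_functor_axioms \<tau>.vertical_transformation_axioms d(1)])
      have r3: "\<forall>(\<theta>, \<psi>s) \<in> set gs. bots \<psi>s = btop \<theta>" unfolding gs_def by auto
      have r4: "is_bdry B (Go H a) (bots (map fst gs)) (hmap H \<Delta>) (GV H a (hsrc \<Delta>) u)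
          (GV H (hend a \<Gamma>s) (htgt \<Delta>) u')"
        unfolding fst bots_trans_row by (rule H.bdry[OF *(1)])
      have r5: "GM H a \<Gamma>s \<Delta> u u' \<theta> \<in> MCell B (Go H a) (bots (map fst gs)) (hmap H \<Delta>)
          (GV H a (hsrc \<Delta>) u) (GV H (hend a \<Gamma>s) (htgt \<Delta>) u')"
        unfolding fst bots_trans_row by (rule H.gm[OF *])
      show ?thesis
        using B.mcmp_assoc[OF r1 r2 r3 r4 r5]
        unfolding cmp' unfolding fst snd tops_trans_row bots_trans_row
        by (simp only: hend_map_hmap rvert_trans_row hmap_sel TV d)
    qed
    finally show "MCmp B (Go F a) (Go F (hsrc \<Delta>)) (GV F a (hsrc \<Delta>) u)
            [Block (map (hmap F) \<Gamma>s) (GM F a \<Gamma>s \<Delta> u u' \<theta>) (hmap F \<Delta>)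
               (GV F (hend a \<Gamma>s) (htgt \<Delta>) u')]
            (hmap H \<Delta>) (TV ?c (hsrc \<Delta>)) (TV ?c (htgt \<Delta>)) (TC ?c \<Delta>)
        = MCmp B (Go F a) (Go H a) (TV ?c a) (trans_row F H ?c \<Gamma>s)
        (hmap H \<Delta>) (GV H a (hsrc \<Delta>) u) (GV H (hend a \<Gamma>s) (htgt \<Delta>) u') (GM H a \<Gamma>s \<Delta> u u' \<theta>)" .
  next
    fix \<Gamma> assume \<Gamma>: "is_hmor A \<Gamma>"
    with B.mcmp[of "Go F (hsrc \<Gamma>)" "Go G (hsrc \<Gamma>)" "TV \<sigma> (hsrc \<Gamma>)" "trans_row F G \<sigma> [\<Gamma>]" "hmap H \<Gamma>"
        "TV \<tau> (hsrc \<Gamma>)" "TV \<tau> (htgt \<Gamma>)" "TC \<tau> \<Gamma>"] c1[OF \<Gamma>] \<tau>.tc[OF \<Gamma>] \<sigma>.tc[OF \<Gamma>]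
    show "TC ?c \<Gamma> \<in> MCell B (Go F (hsrc \<Gamma>)) [hmap F \<Gamma>] (hmap H \<Gamma>) (TV ?c (hsrc \<Gamma>)) (TV ?c (htgt \<Gamma>))"
      by (simp add: is_bdry_def is_hmorD)
  next
    fix a b u assume [simp]: "a \<in> VOb A" "b \<in> VOb A" "u \<in> VHom A a b"
    show "VCmp B (Go F a) (Go F b) (Go H b) (TV ?c b) (GV F a b u)
      = VCmp B (Go F a) (Go H a) (Go H b) (GV H a b u) (TV ?c a)"
      by (simp add: B.vcmp_assoc \<sigma>.tv_nat)
        (simp add: B.vcmp_assoc[symmetric] \<tau>.tv_nat)
  next
    show "?c = mk_vtrans A (TV ?c) (TC ?c)" unfolding VDBL_def by simp
  qed simp
qed

text \<open>The whiskerings that make up the horizontal composition of vertical transformations.\<close>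

definition lwhisker_vtrans where
  "lwhisker_vtrans A F F' G \<sigma> = mk_vtrans A (\<lambda>a. GV G (Go F a) (Go F' a) (TV \<sigma> a))
     (\<lambda>\<Gamma>. GM G (Go F (hsrc \<Gamma>)) [hmap F \<Gamma>] (hmap F' \<Gamma>) (TV \<sigma> (hsrc \<Gamma>)) (TV \<sigma> (htgt \<Gamma>)) (TC \<sigma> \<Gamma>))"

definition rwhisker_vtrans where
  "rwhisker_vtrans A F \<tau> = mk_vtrans A (\<lambda>a. TV \<tau> (Go F a)) (\<lambda>\<Gamma>. TC \<tau> (hmap F \<Gamma>))"

lemma (in vertical_transformation) tc_bdry:
  assumes "virtual_double_functor A B F" "virtual_double_functor A B G" "is_hmor A \<Gamma>"
  shows "is_bdry B (Go F (hsrc \<Gamma>)) [hmap F \<Gamma>] (hmap G \<Gamma>) (TV \<sigma> (hsrc \<Gamma>)) (TV \<sigma> (htgt \<Gamma>))"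
proof -
  interpret F: virtual_double_functor A B F by fact
  interpret G: virtual_double_functor A B G by fact
  show ?thesis using assms(3) by (simp add: is_bdry_def F.hmor G.hmor F.go is_hmorD tv)
qed

lemma vertical_transformation_lwhisker:
  assumes "virtual_double_category B" "virtual_double_functor A B F" "virtual_double_functor A B F'"
    "virtual_double_functor B C G" "vertical_transformation A B F F' \<sigma>"
  shows "vertical_transformation A C (cmp_vd_fun A G F) (cmp_vd_fun A G F') (lwhisker_vtrans A F F' G \<sigma>)"
proof -
  interpret B: virtual_double_category B by fact
  interpret F: virtual_double_functor A B F by fact
  interpret F': virtual_double_functor A B F' by fact
  interpret G: virtual_double_functor B C G by fact
  interpret \<sigma>: vertical_transformation A B F F' \<sigma> by fact
  note tc = \<sigma>.tc_bdry[OF F.virtual_double_functor_axioms F'.virtual_double_functor_axioms]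
  note [simp] = F.go F'.go G.go F.gv F'.gv G.gv F.hmor F'.hmor G.hmor \<sigma>.tv \<sigma>.tc
  let ?c = "lwhisker_vtrans A F F' G \<sigma>"
  have TV [simp]: "TV ?c a = GV G (Go F a) (Go F' a) (TV \<sigma> a)" if "a \<in> VOb A" for a
    using that by (simp add: lwhisker_vtrans_def)
  have TC [simp]: "TC ?c \<Gamma> = GM G (Go F (hsrc \<Gamma>)) [hmap F \<Gamma>] (hmap F' \<Gamma>)
       (TV \<sigma> (hsrc \<Gamma>)) (TV \<sigma> (htgt \<Gamma>)) (TC \<sigma> \<Gamma>)" if "is_hmor A \<Gamma>" for \<Gamma>
    using that by (simp add: lwhisker_vtrans_def)
  have mr: "hpath A a \<Gamma>s \<Longrightarrow> map_row G (Go F a) (TV \<sigma> a) (trans_row F F' \<sigma> \<Gamma>s)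
    = trans_row (cmp_vd_fun A G F) (cmp_vd_fun A G F') ?c \<Gamma>s" for a \<Gamma>s
    by (induction \<Gamma>s arbitrary: a) (auto simp: is_hmorD)
  show ?thesis
  proof
    fix a \<Gamma>s \<Delta> u u' \<theta> assume *: "is_bdry A a \<Gamma>s \<Delta> u u'" "\<theta> \<in> MCell A a \<Gamma>s \<Delta> u u'"
    note d [simp] = is_bdryD[OF *(1)]
    note rs = row_trans_row[OF F.virtual_double_functor_axioms F'.virtual_double_functor_axioms
        \<sigma>.vertical_transformation_axioms d(1)]
    let ?b = "[Block (map (hmap F) \<Gamma>s) (GM F a \<Gamma>s \<Delta> u u' \<theta>) (hmap F \<Delta>) (GV F (hend a \<Gamma>s) (htgt \<Delta>) u')]"
    have "MCmp C (Go G (Go F a)) (Go G (Go F (hsrc \<Delta>))) (GV G (Go F a) (Go F (hsrc \<Delta>)) (GV F a (hsrc \<Delta>) u))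
        (map_row G (Go F a) (GV F a (hsrc \<Delta>) u) ?b)
        (hmap G (hmap F' \<Delta>)) (TV ?c (hsrc \<Delta>)) (TV ?c (htgt \<Delta>)) (TC ?c \<Delta>)
      = GM G (Go F a) (map (hmap F) \<Gamma>s) (hmap F' \<Delta>)
          (VCmp B (Go F a) (Go F (hsrc \<Delta>)) (Go F' (hsrc \<Delta>)) (TV \<sigma> (hsrc \<Delta>)) (GV F a (hsrc \<Delta>) u))
          (VCmp B (Go F (hend a \<Gamma>s)) (Go F (htgt \<Delta>)) (Go F' (htgt \<Delta>)) (TV \<sigma> (htgt \<Delta>))
            (GV F (hend a \<Gamma>s) (htgt \<Delta>) u'))
          (MCmp B (Go F a) (Go F (hsrc \<Delta>)) (GV F a (hsrc \<Delta>) u) ?b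
            (hmap F' \<Delta>) (TV \<sigma> (hsrc \<Delta>)) (TV \<sigma> (htgt \<Delta>)) (TC \<sigma> \<Delta>))"
      using G.gm_cmp[of "Go F a" "Go F (hsrc \<Delta>)" "GV F a (hsrc \<Delta>) u" ?b "hmap F' \<Delta>"
          "TV \<sigma> (hsrc \<Delta>)" "TV \<sigma> (htgt \<Delta>)" "TC \<sigma> \<Delta>"] F.bdry[OF *(1)] F.gm[OF *] tc[of \<Delta>]
      by simp
    also have "\<dots> = GM G (Go F a) (map (hmap F) \<Gamma>s) (hmap F' \<Delta>)
          (VCmp B (Go F a) (Go F' a) (Go F' (hsrc \<Delta>)) (GV F' a (hsrc \<Delta>) u) (TV \<sigma> a))
          (VCmp B (Go F (hend a \<Gamma>s)) (Go F' (hend a \<Gamma>s)) (Go F' (htgt \<Delta>))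
            (GV F' (hend a \<Gamma>s) (htgt \<Delta>) u') (TV \<sigma> (hend a \<Gamma>s)))
          (MCmp B (Go F a) (Go F' a) (TV \<sigma> a) (trans_row F F' \<sigma> \<Gamma>s)
            (hmap F' \<Delta>) (GV F' a (hsrc \<Delta>) u) (GV F' (hend a \<Gamma>s) (htgt \<Delta>) u') (GM F' a \<Gamma>s \<Delta> u u' \<theta>))"
      by (simp only: \<sigma>.tc_nat[OF *] \<sigma>.tv_nat[of a "hsrc \<Delta>" u] \<sigma>.tv_nat[of "hend a \<Gamma>s" "htgt \<Delta>" u'] d)
    also have "\<dots> = MCmp C (Go G (Go F a)) (Go G (Go F' a)) (TV ?c a)
        (map_row G (Go F a) (TV \<sigma> a) (trans_row F F' \<sigma> \<Gamma>s)) (hmap G (hmap F' \<Delta>))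
        (GV G (Go F' a) (Go F' (hsrc \<Delta>)) (GV F' a (hsrc \<Delta>) u))
        (GV G (Go F' (hend a \<Gamma>s)) (Go F' (htgt \<Delta>)) (GV F' (hend a \<Gamma>s) (htgt \<Delta>) u'))
        (GM G (Go F' a) (map (hmap F') \<Gamma>s) (hmap F' \<Delta>) (GV F' a (hsrc \<Delta>) u)
          (GV F' (hend a \<Gamma>s) (htgt \<Delta>) u') (GM F' a \<Gamma>s \<Delta> u u' \<theta>))"
      using G.gm_cmp[OF rs, of "hmap F' \<Delta>" "GV F' a (hsrc \<Delta>) u" "GV F' (hend a \<Gamma>s) (htgt \<Delta>) u'"
          "GM F' a \<Gamma>s \<Delta> u u' \<theta>"] F'.bdry[OF *(1)] F'.gm[OF *]
      unfolding tops_trans_row bots_trans_row by simp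
    finally show "MCmp C (Go (cmp_vd_fun A G F) a) (Go (cmp_vd_fun A G F) (hsrc \<Delta>))
          (GV (cmp_vd_fun A G F) a (hsrc \<Delta>) u)
          [Block (map (hmap (cmp_vd_fun A G F)) \<Gamma>s) (GM (cmp_vd_fun A G F) a \<Gamma>s \<Delta> u u' \<theta>)
            (hmap (cmp_vd_fun A G F) \<Delta>) (GV (cmp_vd_fun A G F) (hend a \<Gamma>s) (htgt \<Delta>) u')]
          (hmap (cmp_vd_fun A G F') \<Delta>) (TV ?c (hsrc \<Delta>)) (TV ?c (htgt \<Delta>)) (TC ?c \<Delta>)
      = MCmp C (Go (cmp_vd_fun A G F) a) (Go (cmp_vd_fun A G F') a) (TV ?c a)
          (trans_row (cmp_vd_fun A G F) (cmp_vd_fun A G F') ?c \<Gamma>s) (hmap (cmp_vd_fun A G F') \<Delta>)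
          (GV (cmp_vd_fun A G F') a (hsrc \<Delta>) u) (GV (cmp_vd_fun A G F') (hend a \<Gamma>s) (htgt \<Delta>) u')
          (GM (cmp_vd_fun A G F') a \<Gamma>s \<Delta> u u' \<theta>)"
      unfolding mr[OF d(1)] map_hmap_cmp[OF d(1)] using * by simp
  next
    fix \<Gamma> assume \<Gamma>: "is_hmor A \<Gamma>"
    with G.gm[OF tc \<sigma>.tc, OF \<Gamma> \<Gamma>]
    show "TC ?c \<Gamma> \<in> MCell C (Go (cmp_vd_fun A G F) (hsrc \<Gamma>)) [hmap (cmp_vd_fun A G F) \<Gamma>]
        (hmap (cmp_vd_fun A G F') \<Gamma>) (TV ?c (hsrc \<Gamma>)) (TV ?c (htgt \<Gamma>))"
      by (simp add: is_hmorD)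
  next
    show "?c = mk_vtrans A (TV ?c) (TC ?c)" unfolding lwhisker_vtrans_def by simp
  qed (simp_all add: G.gv_cmp[symmetric] \<sigma>.tv_nat)
qed

lemma vertical_transformation_rwhisker:
  assumes "virtual_double_functor A B F" "vertical_transformation B C G G' \<tau>"
  shows "vertical_transformation A C (cmp_vd_fun A G F) (cmp_vd_fun A G' F) (rwhisker_vtrans A F \<tau>)"
proof -
  interpret F: virtual_double_functor A B F by fact
  interpret \<tau>: vertical_transformation B C G G' \<tau> by fact
  note [simp] = F.go F.gv F.hmor \<tau>.tv
  let ?c = "rwhisker_vtrans A F \<tau>"
  have TV [simp]: "TV ?c a = TV \<tau> (Go F a)" if "a \<in> VOb A" for a
    using that by (simp add: rwhisker_vtrans_def)
  have TC [simp]: "TC ?c \<Gamma> = TC \<tau> (hmap F \<Gamma>)" if "is_hmor A \<Gamma>" for \<Gamma>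
    using that by (simp add: rwhisker_vtrans_def)
  have tr: "hpath A a \<Gamma>s \<Longrightarrow> trans_row (cmp_vd_fun A G F) (cmp_vd_fun A G' F) ?c \<Gamma>s
    = trans_row G G' \<tau> (map (hmap F) \<Gamma>s)" for a \<Gamma>s
    by (induction \<Gamma>s arbitrary: a) (auto simp: is_hmorD)
  show ?thesis
  proof
    fix a \<Gamma>s \<Delta> u u' \<theta> assume *: "is_bdry A a \<Gamma>s \<Delta> u u'" "\<theta> \<in> MCell A a \<Gamma>s \<Delta> u u'"
    note d [simp] = is_bdryD[OF *(1)]
    show "MCmp C (Go (cmp_vd_fun A G F) a) (Go (cmp_vd_fun A G F) (hsrc \<Delta>))
          (GV (cmp_vd_fun A G F) a (hsrc \<Delta>) u)
          [Block (map (hmap (cmp_vd_fun A G F)) \<Gamma>s) (GM (cmp_vd_fun A G F) a \<Gamma>s \<Delta> u u' \<theta>)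
            (hmap (cmp_vd_fun A G F) \<Delta>) (GV (cmp_vd_fun A G F) (hend a \<Gamma>s) (htgt \<Delta>) u')]
          (hmap (cmp_vd_fun A G' F) \<Delta>) (TV ?c (hsrc \<Delta>)) (TV ?c (htgt \<Delta>)) (TC ?c \<Delta>)
      = MCmp C (Go (cmp_vd_fun A G F) a) (Go (cmp_vd_fun A G' F) a) (TV ?c a)
          (trans_row (cmp_vd_fun A G F) (cmp_vd_fun A G' F) ?c \<Gamma>s) (hmap (cmp_vd_fun A G' F) \<Delta>)
          (GV (cmp_vd_fun A G' F) a (hsrc \<Delta>) u) (GV (cmp_vd_fun A G' F) (hend a \<Gamma>s) (htgt \<Delta>) u')
          (GM (cmp_vd_fun A G' F) a \<Gamma>s \<Delta> u u' \<theta>)"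
      unfolding tr[OF d(1)] map_hmap_cmp[OF d(1)]
      using * \<tau>.tc_nat[OF F.bdry F.gm, OF *(1) *] by simp
  next
    fix \<Gamma> assume \<Gamma>: "is_hmor A \<Gamma>"
    with \<tau>.tc[of "hmap F \<Gamma>"]
    show "TC ?c \<Gamma> \<in> MCell C (Go (cmp_vd_fun A G F) (hsrc \<Gamma>)) [hmap (cmp_vd_fun A G F) \<Gamma>]
        (hmap (cmp_vd_fun A G' F) \<Gamma>) (TV ?c (hsrc \<Gamma>)) (TV ?c (htgt \<Gamma>))"
      by (simp add: is_hmorD)
  next
    show "?c = mk_vtrans A (TV ?c) (TC ?c)" unfolding rwhisker_vtrans_def by simp
  qed (simp_all add: \<tau>.tv_nat)
qed


section \<open>The 2-category of virtual double categories\<close>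

lemma VDBL_sel [simp]:
  "Ob (VDBL U) = {A. virtual_double_category A \<and> large_vdc U A}"
  "Hom1 (VDBL U) A B = {G. virtual_double_functor A B G}"
  "Hom2 (VDBL U) A B F G = {\<sigma>. vertical_transformation A B F G \<sigma>}"
  "Id1 (VDBL U) A = id_vd_fun A"
  "Cmp1 (VDBL U) A B C G F = cmp_vd_fun A G F"
  "Id2 (VDBL U) A B F = mk_vtrans A (\<lambda>a. VId B (Go F a)) (\<lambda>\<Gamma>. MId B (hmap F \<Gamma>))"
  by (simp_all add: VDBL_def)

lemma VDBL_Vc_sel [simp]:
  "a \<in> VOb A \<Longrightarrow> TV (Vc (VDBL U) A B F G H \<tau> \<sigma>) a
    = VCmp B (Go F a) (Go G a) (Go H a) (TV \<tau> a) (TV \<sigma> a)"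
  "is_hmor A \<Gamma> \<Longrightarrow> TC (Vc (VDBL U) A B F G H \<tau> \<sigma>) \<Gamma>
    = MCmp B (Go F (hsrc \<Gamma>)) (Go G (hsrc \<Gamma>)) (TV \<sigma> (hsrc \<Gamma>))
          [Block [hmap F \<Gamma>] (TC \<sigma> \<Gamma>) (hmap G \<Gamma>) (TV \<sigma> (htgt \<Gamma>))] (hmap H \<Gamma>)
          (TV \<tau> (hsrc \<Gamma>)) (TV \<tau> (htgt \<Gamma>)) (TC \<tau> \<Gamma>)"
  by (simp_all add: VDBL_def)

lemma VDBL_Hc_whiskers:
  assumes "virtual_double_functor A B F" "virtual_double_functor A B F'"
  shows "Hc (VDBL U) A B C F F' G G' \<tau> \<sigma> = Vc (VDBL U) A C (cmp_vd_fun A G F) (cmp_vd_fun A G F')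
      (cmp_vd_fun A G' F') (rwhisker_vtrans A F' \<tau>) (lwhisker_vtrans A F F' G \<sigma>)"
proof -
  interpret F: virtual_double_functor A B F by fact
  interpret F': virtual_double_functor A B F' by fact
  show ?thesis
    unfolding VDBL_def lwhisker_vtrans_def rwhisker_vtrans_def
    by (simp, rule mk_vtrans_cong) (simp_all add: is_hmorD)
qed

lemma lwhisker_vtrans_sel [simp]:
  "a \<in> VOb A \<Longrightarrow> TV (lwhisker_vtrans A F F' G \<sigma>) a = GV G (Go F a) (Go F' a) (TV \<sigma> a)"
  "is_hmor A \<Gamma> \<Longrightarrow> TC (lwhisker_vtrans A F F' G \<sigma>) \<Gamma>
    = GM G (Go F (hsrc \<Gamma>)) [hmap F \<Gamma>] (hmap F' \<Gamma>) (TV \<sigma> (hsrc \<Gamma>)) (TV \<sigma> (htgt \<Gamma>)) (TC \<sigma> \<Gamma>)"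
  by (simp_all add: lwhisker_vtrans_def)

lemma rwhisker_vtrans_sel [simp]:
  "a \<in> VOb A \<Longrightarrow> TV (rwhisker_vtrans A F \<tau>) a = TV \<tau> (Go F a)"
  "is_hmor A \<Gamma> \<Longrightarrow> TC (rwhisker_vtrans A F \<tau>) \<Gamma> = TC \<tau> (hmap F \<Gamma>)"
  by (simp_all add: rwhisker_vtrans_def)

lemma vtrans_normal [simp]:
  "mk_vtrans A (TV (Vc (VDBL U) A B F G H \<tau> \<sigma>)) (TC (Vc (VDBL U) A B F G H \<tau> \<sigma>))
    = Vc (VDBL U) A B F G H \<tau> \<sigma>"
  "mk_vtrans A (TV (lwhisker_vtrans A F F' G \<sigma>)) (TC (lwhisker_vtrans A F F' G \<sigma>))
    = lwhisker_vtrans A F F' G \<sigma>"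
  "mk_vtrans A (TV (rwhisker_vtrans A F \<tau>)) (TC (rwhisker_vtrans A F \<tau>)) = rwhisker_vtrans A F \<tau>"
  by (simp_all add: VDBL_def lwhisker_vtrans_def rwhisker_vtrans_def)

lemma vtrans_eqI:
  assumes "\<sigma> = mk_vtrans A (TV \<sigma>) (TC \<sigma>)" "\<tau> = mk_vtrans A (TV \<tau>) (TC \<tau>)"
    and "\<And>a. a \<in> VOb A \<Longrightarrow> TV \<sigma> a = TV \<tau> a" "\<And>\<Gamma>. is_hmor A \<Gamma> \<Longrightarrow> TC \<sigma> \<Gamma> = TC \<tau> \<Gamma>"
  shows "\<sigma> = \<tau>"
  by (subst assms(1), subst assms(2)) (rule mk_vtrans_cong; fact)

lemma cmp_vd_fun_id:
  assumes "virtual_double_functor A B G"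
  shows "cmp_vd_fun A G (id_vd_fun A) = G" and "cmp_vd_fun A (id_vd_fun B) G = G"
proof -
  interpret G: virtual_double_functor A B G by fact
  have 1: "GM G (Go (id_vd_fun A) a) (map (hmap (id_vd_fun A)) \<Gamma>s) (hmap (id_vd_fun A) \<Delta>)
        (GV (id_vd_fun A) a (hsrc \<Delta>) u) (GV (id_vd_fun A) (hend a \<Gamma>s) (htgt \<Delta>) u')
        (GM (id_vd_fun A) a \<Gamma>s \<Delta> u u' \<theta>) = GM G a \<Gamma>s \<Delta> u u' \<theta>"
    if *: "is_bdry A a \<Gamma>s \<Delta> u u'" "\<theta> \<in> MCell A a \<Gamma>s \<Delta> u u'" for a \<Gamma>s \<Delta> u u' \<theta>
    using * is_bdryD[OF *(1)] map_hmap_id[of A a \<Gamma>s] by simp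
  show "cmp_vd_fun A G (id_vd_fun A) = G"
    unfolding cmp_vd_fun_def
    by (rule trans[OF mk_vd_fun_cong G.normal[symmetric]]) (simp_all add: 1 del: id_vd_fun_sel(5))
  show "cmp_vd_fun A (id_vd_fun B) G = G"
    unfolding cmp_vd_fun_def
    by (rule trans[OF mk_vd_fun_cong G.normal[symmetric]]) (simp_all add: G.go G.gv G.gh G.bdry G.gm)
qed

lemma cmp_vd_fun_assoc:
  assumes "virtual_double_functor A B F"
  shows "cmp_vd_fun A (cmp_vd_fun B H G) F = cmp_vd_fun A H (cmp_vd_fun A G F)"
proof -
  interpret F: virtual_double_functor A B F by fact
  show ?thesis
    unfolding cmp_vd_fun_def[of A "cmp_vd_fun B H G"] cmp_vd_fun_def[of A H]
  proof (rule mk_vd_fun_cong)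
    fix a \<Gamma>s \<Delta> u u' \<theta> assume *: "is_bdry A a \<Gamma>s \<Delta> u u'" "\<theta> \<in> MCell A a \<Gamma>s \<Delta> u u'"
    then show "GM (cmp_vd_fun B H G) (Go F a) (map (hmap F) \<Gamma>s) (hmap F \<Delta>)
        (GV F a (hsrc \<Delta>) u) (GV F (hend a \<Gamma>s) (htgt \<Delta>) u') (GM F a \<Gamma>s \<Delta> u u' \<theta>)
      = GM H (Go (cmp_vd_fun A G F) a) (map (hmap (cmp_vd_fun A G F)) \<Gamma>s) (hmap (cmp_vd_fun A G F) \<Delta>)
          (GV (cmp_vd_fun A G F) a (hsrc \<Delta>) u) (GV (cmp_vd_fun A G F) (hend a \<Gamma>s) (htgt \<Delta>) u')
          (GM (cmp_vd_fun A G F) a \<Gamma>s \<Delta> u u' \<theta>)"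
      using is_bdryD[OF *(1)] map_hmap_cmp[of A a \<Gamma>s G F] by (simp add: F.bdry F.gm)
  qed (simp_all add: F.go F.gv F.gh)
qed

lemma two_category_VDBL: fixes U :: "'v::zf" shows "two_category (VDBL U)"
proof (rule whiskered.two_category[where lw = "\<lambda>A B C. lwhisker_vtrans A"
      and rw = "\<lambda>A B C F G G' \<tau>. rwhisker_vtrans A F \<tau>"], unfold_locales;
    unfold VDBL_sel mem_Collect_eq; (elim conjE)?;
    (simp add: virtual_double_functor_id virtual_double_functor_cmp cmp_vd_fun_id cmp_vd_fun_assoc
      VDBL_Hc_whiskers vertical_transformation_id vertical_transformation_vc
      vertical_transformation_lwhisker vertical_transformation_rwhisker; fail)?)

  fix A B :: "'v vdcv" and f g h k :: "'v vd_funv" and \<alpha> \<beta> \<gamma> :: "'v vtransv"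
  assume "virtual_double_category B" "virtual_double_functor A B f" "virtual_double_functor A B g"
    "vertical_transformation A B f g \<alpha>"
  then interpret B: virtual_double_category B + f: virtual_double_functor A B f
    + g: virtual_double_functor A B g + \<alpha>: vertical_transformation A B f g \<alpha> by simp_all
  note [simp] = f.go g.go f.gv g.gv f.hmor g.hmor f.gh g.gh \<alpha>.tv \<alpha>.tc is_hmorD
  have \<alpha>: "is_bdry B (Go f (hsrc \<Gamma>)) [hmap f \<Gamma>] (hmap g \<Gamma>) (TV \<alpha> (hsrc \<Gamma>)) (TV \<alpha> (htgt \<Gamma>))"
    if "is_hmor A \<Gamma>" for \<Gamma>
    using that by (rule \<alpha>.tc_bdry[OF f.virtual_double_functor_axioms g.virtual_double_functor_axioms])
  show "Vc (VDBL U) A B f f g \<alpha> (mk_vtrans A (\<lambda>a. VId B (Go f a)) (\<lambda>\<Gamma>. MId B (hmap f \<Gamma>))) = \<alpha>"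
    "Vc (VDBL U) A B f g g (mk_vtrans A (\<lambda>a. VId B (Go g a)) (\<lambda>\<Gamma>. MId B (hmap g \<Gamma>))) \<alpha> = \<alpha>"
    subgoal
      by (rule vtrans_eqI[OF _ \<alpha>.normal])
        (use B.mcmp_id_right[OF \<alpha> \<alpha>.tc] in \<open>simp_all add: B.vcmp_id_right\<close>)
    subgoal
      by (rule vtrans_eqI[OF _ \<alpha>.normal])
        (use B.mcmp_id_left[OF \<alpha> \<alpha>.tc] in \<open>simp_all add: B.vcmp_id_left\<close>)
    done
  show "lwhisker_vtrans A f g (id_vd_fun B) \<alpha> = \<alpha>" "rwhisker_vtrans A (id_vd_fun A) \<alpha> = \<alpha>"
    by (rule vtrans_eqI[OF _ \<alpha>.normal]; simp add: \<alpha>)+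
  {
    fix C D :: "'v vdcv" and G H :: "'v vd_funv"
    show "lwhisker_vtrans A (cmp_vd_fun A G f) (cmp_vd_fun A G g) H (lwhisker_vtrans A f g G \<alpha>)
      = lwhisker_vtrans A f g (cmp_vd_fun B H G) \<alpha>"
      by (rule vtrans_eqI[where A = A]) (simp_all add: \<alpha>)
  next
    assume "virtual_double_functor A B h" "virtual_double_functor A B k"
      "vertical_transformation A B g h \<beta>" "vertical_transformation A B h k \<gamma>"
    then interpret h: virtual_double_functor A B h + k: virtual_double_functor A B k
      + \<beta>: vertical_transformation A B g h \<beta> + \<gamma>: vertical_transformation A B h k \<gamma> by simp_all
    note [simp] = h.go k.go h.gv k.gv h.hmor k.hmor \<beta>.tv \<beta>.tc \<gamma>.tv \<gamma>.tc
    note \<beta> = \<beta>.tc_bdry[OF g.virtual_double_functor_axioms h.virtual_double_functor_axioms]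
      and \<gamma> = \<gamma>.tc_bdry[OF h.virtual_double_functor_axioms k.virtual_double_functor_axioms]
    show "Vc (VDBL U) A B f g k (Vc (VDBL U) A B g h k \<gamma> \<beta>) \<alpha>
      = Vc (VDBL U) A B f h k \<gamma> (Vc (VDBL U) A B f g h \<beta> \<alpha>)"
    proof (rule vtrans_eqI[where A = A])
      fix \<Gamma> assume \<Gamma>: "is_hmor A \<Gamma>"
      then show "TC (Vc (VDBL U) A B f g k (Vc (VDBL U) A B g h k \<gamma> \<beta>) \<alpha>) \<Gamma>
        = TC (Vc (VDBL U) A B f h k \<gamma> (Vc (VDBL U) A B f g h \<beta> \<alpha>)) \<Gamma>"
        using B.mcmp_assoc11[OF \<alpha> \<alpha>.tc, OF \<Gamma> \<Gamma>, of "hmap h \<Gamma>" "TV \<beta> (hsrc \<Gamma>)" "TV \<beta> (htgt \<Gamma>)" "TC \<beta> \<Gamma>"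
          "hmap k \<Gamma>" "TV \<gamma> (hsrc \<Gamma>)" "TV \<gamma> (htgt \<Gamma>)" "TC \<gamma> \<Gamma>"] \<beta>[OF \<Gamma>] \<gamma>[OF \<Gamma>] \<beta>.tc[OF \<Gamma>] \<gamma>.tc[OF \<Gamma>]
        by simp
    qed (simp_all add: B.vcmp_assoc)
  next
    fix C :: "'v vdcv" and G G' :: "'v vd_funv" and \<tau> :: "'v vtransv" assume "virtual_double_functor B C G" "virtual_double_functor B C G'"
      "vertical_transformation B C G G' \<tau>"
    then interpret G: virtual_double_functor B C G + G': virtual_double_functor B C G'
      + \<tau>: vertical_transformation B C G G' \<tau> by simp_all
    show "Vc (VDBL U) A C (cmp_vd_fun A G f) (cmp_vd_fun A G g) (cmp_vd_fun A G' g)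
          (rwhisker_vtrans A g \<tau>) (lwhisker_vtrans A f g G \<alpha>)
      = Vc (VDBL U) A C (cmp_vd_fun A G f) (cmp_vd_fun A G' f) (cmp_vd_fun A G' g)
          (lwhisker_vtrans A f g G' \<alpha>) (rwhisker_vtrans A f \<tau>)"
    proof (rule vtrans_eqI[where A = A])
      fix \<Gamma> assume \<Gamma>: "is_hmor A \<Gamma>"
      show "TC (Vc (VDBL U) A C (cmp_vd_fun A G f) (cmp_vd_fun A G g) (cmp_vd_fun A G' g)
          (rwhisker_vtrans A g \<tau>) (lwhisker_vtrans A f g G \<alpha>)) \<Gamma>
        = TC (Vc (VDBL U) A C (cmp_vd_fun A G f) (cmp_vd_fun A G' f) (cmp_vd_fun A G' g)
          (lwhisker_vtrans A f g G' \<alpha>) (rwhisker_vtrans A f \<tau>)) \<Gamma>"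
        using \<tau>.tc_nat[OF \<alpha> \<alpha>.tc, OF \<Gamma> \<Gamma>] \<Gamma> by simp
    qed (simp_all add: \<tau>.tv_nat)
  next
    fix C :: "'v vdcv" and f'' G :: "'v vd_funv" and \<alpha>' :: "'v vtransv" assume "virtual_double_functor A B f''" "virtual_double_functor B C G"
      "vertical_transformation A B g f'' \<alpha>'"
    then interpret f'': virtual_double_functor A B f'' + G: virtual_double_functor B C G
      + \<alpha>': vertical_transformation A B g f'' \<alpha>' by simp_all
    note [simp] = f''.go f''.hmor \<alpha>'.tv \<alpha>'.tc
    note \<alpha>' = \<alpha>'.tc_bdry[OF g.virtual_double_functor_axioms f''.virtual_double_functor_axioms]
    show "lwhisker_vtrans A f f'' G (Vc (VDBL U) A B f g f'' \<alpha>' \<alpha>)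
      = Vc (VDBL U) A C (cmp_vd_fun A G f) (cmp_vd_fun A G g) (cmp_vd_fun A G f'')
          (lwhisker_vtrans A g f'' G \<alpha>') (lwhisker_vtrans A f g G \<alpha>)"
    proof (rule vtrans_eqI[where A = A])
      fix \<Gamma> assume \<Gamma>: "is_hmor A \<Gamma>"
      show "TC (lwhisker_vtrans A f f'' G (Vc (VDBL U) A B f g f'' \<alpha>' \<alpha>)) \<Gamma>
        = TC (Vc (VDBL U) A C (cmp_vd_fun A G f) (cmp_vd_fun A G g) (cmp_vd_fun A G f'')
          (lwhisker_vtrans A g f'' G \<alpha>') (lwhisker_vtrans A f g G \<alpha>)) \<Gamma>"
        using G.gm_cmp[of "Go f (hsrc \<Gamma>)" "Go g (hsrc \<Gamma>)" "TV \<alpha> (hsrc \<Gamma>)"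
            "[Block [hmap f \<Gamma>] (TC \<alpha> \<Gamma>) (hmap g \<Gamma>) (TV \<alpha> (htgt \<Gamma>))]" "hmap f'' \<Gamma>" "TV \<alpha>' (hsrc \<Gamma>)"
            "TV \<alpha>' (htgt \<Gamma>)" "TC \<alpha>' \<Gamma>"] \<alpha>[OF \<Gamma>] \<alpha>'[OF \<Gamma>] \<alpha>.tc[OF \<Gamma>] \<alpha>'.tc[OF \<Gamma>] \<Gamma>
        by simp
    qed (simp_all add: G.gv_cmp)
  }
next
  fix A B C :: "'v vdcv" and f g :: "'v vd_funv" assume "virtual_double_functor A B f" "virtual_double_functor B C g"
    "virtual_double_category C"
  then interpret f: virtual_double_functor A B f + g: virtual_double_functor B C g
    + C: virtual_double_category C by simp_all
  note [simp] = f.go f.gv f.hmor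
  show "lwhisker_vtrans A f f g (mk_vtrans A (\<lambda>a. VId B (Go f a)) (\<lambda>\<Gamma>. MId B (hmap f \<Gamma>)))
    = mk_vtrans A (\<lambda>a. VId C (Go (cmp_vd_fun A g f) a)) (\<lambda>\<Gamma>. MId C (hmap (cmp_vd_fun A g f) \<Gamma>))"
    by (rule vtrans_eqI[where A = A])
      (use g.gm_id[OF f.hmor] in \<open>simp_all add: g.gv_id is_hmorD\<close>)
  show "rwhisker_vtrans A f (mk_vtrans B (\<lambda>a. VId C (Go g a)) (\<lambda>\<Gamma>. MId C (hmap g \<Gamma>)))
    = mk_vtrans A (\<lambda>a. VId C (Go (cmp_vd_fun A g f) a)) (\<lambda>\<Gamma>. MId C (hmap (cmp_vd_fun A g f) \<Gamma>))"
    by (rule vtrans_eqI[where A = A]; simp)+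
next
  fix A B C D :: "'v vdcv" and f g g' g'' h :: "'v vd_funv" and \<beta> \<beta>' :: "'v vtransv" assume "virtual_double_functor A B f"
  then interpret f: virtual_double_functor A B f .
  note [simp] = f.go f.gv f.hmor is_hmorD
  show "rwhisker_vtrans A f (Vc (VDBL U) B C g g' g'' \<beta>' \<beta>)
    = Vc (VDBL U) A C (cmp_vd_fun A g f) (cmp_vd_fun A g' f) (cmp_vd_fun A g'' f)
        (rwhisker_vtrans A f \<beta>') (rwhisker_vtrans A f \<beta>)"
    "rwhisker_vtrans A f (rwhisker_vtrans B g \<beta>) = rwhisker_vtrans A (cmp_vd_fun A g f) \<beta>"
    by (rule vtrans_eqI[where A = A]; simp)+
  show "rwhisker_vtrans A f (lwhisker_vtrans B g g' h \<beta>)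
    = lwhisker_vtrans A (cmp_vd_fun A g f) (cmp_vd_fun A g' f) h (rwhisker_vtrans A f \<beta>)"
    by (rule vtrans_eqI[where A = A]; simp)+
qed

section \<open>Generalised elements of enriched categories\<close>

text \<open>A generalised element of a hom-object: a multicell from the path \<open>epath\<close> starting at \<open>estart\<close> to
  \<open>D(esrc, etgt)\<close> over \<open>(eleft, eright)\<close>. Bundling a multicell with its boundary turns the operations of
  virtual double categories, which take the boundary as arguments, into operations with equational laws.\<close>

datatype 'v elem = Elem (estart: 'v) (epath: "('v, 'v) hmor list") (esrc: 'v) (etgt: 'v)
  (eleft: 'v) (eright: 'v) (ecell: 'v)

abbreviation eend :: "'v elem \<Rightarrow> 'v" where
  "eend x \<equiv> hend (estart x) (epath x)"

definition is_elem :: "'v::zf vdcv \<Rightarrow> 'v \<Rightarrow> 'v elem \<Rightarrow> bool" where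
  "is_elem A D x \<longleftrightarrow> esrc x \<in> cat_ob D \<and> etgt x \<in> cat_ob D \<and>
     is_bdry A (estart x) (epath x) (chom D (esrc x) (etgt x)) (eleft x) (eright x) \<and>
     ecell x \<in> MCell A (estart x) (epath x) (chom D (esrc x) (etgt x)) (eleft x) (eright x)"

text \<open>A generalised element as an entry of a row of multicells.\<close>

definition eblock :: "'v::zf \<Rightarrow> 'v elem \<Rightarrow> ('v, 'v, 'v, 'v) block" where
  "eblock D x = Block (epath x) (ecell x) (chom D (esrc x) (etgt x)) (eright x)"

text \<open>The condition for \<open>x\<close> and \<open>y\<close> to stand side by side in a row, with composable targets.\<close>

definition follows :: "'v elem \<Rightarrow> 'v elem \<Rightarrow> bool" where
  "follows x y \<longleftrightarrow> eend x = estart y \<and> etgt x = esrc y \<and> eright x = eleft y"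

text \<open>The product of adjacent generalised elements with respect to the composition of \<open>D\<close>.\<close>

definition emul :: "'v::zf vdcv \<Rightarrow> 'v \<Rightarrow> 'v elem \<Rightarrow> 'v elem \<Rightarrow> 'v elem" where
  "emul A D x y = Elem (estart x) (epath x @ epath y) (esrc x) (etgt y) (eleft x) (eright y)
     (MCmp A (estart x) (ext D (esrc x)) (eleft x) [eblock D x, eblock D y]
        (chom D (esrc x) (etgt y)) (VId A (ext D (esrc x))) (VId A (ext D (etgt y)))
        (cat_mult D (esrc x) (etgt x) (etgt y)))"

text \<open>The unit of \<open>D\<close> at \<open>d\<close>, restricted along the vertical morphism \<open>u\<close> from \<open>a\<close> to the extent of \<open>d\<close>.\<close>

definition eunit :: "'v::zf vdcv \<Rightarrow> 'v \<Rightarrow> 'v \<Rightarrow> 'v \<Rightarrow> 'v \<Rightarrow> 'v elem" where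
  "eunit A D a d u = Elem a [] d d u u
     (MCmp A a (ext D d) u [] (chom D d d) (VId A (ext D d)) (VId A (ext D d)) (cat_unit D d))"

text \<open>Substitution of a row of multicells into the path of \<open>x\<close>.\<close>

definition ecmp :: "'v::zf vdcv \<Rightarrow> 'v \<Rightarrow> 'v elem \<Rightarrow> 'v \<Rightarrow> 'v \<Rightarrow> ('v, 'v, 'v, 'v) block list \<Rightarrow> 'v elem" where
  "ecmp A D x a u bs = Elem a (tops bs) (esrc x) (etgt x)
     (VCmp A a (estart x) (ext D (esrc x)) (eleft x) u)
     (VCmp A (hend a (tops bs)) (eend x) (ext D (etgt x)) (eright x) (rvert u bs))
     (MCmp A a (estart x) u bs (chom D (esrc x) (etgt x)) (eleft x) (eright x) (ecell x))"

text \<open>The identity cell of a hom-object is its generic element, from which all others arise by substitution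
  (\<open>ecmp_ielem\<close>).\<close>

definition ielem :: "'v::zf vdcv \<Rightarrow> 'v \<Rightarrow> 'v \<Rightarrow> 'v \<Rightarrow> 'v elem" where
  "ielem A C c c' = Elem (ext C c) [chom C c c'] c c' (VId A (ext C c)) (VId A (ext C c'))
     (MId A (chom C c c'))"

definition felem :: "'v::zf \<Rightarrow> 'v \<Rightarrow> 'v \<Rightarrow> 'v \<Rightarrow> 'v elem" where
  "felem C f c c' = Elem (ext C c) [chom C c c'] (fun_ob f c) (fun_ob f c')
     (fun_vert f c) (fun_vert f c') (fun_cell f c c')"

definition nelem :: "'v::zf \<Rightarrow> 'v \<Rightarrow> 'v \<Rightarrow> 'v \<Rightarrow> 'v \<Rightarrow> 'v elem" where
  "nelem C f f' \<alpha> c = Elem (ext C c) [] (fun_ob f c) (fun_ob f' c) (fun_vert f c) (fun_vert f' c)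
     (vapp \<alpha> c)"

text \<open>The action of an enriched functor \<open>g\<close> on generalised elements.\<close>

definition eapp :: "'v::zf vdcv \<Rightarrow> 'v \<Rightarrow> 'v \<Rightarrow> 'v \<Rightarrow> 'v elem \<Rightarrow> 'v elem" where
  "eapp A D E g x = ecmp A E (felem D g (esrc x) (etgt x)) (estart x) (eleft x) [eblock D x]"

lemma eblock_sel [simp]: "btop (eblock D x) = epath x" "bcell (eblock D x) = ecell x"
  "bbot (eblock D x) = chom D (esrc x) (etgt x)" "bvert (eblock D x) = eright x"
  by (simp_all add: eblock_def)

lemma emul_sel [simp]: "estart (emul A D x y) = estart x" "epath (emul A D x y) = epath x @ epath y"
  "esrc (emul A D x y) = esrc x" "etgt (emul A D x y) = etgt y"
  "eleft (emul A D x y) = eleft x" "eright (emul A D x y) = eright y"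
  by (simp_all add: emul_def)

lemma eunit_sel [simp]: "estart (eunit A D a d u) = a" "epath (eunit A D a d u) = []"
  "esrc (eunit A D a d u) = d" "etgt (eunit A D a d u) = d"
  "eleft (eunit A D a d u) = u" "eright (eunit A D a d u) = u"
  by (simp_all add: eunit_def)

lemma ecmp_sel [simp]: "estart (ecmp A D x a u bs) = a" "epath (ecmp A D x a u bs) = tops bs"
  "esrc (ecmp A D x a u bs) = esrc x" "etgt (ecmp A D x a u bs) = etgt x"
  "eleft (ecmp A D x a u bs) = VCmp A a (estart x) (ext D (esrc x)) (eleft x) u"
  "eright (ecmp A D x a u bs)
    = VCmp A (hend a (tops bs)) (eend x) (ext D (etgt x)) (eright x) (rvert u bs)"
  by (simp_all add: ecmp_def)

lemma ielem_sel [simp]: "estart (ielem A C c c') = ext C c" "epath (ielem A C c c') = [chom C c c']"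
  "esrc (ielem A C c c') = c" "etgt (ielem A C c c') = c'"
  "eleft (ielem A C c c') = VId A (ext C c)" "eright (ielem A C c c') = VId A (ext C c')"
  by (simp_all add: ielem_def)

lemma felem_sel [simp]: "estart (felem C f c c') = ext C c" "epath (felem C f c c') = [chom C c c']"
  "esrc (felem C f c c') = fun_ob f c" "etgt (felem C f c c') = fun_ob f c'"
  "eleft (felem C f c c') = fun_vert f c" "eright (felem C f c c') = fun_vert f c'"
  "ecell (felem C f c c') = fun_cell f c c'"
  by (simp_all add: felem_def)

lemma nelem_sel [simp]: "estart (nelem C f f' \<alpha> c) = ext C c" "epath (nelem C f f' \<alpha> c) = []"
  "esrc (nelem C f f' \<alpha> c) = fun_ob f c" "etgt (nelem C f f' \<alpha> c) = fun_ob f' c"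
  "eleft (nelem C f f' \<alpha> c) = fun_vert f c" "eright (nelem C f f' \<alpha> c) = fun_vert f' c"
  "ecell (nelem C f f' \<alpha> c) = vapp \<alpha> c"
  by (simp_all add: nelem_def)

lemma eapp_sel [simp]: "estart (eapp A D E g x) = estart x" "epath (eapp A D E g x) = epath x"
  "esrc (eapp A D E g x) = fun_ob g (esrc x)" "etgt (eapp A D E g x) = fun_ob g (etgt x)"
  "eleft (eapp A D E g x) = VCmp A (estart x) (ext D (esrc x)) (ext E (fun_ob g (esrc x)))
     (fun_vert g (esrc x)) (eleft x)"
  "eright (eapp A D E g x) = VCmp A (eend x) (ext D (etgt x)) (ext E (fun_ob g (etgt x)))
     (fun_vert g (etgt x)) (eright x)"
  by (simp_all add: eapp_def)

lemma elem_eqI: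
  assumes "estart x = estart y" "epath x = epath y" "esrc x = esrc y" "etgt x = etgt y"
    "eleft x = eleft y" "eright x = eright y" "ecell x = ecell y"
  shows "x = y"
  using assms by (cases x; cases y) simp

lemma is_elemD:
  assumes "is_elem A D x"
  shows "esrc x \<in> cat_ob D" "etgt x \<in> cat_ob D" "estart x \<in> VOb A" "eend x \<in> VOb A"
    "ext D (esrc x) \<in> VOb A" "ext D (etgt x) \<in> VOb A" "hpath A (estart x) (epath x)"
    "eleft x \<in> VHom A (estart x) (ext D (esrc x))" "eright x \<in> VHom A (eend x) (ext D (etgt x))"
    "is_hmor A (chom D (esrc x) (etgt x))"
    "is_bdry A (estart x) (epath x) (chom D (esrc x) (etgt x)) (eleft x) (eright x)"
    "ecell x \<in> MCell A (estart x) (epath x) (chom D (esrc x) (etgt x)) (eleft x) (eright x)"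
  using assms unfolding is_elem_def by (auto dest: is_bdryD)

locale enrichment = virtual_double_category A for A :: "'v::zf vdcv" +
  fixes U :: 'v
begin

lemma catD:
  assumes "D \<in> enr_cats U A"
  shows "\<And>c. c \<in> cat_ob D \<Longrightarrow> ext D c \<in> VOb A"
    "\<And>c c'. c \<in> cat_ob D \<Longrightarrow> c' \<in> cat_ob D \<Longrightarrow> is_hmor A (chom D c c')"
    "\<And>c. c \<in> cat_ob D \<Longrightarrow> cat_unit D c \<in>
        MCell A (ext D c) [] (chom D c c) (VId A (ext D c)) (VId A (ext D c))"
    "\<And>c\<^sub>0 c\<^sub>1 c\<^sub>2. c\<^sub>0 \<in> cat_ob D \<Longrightarrow> c\<^sub>1 \<in> cat_ob D \<Longrightarrow> c\<^sub>2 \<in> cat_ob D \<Longrightarrow> cat_mult D c\<^sub>0 c\<^sub>1 c\<^sub>2 \<in>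
        MCell A (ext D c\<^sub>0) [chom D c\<^sub>0 c\<^sub>1, chom D c\<^sub>1 c\<^sub>2] (chom D c\<^sub>0 c\<^sub>2)
          (VId A (ext D c\<^sub>0)) (VId A (ext D c\<^sub>2))"
  using assms by (auto simp: enr_cats_def is_hmor_def)

lemma cat_axioms:
  assumes "D \<in> enr_cats U A"
  shows "\<And>c c'. c \<in> cat_ob D \<Longrightarrow> c' \<in> cat_ob D \<Longrightarrow> 
        MCmp A (ext D c) (ext D c) (VId A (ext D c))
          [Block [] (cat_unit D c) (chom D c c) (VId A (ext D c)),
           Block [chom D c c'] (MId A (chom D c c')) (chom D c c') (VId A (ext D c'))]
          (chom D c c') (VId A (ext D c)) (VId A (ext D c')) (cat_mult D c c c')
        = MId A (chom D c c')"
    "\<And>c c'. c \<in> cat_ob D \<Longrightarrow> c' \<in> cat_ob D \<Longrightarrow> 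
        MCmp A (ext D c) (ext D c) (VId A (ext D c))
          [Block [chom D c c'] (MId A (chom D c c')) (chom D c c') (VId A (ext D c')),
           Block [] (cat_unit D c') (chom D c' c') (VId A (ext D c'))]
          (chom D c c') (VId A (ext D c)) (VId A (ext D c')) (cat_mult D c c' c')
        = MId A (chom D c c')"
    "\<And>c\<^sub>0 c\<^sub>1 c\<^sub>2 c\<^sub>3. c\<^sub>0 \<in> cat_ob D \<Longrightarrow> c\<^sub>1 \<in> cat_ob D \<Longrightarrow> c\<^sub>2 \<in> cat_ob D \<Longrightarrow> c\<^sub>3 \<in> cat_ob D \<Longrightarrow>
        MCmp A (ext D c\<^sub>0) (ext D c\<^sub>0) (VId A (ext D c\<^sub>0))
          [Block [chom D c\<^sub>0 c\<^sub>1, chom D c\<^sub>1 c\<^sub>2] (cat_mult D c\<^sub>0 c\<^sub>1 c\<^sub>2) (chom D c\<^sub>0 c\<^sub>2) (VId A (ext D c\<^sub>2)),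
           Block [chom D c\<^sub>2 c\<^sub>3] (MId A (chom D c\<^sub>2 c\<^sub>3)) (chom D c\<^sub>2 c\<^sub>3) (VId A (ext D c\<^sub>3))]
          (chom D c\<^sub>0 c\<^sub>3) (VId A (ext D c\<^sub>0)) (VId A (ext D c\<^sub>3)) (cat_mult D c\<^sub>0 c\<^sub>2 c\<^sub>3)
        = MCmp A (ext D c\<^sub>0) (ext D c\<^sub>0) (VId A (ext D c\<^sub>0))
          [Block [chom D c\<^sub>0 c\<^sub>1] (MId A (chom D c\<^sub>0 c\<^sub>1)) (chom D c\<^sub>0 c\<^sub>1) (VId A (ext D c\<^sub>1)),
           Block [chom D c\<^sub>1 c\<^sub>2, chom D c\<^sub>2 c\<^sub>3] (cat_mult D c\<^sub>1 c\<^sub>2 c\<^sub>3) (chom D c\<^sub>1 c\<^sub>3) (VId A (ext D c\<^sub>3))]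
          (chom D c\<^sub>0 c\<^sub>3) (VId A (ext D c\<^sub>0)) (VId A (ext D c\<^sub>3)) (cat_mult D c\<^sub>0 c\<^sub>1 c\<^sub>3)"
  using assms by (simp_all add: enr_cats_def)

lemma is_bdry_id:
  assumes "D \<in> enr_cats U A" "c \<in> cat_ob D" "c' \<in> cat_ob D" "hpath A (ext D c) \<Gamma>s"
    "hend (ext D c) \<Gamma>s = ext D c'"
  shows "is_bdry A (ext D c) \<Gamma>s (chom D c c') (VId A (ext D c)) (VId A (ext D c'))"
  using assms catD[OF assms(1)] by (simp add: is_bdry_def vid)

lemma emul_elem:
  assumes D: "D \<in> enr_cats U A" and x: "is_elem A D x" and y: "is_elem A D y" and xy: "follows x y"
  shows "is_elem A D (emul A D x y)"
proof -
  note [simp] = catD[OF D] is_elemD[OF x] is_elemD[OF y] vid vcmp_id_left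
  have xy: "estart y = eend x" "esrc y = etgt x" "eleft y = eright x"
    using xy by (simp_all add: follows_def)
  have r: "row A (estart x) (ext D (esrc x)) (eleft x) [eblock D x, eblock D y]"
    using is_elemD[OF y] by (simp add: xy)
  have b: "is_bdry A (ext D (esrc x)) (bots [eblock D x, eblock D y])
      (chom D (esrc x) (etgt y)) (VId A (ext D (esrc x))) (VId A (ext D (etgt y)))"
    using is_elemD[OF y] by (intro is_bdry_id D) (simp_all add: xy)
  show ?thesis
    using mcmp[OF r b] bdry_cmp[OF r b] catD(4)[OF D, of "esrc x" "etgt x" "etgt y"] is_elemD[OF y]
    by (simp add: is_elem_def emul_def xy)
qed

lemma eunit_elem:
  assumes D: "D \<in> enr_cats U A" and "a \<in> VOb A" "d \<in> cat_ob D" "u \<in> VHom A a (ext D d)"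
  shows "is_elem A D (eunit A D a d u)"
proof -
  have r: "row A a (ext D d) u []" using assms catD[OF D] by simp
  have b: "is_bdry A (ext D d) (bots []) (chom D d d) (VId A (ext D d)) (VId A (ext D d))"
    using assms catD[OF D] by (intro is_bdry_id D) simp_all
  show ?thesis
    using mcmp[OF r b] bdry_cmp[OF r b] catD[OF D] assms
    by (simp add: is_elem_def eunit_def vcmp_id_left)
qed

lemma ielem_elem:
  assumes D: "D \<in> enr_cats U A" and c: "c \<in> cat_ob D" "c' \<in> cat_ob D"
  shows "is_elem A D (ielem A D c c')"
  using is_bdry_id[OF D c, of "[chom D c c']"] c catD[OF D] mid[of "chom D c c'"]
  by (simp add: is_elem_def ielem_def)

lemma ecmp_elem:
  assumes x: "is_elem A D x" and r: "row A a (estart x) u bs" and b: "bots bs = epath x"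
  shows "is_elem A D (ecmp A D x a u bs)"
  using mcmp[OF r, unfolded b, OF is_elemD(11,12)[OF x]] bdry_cmp[OF r, unfolded b, OF is_elemD(11)[OF x]]
    is_elemD[OF x]
  by (simp add: is_elem_def ecmp_def)

text \<open>Both products of three elements are the result of substituting the three into a side of the
  associativity law of \<open>D\<close>. The general associativity law of \<open>A\<close> is needed here, because one of the
  three elements is composed with an identity cell while the other two are multiplied.\<close>

lemma emul_assoc:
  assumes D: "D \<in> enr_cats U A" and x: "is_elem A D x" and y: "is_elem A D y" and z: "is_elem A D z"
    and xy: "follows x y" and yz: "follows y z"
  shows "emul A D (emul A D x y) z = emul A D x (emul A D y z)"
proof -
  obtain a \<Gamma>s c c' u u' \<theta> where [simp]: "x = Elem a \<Gamma>s c c' u u' \<theta>" by (cases x)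
  obtain \<Gamma>s' c'' u'' \<theta>' where [simp]: "y = Elem (hend a \<Gamma>s) \<Gamma>s' c' c'' u' u'' \<theta>'"
    using xy by (cases y) (simp add: follows_def)
  obtain \<Gamma>s'' c''' u''' \<theta>'' where [simp]: "z = Elem (hend (hend a \<Gamma>s) \<Gamma>s') \<Gamma>s'' c'' c''' u'' u''' \<theta>''"
    using yz by (cases z) (simp add: follows_def)
  note [simp] = is_elemD[OF x, simplified] is_elemD[OF y, simplified] is_elemD[OF z, simplified]
    catD[OF D] vid vcmp_id_left is_bdry_id[OF D] mid[of "chom D c c'" for c c', simplified]
    mcmp_id_left[where \<Delta> = "chom D c c'" for c c', simplified] Let_def
  have "MCmp A a (ext D c) u
      [Block (\<Gamma>s @ \<Gamma>s') (MCmp A a (ext D c) u [eblock D x, eblock D y] (chom D c c'')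
         (VId A (ext D c)) (VId A (ext D c'')) (cat_mult D c c' c'')) (chom D c c'') u'', eblock D z]
      (chom D c c''') (VId A (ext D c)) (VId A (ext D c''')) (cat_mult D c c'' c''')
    = MCmp A a (ext D c) u [eblock D x, eblock D y, eblock D z] (chom D c c''')
        (VId A (ext D c)) (VId A (ext D c'''))
        (MCmp A (ext D c) (ext D c) (VId A (ext D c))
          [Block [chom D c c', chom D c' c''] (cat_mult D c c' c'') (chom D c c'') (VId A (ext D c'')),
           Block [chom D c'' c'''] (MId A (chom D c'' c''')) (chom D c'' c''') (VId A (ext D c'''))]
          (chom D c c''') (VId A (ext D c)) (VId A (ext D c''')) (cat_mult D c c'' c'''))"
    using mcmp_assoc[of a "ext D c" u
        "[(Block [chom D c c', chom D c' c''] (cat_mult D c c' c'') (chom D c c'') (VId A (ext D c'')),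
            [eblock D x, eblock D y]),
          (Block [chom D c'' c'''] (MId A (chom D c'' c''')) (chom D c'' c''') (VId A (ext D c''')),
            [eblock D z])]" "ext D c" "VId A (ext D c)" "chom D c c'''" "VId A (ext D c)"
        "VId A (ext D c''')" "cat_mult D c c'' c'''"]
    by (simp add: eblock_def)
  also have "\<dots> = MCmp A a (ext D c) u
      [eblock D x, Block (\<Gamma>s' @ \<Gamma>s'') (MCmp A (hend a \<Gamma>s) (ext D c') u' [eblock D y, eblock D z]
         (chom D c' c''') (VId A (ext D c')) (VId A (ext D c''')) (cat_mult D c' c'' c'''))
         (chom D c' c''') u''']
      (chom D c c''') (VId A (ext D c)) (VId A (ext D c''')) (cat_mult D c c' c''')"
    unfolding cat_axioms(3)[OF D is_elemD(1)[OF x] is_elemD(2)[OF x] is_elemD(1)[OF z]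
        is_elemD(2)[OF z], simplified]
    using mcmp_assoc[of a "ext D c" u
        "[(Block [chom D c c'] (MId A (chom D c c')) (chom D c c') (VId A (ext D c')),
            [eblock D x]),
          (Block [chom D c' c'', chom D c'' c'''] (cat_mult D c' c'' c''') (chom D c' c''') (VId A (ext D c''')),
            [eblock D y, eblock D z])]" "ext D c" "VId A (ext D c)" "chom D c c'''" "VId A (ext D c)"
        "VId A (ext D c''')" "cat_mult D c c' c'''"]
    by (simp add: eblock_def)
  finally show ?thesis by (simp add: emul_def eblock_def)
qed

lemma emul_eunit_left:
  assumes D: "D \<in> enr_cats U A" and x: "is_elem A D x"
    and e: "a = estart x" "d = esrc x" "u = eleft x"
  shows "emul A D (eunit A D a d u) x = x"
proof -
  note [simp] = is_elemD[OF x] catD[OF D] vid vcmp_id_left is_bdry_id[OF D]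
    mid[of "chom D c c'" for c c', simplified]
    mcmp_id_left[where \<Delta> = "chom D c c'" for c c', simplified] eblock_def Let_def
  show ?thesis
    using mcmp_assoc[of "estart x" "ext D (esrc x)" "eleft x"
        "[(Block [] (cat_unit D (esrc x)) (chom D (esrc x) (esrc x)) (VId A (ext D (esrc x))), []),
          (Block [chom D (esrc x) (etgt x)] (MId A (chom D (esrc x) (etgt x))) (chom D (esrc x) (etgt x))
             (VId A (ext D (etgt x))), [eblock D x])]" "ext D (esrc x)" "VId A (ext D (esrc x))"
        "chom D (esrc x) (etgt x)" "VId A (ext D (esrc x))" "VId A (ext D (etgt x))"
        "cat_mult D (esrc x) (esrc x) (etgt x)"]
      cat_axioms(1)[OF D is_elemD(1,2)[OF x]]
    by (intro elem_eqI) (simp_all add: emul_def eunit_def e)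
qed

lemma emul_eunit_right:
  assumes D: "D \<in> enr_cats U A" and x: "is_elem A D x"
    and e: "a = eend x" "d = etgt x" "u = eright x"
  shows "emul A D x (eunit A D a d u) = x"
proof -
  note [simp] = is_elemD[OF x] catD[OF D] vid vcmp_id_left is_bdry_id[OF D]
    mid[of "chom D c c'" for c c', simplified]
    mcmp_id_left[where \<Delta> = "chom D c c'" for c c', simplified] eblock_def Let_def
  show ?thesis
    using mcmp_assoc[of "estart x" "ext D (esrc x)" "eleft x"
        "[(Block [chom D (esrc x) (etgt x)] (MId A (chom D (esrc x) (etgt x))) (chom D (esrc x) (etgt x))
             (VId A (ext D (etgt x))), [eblock D x]),
          (Block [] (cat_unit D (etgt x)) (chom D (etgt x) (etgt x)) (VId A (ext D (etgt x))), [])]"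
        "ext D (esrc x)" "VId A (ext D (esrc x))"
        "chom D (esrc x) (etgt x)" "VId A (ext D (esrc x))" "VId A (ext D (etgt x))"
        "cat_mult D (esrc x) (etgt x) (etgt x)"]
      cat_axioms(2)[OF D is_elemD(1,2)[OF x]]
    by (intro elem_eqI) (simp_all add: emul_def eunit_def e)
qed

text \<open>Substitution commutes with multiplication, provided that the row is cut at the place where the two
  paths meet.\<close>

lemma ecmp_emul:
  assumes D: "D \<in> enr_cats U A" and x: "is_elem A D x" and y: "is_elem A D y" and xy: "follows x y"
    and r: "row A a (estart x) u (bs @ bs')" and b: "bots bs = epath x" "bots bs' = epath y"
  shows "ecmp A D (emul A D x y) a u (bs @ bs')
    = emul A D (ecmp A D x a u bs) (ecmp A D y (hend a (tops bs)) (rvert u bs) bs')"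
proof -
  note [simp] = is_elemD[OF x] is_elemD[OF y] catD[OF D] vid vcmp_id_left is_bdry_id[OF D]
  have xy: "estart y = eend x" "esrc y = etgt x" "eleft y = eright x"
    using xy by (simp_all add: follows_def)
  note [simp] = is_elemD[OF y, unfolded xy]
  have "MCmp A a (ext D (esrc x)) (VCmp A a (estart x) (ext D (esrc x)) (eleft x) u)
       [eblock D (ecmp A D x a u bs), eblock D (ecmp A D y (hend a (tops bs)) (rvert u bs) bs')]
       (chom D (esrc x) (etgt y)) (VId A (ext D (esrc x))) (VId A (ext D (etgt y)))
       (cat_mult D (esrc x) (etgt x) (etgt y))
    = MCmp A a (estart x) u (bs @ bs') (chom D (esrc x) (etgt y)) (eleft x) (eright y)
       (MCmp A (estart x) (ext D (esrc x)) (eleft x) [eblock D x, eblock D y]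
          (chom D (esrc x) (etgt y)) (VId A (ext D (esrc x))) (VId A (ext D (etgt y)))
          (cat_mult D (esrc x) (etgt x) (etgt y)))"
    using mcmp_assoc[of a "estart x" u "[(eblock D x, bs), (eblock D y, bs')]" "ext D (esrc x)" "eleft x"
        "chom D (esrc x) (etgt y)" "VId A (ext D (esrc x))" "VId A (ext D (etgt y))"
        "cat_mult D (esrc x) (etgt x) (etgt y)"] r
    by (simp add: b xy eblock_def ecmp_def Let_def)
  then show ?thesis
    by (intro elem_eqI) (simp_all add: emul_def eblock_def ecmp_def xy b)
qed

lemma ecmp_eunit:
  assumes D: "D \<in> enr_cats U A" and "d \<in> cat_ob D" "a \<in> VOb A" "b \<in> VOb A"
    "u \<in> VHom A a b" "v \<in> VHom A b (ext D d)"
  shows "ecmp A D (eunit A D b d v) a u [] = eunit A D a d (VCmp A a b (ext D d) v u)"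
  using assms catD[OF D] mcmp_assoc[of a b u "[]" "ext D d" v "chom D d d" "VId A (ext D d)"
      "VId A (ext D d)" "cat_unit D d"] is_bdry_id[OF D, of d d "[]"]
  by (intro elem_eqI) (simp_all add: ecmp_def eunit_def vid vcmp_id_left)

lemma ecmp_id:
  assumes x: "is_elem A D x" and "epath x = []" "a = estart x" "u = VId A a"
  shows "ecmp A D x a u [] = x"
  using assms is_elemD[OF x] mcmp_id_right[OF is_elemD(11,12)[OF x]]
  by (intro elem_eqI) (simp_all add: ecmp_def vcmp_id_right)

lemma ecmp_ecmp:
  assumes x: "is_elem A D x" and "epath x = []" and "a \<in> VOb A" "u \<in> VHom A a (estart x)"
    "b \<in> VOb A" "v \<in> VHom A b a"
  shows "ecmp A D (ecmp A D x a u []) b v [] = ecmp A D x b (VCmp A b a (estart x) u v) []"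
  using assms(2-) is_elemD[OF x]
    mcmp_assoc[of b a v "[]" "estart x" u "chom D (esrc x) (etgt x)" "eleft x" "eright x" "ecell x"]
  by (intro elem_eqI) (simp_all add: ecmp_def vcmp_assoc)

text \<open>This and the next lemma exhibit the unit and composition of an enriched category as a unit and a product
  of generalised elements, so that preservation of the former can be stated as preservation of the latter.\<close>

lemma eunit_VId:
  assumes D: "D \<in> enr_cats U A" and c: "c \<in> cat_ob D"
  shows "eunit A D (ext D c) c (VId A (ext D c))
    = Elem (ext D c) [] c c (VId A (ext D c)) (VId A (ext D c)) (cat_unit D c)"
  using c catD[OF D] is_bdry_id[OF D c c, of "[]"] 
    mcmp_id_right[of "ext D c" "[]" "chom D c c" "VId A (ext D c)" "VId A (ext D c)" "cat_unit D c"]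
  by (simp add: eunit_def)

lemma emul_ielem:
  assumes D: "D \<in> enr_cats U A" and c: "c \<in> cat_ob D" "c' \<in> cat_ob D" "c'' \<in> cat_ob D"
  shows "emul A D (ielem A D c c') (ielem A D c' c'')
    = Elem (ext D c) [chom D c c', chom D c' c''] c c'' (VId A (ext D c)) (VId A (ext D c''))
        (cat_mult D c c' c'')"
  using c catD[OF D] is_bdry_id[OF D, of c c'' "[chom D c c', chom D c' c'']"] 
    mcmp_id_right[of "ext D c" "[chom D c c', chom D c' c'']" "chom D c c''" "VId A (ext D c)"
      "VId A (ext D c'')" "cat_mult D c c' c''"]
  by (simp add: emul_def ielem_def eblock_def)

section \<open>Enriched functors and natural transformations act on generalised elements\<close>

text \<open>The functor axioms say that the action on generalised elements preserves units and the product of two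
  generic elements.\<close>

lemma enr_funs_iff:
  assumes C: "C \<in> enr_cats U A" and D: "D \<in> enr_cats U A"
  shows "f \<in> enr_funs A C D \<longleftrightarrow> (\<exists>fo fv fw. f = mk_fun (cat_obset C) fo fv fw) \<and>
     (\<forall>c \<in> cat_ob C. fun_ob f c \<in> cat_ob D) \<and>
     (\<forall>c \<in> cat_ob C. fun_vert f c \<in> VHom A (ext C c) (ext D (fun_ob f c))) \<and>
     (\<forall>c \<in> cat_ob C. \<forall>c' \<in> cat_ob C. is_elem A D (felem C f c c')) \<and>
     (\<forall>c \<in> cat_ob C. eapp A C D f (eunit A C (ext C c) c (VId A (ext C c)))
        = eunit A D (ext C c) (fun_ob f c) (fun_vert f c)) \<and>
     (\<forall>c\<^sub>0 \<in> cat_ob C. \<forall>c\<^sub>1 \<in> cat_ob C. \<forall>c\<^sub>2 \<in> cat_ob C.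
        eapp A C D f (emul A C (ielem A C c\<^sub>0 c\<^sub>1) (ielem A C c\<^sub>1 c\<^sub>2))
        = emul A D (felem C f c\<^sub>0 c\<^sub>1) (felem C f c\<^sub>1 c\<^sub>2))"
proof -
  note [simp] = catD[OF C] catD[OF D] vcmp_id_right
  have 1: "(fun_cell f c c' \<in> MCell A (ext C c) [chom C c c'] (chom D (fun_ob f c) (fun_ob f c'))
          (fun_vert f c) (fun_vert f c')) = is_elem A D (felem C f c c')"
    if "c \<in> cat_ob C" "c' \<in> cat_ob C" "\<forall>c \<in> cat_ob C. fun_ob f c \<in> cat_ob D"
      "\<forall>c \<in> cat_ob C. fun_vert f c \<in> VHom A (ext C c) (ext D (fun_ob f c))" for c c'
    using that by (simp add: is_elem_def felem_def is_bdry_def)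
  have 2: "(MCmp A (ext C c) (ext C c) (VId A (ext C c))
          [Block [] (cat_unit C c) (chom C c c) (VId A (ext C c))]
          (chom D (fun_ob f c) (fun_ob f c)) (fun_vert f c) (fun_vert f c) (fun_cell f c c)
        = MCmp A (ext C c) (ext D (fun_ob f c)) (fun_vert f c) []
          (chom D (fun_ob f c) (fun_ob f c))
          (VId A (ext D (fun_ob f c))) (VId A (ext D (fun_ob f c))) (cat_unit D (fun_ob f c)))
    = (eapp A C D f (eunit A C (ext C c) c (VId A (ext C c)))
        = eunit A D (ext C c) (fun_ob f c) (fun_vert f c))"
    if "c \<in> cat_ob C" "\<forall>c \<in> cat_ob C. fun_ob f c \<in> cat_ob D"
      "\<forall>c \<in> cat_ob C. fun_vert f c \<in> VHom A (ext C c) (ext D (fun_ob f c))" for c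
    using that
    by (simp add: eunit_VId[OF C] eunit_def[of A D] eapp_def ecmp_def eblock_def)
  have 3: "(MCmp A (ext C c\<^sub>0) (ext C c\<^sub>0) (VId A (ext C c\<^sub>0))
          [Block [chom C c\<^sub>0 c\<^sub>1, chom C c\<^sub>1 c\<^sub>2] (cat_mult C c\<^sub>0 c\<^sub>1 c\<^sub>2) (chom C c\<^sub>0 c\<^sub>2) (VId A (ext C c\<^sub>2))]
          (chom D (fun_ob f c\<^sub>0) (fun_ob f c\<^sub>2)) (fun_vert f c\<^sub>0) (fun_vert f c\<^sub>2) (fun_cell f c\<^sub>0 c\<^sub>2)
        = MCmp A (ext C c\<^sub>0) (ext D (fun_ob f c\<^sub>0)) (fun_vert f c\<^sub>0)
          [Block [chom C c\<^sub>0 c\<^sub>1] (fun_cell f c\<^sub>0 c\<^sub>1) (chom D (fun_ob f c\<^sub>0) (fun_ob f c\<^sub>1)) (fun_vert f c\<^sub>1),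
           Block [chom C c\<^sub>1 c\<^sub>2] (fun_cell f c\<^sub>1 c\<^sub>2) (chom D (fun_ob f c\<^sub>1) (fun_ob f c\<^sub>2)) (fun_vert f c\<^sub>2)]
          (chom D (fun_ob f c\<^sub>0) (fun_ob f c\<^sub>2))
          (VId A (ext D (fun_ob f c\<^sub>0))) (VId A (ext D (fun_ob f c\<^sub>2)))
          (cat_mult D (fun_ob f c\<^sub>0) (fun_ob f c\<^sub>1) (fun_ob f c\<^sub>2)))
    = (eapp A C D f (emul A C (ielem A C c\<^sub>0 c\<^sub>1) (ielem A C c\<^sub>1 c\<^sub>2))
        = emul A D (felem C f c\<^sub>0 c\<^sub>1) (felem C f c\<^sub>1 c\<^sub>2))"
    if "c\<^sub>0 \<in> cat_ob C" "c\<^sub>1 \<in> cat_ob C" "c\<^sub>2 \<in> cat_ob C" "\<forall>c \<in> cat_ob C. fun_ob f c \<in> cat_ob D"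
      "\<forall>c \<in> cat_ob C. fun_vert f c \<in> VHom A (ext C c) (ext D (fun_ob f c))" for c\<^sub>0 c\<^sub>1 c\<^sub>2
    using that
    by (simp add: emul_ielem[OF C] emul_def[of A D] eapp_def ecmp_def eblock_def)
  show ?thesis
    unfolding enr_funs_def mem_Collect_eq
    by (intro conj_cong refl ball_cong; (rule 1 2 3; assumption)?)
qed

lemma funD:
  assumes C: "C \<in> enr_cats U A" and D: "D \<in> enr_cats U A" and f: "f \<in> enr_funs A C D"
  shows "\<And>c. c \<in> cat_ob C \<Longrightarrow> fun_ob f c \<in> cat_ob D"
    "\<And>c. c \<in> cat_ob C \<Longrightarrow> fun_vert f c \<in> VHom A (ext C c) (ext D (fun_ob f c))"
    "\<And>c c'. c \<in> cat_ob C \<Longrightarrow> c' \<in> cat_ob C \<Longrightarrow> is_elem A D (felem C f c c')"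
    "\<And>c. c \<in> cat_ob C \<Longrightarrow> eapp A C D f (eunit A C (ext C c) c (VId A (ext C c)))
        = eunit A D (ext C c) (fun_ob f c) (fun_vert f c)"
    "\<And>c\<^sub>0 c\<^sub>1 c\<^sub>2. c\<^sub>0 \<in> cat_ob C \<Longrightarrow> c\<^sub>1 \<in> cat_ob C \<Longrightarrow> c\<^sub>2 \<in> cat_ob C \<Longrightarrow>
        eapp A C D f (emul A C (ielem A C c\<^sub>0 c\<^sub>1) (ielem A C c\<^sub>1 c\<^sub>2))
        = emul A D (felem C f c\<^sub>0 c\<^sub>1) (felem C f c\<^sub>1 c\<^sub>2)"
  using f unfolding enr_funs_iff[OF C D] by auto

lemma eapp_ecmp:
  assumes C: "C \<in> enr_cats U A" and D: "D \<in> enr_cats U A" and f: "f \<in> enr_funs A C D"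
    and x: "is_elem A C x" and r: "row A a (estart x) u bs" and b: "bots bs = epath x"
  shows "eapp A C D f (ecmp A C x a u bs) = ecmp A D (eapp A C D f x) a u bs"
proof -
  note [simp] = is_elemD[OF x] funD[OF C D f] catD[OF C] catD[OF D]
  have g: "is_elem A D (felem C f (esrc x) (etgt x))" by simp
  show ?thesis
    using mcmp_assoc1[OF r b is_elemD(11,12)[OF x], of "chom D (fun_ob f (esrc x)) (fun_ob f (etgt x))"
        "fun_vert f (esrc x)" "fun_vert f (etgt x)" "fun_cell f (esrc x) (etgt x)"]
      is_elemD[OF g] row_start[OF r] row_paths[OF r] hpath_hend[OF conjunct1[OF row_paths[OF r]]]
    by (intro elem_eqI) (auto simp: eapp_def ecmp_def eblock_def vcmp_assoc b)
qed

lemma eapp_elem: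
  assumes C: "C \<in> enr_cats U A" and D: "D \<in> enr_cats U A" and f: "f \<in> enr_funs A C D"
    and x: "is_elem A C x"
  shows "is_elem A D (eapp A C D f x)"
  unfolding eapp_def using is_elemD[OF x] funD[OF C D f] catD[OF C]
  by (intro ecmp_elem) simp_all

text \<open>The Yoneda principle: every generalised element is a substitution instance of an identity cell, hence
  laws that are stable under substitution need only be checked on identity cells.\<close>

lemma ecmp_ielem:
  assumes D: "D \<in> enr_cats U A" and x: "is_elem A D x"
  shows "ecmp A D (ielem A D (esrc x) (etgt x)) (estart x) (eleft x) [eblock D x] = x"
  using is_elemD[OF x] mcmp_id_left[OF is_elemD(11,12)[OF x]]
  by (intro elem_eqI) (simp_all add: ecmp_def ielem_def vcmp_id_left eblock_def)

text \<open>By the functor axiom this holds for generic elements, and both sides are stable under substitution.\<close>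

lemma eapp_emul:
  assumes C: "C \<in> enr_cats U A" and D: "D \<in> enr_cats U A" and f: "f \<in> enr_funs A C D"
    and x: "is_elem A C x" and y: "is_elem A C y" and xy: "follows x y"
  shows "eapp A C D f (emul A C x y) = emul A D (eapp A C D f x) (eapp A C D f y)"
proof -
  note [simp] = is_elemD[OF x] is_elemD[OF y] funD(1,2,3)[OF C D f] catD[OF C] catD[OF D]
    ielem_elem[OF C]
  have xy': "estart y = eend x" "esrc y = etgt x" "eleft y = eright x"
    using xy by (simp_all add: follows_def)
  note [simp] = is_elemD[OF y, unfolded xy']
  let ?i = "emul A C (ielem A C (esrc x) (etgt x)) (ielem A C (etgt x) (etgt y))"
  have r: "row A (estart x) (ext C (esrc x)) (eleft x) ([eblock C x] @ [eblock C y])"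
    by (simp add: xy')
  have i: "emul A C x y = ecmp A C ?i (estart x) (eleft x) ([eblock C x] @ [eblock C y])"
    by (subst ecmp_emul[OF C]) (use r ecmp_ielem[OF C x] ecmp_ielem[OF C y] in \<open>simp_all add: xy' follows_def\<close>)
  have "eapp A C D f (emul A C x y)
      = ecmp A D (eapp A C D f ?i) (estart x) (eleft x) ([eblock C x] @ [eblock C y])"
    unfolding i by (rule eapp_ecmp[OF C D f]) (use r in \<open>simp_all add: emul_elem[OF C] follows_def xy'\<close>)
  also have "\<dots> = ecmp A D (emul A D (felem C f (esrc x) (etgt x)) (felem C f (etgt x) (etgt y)))
      (estart x) (eleft x) ([eblock C x] @ [eblock C y])"
    by (subst funD(5)[OF C D f]) simp_all
  also have "\<dots> = emul A D (eapp A C D f x) (eapp A C D f y)"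
    by (subst ecmp_emul[OF D]) (use r in \<open>simp_all add: follows_def eapp_def xy'\<close>)
  finally show ?thesis .
qed

lemma eapp_eunit:
  assumes C: "C \<in> enr_cats U A" and D: "D \<in> enr_cats U A" and f: "f \<in> enr_funs A C D"
    and c: "a \<in> VOb A" "c \<in> cat_ob C" "u \<in> VHom A a (ext C c)"
  shows "eapp A C D f (eunit A C a c u)
    = eunit A D a (fun_ob f c) (VCmp A a (ext C c) (ext D (fun_ob f c)) (fun_vert f c) u)"
proof -
  note [simp] = c funD[OF C D f] catD[OF C] catD[OF D] vid
  have "eunit A C a c u = ecmp A C (eunit A C (ext C c) c (VId A (ext C c))) a u []"
    by (subst ecmp_eunit[OF C]) (simp_all add: vcmp_id_left)
  then have "eapp A C D f (eunit A C a c u)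
      = ecmp A D (eapp A C D f (eunit A C (ext C c) c (VId A (ext C c)))) a u []"
    by (simp only:) (rule eapp_ecmp[OF C D f]; simp add: eunit_elem[OF C])
  then show ?thesis by (simp add: ecmp_eunit[OF D])
qed

text \<open>The naturality axiom is the case of the generic element; the general case follows by substitution.
  The components of \<open>\<alpha>\<close> have to be restricted along the boundary of \<open>x\<close>.\<close>

lemma emul_eapp_natural:
  assumes C: "C \<in> enr_cats U A" and D: "D \<in> enr_cats U A"
    and f: "f \<in> enr_funs A C D" and f': "f' \<in> enr_funs A C D"
    and \<alpha>: "\<forall>c \<in> cat_ob C. is_elem A D (nelem C f f' \<alpha> c)"
      "\<forall>c \<in> cat_ob C. \<forall>c' \<in> cat_ob C. emul A D (nelem C f f' \<alpha> c) (felem C f' c c')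
        = emul A D (felem C f c c') (nelem C f f' \<alpha> c')"
    and x: "is_elem A C x"
  shows "emul A D (eapp A C D f x) (ecmp A D (nelem C f f' \<alpha> (etgt x)) (eend x) (eright x) [])
    = emul A D (ecmp A D (nelem C f f' \<alpha> (esrc x)) (estart x) (eleft x) []) (eapp A C D f' x)"
proof -
  note [simp] = is_elemD[OF x] funD(1-3)[OF C D f] funD(1-3)[OF C D f'] \<alpha>(1)[rule_format]
  have "emul A D (eapp A C D f x) (ecmp A D (nelem C f f' \<alpha> (etgt x)) (eend x) (eright x) [])
    = ecmp A D (emul A D (felem C f (esrc x) (etgt x)) (nelem C f f' \<alpha> (etgt x)))
       (estart x) (eleft x) ([eblock C x] @ [])"
    by (subst ecmp_emul[OF D]) (simp_all add: follows_def eapp_def)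
  also have "\<dots> = ecmp A D (emul A D (nelem C f f' \<alpha> (esrc x)) (felem C f' (esrc x) (etgt x)))
       (estart x) (eleft x) ([] @ [eblock C x])"
    by (subst \<alpha>(2)[rule_format]) simp_all
  also have "\<dots> = emul A D (ecmp A D (nelem C f f' \<alpha> (esrc x)) (estart x) (eleft x) []) (eapp A C D f' x)"
    by (subst ecmp_emul[OF D]) (simp_all add: follows_def eapp_def)
  finally show ?thesis .
qed

lemma enr_nats_iff:
  assumes C: "C \<in> enr_cats U A" and D: "D \<in> enr_cats U A"
    and f: "f \<in> enr_funs A C D" and f': "f' \<in> enr_funs A C D"
  shows "\<alpha> \<in> enr_nats A C D f f' \<longleftrightarrow> (\<exists>t. \<alpha> = vlam (cat_ob C) t) \<and>
     (\<forall>c \<in> cat_ob C. is_elem A D (nelem C f f' \<alpha> c)) \<and>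
     (\<forall>c \<in> cat_ob C. \<forall>c' \<in> cat_ob C. emul A D (nelem C f f' \<alpha> c) (felem C f' c c')
        = emul A D (felem C f c c') (nelem C f f' \<alpha> c'))"
proof -
  note [simp] = catD[OF C] catD[OF D] funD[OF C D f] funD[OF C D f']
  have 1: "(vapp \<alpha> c \<in> MCell A (ext C c) [] (chom D (fun_ob f c) (fun_ob f' c)) (fun_vert f c) (fun_vert f' c))
    = is_elem A D (nelem C f f' \<alpha> c)" if "c \<in> cat_ob C" for c
    using that by (simp add: is_elem_def is_bdry_def)
  show ?thesis
    unfolding enr_nats_def mem_Collect_eq
    by (auto simp: 1 emul_def eblock_def)
qed

lemma natD:
  assumes C: "C \<in> enr_cats U A" and D: "D \<in> enr_cats U A"
    and f: "f \<in> enr_funs A C D" and f': "f' \<in> enr_funs A C D" and \<alpha>: "\<alpha> \<in> enr_nats A C D f f'"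
  shows "\<And>c. c \<in> cat_ob C \<Longrightarrow> is_elem A D (nelem C f f' \<alpha> c)"
    "\<And>c c'. c \<in> cat_ob C \<Longrightarrow> c' \<in> cat_ob C \<Longrightarrow> emul A D (nelem C f f' \<alpha> c) (felem C f' c c')
        = emul A D (felem C f c c') (nelem C f f' \<alpha> c')"
    "\<And>x. is_elem A C x \<Longrightarrow>
      emul A D (eapp A C D f x) (ecmp A D (nelem C f f' \<alpha> (etgt x)) (eend x) (eright x) [])
    = emul A D (ecmp A D (nelem C f f' \<alpha> (esrc x)) (estart x) (eleft x) []) (eapp A C D f' x)"
  using \<alpha> unfolding enr_nats_iff[OF C D f f'] by (auto intro!: emul_eapp_natural C D f f')

end

lemma enr_cat_eqI:
  assumes "C \<in> enr_cats U A" "\<exists>e h n m. C' = mk_cat (cat_obset C) e h n m"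
    "\<And>c. c \<in> cat_ob C \<Longrightarrow> ext C c = ext C' c"
    "\<And>c c'. c \<in> cat_ob C \<Longrightarrow> c' \<in> cat_ob C \<Longrightarrow> cat_hom C c c' = cat_hom C' c c'"
    "\<And>c. c \<in> cat_ob C \<Longrightarrow> cat_unit C c = cat_unit C' c"
    "\<And>c c' c''. c \<in> cat_ob C \<Longrightarrow> c' \<in> cat_ob C \<Longrightarrow> c'' \<in> cat_ob C \<Longrightarrow>
      cat_mult C c c' c'' = cat_mult C' c c' c''"
  shows "C = C'"
proof -
  obtain X e h n m where C: "C = mk_cat X e h n m" using assms(1) by (auto simp: enr_cats_def)
  obtain e' h' n' m' where C': "C' = mk_cat X e' h' n' m'" using assms(2) by (auto simp: C)
  show ?thesis
    using assms(3-) unfolding C C' by (intro mk_cat_cong) simp_all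
qed

lemma enr_fun_eqI:
  assumes "\<exists>fo fv fw. f = mk_fun X fo fv fw" "\<exists>fo fv fw. g = mk_fun X fo fv fw"
    "\<And>c. c \<in> elts X \<Longrightarrow> fun_ob f c = fun_ob g c"
    "\<And>c. c \<in> elts X \<Longrightarrow> fun_vert f c = fun_vert g c"
    "\<And>c c'. c \<in> elts X \<Longrightarrow> c' \<in> elts X \<Longrightarrow> fun_cell f c c' = fun_cell g c c'"
  shows "f = g"
proof -
  obtain fo fv fw where f: "f = mk_fun X fo fv fw" using assms(1) by blast
  obtain go gv gw where g: "g = mk_fun X go gv gw" using assms(2) by blast
  show ?thesis using assms(3-) unfolding f g by (intro mk_fun_cong) simp_all
qed

section \<open>The 2-category of enriched categories\<close>

lemma ACat_sel [simp]:
  "Ob (ACat U A) = enr_cats U A" "Hom1 (ACat U A) = enr_funs A" "Hom2 (ACat U A) = enr_nats A"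
  "Id1 (ACat U A) = id_fun A" "Cmp1 (ACat U A) = cmp_fun A" "Id2 (ACat U A) = id_nat A"
  "Vc (ACat U A) = vcmp_nat A"
  "Hc (ACat U A) C D E f f' g g' \<beta> \<alpha>
    = vcmp_nat A C E (cmp_fun A C D E g f) (cmp_fun A C D E g f') (cmp_fun A C D E g' f')
         (rwhisker A C D E f' g g' \<beta>) (lwhisker A C D E f f' g \<alpha>)"
  by (simp_all add: ACat_def)

lemma id_fun_sel [simp]:
  "c \<in> cat_ob C \<Longrightarrow> fun_ob (id_fun A C) c = c"
  "c \<in> cat_ob C \<Longrightarrow> fun_vert (id_fun A C) c = VId A (ext C c)"
  "c \<in> cat_ob C \<Longrightarrow> c' \<in> cat_ob C \<Longrightarrow> fun_cell (id_fun A C) c c' = MId A (chom C c c')"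
  by (simp_all add: id_fun_def)

lemma cmp_fun_sel [simp]:
  "c \<in> cat_ob C \<Longrightarrow> fun_ob (cmp_fun A C D E g f) c = fun_ob g (fun_ob f c)"
  "c \<in> cat_ob C \<Longrightarrow> fun_vert (cmp_fun A C D E g f) c
    = VCmp A (ext C c) (ext D (fun_ob f c)) (ext E (fun_ob g (fun_ob f c)))
        (fun_vert g (fun_ob f c)) (fun_vert f c)"
  "c \<in> cat_ob C \<Longrightarrow> c' \<in> cat_ob C \<Longrightarrow>
    fun_cell (cmp_fun A C D E g f) c c' = ecell (eapp A D E g (felem C f c c'))"
  by (simp_all add: cmp_fun_def eapp_def ecmp_def eblock_def)

lemma felem_id: "c \<in> cat_ob C \<Longrightarrow> c' \<in> cat_ob C \<Longrightarrow> felem C (id_fun A C) c c' = ielem A C c c'"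
  by (simp add: felem_def ielem_def)

lemma felem_cmp: "c \<in> cat_ob C \<Longrightarrow> c' \<in> cat_ob C \<Longrightarrow>
    felem C (cmp_fun A C D E g f) c c' = eapp A D E g (felem C f c c')"
  by (rule elem_eqI) simp_all

lemma nelem_id: "c \<in> cat_ob C \<Longrightarrow>
    nelem C f f (id_nat A C D f) c = eunit A D (ext C c) (fun_ob f c) (fun_vert f c)"
  by (simp add: nelem_def id_nat_def eunit_def)

lemma nelem_vcmp: "c \<in> cat_ob C \<Longrightarrow> nelem C f f'' (vcmp_nat A C D f f' f'' \<beta> \<alpha>) c
    = emul A D (nelem C f f' \<alpha> c) (nelem C f' f'' \<beta> c)"
  by (simp add: nelem_def vcmp_nat_def emul_def eblock_def)

lemma nelem_lwhisker: "c \<in> cat_ob C \<Longrightarrow>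
    nelem C (cmp_fun A C D E g f) (cmp_fun A C D E g f') (lwhisker A C D E f f' g \<alpha>) c
    = eapp A D E g (nelem C f f' \<alpha> c)"
  by (simp add: nelem_def lwhisker_def eapp_def ecmp_def eblock_def)

lemma nelem_rwhisker: "c \<in> cat_ob C \<Longrightarrow>
    nelem C (cmp_fun A C D E g h) (cmp_fun A C D E g' h) (rwhisker A C D E h g g' \<beta>) c
    = ecmp A E (nelem D g g' \<beta> (fun_ob h c)) (ext C c) (fun_vert h c) []"
  by (simp add: nelem_def rwhisker_def ecmp_def)

text \<open>The functors \<open>f\<close> and \<open>f'\<close> only serve to state the components as generalised elements.\<close>

lemma nat_eqI:
  assumes "\<exists>t. \<alpha> = vlam (cat_ob C) t" "\<exists>t. \<beta> = vlam (cat_ob C) t"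
    "\<And>c. c \<in> cat_ob C \<Longrightarrow> nelem C f f' \<alpha> c = nelem C f f' \<beta> c"
  shows "\<alpha> = \<beta>"
  using assms by (intro vlam_extend[OF assms(1,2)]) (metis nelem_sel(7))

lemma nat_vlam:
  "\<exists>t. id_nat A C D f = vlam (cat_ob C) t" "\<exists>t. vcmp_nat A C D f f' f'' \<beta> \<alpha> = vlam (cat_ob C) t"
  "\<exists>t. lwhisker A C D E f f' g \<alpha> = vlam (cat_ob C) t" "\<exists>t. rwhisker A C D E h g g' \<beta> = vlam (cat_ob C) t"
  by (auto simp: id_nat_def vcmp_nat_def lwhisker_def rwhisker_def)

lemma fun_mk_fun:
  "\<exists>fo fv fw. id_fun A C = mk_fun (cat_obset C) fo fv fw"
  "\<exists>fo fv fw. cmp_fun A C D E g f = mk_fun (cat_obset C) fo fv fw"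
  "f \<in> enr_funs A C D \<Longrightarrow> \<exists>fo fv fw. f = mk_fun (cat_obset C) fo fv fw"
  unfolding id_fun_def cmp_fun_def enr_funs_def by blast+

lemma nat_mk_nat: "\<alpha> \<in> enr_nats A C D f f' \<Longrightarrow> \<exists>t. \<alpha> = vlam (cat_ob C) t"
  unfolding enr_nats_def by blast

context enrichment
begin

lemma eapp_id: "C \<in> enr_cats U A \<Longrightarrow> is_elem A C x \<Longrightarrow> eapp A C C (id_fun A C) x = x"
  by (simp add: eapp_def felem_id is_elemD ecmp_ielem)

lemma eapp_ielem:
  assumes C: "C \<in> enr_cats U A" and D: "D \<in> enr_cats U A" and f: "f \<in> enr_funs A C D"
    and c: "c \<in> cat_ob C" "c' \<in> cat_ob C"
  shows "eapp A C D f (ielem A C c c') = felem C f c c'"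
  using is_elemD[OF funD(3)[OF C D f c]] funD[OF C D f] catD[OF C] c
    mcmp_id_right[OF is_elemD(11,12), OF funD(3)[OF C D f c] funD(3)[OF C D f c]]
  by (intro elem_eqI)
    (simp_all add: eapp_def ecmp_def eblock_def ielem_def vcmp_id_right)

lemma eapp_cmp:
  assumes C: "C \<in> enr_cats U A" and D: "D \<in> enr_cats U A" and E: "E \<in> enr_cats U A"
    and f: "f \<in> enr_funs A C D" and g: "g \<in> enr_funs A D E" and x: "is_elem A C x"
  shows "eapp A C E (cmp_fun A C D E g f) x = eapp A D E g (eapp A C D f x)"
  unfolding eapp_def[of A C] using is_elemD[OF x] funD[OF C D f] catD[OF C]
  by (simp add: felem_cmp eapp_ecmp[OF D E g])

lemma id_fun: "C \<in> enr_cats U A \<Longrightarrow> id_fun A C \<in> enr_funs A C C"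
  by (subst enr_funs_iff)
    (auto simp: fun_mk_fun catD felem_id ielem_elem eapp_id eunit_elem emul_elem follows_def vid)

lemma cmp_fun:
  assumes C: "C \<in> enr_cats U A" and D: "D \<in> enr_cats U A" and E: "E \<in> enr_cats U A"
    and f: "f \<in> enr_funs A C D" and g: "g \<in> enr_funs A D E"
  shows "cmp_fun A C D E g f \<in> enr_funs A C E"
proof -
  note [simp] = catD[OF C] catD[OF D] catD[OF E] funD[OF C D f] funD[OF D E g] vid vcmp
    eapp_elem[OF D E g] eunit_elem[OF C] ielem_elem[OF C] emul_elem[OF C]
  show ?thesis
    unfolding enr_funs_iff[OF C E]
    by (simp add: fun_mk_fun felem_cmp eapp_cmp[OF C D E f g] eapp_eunit[OF D E g]
        eapp_emul[OF D E g] follows_def)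
qed

lemma cmp_fun_id:
  assumes C: "C \<in> enr_cats U A" and D: "D \<in> enr_cats U A" and f: "f \<in> enr_funs A C D"
  shows "cmp_fun A C C D f (id_fun A C) = f" "cmp_fun A C D D (id_fun A D) f = f"
proof -
  note [simp] = catD[OF C] catD[OF D] funD(1,2,3)[OF C D f] eapp_ielem[OF C D f] fun_mk_fun
    fun_mk_fun(3)[OF f] vcmp_id_left vcmp_id_right felem_id eapp_id[OF D]
  show "cmp_fun A C C D f (id_fun A C) = f" "cmp_fun A C D D (id_fun A D) f = f"
    by (rule enr_fun_eqI[where X = "cat_obset C"]; simp)+
qed

lemma cmp_fun_assoc:
  assumes C: "C \<in> enr_cats U A" and D: "D \<in> enr_cats U A" and E: "E \<in> enr_cats U A"
    and F: "F \<in> enr_cats U A"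
    and f: "f \<in> enr_funs A C D" and g: "g \<in> enr_funs A D E" and h: "h \<in> enr_funs A E F"
  shows "cmp_fun A C D F (cmp_fun A D E F h g) f = cmp_fun A C E F h (cmp_fun A C D E g f)"
  using catD[OF C] catD[OF D] catD[OF E] catD[OF F] funD[OF C D f] funD[OF D E g] funD[OF E F h]
  by (rule_tac enr_fun_eqI[where X = "cat_obset C"])
    (simp_all add: fun_mk_fun vcmp_assoc eapp_cmp[OF D E F g h] felem_cmp)

lemma id_nat:
  assumes C: "C \<in> enr_cats U A" and D: "D \<in> enr_cats U A" and f: "f \<in> enr_funs A C D"
  shows "id_nat A C D f \<in> enr_nats A C D f f"
  unfolding enr_nats_iff[OF C D f f] using catD[OF C] funD[OF C D f]
  by (simp add: nat_vlam nelem_id eunit_elem[OF D] emul_eunit_left[OF D] emul_eunit_right[OF D])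

lemma vcmp_nat:
  assumes C: "C \<in> enr_cats U A" and D: "D \<in> enr_cats U A"
    and f: "f \<in> enr_funs A C D" "f' \<in> enr_funs A C D" "f'' \<in> enr_funs A C D"
    and \<alpha>: "\<alpha> \<in> enr_nats A C D f f'" and \<beta>: "\<beta> \<in> enr_nats A C D f' f''"
  shows "vcmp_nat A C D f f' f'' \<beta> \<alpha> \<in> enr_nats A C D f f''"
  unfolding enr_nats_iff[OF C D f(1,3)]
proof (intro conjI ballI)
  note [simp] = funD(1,2,3)[OF C D f(1)] funD(1,2,3)[OF C D f(2)] funD(1,2,3)[OF C D f(3)]
    natD(1)[OF C D f(1,2) \<alpha>] natD(1)[OF C D f(2,3) \<beta>] nelem_vcmp nat_vlam
  show "\<exists>t. vcmp_nat A C D f f' f'' \<beta> \<alpha> = vlam (cat_ob C) t" by simp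
  fix c assume [simp]: "c \<in> cat_ob C"
  show "is_elem A D (nelem C f f'' (vcmp_nat A C D f f' f'' \<beta> \<alpha>) c)"
    by (simp add: emul_elem[OF D] follows_def)
  fix c' assume [simp]: "c' \<in> cat_ob C"
  have "emul A D (nelem C f f'' (vcmp_nat A C D f f' f'' \<beta> \<alpha>) c) (felem C f'' c c')
    = emul A D (nelem C f f' \<alpha> c) (emul A D (nelem C f' f'' \<beta> c) (felem C f'' c c'))"
    by (simp add: emul_assoc[OF D] follows_def)
  also have "\<dots> = emul A D (nelem C f f' \<alpha> c) (emul A D (felem C f' c c') (nelem C f' f'' \<beta> c'))"
    by (simp add: natD(2)[OF C D f(2,3) \<beta>])
  also have "\<dots> = emul A D (emul A D (nelem C f f' \<alpha> c) (felem C f' c c')) (nelem C f' f'' \<beta> c')"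
    by (simp add: emul_assoc[OF D] follows_def)
  also have "\<dots> = emul A D (emul A D (felem C f c c') (nelem C f f' \<alpha> c')) (nelem C f' f'' \<beta> c')"
    by (simp add: natD(2)[OF C D f(1,2) \<alpha>])
  also have "\<dots> = emul A D (felem C f c c') (nelem C f f'' (vcmp_nat A C D f f' f'' \<beta> \<alpha>) c')"
    by (simp add: emul_assoc[OF D] follows_def)
  finally show "emul A D (nelem C f f'' (vcmp_nat A C D f f' f'' \<beta> \<alpha>) c) (felem C f'' c c')
    = emul A D (felem C f c c') (nelem C f f'' (vcmp_nat A C D f f' f'' \<beta> \<alpha>) c')" .
qed

lemma lwhisker:
  assumes C: "C \<in> enr_cats U A" and D: "D \<in> enr_cats U A" and E: "E \<in> enr_cats U A"
    and f: "f \<in> enr_funs A C D" "f' \<in> enr_funs A C D" and g: "g \<in> enr_funs A D E"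
    and \<alpha>: "\<alpha> \<in> enr_nats A C D f f'"
  shows "lwhisker A C D E f f' g \<alpha> \<in> enr_nats A C E (cmp_fun A C D E g f) (cmp_fun A C D E g f')"
  unfolding enr_nats_iff[OF C E cmp_fun[OF C D E f(1) g] cmp_fun[OF C D E f(2) g]]
  using funD[OF C D f(1)] funD[OF C D f(2)] natD(1)[OF C D f \<alpha>]
  by (simp add: nat_vlam nelem_lwhisker felem_cmp eapp_elem[OF D E g] eapp_emul[OF D E g, symmetric]
      follows_def natD(2)[OF C D f \<alpha>])

lemma rwhisker:
  assumes C: "C \<in> enr_cats U A" and D: "D \<in> enr_cats U A" and E: "E \<in> enr_cats U A"
    and h: "h \<in> enr_funs A C D" and g: "g \<in> enr_funs A D E" "g' \<in> enr_funs A D E"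
    and \<beta>: "\<beta> \<in> enr_nats A D E g g'"
  shows "rwhisker A C D E h g g' \<beta> \<in> enr_nats A C E (cmp_fun A C D E g h) (cmp_fun A C D E g' h)"
  unfolding enr_nats_iff[OF C E cmp_fun[OF C D E h g(1)] cmp_fun[OF C D E h g(2)]]
  using funD[OF C D h] natD(1)[OF D E g \<beta>] catD[OF C] catD[OF D]
    natD(3)[OF D E g \<beta> funD(3)[OF C D h]]
  by (simp add: nat_vlam nelem_rwhisker felem_cmp ecmp_elem)

text \<open>This is naturality of \<open>\<beta>\<close> at the generalised element given by a component of \<open>\<alpha>\<close>.\<close>

lemma exchange:
  assumes C: "C \<in> enr_cats U A" and D: "D \<in> enr_cats U A" and E: "E \<in> enr_cats U A"
    and f: "f \<in> enr_funs A C D" "f' \<in> enr_funs A C D" and g: "g \<in> enr_funs A D E" "g' \<in> enr_funs A D E"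
    and \<alpha>: "\<alpha> \<in> enr_nats A C D f f'" and \<beta>: "\<beta> \<in> enr_nats A D E g g'"
  shows "vcmp_nat A C E (cmp_fun A C D E g f) (cmp_fun A C D E g f') (cmp_fun A C D E g' f')
            (rwhisker A C D E f' g g' \<beta>) (lwhisker A C D E f f' g \<alpha>)
        = vcmp_nat A C E (cmp_fun A C D E g f) (cmp_fun A C D E g' f) (cmp_fun A C D E g' f')
            (lwhisker A C D E f f' g' \<alpha>) (rwhisker A C D E f g g' \<beta>)"
  using natD(3)[OF D E g \<beta> natD(1)[OF C D f \<alpha>]]
  by (intro nat_eqI[where C = C and f = "cmp_fun A C D E g f" and f' = "cmp_fun A C D E g' f'"] nat_vlam)
    (simp add: nelem_vcmp nelem_lwhisker nelem_rwhisker)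

lemma whisker_id_nat:
  assumes C: "C \<in> enr_cats U A" and D: "D \<in> enr_cats U A" and E: "E \<in> enr_cats U A"
    and f: "f \<in> enr_funs A C D" and g: "g \<in> enr_funs A D E"
  shows "lwhisker A C D E f f g (id_nat A C D f) = id_nat A C E (cmp_fun A C D E g f)"
    and "rwhisker A C D E f g g (id_nat A D E g) = id_nat A C E (cmp_fun A C D E g f)"
proof -
  note [simp] = funD(1,2,3)[OF C D f] funD(1,2,3)[OF D E g] catD[OF C] catD[OF D] catD[OF E] nat_vlam
  show "lwhisker A C D E f f g (id_nat A C D f) = id_nat A C E (cmp_fun A C D E g f)"
    by (rule nat_eqI[where C = C and f = "cmp_fun A C D E g f" and f' = "cmp_fun A C D E g f"])
      (simp_all add: nelem_lwhisker nelem_id eapp_eunit[OF D E g])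
  show "rwhisker A C D E f g g (id_nat A D E g) = id_nat A C E (cmp_fun A C D E g f)"
    by (rule nat_eqI[where C = C and f = "cmp_fun A C D E g f" and f' = "cmp_fun A C D E g f"])
      (simp_all add: nelem_rwhisker nelem_id ecmp_eunit[OF E])
qed

lemma vcmp_nat_id:
  assumes C: "C \<in> enr_cats U A" and D: "D \<in> enr_cats U A"
    and f: "f \<in> enr_funs A C D" "f' \<in> enr_funs A C D" and \<alpha>: "\<alpha> \<in> enr_nats A C D f f'"
  shows "vcmp_nat A C D f f f' \<alpha> (id_nat A C D f) = \<alpha>"
    and "vcmp_nat A C D f f' f' (id_nat A C D f') \<alpha> = \<alpha>"
  using natD(1)[OF C D f \<alpha>]
  by (rule_tac [!] nat_eqI[where C = C and f = f and f' = f'])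
    (simp_all add: nat_vlam nat_mk_nat[OF \<alpha>] nelem_vcmp nelem_id emul_eunit_left[OF D]
      emul_eunit_right[OF D])

lemma Hc_id_nat:
  assumes C: "C \<in> enr_cats U A" and D: "D \<in> enr_cats U A" and E: "E \<in> enr_cats U A"
    and f: "f \<in> enr_funs A C D" "f' \<in> enr_funs A C D" and g: "g \<in> enr_funs A D E" "g' \<in> enr_funs A D E"
  shows "\<alpha> \<in> enr_nats A C D f f' \<Longrightarrow>
      Hc (ACat U A) C D E f f' g g (id_nat A D E g) \<alpha> = lwhisker A C D E f f' g \<alpha>"
    and "\<beta> \<in> enr_nats A D E g g' \<Longrightarrow>
      Hc (ACat U A) C D E f f g g' \<beta> (id_nat A C D f) = rwhisker A C D E f g g' \<beta>"
  using assms by (simp_all add: whisker_id_nat vcmp_nat_id cmp_fun lwhisker rwhisker)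

text \<open>By passing to components, every axiom becomes a law of generalised elements: associativity of vertical
  composition is \<open>emul_assoc\<close>, functoriality of the left whiskering is \<open>eapp_emul\<close>, functoriality of the
  right whiskering is \<open>ecmp_emul\<close>.\<close>

theorem two_category_ACat: "two_category (ACat U A)"
proof (rule whiskered.two_category[where lw = "lwhisker A" and rw = "rwhisker A"], unfold_locales;
    unfold ACat_sel; (simp add: id_fun cmp_fun cmp_fun_id cmp_fun_assoc id_nat vcmp_nat lwhisker
      rwhisker exchange whisker_id_nat vcmp_nat_id; fail)?)
  fix C D f f' f'' f''' \<alpha> \<beta> \<gamma>
  assume C: "C \<in> enr_cats U A" and D: "D \<in> enr_cats U A"
    and f: "f \<in> enr_funs A C D" "f' \<in> enr_funs A C D" and \<alpha>: "\<alpha> \<in> enr_nats A C D f f'"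
  note \<alpha>_elem [simp] = natD(1)[OF C D f \<alpha>]
  note [simp] = nat_vlam nat_mk_nat[OF \<alpha>] funD(1,2,3)[OF C D f(1)] funD(1,2,3)[OF C D f(2)] catD[OF C] catD[OF D]
  show "lwhisker A C D D f f' (id_fun A D) \<alpha> = \<alpha>"
    using nelem_lwhisker[of _ C A D D "id_fun A D" f f' \<alpha>]
    by (intro nat_eqI[where C = C and f = f and f' = f'])
      (simp_all add: cmp_fun_id[OF C D f(1)] cmp_fun_id[OF C D f(2)] eapp_id[OF D])
  show "rwhisker A C C D (id_fun A C) f f' \<alpha> = \<alpha>"
    using nelem_rwhisker[of _ C A C D f "id_fun A C" f' \<alpha>]
    by (intro nat_eqI[where C = C and f = f and f' = f'])
      (simp_all add: cmp_fun_id[OF C D f(1)] cmp_fun_id[OF C D f(2)] ecmp_id)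
  {
    fix E g assume E: "E \<in> enr_cats U A" and g: "g \<in> enr_funs A D E"
    note [simp] = funD(1,2,3)[OF D E g] catD[OF E]
    fix F h assume F: "F \<in> enr_cats U A" and h: "h \<in> enr_funs A E F"
    show "lwhisker A C E F (cmp_fun A C D E g f) (cmp_fun A C D E g f') h (lwhisker A C D E f f' g \<alpha>)
      = lwhisker A C D F f f' (cmp_fun A D E F h g) \<alpha>"
    proof (rule nat_eqI[where C = C and f = "cmp_fun A C D F (cmp_fun A D E F h g) f"
          and f' = "cmp_fun A C D F (cmp_fun A D E F h g) f'"])
      fix c assume "c \<in> cat_ob C"
      then show "nelem C (cmp_fun A C D F (cmp_fun A D E F h g) f) (cmp_fun A C D F (cmp_fun A D E F h g) f')
          (lwhisker A C E F (cmp_fun A C D E g f) (cmp_fun A C D E g f') h (lwhisker A C D E f f' g \<alpha>)) c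
        = nelem C (cmp_fun A C D F (cmp_fun A D E F h g) f) (cmp_fun A C D F (cmp_fun A D E F h g) f')
          (lwhisker A C D F f f' (cmp_fun A D E F h g) \<alpha>) c"
        using nelem_lwhisker[of c C A E F h "cmp_fun A C D E g f" "cmp_fun A C D E g f'" "lwhisker A C D E f f' g \<alpha>"]
        unfolding cmp_fun_assoc[OF C D E F f(1) g h] cmp_fun_assoc[OF C D E F f(2) g h]
        using nelem_lwhisker[of c C A D F "cmp_fun A D E F h g" f f' \<alpha>]
        unfolding cmp_fun_assoc[OF C D E F f(1) g h] cmp_fun_assoc[OF C D E F f(2) g h]
        by (simp add: nelem_lwhisker eapp_cmp[OF D E F g h])
    qed (simp_all add: nat_vlam)
  next
    fix E g f'' \<alpha>' assume E: "E \<in> enr_cats U A" and g: "g \<in> enr_funs A D E"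
      and f'': "f'' \<in> enr_funs A C D" and \<alpha>': "\<alpha>' \<in> enr_nats A C D f' f''"
    note [simp] = natD(1)[OF C D f(2) f'' \<alpha>']
    show "lwhisker A C D E f f'' g (vcmp_nat A C D f f' f'' \<alpha>' \<alpha>)
      = vcmp_nat A C E (cmp_fun A C D E g f) (cmp_fun A C D E g f') (cmp_fun A C D E g f'')
          (lwhisker A C D E f' f'' g \<alpha>') (lwhisker A C D E f f' g \<alpha>)"
      by (rule nat_eqI[where C = C and f = "cmp_fun A C D E g f" and f' = "cmp_fun A C D E g f''"])
        (simp_all add: nelem_lwhisker nelem_vcmp eapp_emul[OF D E g] follows_def)
  next
    fix B h assume B: "B \<in> enr_cats U A" and h: "h \<in> enr_funs A B C"
    note [simp] = funD(1,2,3)[OF B C h] catD[OF B]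
    {
      fix f'' \<alpha>' assume f'': "f'' \<in> enr_funs A C D" and \<alpha>': "\<alpha>' \<in> enr_nats A C D f' f''"
      note [simp] = natD(1)[OF C D f(2) f'' \<alpha>']
      show "rwhisker A B C D h f f'' (vcmp_nat A C D f f' f'' \<alpha>' \<alpha>)
        = vcmp_nat A B D (cmp_fun A B C D f h) (cmp_fun A B C D f' h) (cmp_fun A B C D f'' h)
            (rwhisker A B C D h f' f'' \<alpha>') (rwhisker A B C D h f f' \<alpha>)"
        by (rule nat_eqI[where C = B and f = "cmp_fun A B C D f h" and f' = "cmp_fun A B C D f'' h"])
          (simp_all add: nelem_rwhisker nelem_vcmp ecmp_emul[OF D, where bs = "[]" and bs' = "[]", simplified]
            follows_def)
    next
      fix E g assume E: "E \<in> enr_cats U A" and g: "g \<in> enr_funs A D E"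
      show "rwhisker A B C E h (cmp_fun A C D E g f) (cmp_fun A C D E g f') (lwhisker A C D E f f' g \<alpha>)
        = lwhisker A B D E (cmp_fun A B C D f h) (cmp_fun A B C D f' h) g (rwhisker A B C D h f f' \<alpha>)"
      proof (rule nat_eqI[where C = B and f = "cmp_fun A B C E (cmp_fun A C D E g f) h"
          and f' = "cmp_fun A B C E (cmp_fun A C D E g f') h"])
        fix c assume "c \<in> cat_ob B"
        then show "nelem B (cmp_fun A B C E (cmp_fun A C D E g f) h) (cmp_fun A B C E (cmp_fun A C D E g f') h)
            (rwhisker A B C E h (cmp_fun A C D E g f) (cmp_fun A C D E g f') (lwhisker A C D E f f' g \<alpha>)) c
          = nelem B (cmp_fun A B C E (cmp_fun A C D E g f) h) (cmp_fun A B C E (cmp_fun A C D E g f') h)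
            (lwhisker A B D E (cmp_fun A B C D f h) (cmp_fun A B C D f' h) g (rwhisker A B C D h f f' \<alpha>)) c"
          using nelem_lwhisker[of c B A D E g "cmp_fun A B C D f h" "cmp_fun A B C D f' h" "rwhisker A B C D h f f' \<alpha>"]
          unfolding cmp_fun_assoc[OF B C D E h f(1) g, symmetric] cmp_fun_assoc[OF B C D E h f(2) g, symmetric]
          by (simp add: nelem_lwhisker nelem_rwhisker eapp_ecmp[OF D E g])
      qed (simp_all add: nat_vlam)
    next
      fix B' h' assume B': "B' \<in> enr_cats U A" and h': "h' \<in> enr_funs A B' B"
      note [simp] = funD(1,2,3)[OF B' B h'] catD[OF B']
      show "rwhisker A B' B D h' (cmp_fun A B C D f h) (cmp_fun A B C D f' h) (rwhisker A B C D h f f' \<alpha>)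
        = rwhisker A B' C D (cmp_fun A B' B C h h') f f' \<alpha>"
      proof (rule nat_eqI[where C = B' and f = "cmp_fun A B' B D (cmp_fun A B C D f h) h'"
          and f' = "cmp_fun A B' B D (cmp_fun A B C D f' h) h'"])
        fix c assume "c \<in> cat_ob B'"
        then show "nelem B' (cmp_fun A B' B D (cmp_fun A B C D f h) h') (cmp_fun A B' B D (cmp_fun A B C D f' h) h')
            (rwhisker A B' B D h' (cmp_fun A B C D f h) (cmp_fun A B C D f' h) (rwhisker A B C D h f f' \<alpha>)) c
          = nelem B' (cmp_fun A B' B D (cmp_fun A B C D f h) h') (cmp_fun A B' B D (cmp_fun A B C D f' h) h')
            (rwhisker A B' C D (cmp_fun A B' B C h h') f f' \<alpha>) c"
          using nelem_rwhisker[of c B' A C D f "cmp_fun A B' B C h h'" f' \<alpha>]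
          unfolding cmp_fun_assoc[OF B' B C D h' h f(1), symmetric] cmp_fun_assoc[OF B' B C D h' h f(2), symmetric]
          by (simp add: nelem_rwhisker ecmp_ecmp)
      qed (simp_all add: nat_vlam)
    }
  next
    assume f'': "f'' \<in> enr_funs A C D" "f''' \<in> enr_funs A C D"
      and \<beta>: "\<beta> \<in> enr_nats A C D f' f''" and \<gamma>: "\<gamma> \<in> enr_nats A C D f'' f'''"
    note [simp] = natD(1)[OF C D f(2) f''(1) \<beta>] natD(1)[OF C D f'' \<gamma>]
    show "vcmp_nat A C D f f' f''' (vcmp_nat A C D f' f'' f''' \<gamma> \<beta>) \<alpha>
      = vcmp_nat A C D f f'' f''' \<gamma> (vcmp_nat A C D f f' f'' \<beta> \<alpha>)"
      by (rule nat_eqI[where C = C and f = f and f' = f'''])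
        (simp_all add: nelem_vcmp emul_assoc[OF D] follows_def)
  }
qed

end

text \<open>The dependent product of a family of sets. An enriched category is an element of an iterated dependent sum
  of such products, formed from the sets of cells of \<open>A\<close>; as the objects form a small set, hence a large
  one, this sum is large. The same applies to functors and transformations.\<close>

abbreviation graphs :: "'v::zf \<Rightarrow> ('v \<Rightarrow> 'v set) \<Rightarrow> 'v set" where
  "graphs X B \<equiv> {vlam (elts X) f | f. \<forall>x \<in> elts X. f x \<in> B x}"

lemma vlam_in_graphs: "(\<And>x. x \<in> elts X \<Longrightarrow> f x \<in> B x) \<Longrightarrow> vlam (elts X) f \<in> graphs X B"
  by auto

lemma graphsD: "g \<in> graphs X B \<Longrightarrow> x \<in> elts X \<Longrightarrow> vapp g x \<in> B x"
  by auto

lemma large_ACat: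
  fixes A :: "'v::zf vdcv"
  assumes A: "virtual_double_category A" "large_vdc U2 A"
    and U2: "grothendieck_universe U2" and U1: "U1 \<in> elts U2"
  shows "large_two_cat U2 (ACat U1 A)"
proof -
  interpret enrichment A U1 by (simp add: enrichment_def A(1))
  have VOb: "set_in U2 (VOb A)" and VHom: "\<And>a b. a \<in> VOb A \<Longrightarrow> b \<in> VOb A \<Longrightarrow> set_in U2 (VHom A a b)"
    and HHom: "\<And>a b. a \<in> VOb A \<Longrightarrow> b \<in> VOb A \<Longrightarrow> set_in U2 (HHom A a b)"
    and MCell: "\<And>a \<Gamma>s \<Delta> u u'. is_bdry A a \<Gamma>s \<Delta> u u' \<Longrightarrow> set_in U2 (MCell A a \<Gamma>s \<Delta> u u')"
    using A(2) unfolding large_vdc_def by blast+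
  note Pi = set_in_Pi[OF U2] and Sigma = set_in_Sigma[OF U2]
  define B\<^sub>h where "B\<^sub>h X e = graphs X (\<lambda>c. graphs X (\<lambda>c'. HHom A (vapp e c) (vapp e c')))" for X e
  define H where "H e h c c' = HMor (vapp e c) (vapp (vapp h c) c') (vapp e c')" for e h c c' :: 'v
  define B\<^sub>n where "B\<^sub>n X e h = graphs X (\<lambda>c. MCell A (vapp e c) [] (H e h c c)
      (VId A (vapp e c)) (VId A (vapp e c)))" for X e h :: 'v
  define B\<^sub>m where "B\<^sub>m X e h = graphs X (\<lambda>c. graphs X (\<lambda>c'. graphs X (\<lambda>c''.
      MCell A (vapp e c) [H e h c c', H e h c' c''] (H e h c c'') (VId A (vapp e c)) (VId A (vapp e c'')))))"
    for X e h :: 'v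
  define S where "S = {vpair X r | X r. X \<in> elts U1 \<and> r \<in>
    {vpair e r | e r. e \<in> graphs X (\<lambda>_. VOb A) \<and> r \<in>
    {vpair h r | h r. h \<in> B\<^sub>h X e \<and> r \<in>
    {vpair n m | n m. n \<in> B\<^sub>n X e h \<and> m \<in> B\<^sub>m X e h}}}}"
  have "set_in U2 S"
    unfolding S_def
  proof (intro Sigma)
    show "set_in U2 (elts U1)" using U1 by (rule set_in_elts[OF U2])
    fix X assume X: "X \<in> elts U1"
    then have X2: "X \<in> elts U2" using universe_transitive[OF U2 U1] by blast
    show "set_in U2 (graphs X (\<lambda>_. VOb A))" by (rule Pi[OF X2 VOb])
    fix e assume e: "e \<in> graphs X (\<lambda>_. VOb A)"
    note e = graphsD[OF e]
    show "set_in U2 (B\<^sub>h X e)" unfolding B\<^sub>h_def by (intro Pi X2 HHom e)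
    fix h assume h: "h \<in> B\<^sub>h X e"
    have h: "is_hmor A (H e h c c')" if "c \<in> elts X" "c' \<in> elts X" for c c'
      using graphsD[OF graphsD[OF h[unfolded B\<^sub>h_def]]] that e by (simp add: H_def is_hmor_def)
    have H: "hsrc (H e h c c') = vapp e c" "htgt (H e h c c') = vapp e c'" for c c'
      by (simp_all add: H_def)
    show "set_in U2 (B\<^sub>n X e h)" unfolding B\<^sub>n_def
      by (intro Pi X2 MCell) (simp add: is_bdry_def h e vid H)
    show "set_in U2 (B\<^sub>m X e h)" unfolding B\<^sub>m_def
      by (intro Pi X2 MCell) (simp add: is_bdry_def h e vid H)
  qed
  moreover have "enr_cats U1 A \<subseteq> S"
  proof
    fix C assume C: "C \<in> enr_cats U1 A"
    obtain X e h n m where X: "X \<in> elts U1" and C': "C = mk_cat X e h n m"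
      using C by (auto simp: enr_cats_def)
    have hom: "c \<in> elts X \<Longrightarrow> c' \<in> elts X \<Longrightarrow> h c c' \<in> HHom A (e c) (e c')" for c c'
      using catD(2)[OF C, of c c'] by (simp add: C' is_hmor_def)
    let ?e = "vlam (elts X) e" and ?h = "vlam (elts X) (\<lambda>c. vlam (elts X) (h c))"
    have "?e \<in> graphs X (\<lambda>_. VOb A)"
      using catD(1)[OF C] by (intro vlam_in_graphs) (simp add: C')
    moreover have "?h \<in> B\<^sub>h X ?e"
      using hom unfolding B\<^sub>h_def by (intro vlam_in_graphs) simp
    moreover have "vlam (elts X) n \<in> B\<^sub>n X ?e ?h"
      using catD(3)[OF C] unfolding B\<^sub>n_def by (intro vlam_in_graphs) (simp add: C' H_def)
    moreover have "vlam (elts X) (\<lambda>c. vlam (elts X) (\<lambda>c'. vlam (elts X) (m c c'))) \<in> B\<^sub>m X ?e ?h"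
      using catD(4)[OF C] unfolding B\<^sub>m_def by (intro vlam_in_graphs) (simp add: C' H_def)
    ultimately show "C \<in> S"
      unfolding S_def C' mk_cat_def using X by blast
  qed
  ultimately have Ob: "set_in U2 (enr_cats U1 A)" by (rule set_in_subset[OF U2])
  have obset: "cat_obset C \<in> elts U2" if "C \<in> enr_cats U1 A" for C
    using that universe_transitive[OF U2 U1] by (auto simp: enr_cats_def)
  have Hom1: "set_in U2 (enr_funs A C D)" if C: "C \<in> enr_cats U1 A" and D: "D \<in> enr_cats U1 A" for C D
  proof -
    let ?X = "cat_obset C"
    define S where "S = {vpair p r | p r. p \<in> graphs ?X (\<lambda>_. cat_ob D) \<and> r \<in>
      {vpair v w | v w. v \<in> graphs ?X (\<lambda>c. VHom A (ext C c) (ext D (vapp p c))) \<and>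
       w \<in> graphs ?X (\<lambda>c. graphs ?X (\<lambda>c'. MCell A (ext C c) [chom C c c']
         (chom D (vapp p c) (vapp p c')) (vapp v c) (vapp v c')))}}"
    have "set_in U2 S"
      unfolding S_def
    proof (intro Sigma Pi obset C set_in_elts[OF U2] D)
      fix p c assume p: "p \<in> graphs ?X (\<lambda>_. cat_ob D)" and c: "c \<in> cat_ob C"
      show "set_in U2 (VHom A (ext C c) (ext D (vapp p c)))"
        by (intro VHom catD(1)[OF C] catD(1)[OF D] graphsD[OF p] c)
      fix v c' assume v: "v \<in> graphs ?X (\<lambda>c. VHom A (ext C c) (ext D (vapp p c)))" and c': "c' \<in> cat_ob C"
      show "set_in U2 (MCell A (ext C c) [chom C c c'] (chom D (vapp p c) (vapp p c')) (vapp v c) (vapp v c'))"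
        using graphsD[OF p] graphsD[OF v] c c' catD[OF C] catD[OF D]
        by (intro MCell) (simp add: is_bdry_def)
    qed
    moreover have "enr_funs A C D \<subseteq> S"
    proof
      fix f assume f: "f \<in> enr_funs A C D"
      obtain fo fv fw where f': "f = mk_fun ?X fo fv fw" using fun_mk_fun(3)[OF f] by blast
      have "vlam (elts ?X) fo \<in> graphs ?X (\<lambda>_. cat_ob D)"
        using funD(1)[OF C D f] by (intro vlam_in_graphs) (simp add: f')
      moreover have "vlam (elts ?X) fv \<in> graphs ?X (\<lambda>c. VHom A (ext C c) (ext D (vapp (vlam (elts ?X) fo) c)))"
        using funD(2)[OF C D f] by (intro vlam_in_graphs) (simp add: f')
      moreover have "vlam (elts ?X) (\<lambda>c. vlam (elts ?X) (\<lambda>c'. fw c c')) \<in> graphs ?X (\<lambda>c. graphs ?X (\<lambda>c'.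
          MCell A (ext C c) [chom C c c'] (chom D (vapp (vlam (elts ?X) fo) c) (vapp (vlam (elts ?X) fo) c'))
          (vapp (vlam (elts ?X) fv) c) (vapp (vlam (elts ?X) fv) c')))"
        using is_elemD(12)[OF funD(3)[OF C D f]] by (intro vlam_in_graphs) (simp add: f')
      ultimately show "f \<in> S" unfolding S_def f' mk_fun_def by blast
    qed
    ultimately show ?thesis by (rule set_in_subset[OF U2])
  qed
  have Hom2: "set_in U2 (enr_nats A C D f f')" if C: "C \<in> enr_cats U1 A" and D: "D \<in> enr_cats U1 A"
    and f: "f \<in> enr_funs A C D" "f' \<in> enr_funs A C D" for C D f f'
  proof (rule set_in_subset[OF U2 Pi[OF obset[OF C]]])
    fix c assume c: "c \<in> cat_ob C"
    show "set_in U2 (MCell A (ext C c) [] (chom D (fun_ob f c) (fun_ob f' c)) (fun_vert f c) (fun_vert f' c))"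
      using c funD[OF C D f(1)] funD[OF C D f(2)] catD[OF C] catD[OF D] by (intro MCell) (simp add: is_bdry_def)
  next
    show "enr_nats A C D f f' \<subseteq> graphs (cat_obset C) (\<lambda>c. MCell A (ext C c) []
      (chom D (fun_ob f c) (fun_ob f' c)) (fun_vert f c) (fun_vert f' c))"
      unfolding enr_nats_def by auto
  qed
  show ?thesis unfolding large_two_cat_def ACat_sel using Ob Hom1 Hom2 by blast
qed

section \<open>Change of enrichment along virtual double functors\<close>

lemma hmap_HMor [simp]: "hmap G (HMor a h b) = HMor (Go G a) (GH G a b h) (Go G b)"
  by (simp add: hmap_def)

lemma push_cat_sel [simp]:
  "cat_obset (push_cat A G C) = cat_obset C"
  "c \<in> cat_ob C \<Longrightarrow> ext (push_cat A G C) c = Go G (ext C c)"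
  "c \<in> cat_ob C \<Longrightarrow> c' \<in> cat_ob C \<Longrightarrow>
    cat_hom (push_cat A G C) c c' = GH G (ext C c) (ext C c') (cat_hom C c c')"
  "c \<in> cat_ob C \<Longrightarrow> cat_unit (push_cat A G C) c
    = GM G (ext C c) [] (chom C c c) (VId A (ext C c)) (VId A (ext C c)) (cat_unit C c)"
  "c \<in> cat_ob C \<Longrightarrow> c' \<in> cat_ob C \<Longrightarrow> c'' \<in> cat_ob C \<Longrightarrow> cat_mult (push_cat A G C) c c' c''
    = GM G (ext C c) [chom C c c', chom C c' c''] (chom C c c'')
        (VId A (ext C c)) (VId A (ext C c'')) (cat_mult C c c' c'')"
  by (simp_all add: push_cat_def)

lemma push_fun_sel [simp]:
  "c \<in> cat_ob C \<Longrightarrow> fun_ob (push_fun G C D f) c = fun_ob f c"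
  "c \<in> cat_ob C \<Longrightarrow> fun_vert (push_fun G C D f) c = GV G (ext C c) (ext D (fun_ob f c)) (fun_vert f c)"
  "c \<in> cat_ob C \<Longrightarrow> c' \<in> cat_ob C \<Longrightarrow> fun_cell (push_fun G C D f) c c'
    = GM G (ext C c) [chom C c c'] (chom D (fun_ob f c) (fun_ob f c'))
        (fun_vert f c) (fun_vert f c') (fun_cell f c c')"
  by (simp_all add: push_fun_def)

lemma push_nat_sel [simp]:
  "c \<in> cat_ob C \<Longrightarrow> vapp (push_nat G C D f f' \<alpha>) c
    = GM G (ext C c) [] (chom D (fun_ob f c) (fun_ob f' c)) (fun_vert f c) (fun_vert f' c) (vapp \<alpha> c)"
  by (simp add: push_nat_def)

lemma push_mk:
  "\<exists>e h n m. push_cat A G C = mk_cat (cat_obset C) e h n m"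
  "\<exists>fo fv fw. push_fun G C D f = mk_fun (cat_obset C) fo fv fw"
  "\<exists>t. push_nat G C D f f' \<alpha> = vlam (cat_ob C) t"
  unfolding push_cat_def push_fun_def push_nat_def by blast+

text \<open>In terms of \<open>uelem\<close>, \<open>melem\<close> and \<open>ielem\<close> the axioms of an enriched category are equations between
  products. This makes their preservation under change of base a consequence of \<open>epush_emul\<close>.\<close>

definition uelem :: "'v::zf vdcv \<Rightarrow> 'v \<Rightarrow> 'v \<Rightarrow> 'v elem" where
  "uelem A C c = Elem (ext C c) [] c c (VId A (ext C c)) (VId A (ext C c)) (cat_unit C c)"

definition melem :: "'v::zf vdcv \<Rightarrow> 'v \<Rightarrow> 'v \<Rightarrow> 'v \<Rightarrow> 'v \<Rightarrow> 'v elem" where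
  "melem A C c c' c'' = Elem (ext C c) [chom C c c', chom C c' c''] c c'' (VId A (ext C c)) (VId A (ext C c''))
     (cat_mult C c c' c'')"

lemma uelem_sel [simp]: "estart (uelem A C c) = ext C c" "epath (uelem A C c) = []"
  "esrc (uelem A C c) = c" "etgt (uelem A C c) = c"
  "eleft (uelem A C c) = VId A (ext C c)" "eright (uelem A C c) = VId A (ext C c)"
  "ecell (uelem A C c) = cat_unit C c"
  by (simp_all add: uelem_def)

lemma melem_sel [simp]: "estart (melem A C c c' c'') = ext C c"
  "epath (melem A C c c' c'') = [chom C c c', chom C c' c'']"
  "esrc (melem A C c c' c'') = c" "etgt (melem A C c c' c'') = c''"
  "eleft (melem A C c c' c'') = VId A (ext C c)" "eright (melem A C c c' c'') = VId A (ext C c'')"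
  "ecell (melem A C c c' c'') = cat_mult C c c' c''"
  by (simp_all add: melem_def)

lemma enr_cats_iff:
  "C \<in> enr_cats U A \<longleftrightarrow> (\<exists>X \<in> elts U. \<exists>e h n m. C = mk_cat X e h n m) \<and>
     (\<forall>c \<in> cat_ob C. ext C c \<in> VOb A) \<and>
     (\<forall>c \<in> cat_ob C. \<forall>c' \<in> cat_ob C. cat_hom C c c' \<in> HHom A (ext C c) (ext C c')) \<and>
     (\<forall>c \<in> cat_ob C. cat_unit C c \<in>
        MCell A (ext C c) [] (chom C c c) (VId A (ext C c)) (VId A (ext C c))) \<and>
     (\<forall>c\<^sub>0 \<in> cat_ob C. \<forall>c\<^sub>1 \<in> cat_ob C. \<forall>c\<^sub>2 \<in> cat_ob C. cat_mult C c\<^sub>0 c\<^sub>1 c\<^sub>2 \<in>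
        MCell A (ext C c\<^sub>0) [chom C c\<^sub>0 c\<^sub>1, chom C c\<^sub>1 c\<^sub>2] (chom C c\<^sub>0 c\<^sub>2)
          (VId A (ext C c\<^sub>0)) (VId A (ext C c\<^sub>2))) \<and>
     (\<forall>c \<in> cat_ob C. \<forall>c' \<in> cat_ob C. emul A C (uelem A C c) (ielem A C c c') = ielem A C c c') \<and>
     (\<forall>c \<in> cat_ob C. \<forall>c' \<in> cat_ob C. emul A C (ielem A C c c') (uelem A C c') = ielem A C c c') \<and>
     (\<forall>c\<^sub>0 \<in> cat_ob C. \<forall>c\<^sub>1 \<in> cat_ob C. \<forall>c\<^sub>2 \<in> cat_ob C. \<forall>c\<^sub>3 \<in> cat_ob C.
        emul A C (melem A C c\<^sub>0 c\<^sub>1 c\<^sub>2) (ielem A C c\<^sub>2 c\<^sub>3) = emul A C (ielem A C c\<^sub>0 c\<^sub>1) (melem A C c\<^sub>1 c\<^sub>2 c\<^sub>3))"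
  unfolding enr_cats_def mem_Collect_eq
  by (simp add: emul_def uelem_def melem_def ielem_def eblock_def)

context enrichment
begin

lemma uelem_elem: "C \<in> enr_cats U A \<Longrightarrow> c \<in> cat_ob C \<Longrightarrow> is_elem A C (uelem A C c)"
  using catD[of C] is_bdry_id[of C c c "[]"] by (simp add: is_elem_def)

lemma melem_elem: "C \<in> enr_cats U A \<Longrightarrow> c \<in> cat_ob C \<Longrightarrow> c' \<in> cat_ob C \<Longrightarrow> c'' \<in> cat_ob C \<Longrightarrow>
    is_elem A C (melem A C c c' c'')"
  using catD[of C] is_bdry_id[of C c c'' "[chom C c c', chom C c' c'']"] by (simp add: is_elem_def)

end

text \<open>Transport of generalised elements along a virtual double functor.\<close>

definition epush :: "'v::zf vd_funv \<Rightarrow> 'v \<Rightarrow> 'v elem \<Rightarrow> 'v elem" where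
  "epush G D x = Elem (Go G (estart x)) (map (hmap G) (epath x)) (esrc x) (etgt x)
     (GV G (estart x) (ext D (esrc x)) (eleft x)) (GV G (eend x) (ext D (etgt x)) (eright x))
     (GM G (estart x) (epath x) (chom D (esrc x) (etgt x)) (eleft x) (eright x) (ecell x))"

lemma epush_sel [simp]: "estart (epush G D x) = Go G (estart x)"
  "epath (epush G D x) = map (hmap G) (epath x)" "esrc (epush G D x) = esrc x" "etgt (epush G D x) = etgt x"
  "eleft (epush G D x) = GV G (estart x) (ext D (esrc x)) (eleft x)"
  "eright (epush G D x) = GV G (eend x) (ext D (etgt x)) (eright x)"
  by (simp_all add: epush_def)

abbreviation Push :: "'v::zf \<Rightarrow> 'v vdcv \<Rightarrow> 'v vd_funv \<Rightarrow> ('v, 'v, 'v, 'v, 'v, 'v) two_fun" where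
  "Push U A G \<equiv> mk_two_fun (ACat U A) (push_cat A G) (push_fun G) (push_nat G)"

locale enr_push = A: enrichment A U + B: enrichment B U + virtual_double_functor A B G
  for A B :: "'v::zf vdcv" and U :: 'v and G :: "'v vd_funv"
begin

lemma epush_elem: "is_elem A D x \<Longrightarrow> is_elem B (push_cat A G D) (epush G D x)"
  using gm[OF is_elemD(11,12), of D x] bdry[OF is_elemD(11), of D x]
  by (simp add: is_elem_def epush_def)

lemma map_row_eblock: "is_elem A D x \<Longrightarrow>
    map_row G (estart x) (eleft x) [eblock D x] = [eblock (push_cat A G D) (epush G D x)]"
  by (simp add: eblock_def epush_def is_elemD)

lemma epush_emul:
  assumes D: "D \<in> enr_cats U A" and x: "is_elem A D x" and y: "is_elem A D y" and xy: "follows x y"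
  shows "epush G D (emul A D x y) = emul B (push_cat A G D) (epush G D x) (epush G D y)"
proof -
  note [simp] = A.catD[OF D] is_elemD[OF x] is_elemD[OF y] A.vid A.vcmp_id_left gv_id
  have xy': "estart y = eend x" "esrc y = etgt x" "eleft y = eright x"
    using xy by (simp_all add: follows_def)
  have r: "row A (estart x) (ext D (esrc x)) (eleft x) [eblock D x, eblock D y]"
    using is_elemD[OF y] by (simp add: xy')
  have b: "is_bdry A (ext D (esrc x)) (bots [eblock D x, eblock D y])
      (chom D (esrc x) (etgt y)) (VId A (ext D (esrc x))) (VId A (ext D (etgt y)))"
    using is_elemD[OF y] by (intro A.is_bdry_id D) (simp_all add: xy')
  show ?thesis
    using gm_cmp[OF r b, of "cat_mult D (esrc x) (etgt x) (etgt y)"] is_elemD[OF y, unfolded xy']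
    by (intro elem_eqI) (simp_all add: epush_def emul_def xy' eblock_def)
qed

lemma epush_eunit:
  assumes D: "D \<in> enr_cats U A" and d: "a \<in> VOb A" "d \<in> cat_ob D" "u \<in> VHom A a (ext D d)"
  shows "epush G D (eunit A D a d u) = eunit B (push_cat A G D) (Go G a) d (GV G a (ext D d) u)"
  using gm_cmp[of a "ext D d" u "[]" "chom D d d" "VId A (ext D d)" "VId A (ext D d)" "cat_unit D d"]
    A.is_bdry_id[OF D d(2) d(2), of "[]"] d A.catD[OF D]
  by (intro elem_eqI) (simp_all add: epush_def eunit_def A.vid A.vcmp_id_left gv_id)

lemma epush_uelem: "D \<in> enr_cats U A \<Longrightarrow> d \<in> cat_ob D \<Longrightarrow>
    epush G D (uelem A D d) = uelem B (push_cat A G D) d"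
  by (intro elem_eqI) (simp_all add: epush_def A.catD gv_id)

lemma epush_melem: "D \<in> enr_cats U A \<Longrightarrow> d \<in> cat_ob D \<Longrightarrow> d' \<in> cat_ob D \<Longrightarrow> d'' \<in> cat_ob D \<Longrightarrow>
    epush G D (melem A D d d' d'') = melem B (push_cat A G D) d d' d''"
  by (intro elem_eqI) (simp_all add: epush_def A.catD gv_id)

lemma epush_ielem: "D \<in> enr_cats U A \<Longrightarrow> d \<in> cat_ob D \<Longrightarrow> d' \<in> cat_ob D \<Longrightarrow>
    epush G D (ielem A D d d') = ielem B (push_cat A G D) d d'"
  using gm_id[OF A.catD(2), of D d d']
  by (intro elem_eqI) (simp_all add: epush_def ielem_def A.catD gv_id)

lemma epush_ecmp:
  assumes x: "is_elem A D x" and r: "row A a (estart x) u bs" and b: "bots bs = epath x"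
  shows "epush G D (ecmp A D x a u bs)
    = ecmp B (push_cat A G D) (epush G D x) (Go G a) (GV G a (estart x) u) (map_row G a u bs)"
  using gm_cmp[OF r, of "chom D (esrc x) (etgt x)" "eleft x" "eright x" "ecell x"] is_elemD[OF x]
    row_start[OF r] row_paths[OF r] hpath_hend[OF conjunct1[OF row_paths[OF r]]]
  by (intro elem_eqI) (auto simp: epush_def ecmp_def b gv_cmp rvert_map_row[OF r])

text \<open>Transport preserves products of generalised elements and sends the structural elements of \<open>D\<close> to those of
  its change of base.\<close>

lemma push_cat:
  assumes D: "D \<in> enr_cats U A"
  shows "push_cat A G D \<in> enr_cats U B"
proof -
  note [simp] = A.catD[OF D] A.vid gv_id go
  note axioms = D[unfolded enr_cats_iff]
  let ?D = "push_cat A G D"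
  have 1: "emul B ?D (uelem B ?D c) (ielem B ?D c c') = ielem B ?D c c'"
    if "c \<in> cat_ob D" "c' \<in> cat_ob D" for c c'
    using that axioms
    by (simp add: epush_emul[OF D, symmetric] epush_uelem[OF D, symmetric] epush_ielem[OF D, symmetric]
        A.uelem_elem[OF D] A.ielem_elem[OF D] follows_def)
  have 2: "emul B ?D (ielem B ?D c c') (uelem B ?D c') = ielem B ?D c c'"
    if "c \<in> cat_ob D" "c' \<in> cat_ob D" for c c'
    using that axioms
    by (simp add: epush_emul[OF D, symmetric] epush_uelem[OF D, symmetric] epush_ielem[OF D, symmetric]
        A.uelem_elem[OF D] A.ielem_elem[OF D] follows_def)
  have 3: "emul B ?D (melem B ?D c\<^sub>0 c\<^sub>1 c\<^sub>2) (ielem B ?D c\<^sub>2 c\<^sub>3) = emul B ?D (ielem B ?D c\<^sub>0 c\<^sub>1) (melem B ?D c\<^sub>1 c\<^sub>2 c\<^sub>3)"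
    if "c\<^sub>0 \<in> cat_ob D" "c\<^sub>1 \<in> cat_ob D" "c\<^sub>2 \<in> cat_ob D" "c\<^sub>3 \<in> cat_ob D" for c\<^sub>0 c\<^sub>1 c\<^sub>2 c\<^sub>3
    using that axioms
    by (simp add: epush_emul[OF D, symmetric] epush_melem[OF D, symmetric] epush_ielem[OF D, symmetric]
        A.melem_elem[OF D] A.ielem_elem[OF D] follows_def)
  have "is_hmor A (chom D c c')" if "c \<in> cat_ob D" "c' \<in> cat_ob D" for c c' using that by simp
  then have 4: "GH G (ext D c) (ext D c') (cat_hom D c c') \<in> HHom B (Go G (ext D c)) (Go G (ext D c'))"
    if "c \<in> cat_ob D" "c' \<in> cat_ob D" for c c'
    using that by (intro gh) (auto simp: is_hmor_def)
  have 5: "\<exists>X \<in> elts U. \<exists>e h n m. ?D = mk_cat X e h n m"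
  proof -
    have "cat_obset D \<in> elts U" using axioms by auto
    then show ?thesis using push_mk(1)[of A G D] by blast
  qed
  have 6: "cat_unit ?D c \<in> MCell B (Go G (ext D c)) [] (hmap G (chom D c c)) (VId B (Go G (ext D c))) (VId B (Go G (ext D c)))"
    if "c \<in> cat_ob D" for c
    using is_elemD(12)[OF epush_elem[OF A.uelem_elem[OF D that]]] that by (simp add: epush_uelem[OF D])
  have 7: "cat_mult ?D c c' c'' \<in> MCell B (Go G (ext D c)) [hmap G (chom D c c'), hmap G (chom D c' c'')]
      (hmap G (chom D c c'')) (VId B (Go G (ext D c))) (VId B (Go G (ext D c'')))"
    if "c \<in> cat_ob D" "c' \<in> cat_ob D" "c'' \<in> cat_ob D" for c c' c''
    using is_elemD(12)[OF epush_elem[OF A.melem_elem[OF D that]]] that by (simp add: epush_melem[OF D])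
  show ?thesis
    unfolding enr_cats_iff[of ?D]
    using 1 2 3 4 5 6 7 by (simp del: push_cat_sel(4,5))
qed

lemma felem_push:
  "c \<in> cat_ob C \<Longrightarrow> c' \<in> cat_ob C \<Longrightarrow>
    felem (push_cat A G C) (push_fun G C D f) c c' = epush G D (felem C f c c')"
  by (intro elem_eqI) (simp_all add: epush_def)

lemma nelem_push:
  "c \<in> cat_ob C \<Longrightarrow> nelem (push_cat A G C) (push_fun G C D f) (push_fun G C D f') (push_nat G C D f f' \<alpha>) c
    = epush G D (nelem C f f' \<alpha> c)"
  by (intro elem_eqI) (simp_all add: epush_def)

lemma epush_eapp:
  assumes C: "C \<in> enr_cats U A" and D: "D \<in> enr_cats U A" and f: "f \<in> enr_funs A C D"
    and x: "is_elem A C x"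
  shows "epush G D (eapp A C D f x)
    = eapp B (push_cat A G C) (push_cat A G D) (push_fun G C D f) (epush G C x)"
  using is_elemD[OF x] A.funD[OF C D f] A.catD[OF C]
  by (simp add: eapp_def epush_ecmp map_row_eblock[OF x] felem_push del: map_row_simps)

text \<open>Transport commutes with the action of functors (\<open>epush_eapp\<close>), so the equations that characterise
  enriched functors are preserved.\<close>

lemma push_fun:
  assumes C: "C \<in> enr_cats U A" and D: "D \<in> enr_cats U A" and f: "f \<in> enr_funs A C D"
  shows "push_fun G C D f \<in> enr_funs B (push_cat A G C) (push_cat A G D)"
proof -
  note [simp] = A.catD[OF C] A.catD[OF D] A.funD(1,2,3)[OF C D f] gv gv_id[symmetric] A.vid
    epush_eunit[OF C, symmetric] epush_eunit[OF D, symmetric] epush_ielem[OF C, symmetric]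
    A.ielem_elem[OF C] A.eunit_elem[OF C] A.emul_elem[OF C] felem_push epush_elem
  show ?thesis
    unfolding B.enr_funs_iff[OF push_cat[OF C] push_cat[OF D]]
    by (simp add: push_mk epush_eapp[OF C D f, symmetric] epush_emul[OF C, symmetric]
        epush_emul[OF D, symmetric] A.funD(4,5)[OF C D f] follows_def)
qed

lemma push_nat:
  assumes C: "C \<in> enr_cats U A" and D: "D \<in> enr_cats U A" and f: "f \<in> enr_funs A C D" "f' \<in> enr_funs A C D"
    and \<alpha>: "\<alpha> \<in> enr_nats A C D f f'"
  shows "push_nat G C D f f' \<alpha> \<in> enr_nats B (push_cat A G C) (push_cat A G D) (push_fun G C D f) (push_fun G C D f')"
  unfolding B.enr_nats_iff[OF push_cat[OF C] push_cat[OF D] push_fun[OF C D f(1)] push_fun[OF C D f(2)]]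
  using A.natD[OF C D f \<alpha>] A.funD[OF C D f(1)] A.funD[OF C D f(2)]
  by (simp add: push_mk nelem_push felem_push epush_elem epush_emul[OF D, symmetric] follows_def)

lemma push_id_fun: 
  assumes C: "C \<in> enr_cats U A"
  shows "push_fun G C C (id_fun A C) = id_fun B (push_cat A G C)"
proof (rule enr_fun_eqI[where X = "cat_obset C"])
  fix c c' assume c: "c \<in> cat_ob C" "c' \<in> cat_ob C"
  show "fun_cell (push_fun G C C (id_fun A C)) c c' = fun_cell (id_fun B (push_cat A G C)) c c'"
    using c gm_id[OF A.catD(2)[OF C c]] by simp
qed (use A.catD[OF C] push_mk(2) fun_mk_fun(1)[of B "push_cat A G C"] in \<open>simp_all add: gv_id\<close>)

lemma push_cmp_fun:
  assumes C: "C \<in> enr_cats U A" and D: "D \<in> enr_cats U A" and E: "E \<in> enr_cats U A"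
    and f: "f \<in> enr_funs A C D" and g: "g \<in> enr_funs A D E"
  shows "push_fun G C E (cmp_fun A C D E g f)
    = cmp_fun B (push_cat A G C) (push_cat A G D) (push_cat A G E) (push_fun G D E g) (push_fun G C D f)"
proof (rule enr_fun_eqI[where X = "cat_obset C"])
  note [simp] = A.catD[OF C] A.catD[OF D] A.catD[OF E] A.funD(1,2,3)[OF C D f] A.funD(1,2,3)[OF D E g]
  fix c c' assume c: "c \<in> cat_ob C" "c' \<in> cat_ob C"
  show "fun_vert (push_fun G C E (cmp_fun A C D E g f)) c
    = fun_vert (cmp_fun B (push_cat A G C) (push_cat A G D) (push_cat A G E) (push_fun G D E g) (push_fun G C D f)) c"
    using c by (simp add: gv_cmp)
  have "felem (push_cat A G C) (push_fun G C E (cmp_fun A C D E g f)) c c'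
    = felem (push_cat A G C) (cmp_fun B (push_cat A G C) (push_cat A G D) (push_cat A G E) (push_fun G D E g) (push_fun G C D f)) c c'"
    using c by (simp add: felem_cmp felem_push epush_eapp[OF D E g, symmetric])
  from arg_cong[OF this, of ecell]
  show "fun_cell (push_fun G C E (cmp_fun A C D E g f)) c c'
    = fun_cell (cmp_fun B (push_cat A G C) (push_cat A G D) (push_cat A G E) (push_fun G D E g) (push_fun G C D f)) c c'"
    by (simp only: felem_sel)
qed (use A.funD[OF C D f] push_mk(2) fun_mk_fun(2)[of B "push_cat A G C"] in simp_all)

lemma two_functor_Push: "two_functor (ACat U A) (ACat U B) (Push U A G)"
proof (unfold_locales; (unfold ACat_sel)?)
  let ?H = "Push U A G"
  fix C D f f' f'' \<alpha> \<beta>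
  assume C: "C \<in> enr_cats U A" and D: "D \<in> enr_cats U A" and f: "f \<in> enr_funs A C D"
  note PC = push_cat[OF C] and PD = push_cat[OF D]
  note [simp] = C D f A.funD(1,2,3)[OF C D f] A.catD[OF C] A.catD[OF D] push_mk nat_vlam
    nat_vlam[where C = "push_cat A G C", unfolded push_cat_sel(1)]
  show "F2 ?H C D f f (id_nat A C D f) = id_nat B (Fo ?H C) (Fo ?H D) (F1 ?H C D f)"
    by (simp add: A.id_nat)
      (rule nat_eqI[where C = "push_cat A G C" and f = "push_fun G C D f" and f' = "push_fun G C D f"];
        simp add: nelem_push nelem_id epush_eunit[OF D])
  assume f': "f' \<in> enr_funs A C D" and \<alpha>: "\<alpha> \<in> enr_nats A C D f f'"
  note [simp] = f' \<alpha> A.funD(1,2,3)[OF C D f'] A.natD(1)[OF C D f f' \<alpha>]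
  {
    assume f'': "f'' \<in> enr_funs A C D" and \<beta>: "\<beta> \<in> enr_nats A C D f' f''"
    note [simp] = A.natD(1)[OF C D f' f'' \<beta>]
    show "F2 ?H C D f f'' (vcmp_nat A C D f f' f'' \<beta> \<alpha>)
      = vcmp_nat B (Fo ?H C) (Fo ?H D) (F1 ?H C D f) (F1 ?H C D f') (F1 ?H C D f'')
          (F2 ?H C D f' f'' \<beta>) (F2 ?H C D f f' \<alpha>)"
      using f'' \<beta> A.vcmp_nat[OF C D f f' f'' \<alpha> \<beta>]
      by (simp, rule_tac nat_eqI[where C = "push_cat A G C" and f = "push_fun G C D f" and f' = "push_fun G C D f''"];
          simp add: nelem_push nelem_vcmp epush_emul[OF D] follows_def)
  next
    fix E g g' \<beta> assume E: "E \<in> enr_cats U A" and g: "g \<in> enr_funs A D E" "g' \<in> enr_funs A D E"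
      and \<beta>: "\<beta> \<in> enr_nats A D E g g'"
    note hc = two_category.hc[OF A.two_category_ACat, of C D E f f' g g' \<alpha> \<beta>, unfolded ACat_sel, OF C D E f f' g \<alpha> \<beta>]
    note [simp] = g \<beta> E A.cmp_fun[OF C D E f g(1)] A.cmp_fun[OF C D E f' g(1)] A.cmp_fun[OF C D E f g(2)]
      A.cmp_fun[OF C D E f' g(2)] hc A.natD(1)[OF D E g \<beta>] A.funD(1,2,3)[OF D E g(1)] A.funD(1,2,3)[OF D E g(2)] A.catD[OF E]
    note pc = push_cmp_fun[OF C D E]
    show "F2 ?H C E (cmp_fun A C D E g f) (cmp_fun A C D E g' f')
          (vcmp_nat A C E (cmp_fun A C D E g f) (cmp_fun A C D E g f') (cmp_fun A C D E g' f')
            (rwhisker A C D E f' g g' \<beta>) (lwhisker A C D E f f' g \<alpha>))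
      = vcmp_nat B (Fo ?H C) (Fo ?H E)
         (cmp_fun B (Fo ?H C) (Fo ?H D) (Fo ?H E) (F1 ?H D E g) (F1 ?H C D f))
         (cmp_fun B (Fo ?H C) (Fo ?H D) (Fo ?H E) (F1 ?H D E g) (F1 ?H C D f'))
         (cmp_fun B (Fo ?H C) (Fo ?H D) (Fo ?H E) (F1 ?H D E g') (F1 ?H C D f'))
         (rwhisker B (Fo ?H C) (Fo ?H D) (Fo ?H E) (F1 ?H C D f') (F1 ?H D E g) (F1 ?H D E g') (F2 ?H D E g g' \<beta>))
         (lwhisker B (Fo ?H C) (Fo ?H D) (Fo ?H E) (F1 ?H C D f) (F1 ?H C D f') (F1 ?H D E g) (F2 ?H C D f f' \<alpha>))"
    proof (simp, rule nat_eqI[where C = "push_cat A G C" and f = "push_fun G C E (cmp_fun A C D E g f)"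
          and f' = "push_fun G C E (cmp_fun A C D E g' f')"])
      fix c assume c: "c \<in> cat_ob (push_cat A G C)"
      then have [simp]: "c \<in> cat_ob C" by simp
      let ?rw = "nelem (push_cat A G C) (push_fun G C E (cmp_fun A C D E g f')) (push_fun G C E (cmp_fun A C D E g' f'))"
      let ?lw = "nelem (push_cat A G C) (push_fun G C E (cmp_fun A C D E g f)) (push_fun G C E (cmp_fun A C D E g f'))"
      have lw: "?lw (lwhisker B (push_cat A G C) (push_cat A G D) (push_cat A G E)
            (push_fun G C D f) (push_fun G C D f') (push_fun G D E g) (push_nat G C D f f' \<alpha>)) c
          = epush G E (eapp A D E g (nelem C f f' \<alpha> c))"
        using c nelem_lwhisker[OF c, of B "push_cat A G D" "push_cat A G E" "push_fun G D E g"
            "push_fun G C D f" "push_fun G C D f'" "push_nat G C D f f' \<alpha>"]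
        by (simp add: pc[OF f g(1)] pc[OF f' g(1)] nelem_push epush_eapp[OF D E g(1)])
      have rw: "?rw (rwhisker B (push_cat A G C) (push_cat A G D) (push_cat A G E)
            (push_fun G C D f') (push_fun G D E g) (push_fun G D E g') (push_nat G D E g g' \<beta>)) c
          = epush G E (ecmp A E (nelem D g g' \<beta> (fun_ob f' c)) (ext C c) (fun_vert f' c) [])"
        using c nelem_rwhisker[OF c, of B "push_cat A G D" "push_cat A G E" "push_fun G D E g"
            "push_fun G C D f'" "push_fun G D E g'" "push_nat G D E g g' \<beta>"]
        by (simp add: pc[OF f' g(1)] pc[OF f' g(2)] nelem_push epush_ecmp)
      show "nelem (push_cat A G C) (push_fun G C E (cmp_fun A C D E g f)) (push_fun G C E (cmp_fun A C D E g' f'))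
          (push_nat G C E (cmp_fun A C D E g f) (cmp_fun A C D E g' f')
            (vcmp_nat A C E (cmp_fun A C D E g f) (cmp_fun A C D E g f') (cmp_fun A C D E g' f')
              (rwhisker A C D E f' g g' \<beta>) (lwhisker A C D E f f' g \<alpha>))) c
        = nelem (push_cat A G C) (push_fun G C E (cmp_fun A C D E g f)) (push_fun G C E (cmp_fun A C D E g' f'))
          (vcmp_nat B (push_cat A G C) (push_cat A G E)
           (cmp_fun B (push_cat A G C) (push_cat A G D) (push_cat A G E) (push_fun G D E g) (push_fun G C D f))
           (cmp_fun B (push_cat A G C) (push_cat A G D) (push_cat A G E) (push_fun G D E g) (push_fun G C D f'))
           (cmp_fun B (push_cat A G C) (push_cat A G D) (push_cat A G E) (push_fun G D E g') (push_fun G C D f'))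
           (rwhisker B (push_cat A G C) (push_cat A G D) (push_cat A G E) (push_fun G C D f') (push_fun G D E g)
             (push_fun G D E g') (push_nat G D E g g' \<beta>))
           (lwhisker B (push_cat A G C) (push_cat A G D) (push_cat A G E) (push_fun G C D f) (push_fun G C D f')
             (push_fun G D E g) (push_nat G C D f f' \<alpha>))) c"
        unfolding pc[OF f g(1), symmetric] pc[OF f' g(1), symmetric] pc[OF f' g(2), symmetric]
          nelem_vcmp[OF c] lw rw
        by (simp add: nelem_push nelem_vcmp nelem_lwhisker nelem_rwhisker
            epush_emul[OF E, symmetric] A.eapp_elem[OF D E g(1)] A.ecmp_elem follows_def)
    qed simp_all
  }
qed (simp_all add: push_cat push_fun push_nat A.id_fun A.cmp_fun push_id_fun push_cmp_fun)

end

section \<open>Enrichment as a 2-functor\<close>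

text \<open>The component at \<open>C\<close> of the 2-natural transformation between changes of base that \<open>\<sigma>\<close> induces.\<close>

definition trans_fun :: "'v::zf vtransv \<Rightarrow> 'v \<Rightarrow> 'v" where
  "trans_fun \<sigma> C = mk_fun (cat_obset C) (\<lambda>c. c) (\<lambda>c. TV \<sigma> (ext C c)) (\<lambda>c c'. TC \<sigma> (chom C c c'))"

lemma trans_fun_sel [simp]:
  "c \<in> cat_ob C \<Longrightarrow> fun_ob (trans_fun \<sigma> C) c = c"
  "c \<in> cat_ob C \<Longrightarrow> fun_vert (trans_fun \<sigma> C) c = TV \<sigma> (ext C c)"
  "c \<in> cat_ob C \<Longrightarrow> c' \<in> cat_ob C \<Longrightarrow> fun_cell (trans_fun \<sigma> C) c c' = TC \<sigma> (chom C c c')"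
  "fun_obmap (trans_fun \<sigma> C) = vlam (cat_ob C) (\<lambda>c. c)"
  by (simp_all add: trans_fun_def)

lemma trans_fun_mk: "\<exists>fo fv fw. trans_fun \<sigma> C = mk_fun (cat_obset C) fo fv fw"
  unfolding trans_fun_def by blast

locale enr_trans = F: enr_push A B U F + G: enr_push A B U G + vertical_transformation A B F G \<sigma>
  for A B :: "'v::zf vdcv" and U :: 'v and F G :: "'v vd_funv" and \<sigma> :: "'v vtransv"
begin

lemma trans_elem:
  assumes C: "C \<in> enr_cats U A" and c: "c \<in> cat_ob C" "c' \<in> cat_ob C"
  shows "is_elem B (push_cat A G C) (felem (push_cat A F C) (trans_fun \<sigma> C) c c')"
  using tc[OF F.A.catD(2)[OF C c]] F.hmor[OF F.A.catD(2)[OF C c]] G.hmor[OF F.A.catD(2)[OF C c]]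
    tv F.A.catD(1)[OF C] c
  by (simp add: is_elem_def is_bdry_def F.go)

text \<open>The naturality law of \<open>\<sigma>\<close> at the multicell \<open>x\<close>, read as a description of the action of its component:
  acting after transport along \<open>F\<close> is substituting the components of \<open>\<sigma>\<close> into the transport along \<open>G\<close>.\<close>

lemma eapp_trans:
  assumes C: "C \<in> enr_cats U A" and x: "is_elem A C x"
  shows "eapp B (push_cat A F C) (push_cat A G C) (trans_fun \<sigma> C) (epush F C x)
    = ecmp B (push_cat A G C) (epush G C x) (Go F (estart x)) (TV \<sigma> (estart x)) (trans_row F G \<sigma> (epath x))"
  using is_elemD[OF x] tc_nat[OF is_elemD(11,12)[OF x]]
  by (intro elem_eqI) (simp_all add: eapp_def ecmp_def eblock_def epush_def tv_nat comp_def del: map_eq_conv)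

lemma ecmp_trans_row:
  assumes C: "C \<in> enr_cats U A" and c: "c \<in> cat_ob C" "c' \<in> cat_ob C"
  shows "ecmp B (push_cat A G C) (ielem B (push_cat A G C) c c') (Go F (ext C c)) (TV \<sigma> (ext C c))
      (trans_row F G \<sigma> [chom C c c']) = felem (push_cat A F C) (trans_fun \<sigma> C) c c'"
  using F.B.ecmp_ielem[OF G.push_cat[OF C] trans_elem[OF C c]] c
  by (simp add: eblock_def)

lemma trans_fun:
  assumes C: "C \<in> enr_cats U A"
  shows "trans_fun \<sigma> C \<in> enr_funs B (push_cat A F C) (push_cat A G C)"
  unfolding F.B.enr_funs_iff[OF F.push_cat[OF C] G.push_cat[OF C]]
proof (intro conjI ballI)
  note [simp] = F.A.catD[OF C] tv F.go G.go F.A.vid F.B.vid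
  show "\<exists>fo fv fw. trans_fun \<sigma> C = mk_fun (cat_obset (push_cat A F C)) fo fv fw"
    by (simp add: trans_fun_mk)
  show "eapp B (push_cat A F C) (push_cat A G C) (trans_fun \<sigma> C)
      (eunit B (push_cat A F C) (ext (push_cat A F C) c) c (VId B (ext (push_cat A F C) c)))
    = eunit B (push_cat A G C) (ext (push_cat A F C) c) (fun_ob (trans_fun \<sigma> C) c) (fun_vert (trans_fun \<sigma> C) c)"
    if "c \<in> cat_ob (push_cat A F C)" for c
  proof -
    have [simp]: "c \<in> cat_ob C" using that by simp
    have "eunit B (push_cat A F C) (Go F (ext C c)) c (VId B (Go F (ext C c)))
      = epush F C (eunit A C (ext C c) c (VId A (ext C c)))"
      by (simp add: F.epush_eunit[OF C] F.gv_id)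
    then show ?thesis
      using F.B.ecmp_eunit[OF G.push_cat[OF C], of c "Go F (ext C c)" "Go G (ext C c)" "TV \<sigma> (ext C c)"
          "VId B (Go G (ext C c))"]
      by (simp add: eapp_trans[OF C] F.A.eunit_elem[OF C] G.epush_eunit[OF C] G.gv_id F.B.vcmp_id_left)
  qed
  show "eapp B (push_cat A F C) (push_cat A G C) (trans_fun \<sigma> C)
       (emul B (push_cat A F C) (ielem B (push_cat A F C) c\<^sub>0 c\<^sub>1) (ielem B (push_cat A F C) c\<^sub>1 c\<^sub>2))
    = emul B (push_cat A G C) (felem (push_cat A F C) (trans_fun \<sigma> C) c\<^sub>0 c\<^sub>1)
       (felem (push_cat A F C) (trans_fun \<sigma> C) c\<^sub>1 c\<^sub>2)"
    if "c\<^sub>0 \<in> cat_ob (push_cat A F C)" "c\<^sub>1 \<in> cat_ob (push_cat A F C)" "c\<^sub>2 \<in> cat_ob (push_cat A F C)" for c\<^sub>0 c\<^sub>1 c\<^sub>2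
  proof -
    have [simp]: "c\<^sub>0 \<in> cat_ob C" "c\<^sub>1 \<in> cat_ob C" "c\<^sub>2 \<in> cat_ob C" using that by simp_all
    let ?i = "ielem B (push_cat A G C)"
    have r: "row B (Go F (ext C c\<^sub>0)) (Go G (ext C c\<^sub>0)) (TV \<sigma> (ext C c\<^sub>0))
        (trans_row F G \<sigma> [chom C c\<^sub>0 c\<^sub>1, chom C c\<^sub>1 c\<^sub>2])"
      by (rule row_trans_row[OF F.virtual_double_functor_axioms G.virtual_double_functor_axioms
            vertical_transformation_axioms]) simp
    have "eapp B (push_cat A F C) (push_cat A G C) (trans_fun \<sigma> C)
        (epush F C (emul A C (ielem A C c\<^sub>0 c\<^sub>1) (ielem A C c\<^sub>1 c\<^sub>2)))
      = ecmp B (push_cat A G C) (emul B (push_cat A G C) (?i c\<^sub>0 c\<^sub>1) (?i c\<^sub>1 c\<^sub>2))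
          (Go F (ext C c\<^sub>0)) (TV \<sigma> (ext C c\<^sub>0)) (trans_row F G \<sigma> [chom C c\<^sub>0 c\<^sub>1] @ trans_row F G \<sigma> [chom C c\<^sub>1 c\<^sub>2])"
      by (subst eapp_trans[OF C])
        (simp_all add: F.A.emul_elem[OF C] F.A.ielem_elem[OF C] follows_def G.epush_emul[OF C] G.epush_ielem[OF C])
    also have "\<dots> = emul B (push_cat A G C)
        (ecmp B (push_cat A G C) (?i c\<^sub>0 c\<^sub>1) (Go F (ext C c\<^sub>0)) (TV \<sigma> (ext C c\<^sub>0)) (trans_row F G \<sigma> [chom C c\<^sub>0 c\<^sub>1]))
        (ecmp B (push_cat A G C) (?i c\<^sub>1 c\<^sub>2) (Go F (ext C c\<^sub>1)) (TV \<sigma> (ext C c\<^sub>1)) (trans_row F G \<sigma> [chom C c\<^sub>1 c\<^sub>2]))"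
      using r by (subst F.B.ecmp_emul[OF G.push_cat[OF C]])
        (simp_all add: F.B.ielem_elem[OF G.push_cat[OF C]] follows_def)
    finally show ?thesis
      by (simp only: ecmp_trans_row[OF C] \<open>c\<^sub>0 \<in> cat_ob C\<close> \<open>c\<^sub>1 \<in> cat_ob C\<close> \<open>c\<^sub>2 \<in> cat_ob C\<close>)
        (simp add: F.epush_emul[OF C] F.A.ielem_elem[OF C] follows_def F.epush_ielem[OF C])
  qed
qed (simp_all add: trans_elem[OF C] F.A.catD[OF C] tv)

lemma trans_natural1:
  assumes C: "C \<in> enr_cats U A" and D: "D \<in> enr_cats U A" and f: "f \<in> enr_funs A C D"
  shows "cmp_fun B (push_cat A F C) (push_cat A F D) (push_cat A G D) (trans_fun \<sigma> D) (push_fun F C D f)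
    = cmp_fun B (push_cat A F C) (push_cat A G C) (push_cat A G D) (push_fun G C D f) (trans_fun \<sigma> C)"
    (is "?l = ?r")
proof (rule enr_fun_eqI[where X = "cat_obset (push_cat A F C)"])
  note [simp] = F.A.funD(1,2,3)[OF C D f] F.A.catD[OF C] F.A.catD[OF D]
  fix c c' assume c: "c \<in> cat_ob (push_cat A F C)" "c' \<in> cat_ob (push_cat A F C)"
  then have [simp]: "c \<in> cat_ob C" "c' \<in> cat_ob C" by simp_all
  show "fun_ob ?l c = fun_ob ?r c" "fun_vert ?l c = fun_vert ?r c"
    by (simp_all add: tv_nat)
  have "felem (push_cat A F C) ?l c c' = felem (push_cat A F C) ?r c c'"
    by (simp add: felem_cmp F.felem_push eapp_trans[OF D] eapp_def[of B "push_cat A G C"] G.felem_push eblock_def)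
  from arg_cong[OF this, of ecell] show "fun_cell ?l c c' = fun_cell ?r c c'"
    by (simp only: felem_sel)
qed (rule fun_mk_fun)+

lemma trans_natural2:
  assumes C: "C \<in> enr_cats U A" and D: "D \<in> enr_cats U A" and f: "f \<in> enr_funs A C D" "f' \<in> enr_funs A C D"
    and \<alpha>: "\<alpha> \<in> enr_nats A C D f f'"
  shows "Hc (ACat U B) (push_cat A F C) (push_cat A F D) (push_cat A G D) (push_fun F C D f) (push_fun F C D f')
      (trans_fun \<sigma> D) (trans_fun \<sigma> D) (id_nat B (push_cat A F D) (push_cat A G D) (trans_fun \<sigma> D)) (push_nat F C D f f' \<alpha>)
    = Hc (ACat U B) (push_cat A F C) (push_cat A G C) (push_cat A G D) (trans_fun \<sigma> C) (trans_fun \<sigma> C)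
      (push_fun G C D f) (push_fun G C D f') (push_nat G C D f f' \<alpha>) (id_nat B (push_cat A F C) (push_cat A G C) (trans_fun \<sigma> C))"
proof -
  note [simp] = F.A.funD(1,2,3)[OF C D f(1)] F.A.funD(1,2,3)[OF C D f(2)] F.A.natD(1)[OF C D f \<alpha>] F.A.catD[OF C]
  note n = trans_natural1[OF C D f(1)] trans_natural1[OF C D f(2)]
  show ?thesis
    unfolding F.B.Hc_id_nat(1)[OF F.push_cat[OF C] F.push_cat[OF D] G.push_cat[OF D] F.push_fun[OF C D f(1)]
        F.push_fun[OF C D f(2)] trans_fun[OF D] trans_fun[OF D] F.push_nat[OF C D f \<alpha>]]
      F.B.Hc_id_nat(2)[OF F.push_cat[OF C] G.push_cat[OF C] G.push_cat[OF D] trans_fun[OF C] trans_fun[OF C]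
        G.push_fun[OF C D f(1)] G.push_fun[OF C D f(2)] G.push_nat[OF C D f \<alpha>]]
  proof (rule nat_eqI[OF nat_vlam(3) nat_vlam(4)])
    fix c assume c: "c \<in> cat_ob (push_cat A F C)"
    then have [simp]: "c \<in> cat_ob C" by simp
    show "nelem (push_cat A F C)
        (cmp_fun B (push_cat A F C) (push_cat A F D) (push_cat A G D) (trans_fun \<sigma> D) (push_fun F C D f))
        (cmp_fun B (push_cat A F C) (push_cat A F D) (push_cat A G D) (trans_fun \<sigma> D) (push_fun F C D f'))
        (lwhisker B (push_cat A F C) (push_cat A F D) (push_cat A G D) (push_fun F C D f) (push_fun F C D f')
           (trans_fun \<sigma> D) (push_nat F C D f f' \<alpha>)) c
      = nelem (push_cat A F C)
        (cmp_fun B (push_cat A F C) (push_cat A F D) (push_cat A G D) (trans_fun \<sigma> D) (push_fun F C D f))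
        (cmp_fun B (push_cat A F C) (push_cat A F D) (push_cat A G D) (trans_fun \<sigma> D) (push_fun F C D f'))
        (rwhisker B (push_cat A F C) (push_cat A G C) (push_cat A G D) (trans_fun \<sigma> C) (push_fun G C D f)
           (push_fun G C D f') (push_nat G C D f f' \<alpha>)) c"
      unfolding nelem_lwhisker[OF c] unfolding n nelem_rwhisker[OF c]
      by (simp add: F.nelem_push G.nelem_push eapp_trans[OF D])
  qed
qed

lemma two_nat_trans: "two_nat (ACat U A) (ACat U B) (Push U A F) (Push U A G) (\<lambda>C\<in>enr_cats U A. trans_fun \<sigma> C)"
proof (unfold_locales; (unfold ACat_sel(1-7))?)
qed (simp_all add: trans_fun trans_natural1 trans_natural2 del: ACat_sel(8))

end

lemma cat_obset_in: "C \<in> enr_cats U A \<Longrightarrow> cat_obset C \<in> elts U"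
  by (auto simp: enr_cats_def)

lemma fun_obmap_eq: "f \<in> enr_funs A C D \<Longrightarrow> fun_obmap f = vlam (cat_ob C) (\<lambda>c. fun_ob f c)"
  using fun_mk_fun(3)[of f A C D] by (auto intro!: vlam_cong)

lemma fun_obmap_sel:
  "fun_obmap (id_fun A C) = vlam (cat_ob C) (\<lambda>c. c)"
  "fun_obmap (cmp_fun A C D E g f) = vlam (cat_ob C) (\<lambda>c. fun_ob g (fun_ob f c))"
  "fun_obmap (push_fun G C D f) = vlam (cat_ob C) (\<lambda>c. fun_ob f c)"
  by (simp_all add: id_fun_def cmp_fun_def push_fun_def)

lemma two_functor_ob:
  assumes "virtual_double_category A"
  shows "two_functor (ACat U A) (Set_lc U) (ob_functor U A)"
proof -
  interpret enrichment A U by (simp add: enrichment_def assms)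
  note C2 = two_category.id1[OF two_category_ACat] two_category.cmp1[OF two_category_ACat]
    two_category.id2[OF two_category_ACat] two_category.vc[OF two_category_ACat]
    two_category.hc[OF two_category_ACat]
  note C2' = C2[unfolded ACat_sel(1-7)]
  show ?thesis
    unfolding ob_functor_def
  proof (unfold_locales; (unfold ACat_sel(1-7) Set_lc_sel)?)
    fix C D f assume "C \<in> enr_cats U A" "D \<in> enr_cats U A" "f \<in> enr_funs A C D"
    then show "F1 (mk_two_fun (ACat U A) cat_obset (\<lambda>C D. fun_obmap) (\<lambda>C D f g \<alpha>. vempty)) C D f
      \<in> {vlam (elts (Fo (mk_two_fun (ACat U A) cat_obset (\<lambda>C D. fun_obmap) (\<lambda>C D f g \<alpha>. vempty)) C)) h |h.
          h \<in> elts (Fo (mk_two_fun (ACat U A) cat_obset (\<lambda>C D. fun_obmap) (\<lambda>C D f g \<alpha>. vempty)) C)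
           \<rightarrow> elts (Fo (mk_two_fun (ACat U A) cat_obset (\<lambda>C D. fun_obmap) (\<lambda>C D f g \<alpha>. vempty)) D)}"
      using fun_obmap_eq[of f A C D] funD(1)[of C D f] by auto
  qed (use C2' in \<open>simp_all add: fun_obmap_sel cat_obset_in del: ACat_sel(8)\<close>)
qed

text \<open>Change of base does not alter the sets of objects.\<close>

lemma ob_push:
  assumes "virtual_double_category A" "virtual_double_category B" "virtual_double_functor A B G"
  shows "cmp_two_fun (ACat U A) (ob_functor U B) (Push U A G)
    = ob_functor U A"
proof -
  interpret enr_push A B U G by (simp add: enr_push_def enrichment_def assms)
  show ?thesis
    unfolding cmp_two_fun_def ob_functor_def
    by (rule mk_two_fun_cong)
      (simp_all add: push_cat push_fun push_nat fun_obmap_sel fun_obmap_eq[symmetric])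
qed

lemma Enr1_sel:
  assumes "A \<in> Ob (VDBL U2)"
  shows "Fo (Enr1 U1 U2) A = (ACat U1 A, ob_functor U1 A)"
    "B \<in> Ob (VDBL U2) \<Longrightarrow> G \<in> Hom1 (VDBL U2) A B \<Longrightarrow>
      F1 (Enr1 U1 U2) A B G = Push U1 A G"
    "B \<in> Ob (VDBL U2) \<Longrightarrow> F \<in> Hom1 (VDBL U2) A B \<Longrightarrow> G \<in> Hom1 (VDBL U2) A B \<Longrightarrow>
      \<sigma> \<in> Hom2 (VDBL U2) A B F G \<Longrightarrow> F2 (Enr1 U1 U2) A B F G \<sigma> = (\<lambda>C\<in>enr_cats U1 A. trans_fun \<sigma> C)"
  using assms unfolding Enr1_def Enr_def trans_fun_def by (simp_all del: VDBL_sel)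

lemma VDBL_Hc_sel:
  "a \<in> VOb A \<Longrightarrow> TV (Hc (VDBL U) A B C F F' G G' \<tau> \<sigma>) a
    = VCmp C (Go G (Go F a)) (Go G (Go F' a)) (Go G' (Go F' a))
          (TV \<tau> (Go F' a)) (GV G (Go F a) (Go F' a) (TV \<sigma> a))"
  "is_hmor A \<Gamma> \<Longrightarrow> TC (Hc (VDBL U) A B C F F' G G' \<tau> \<sigma>) \<Gamma>
    = MCmp C (Go G (Go F (hsrc \<Gamma>))) (Go G (Go F' (hsrc \<Gamma>)))
          (GV G (Go F (hsrc \<Gamma>)) (Go F' (hsrc \<Gamma>)) (TV \<sigma> (hsrc \<Gamma>)))
          [Block [hmap G (hmap F \<Gamma>)]
             (GM G (Go F (hsrc \<Gamma>)) [hmap F \<Gamma>] (hmap F' \<Gamma>)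
                (TV \<sigma> (hsrc \<Gamma>)) (TV \<sigma> (htgt \<Gamma>)) (TC \<sigma> \<Gamma>))
             (hmap G (hmap F' \<Gamma>))
             (GV G (Go F (htgt \<Gamma>)) (Go F' (htgt \<Gamma>)) (TV \<sigma> (htgt \<Gamma>)))]
          (hmap G' (hmap F' \<Gamma>)) (TV \<tau> (Go F' (hsrc \<Gamma>))) (TV \<tau> (Go F' (htgt \<Gamma>)))
          (TC \<tau> (hmap F' \<Gamma>))"
  by (simp_all add: VDBL_def)

lemma Push_id:
  assumes "virtual_double_category A"
  shows "Push U A (id_vd_fun A)
    = id_two_fun (ACat U A)"
proof -
  interpret enrichment A U by (simp add: enrichment_def assms)
  show ?thesis
    unfolding id_two_fun_def
  proof (rule mk_two_fun_cong; unfold ACat_sel)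
    fix C assume C: "C \<in> enr_cats U A"
    have "is_hmor A (chom C c c')" if "c \<in> cat_ob C" "c' \<in> cat_ob C" for c c' using catD[OF C] that by simp
    then have h: "cat_hom C c c' \<in> HHom A (ext C c) (ext C c')" if "c \<in> cat_ob C" "c' \<in> cat_ob C" for c c'
      using that by (auto simp: is_hmor_def)
    show "push_cat A (id_vd_fun A) C = C"
      by (rule enr_cat_eqI[OF C push_mk(1), symmetric])
        (simp_all add: catD[OF C] h is_bdry_id[OF C])
    fix D f assume D: "D \<in> enr_cats U A" and f: "f \<in> enr_funs A C D"
    show "push_fun (id_vd_fun A) C D f = f"
      by (rule enr_fun_eqI[OF push_mk(2) fun_mk_fun(3)[OF f]])
        (use is_elemD(11,12)[OF funD(3)[OF C D f]] in \<open>simp_all add: catD[OF C] catD[OF D] funD[OF C D f]\<close>)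
    fix f' \<alpha> assume f': "f' \<in> enr_funs A C D" and \<alpha>: "\<alpha> \<in> enr_nats A C D f f'"
    show "push_nat (id_vd_fun A) C D f f' \<alpha> = \<alpha>"
      by (rule vlam_extend[OF push_mk(3) nat_mk_nat[OF \<alpha>]])
        (use is_elemD(11,12)[OF natD(1)[OF C D f f' \<alpha>]] in simp)
  qed
qed

lemma Push_cmp:
  assumes "virtual_double_category A" "virtual_double_category B" "virtual_double_category C"
    "virtual_double_functor A B F" "virtual_double_functor B C G"
  shows "Push U A (cmp_vd_fun A G F)
    = cmp_two_fun (ACat U A) (Push U B G)
        (Push U A F)"
proof -
  interpret F: enr_push A B U F by (simp add: enr_push_def enrichment_def assms)
  interpret G: enr_push B C U G by (simp add: enr_push_def enrichment_def assms)
  show ?thesis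
    unfolding cmp_two_fun_def
  proof (rule mk_two_fun_cong; unfold ACat_sel)
    fix X assume X: "X \<in> enr_cats U A"
    note [simp] = F.A.catD[OF X] F.A.vid F.gv_id F.gv F.push_cat[OF X] F.go
    have "is_hmor A (chom X c c')" if "c \<in> cat_ob X" "c' \<in> cat_ob X" for c c' using that by simp
    then have h: "cat_hom X c c' \<in> HHom A (ext X c) (ext X c')" if "c \<in> cat_ob X" "c' \<in> cat_ob X" for c c'
      using that by (auto simp: is_hmor_def)
    show "push_cat A (cmp_vd_fun A G F) X = Fo (Push U B G) (Fo (Push U A F) X)"
      unfolding push_cat_def[of A "cmp_vd_fun A G F"]
      using X by (simp add: push_cat_def[of B G])
        (rule mk_cat_cong; simp add: F.A.is_bdry_id[OF X] h)
    fix Y f assume Y: "Y \<in> enr_cats U A" and f: "f \<in> enr_funs A X Y"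
    note [simp] = F.A.catD[OF Y] F.A.funD(1,2,3)[OF X Y f] F.push_cat[OF Y] F.push_fun[OF X Y f]
    show "push_fun (cmp_vd_fun A G F) X Y f = F1 (Push U B G) (Fo (Push U A F) X) (Fo (Push U A F) Y) (F1 (Push U A F) X Y f)"
      unfolding push_fun_def[of "cmp_vd_fun A G F"]
      using X Y f is_elemD(11,12)[OF F.A.funD(3)[OF X Y f]]
      by (simp add: push_fun_def[of G]) (rule mk_fun_cong; simp)
    fix f' \<alpha> assume f': "f' \<in> enr_funs A X Y" and \<alpha>: "\<alpha> \<in> enr_nats A X Y f f'"
    note [simp] = F.A.funD(1,2,3)[OF X Y f'] F.push_fun[OF X Y f'] F.push_nat[OF X Y f f' \<alpha>]
    show "push_nat (cmp_vd_fun A G F) X Y f f' \<alpha>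
      = F2 (Push U B G) (Fo (Push U A F) X) (Fo (Push U A F) Y) (F1 (Push U A F) X Y f) (F1 (Push U A F) X Y f') (F2 (Push U A F) X Y f f' \<alpha>)"
      unfolding push_nat_def[of "cmp_vd_fun A G F"]
      using X Y f f' \<alpha> is_elemD(11,12)[OF F.A.natD(1)[OF X Y f f' \<alpha>]]
      by (simp add: push_nat_def[of G]) (rule vlam_cong; simp)
  qed
qed

theorem two_functor_Enr1:
  assumes U2: "grothendieck_universe U2" and U1: "U1 \<in> elts U2"
  shows "two_functor (VDBL U2) (slice (two_CAT U2) (Set_lc U1)) (Enr1 U1 U2)"
proof (unfold_locales)
  show "Enr1 U1 U2 = mk_two_fun (VDBL U2) (Fo (Enr1 U1 U2)) (F1 (Enr1 U1 U2)) (F2 (Enr1 U1 U2))"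
    unfolding Enr1_def by simp
next
  fix A assume A: "A \<in> Ob (VDBL U2)"
  then have A': "virtual_double_category A" "large_vdc U2 A" by simp_all
  interpret A: enrichment A U1 by (simp add: enrichment_def A')
  show "Fo (Enr1 U1 U2) A \<in> Ob (slice (two_CAT U2) (Set_lc U1))"
    using A.two_category_ACat large_ACat[OF A' U2 U1] two_functor_ob[OF A'(1), of U1]
    by (simp add: Enr1_sel[OF A])
  show "F1 (Enr1 U1 U2) A A (Id1 (VDBL U2) A) = Id1 (slice (two_CAT U2) (Set_lc U1)) (Fo (Enr1 U1 U2) A)"
    using A Push_id[OF A'(1), of U1] by (simp add: Enr1_sel virtual_double_functor_id)
  fix B F assume B: "B \<in> Ob (VDBL U2)" and F: "F \<in> Hom1 (VDBL U2) A B"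
  then have B': "virtual_double_category B" and F': "virtual_double_functor A B F" by simp_all
  interpret F: enr_push A B U1 F by (simp add: enr_push_def enrichment_def A' B' F')
  show "F1 (Enr1 U1 U2) A B F \<in> Hom1 (slice (two_CAT U2) (Set_lc U1)) (Fo (Enr1 U1 U2) A) (Fo (Enr1 U1 U2) B)"
    using F.two_functor_Push ob_push[OF A'(1) B' F'] by (simp add: Enr1_sel[OF A] Enr1_sel[OF B] B F del: VDBL_sel)
  show "F2 (Enr1 U1 U2) A B F F (Id2 (VDBL U2) A B F)
    = Id2 (slice (two_CAT U2) (Set_lc U1)) (Fo (Enr1 U1 U2) A) (Fo (Enr1 U1 U2) B) (F1 (Enr1 U1 U2) A B F)"
  proof -
    have "Id2 (VDBL U2) A B F \<in> Hom2 (VDBL U2) A B F F"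
      using two_category.id2[OF two_category_VDBL A B F] .
    then have "F2 (Enr1 U1 U2) A B F F (Id2 (VDBL U2) A B F)
      = (\<lambda>C\<in>enr_cats U1 A. trans_fun (Id2 (VDBL U2) A B F) C)"
      by (intro Enr1_sel(3) A B F)
    also have "\<dots> = (\<lambda>C\<in>enr_cats U1 A. id_fun B (push_cat A F C))"
    proof (rule restrict_ext)
      fix C assume C: "C \<in> enr_cats U1 A"
      show "trans_fun (Id2 (VDBL U2) A B F) C = id_fun B (push_cat A F C)"
        unfolding trans_fun_def id_fun_def using A.catD[OF C] by (simp, intro mk_fun_cong) simp_all
    qed
    also have "\<dots> = Id2 (slice (two_CAT U2) (Set_lc U1)) (Fo (Enr1 U1 U2) A) (Fo (Enr1 U1 U2) B) (F1 (Enr1 U1 U2) A B F)"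
      by (simp add: Enr1_sel[OF A] Enr1_sel[OF B] B F del: VDBL_sel cong: restrict_cong)
    finally show ?thesis .
  qed
  fix G assume G: "G \<in> Hom1 (VDBL U2) A B"
  then have G': "virtual_double_functor A B G" by simp
  interpret G: enr_push A B U1 G by (simp add: enr_push_def enrichment_def A' B' G')
  {
    fix \<sigma> assume \<sigma>: "\<sigma> \<in> Hom2 (VDBL U2) A B F G"
    then interpret \<sigma>: enr_trans A B U1 F G \<sigma>
      by (simp add: enr_trans_def F.enr_push_axioms G.enr_push_axioms)
    show "F2 (Enr1 U1 U2) A B F G \<sigma> \<in> Hom2 (slice (two_CAT U2) (Set_lc U1)) (Fo (Enr1 U1 U2) A) (Fo (Enr1 U1 U2) B)
        (F1 (Enr1 U1 U2) A B F) (F1 (Enr1 U1 U2) A B G)"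
      unfolding Enr1_sel[OF A] Enr1_sel[OF B] Enr1_sel(2)[OF A B F] Enr1_sel(2)[OF A B G] Enr1_sel(3)[OF A B F G \<sigma>]
        slice_sel(3) two_nat_over_Set_lc_iff[OF F.two_functor_Push G.two_functor_Push \<sigma>.two_nat_trans
          two_functor_ob[OF B'] ob_push[OF A'(1) B' F'] ob_push[OF A'(1) B' G']]
      using \<sigma>.two_nat_trans \<sigma>.trans_fun F.push_cat G.push_cat by (simp add: ob_functor_def)
    fix H \<tau> assume H: "H \<in> Hom1 (VDBL U2) A B" and \<tau>: "\<tau> \<in> Hom2 (VDBL U2) A B G H"
    then have H': "virtual_double_functor A B H" by simp
    interpret H: enr_push A B U1 H by (simp add: enr_push_def enrichment_def A' B' H')
    interpret \<tau>: enr_trans A B U1 G H \<tau>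
      using \<tau> by (simp add: enr_trans_def H.enr_push_axioms G.enr_push_axioms)
    have "Vc (VDBL U2) A B F G H \<tau> \<sigma> \<in> Hom2 (VDBL U2) A B F H"
      using two_category.vc[OF two_category_VDBL A B F G H \<sigma> \<tau>] .
    then have "F2 (Enr1 U1 U2) A B F H (Vc (VDBL U2) A B F G H \<tau> \<sigma>)
      = (\<lambda>C\<in>enr_cats U1 A. trans_fun (Vc (VDBL U2) A B F G H \<tau> \<sigma>) C)"
      by (intro Enr1_sel(3) A B F H)
    also have "\<dots> = (\<lambda>C\<in>enr_cats U1 A. cmp_fun B (push_cat A F C) (push_cat A G C) (push_cat A H C) (trans_fun \<tau> C) (trans_fun \<sigma> C))"
    proof (rule restrict_ext)
      fix C assume C: "C \<in> enr_cats U1 A"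
      show "trans_fun (Vc (VDBL U2) A B F G H \<tau> \<sigma>) C
        = cmp_fun B (push_cat A F C) (push_cat A G C) (push_cat A H C) (trans_fun \<tau> C) (trans_fun \<sigma> C)"
        unfolding trans_fun_def[of "Vc (VDBL U2) A B F G H \<tau> \<sigma>"] cmp_fun_def
        using A.catD[OF C] by (simp, intro mk_fun_cong) simp_all
    qed
    also have "\<dots> = Vc (slice (two_CAT U2) (Set_lc U1)) (Fo (Enr1 U1 U2) A) (Fo (Enr1 U1 U2) B)
          (F1 (Enr1 U1 U2) A B F) (F1 (Enr1 U1 U2) A B G) (F1 (Enr1 U1 U2) A B H)
          (F2 (Enr1 U1 U2) A B G H \<tau>) (F2 (Enr1 U1 U2) A B F G \<sigma>)"
      by (simp add: Enr1_sel[OF A] Enr1_sel[OF B] B F G H \<sigma> \<tau> del: VDBL_sel cong: restrict_cong)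
    finally show "F2 (Enr1 U1 U2) A B F H (Vc (VDBL U2) A B F G H \<tau> \<sigma>)
      = Vc (slice (two_CAT U2) (Set_lc U1)) (Fo (Enr1 U1 U2) A) (Fo (Enr1 U1 U2) B)
          (F1 (Enr1 U1 U2) A B F) (F1 (Enr1 U1 U2) A B G) (F1 (Enr1 U1 U2) A B H)
          (F2 (Enr1 U1 U2) A B G H \<tau>) (F2 (Enr1 U1 U2) A B F G \<sigma>)" .
  next
    fix C H assume C: "C \<in> Ob (VDBL U2)" and H: "H \<in> Hom1 (VDBL U2) B C"
    then have C': "virtual_double_category C" and H': "virtual_double_functor B C H" by simp_all
    have "cmp_vd_fun A H F \<in> Hom1 (VDBL U2) A C"
      using two_category.cmp1[OF two_category_VDBL A B C F H] by simp
    then show "F1 (Enr1 U1 U2) A C (Cmp1 (VDBL U2) A B C H F)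
      = Cmp1 (slice (two_CAT U2) (Set_lc U1)) (Fo (Enr1 U1 U2) A) (Fo (Enr1 U1 U2) B) (Fo (Enr1 U1 U2) C)
          (F1 (Enr1 U1 U2) B C H) (F1 (Enr1 U1 U2) A B F)"
      using Push_cmp[OF A'(1) B' C' F' H', of U1] A B C F H
      by (simp add: Enr1_sel[OF A] Enr1_sel[OF B] Enr1_sel[OF C])
    interpret H: enr_push B C U1 H by (simp add: enr_push_def enrichment_def C' B' H')
    fix \<sigma> H2 \<tau> assume \<sigma>: "\<sigma> \<in> Hom2 (VDBL U2) A B F G" and H2: "H2 \<in> Hom1 (VDBL U2) B C"
      and \<tau>: "\<tau> \<in> Hom2 (VDBL U2) B C H H2"
    interpret \<sigma>: enr_trans A B U1 F G \<sigma>
      using \<sigma> by (simp add: enr_trans_def F.enr_push_axioms G.enr_push_axioms)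
    let ?h = "Hc (VDBL U2) A B C F G H H2 \<tau> \<sigma>"
    have "?h \<in> Hom2 (VDBL U2) A C (Cmp1 (VDBL U2) A B C H F) (Cmp1 (VDBL U2) A B C H2 G)"
      using two_category.hc[OF two_category_VDBL A B C F G H H2 \<sigma> \<tau>] .
    then have "F2 (Enr1 U1 U2) A C (Cmp1 (VDBL U2) A B C H F) (Cmp1 (VDBL U2) A B C H2 G) ?h
      = (\<lambda>X\<in>enr_cats U1 A. trans_fun ?h X)"
      by (intro Enr1_sel(3) A C two_category.cmp1[OF two_category_VDBL A B C] F G H H2)
    also have "\<dots> = (\<lambda>X\<in>enr_cats U1 A. cmp_fun C (push_cat B H (push_cat A F X)) (push_cat B H (push_cat A G X))
        (push_cat B H2 (push_cat A G X)) (trans_fun \<tau> (push_cat A G X)) (push_fun H (push_cat A F X) (push_cat A G X) (trans_fun \<sigma> X)))"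
    proof (rule restrict_ext)
      fix X assume X: "X \<in> enr_cats U1 A"
      show "trans_fun ?h X = cmp_fun C (push_cat B H (push_cat A F X)) (push_cat B H (push_cat A G X))
        (push_cat B H2 (push_cat A G X)) (trans_fun \<tau> (push_cat A G X)) (push_fun H (push_cat A F X) (push_cat A G X) (trans_fun \<sigma> X))"
        unfolding trans_fun_def[of ?h] cmp_fun_def
        using A.catD[OF X] by (simp, intro mk_fun_cong) (simp_all add: VDBL_Hc_sel)
    qed
    also have "\<dots> = Hc (slice (two_CAT U2) (Set_lc U1)) (Fo (Enr1 U1 U2) A) (Fo (Enr1 U1 U2) B) (Fo (Enr1 U1 U2) C)
          (F1 (Enr1 U1 U2) A B F) (F1 (Enr1 U1 U2) A B G) (F1 (Enr1 U1 U2) B C H) (F1 (Enr1 U1 U2) B C H2)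
          (F2 (Enr1 U1 U2) B C H H2 \<tau>) (F2 (Enr1 U1 U2) A B F G \<sigma>)"
      by (simp add: Enr1_sel[OF A] Enr1_sel[OF B] Enr1_sel[OF C] B F G H \<sigma> \<tau> C H2 F.push_cat G.push_cat \<sigma>.trans_fun
          del: VDBL_sel cong: restrict_cong)
    finally show "F2 (Enr1 U1 U2) A C (Cmp1 (VDBL U2) A B C H F) (Cmp1 (VDBL U2) A B C H2 G) ?h
      = Hc (slice (two_CAT U2) (Set_lc U1)) (Fo (Enr1 U1 U2) A) (Fo (Enr1 U1 U2) B) (Fo (Enr1 U1 U2) C)
          (F1 (Enr1 U1 U2) A B F) (F1 (Enr1 U1 U2) A B G) (F1 (Enr1 U1 U2) B C H) (F1 (Enr1 U1 U2) B C H2)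
          (F2 (Enr1 U1 U2) B C H H2 \<tau>) (F2 (Enr1 U1 U2) A B F G \<sigma>)" .
  }
qed

section \<open>The virtual double category of a 2-category over sets\<close>

text \<open>The input of the construction \<open>L\<close>: an object over \<open>Set_lc\<close>.\<close>

locale set_functor = K: two_category K + F: two_functor K "Set_lc U" F
  for K :: "('v::zf, 'v, 'v) two_cat" and U :: 'v and F :: "('v, 'v, 'v, 'v, 'v, 'v) two_fun"
begin

lemma F1_app: "\<lbrakk>A \<in> Ob K; B \<in> Ob K; f \<in> Hom1 K A B; x \<in> elts (Fo F A)\<rbrakk> \<Longrightarrow> vapp (F1 F A B f) x \<in> elts (Fo F B)"
  using F.f1[of A B f] by auto

lemma F1_vlam: "\<lbrakk>A \<in> Ob K; B \<in> Ob K; f \<in> Hom1 K A B\<rbrakk> \<Longrightarrow> vlam (elts (Fo F A)) (vapp (F1 F A B f)) = F1 F A B f"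
  using F.f1[of A B f] by (intro vlam_vapp) auto

lemma F1_id_app: "\<lbrakk>A \<in> Ob K; x \<in> elts (Fo F A)\<rbrakk> \<Longrightarrow> vapp (F1 F A A (Id1 K A)) x = x"
  by (simp add: F.f1_id)

lemma F1_cmp_app: "\<lbrakk>A \<in> Ob K; B \<in> Ob K; C \<in> Ob K; f \<in> Hom1 K A B; g \<in> Hom1 K B C; x \<in> elts (Fo F A)\<rbrakk>
    \<Longrightarrow> vapp (F1 F A C (Cmp1 K A B C g f)) x = vapp (F1 F B C g) (vapp (F1 F A B f) x)"
  by (simp add: F.f1_cmp)

abbreviation V :: "'v vdcv" where "V \<equiv> LL K F"

lemma LL_VOb: "p \<in> VOb V \<longleftrightarrow> vfst p \<in> Ob K \<and> vsnd p \<in> elts (Fo F (vfst p)) \<and> p = vpair (vfst p) (vsnd p)"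
  by (auto simp: LL_def)

lemma LL_vpair [simp]: "vpair A x \<in> VOb V \<longleftrightarrow> A \<in> Ob K \<and> x \<in> elts (Fo F A)"
  by (simp add: LL_VOb)

lemma LL_VHom: "f \<in> VHom V p q \<longleftrightarrow> f \<in> Hom1 K (vfst p) (vfst q) \<and> vapp (F1 F (vfst p) (vfst q) f) (vsnd p) = vsnd q"
  by (simp add: LL_def)

lemma LL_sel [simp]:
  "MCell V p \<Gamma>s \<Delta> f f' = Hom2 K (vfst p) (vfst (hsrc \<Delta>)) f f'"
  "VId V p = Id1 K (vfst p)"
  "VCmp V p q r g f = Cmp1 K (vfst p) (vfst q) (vfst r) g f"
  "MId V \<Gamma> = Id2 K (vfst (hsrc \<Gamma>)) (vfst (hsrc \<Gamma>)) (Id1 K (vfst (hsrc \<Gamma>)))"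
  "MCmp V p q f bs \<Lambda> g g' \<kappa> = Hc K (vfst p) (vfst q) (vfst (hsrc \<Lambda>)) f (rvert f bs) g g' \<kappa>
         (pasted K (vfst p) (vfst q) f bs)"
  by (simp_all add: LL_def)

lemma LL_HHom [simp]: "\<gamma> \<in> HHom V p q \<longleftrightarrow> vfst p = vfst q \<and> \<gamma> = vempty"
  by (simp add: LL_def)

lemma LL_hmor: "is_hmor V \<Gamma> \<longleftrightarrow> hsrc \<Gamma> \<in> VOb V \<and> htgt \<Gamma> \<in> VOb V \<and> vfst (htgt \<Gamma>) = vfst (hsrc \<Gamma>) \<and> hlab \<Gamma> = vempty"
  by (auto simp: is_hmor_def)

lemma vfst_hend: "hpath V p \<Gamma>s \<Longrightarrow> vfst (hend p \<Gamma>s) = vfst p"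
  by (induction \<Gamma>s arbitrary: p) (auto simp: LL_hmor)

lemma VObD: "p \<in> VOb V \<Longrightarrow> vfst p \<in> Ob K" "p \<in> VOb V \<Longrightarrow> vsnd p \<in> elts (Fo F (vfst p))"
  by (simp_all add: LL_VOb)

lemma LL_bdryD:
  assumes "is_bdry V p \<Gamma>s \<Delta> f f'"
  shows "vfst p \<in> Ob K" "vfst (hsrc \<Delta>) \<in> Ob K" "vfst (htgt \<Delta>) = vfst (hsrc \<Delta>)"
    "vfst (hend p \<Gamma>s) = vfst p" "f \<in> Hom1 K (vfst p) (vfst (hsrc \<Delta>))" "f' \<in> Hom1 K (vfst p) (vfst (hsrc \<Delta>))"
    "vapp (F1 F (vfst p) (vfst (hsrc \<Delta>)) f) (vsnd p) = vsnd (hsrc \<Delta>)"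
    "vapp (F1 F (vfst p) (vfst (hsrc \<Delta>)) f') (vsnd (hend p \<Gamma>s)) = vsnd (htgt \<Delta>)"
  using is_bdryD[OF assms] vfst_hend[of p \<Gamma>s] by (auto simp: LL_hmor LL_VHom VObD)

lemma pasted_Cons: "pasted K a b f (B # bs)
    = Vc K a b f (bvert B) (rvert (bvert B) bs) (pasted K a b (bvert B) bs) (bcell B)"
  by (cases B) simp

lemma row_pasted:
  assumes "row V p q f bs"
  shows "vfst p \<in> Ob K" "vfst q \<in> Ob K" "f \<in> Hom1 K (vfst p) (vfst q)" "rvert f bs \<in> Hom1 K (vfst p) (vfst q)"
    "vfst (hend p (tops bs)) = vfst p" "vfst (hend q (bots bs)) = vfst q"
    "pasted K (vfst p) (vfst q) f bs \<in> Hom2 K (vfst p) (vfst q) f (rvert f bs)"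
proof -
  show f: "vfst p \<in> Ob K" "vfst q \<in> Ob K" "f \<in> Hom1 K (vfst p) (vfst q)"
    using row_start[OF assms] by (auto simp: VObD LL_VHom)
  show v: "vfst (hend p (tops bs)) = vfst p" "vfst (hend q (bots bs)) = vfst q"
    using row_paths[OF assms] by (auto simp: vfst_hend)
  show "rvert f bs \<in> Hom1 K (vfst p) (vfst q)"
    using row_paths[OF assms] by (auto simp: v LL_VHom)
  show "pasted K (vfst p) (vfst q) f bs \<in> Hom2 K (vfst p) (vfst q) f (rvert f bs)"
    using assms
  proof (induction bs arbitrary: p q f)
    case Nil
    then show ?case by (auto intro!: K.id2 simp: VObD LL_VHom)
  next
    case (Cons B bs)
    then have B: "is_bdry V p (btop B) (bbot B) f (bvert B)" "hsrc (bbot B) = q"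
      "bcell B \<in> MCell V p (btop B) (bbot B) f (bvert B)"
      "row V (hend p (btop B)) (htgt (bbot B)) (bvert B) bs" by (simp_all del: LL_sel)
    have "rvert (bvert B) bs \<in> Hom1 K (vfst p) (vfst q)"
      using row_paths[OF Cons.prems] LL_bdryD(3,4)[OF B(1)] B(2) vfst_hend[of p "tops (B # bs)"] vfst_hend[of q "bots (B # bs)"]
      by (simp add: LL_VHom)
    then show ?case
      using B Cons.IH[OF B(4)] LL_bdryD[OF B(1)] by (auto simp: pasted_Cons intro!: K.vc)
  qed
qed

lemma pasted_append:
  "row V p q f (bs @ bs') \<Longrightarrow> pasted K (vfst p) (vfst q) f (bs @ bs')
    = Vc K (vfst p) (vfst q) f (rvert f bs) (rvert f (bs @ bs'))
        (pasted K (vfst p) (vfst q) (rvert f bs) bs') (pasted K (vfst p) (vfst q) f bs)"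
proof (induction bs arbitrary: p q f)
  case Nil
  then show ?case using row_pasted[OF Nil] by (simp add: K.vc_id_right)
next
  case (Cons B bs)
  then have B: "is_bdry V p (btop B) (bbot B) f (bvert B)" "hsrc (bbot B) = q"
    "bcell B \<in> MCell V p (btop B) (bbot B) f (bvert B)"
    "row V (hend p (btop B)) (htgt (bbot B)) (bvert B) (bs @ bs')" by (simp_all del: LL_sel)
  have r: "row V (hend p (btop B)) (htgt (bbot B)) (bvert B) bs"
    "row V (hend (hend p (btop B)) (tops bs)) (hend (htgt (bbot B)) (bots bs)) (rvert (bvert B) bs) bs'"
    using B(4) by simp_all
  show ?case
    using Cons.IH[OF B(4)] LL_bdryD[OF B(1)] B(2,3) row_pasted[OF r(1)] row_pasted[OF r(2)]
    by (simp add: pasted_Cons K.vc_assoc)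
qed

text \<open>A composite of two rows pastes to the horizontal composite of their pastings; this is a repeated use of
  the interchange law of \<open>K\<close>.\<close>

lemma pasted_cmp_row:
  assumes "row V z a w (concat (map snd gs))" "row V a b u (map fst gs)"
    "\<forall>(\<theta>, \<psi>s) \<in> set gs. bots \<psi>s = btop \<theta>"
  shows "rvert (Cmp1 K (vfst z) (vfst a) (vfst b) u w) (cmp_row V z a b w u gs)
      = Cmp1 K (vfst z) (vfst a) (vfst b) (rvert u (map fst gs)) (rvert w (concat (map snd gs))) \<and>
    pasted K (vfst z) (vfst b) (Cmp1 K (vfst z) (vfst a) (vfst b) u w) (cmp_row V z a b w u gs)
      = Hc K (vfst z) (vfst a) (vfst b) w (rvert w (concat (map snd gs))) u (rvert u (map fst gs))
          (pasted K (vfst a) (vfst b) u (map fst gs)) (pasted K (vfst z) (vfst a) w (concat (map snd gs)))"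
  using assms
proof (induction gs arbitrary: z a b w u)
  case Nil
  then show ?case by (simp add: K.hc_id2 VObD LL_VHom)
next
  case (Cons g gs)
  obtain \<Gamma>s \<theta> \<Delta> u' \<psi>s where g: "g = (Block \<Gamma>s \<theta> \<Delta> u', \<psi>s)" by (metis block.exhaust surj_pair)
  have b: "hsrc \<Delta> = b" and bdry: "is_bdry V a \<Gamma>s \<Delta> u u'" and \<theta>: "\<theta> \<in> Hom2 K (vfst a) (vfst b) u u'"
    and r1: "row V (hend a \<Gamma>s) (htgt \<Delta>) u' (map fst gs)"
    and r2: "row V z a w \<psi>s" and bots: "bots \<psi>s = \<Gamma>s"
    and r3: "row V (hend z (tops \<psi>s)) (hend a \<Gamma>s) (rvert w \<psi>s) (concat (map snd gs))"
    and gs: "\<forall>(\<theta>, \<psi>s) \<in> set gs. bots \<psi>s = btop \<theta>"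
    using Cons.prems unfolding g by auto
  note IH = Cons.IH[OF r3 r1 gs]
  note p1 = row_pasted[OF r1] and p2 = row_pasted[OF r2] and p3 = row_pasted[OF r3] and d = LL_bdryD[OF bdry]
  have v: "vfst (hend z (tops \<psi>s)) = vfst z" "vfst (hend a \<Gamma>s) = vfst a" "vfst (htgt \<Delta>) = vfst b"
    using p2 d b by simp_all
  note p1 = p1[unfolded v] and p3 = p3[unfolded v] and d = d[unfolded v b] and IH = IH[unfolded v]
  have "row V z a w (\<psi>s @ concat (map snd gs))" using r2 r3 bots by simp
  note pa = pasted_append[OF this]
  show ?case
    using IH p1 p2 p3 d \<theta> unfolding g
    by (simp add: Let_def v b pa K.interchange[symmetric])
qed

text \<open>Associativity of multicell composition is \<open>pasted_cmp_row\<close> together with associativity of horizontal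
  composition in \<open>K\<close>.\<close>

lemma virtual_double_category_LL: "virtual_double_category V"
proof
  fix a b c u v assume "a \<in> VOb V" "b \<in> VOb V" "c \<in> VOb V" "u \<in> VHom V a b" "v \<in> VHom V b c"
  then show "VCmp V a b c v u \<in> VHom V a c"
    by (simp add: LL_VHom VObD K.cmp1 F1_cmp_app)
next
  fix a b u bs \<Lambda> v v' \<kappa>
  assume r: "row V a b u bs" and b: "is_bdry V b (bots bs) \<Lambda> v v'" and \<kappa>: "\<kappa> \<in> MCell V b (bots bs) \<Lambda> v v'"
  show "MCmp V a b u bs \<Lambda> v v' \<kappa> \<in> MCell V a (tops bs) \<Lambda> (VCmp V a b (hsrc \<Lambda>) v u)
            (VCmp V (hend a (tops bs)) (hend b (bots bs)) (htgt \<Lambda>) v' (rvert u bs))"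
    using row_pasted[OF r] LL_bdryD[OF b] \<kappa> by (simp add: K.hc)
next
  fix b \<Delta>s \<Lambda> v v' \<kappa>
  assume b: "is_bdry V b \<Delta>s \<Lambda> v v'" and \<kappa>: "\<kappa> \<in> MCell V b \<Delta>s \<Lambda> v v'"
  have "hpath V b \<Delta>s \<Longrightarrow> rvert (Id1 K (vfst b)) (map (\<lambda>\<Delta>. Block [\<Delta>] (MId V \<Delta>) \<Delta> (VId V (htgt \<Delta>))) \<Delta>s) = Id1 K (vfst b) \<and>
      pasted K (vfst b) (vfst b) (Id1 K (vfst b)) (map (\<lambda>\<Delta>. Block [\<Delta>] (MId V \<Delta>) \<Delta> (VId V (htgt \<Delta>))) \<Delta>s)
      = Id2 K (vfst b) (vfst b) (Id1 K (vfst b))" for b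
  proof (induction \<Delta>s arbitrary: b)
    case (Cons \<Delta> \<Delta>s)
    then show ?case
      using Cons.IH[of "htgt \<Delta>"] by (auto simp: LL_hmor VObD K.id1 K.id2 K.vc_id_left)
  qed simp
  then show "MCmp V b b (VId V b) (map (\<lambda>\<Delta>. Block [\<Delta>] (MId V \<Delta>) \<Delta> (VId V (htgt \<Delta>))) \<Delta>s) \<Lambda> v v' \<kappa> = \<kappa>"
    using LL_bdryD[OF b] is_bdryD[OF b] \<kappa> by (simp add: K.hc_id_right)
next
  fix a \<Gamma>s \<Delta> u u' \<theta> assume b: "is_bdry V a \<Gamma>s \<Delta> u u'" and \<theta>: "\<theta> \<in> MCell V a \<Gamma>s \<Delta> u u'"
  show "MCmp V a (hsrc \<Delta>) u [Block \<Gamma>s \<theta> \<Delta> u'] \<Delta> (VId V (hsrc \<Delta>)) (VId V (htgt \<Delta>)) (MId V \<Delta>) = \<theta>"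
    using LL_bdryD[OF b] \<theta> by (simp add: K.vc_id_left K.hc_id_left)
next
  fix z a w gs b u \<Lambda> v v' \<kappa>
  assume r1: "row V z a w (concat (map snd gs))" and r2: "row V a b u (map fst gs)"
    and gs: "\<forall>(\<theta>, \<psi>s) \<in> set gs. bots \<psi>s = btop \<theta>"
    and b: "is_bdry V b (bots (map fst gs)) \<Lambda> v v'" and \<kappa>: "\<kappa> \<in> MCell V b (bots (map fst gs)) \<Lambda> v v'"
  show "MCmp V z b (VCmp V z a b u w) (cmp_row V z a b w u gs) \<Lambda> v v' \<kappa>
        = MCmp V z a w (concat (map snd gs)) \<Lambda>
            (VCmp V a b (hsrc \<Lambda>) v u)
            (VCmp V (hend a (tops (map fst gs))) (hend b (bots (map fst gs))) (htgt \<Lambda>)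
              v' (rvert u (map fst gs)))
            (MCmp V a b u (map fst gs) \<Lambda> v v' \<kappa>)"
    using pasted_cmp_row[OF r1 r2 gs] row_pasted[OF r1] row_pasted[OF r2] LL_bdryD[OF b] \<kappa>
    by (simp only: LL_sel) (simp add: K.hc_assoc)
qed (auto simp: LL_VHom VObD K.id1 F1_id_app K.cmp1_id_left K.cmp1_id_right K.cmp1_assoc LL_hmor K.id2)

lemma large_LL:
  assumes K: "large_two_cat U2 K" and U2: "grothendieck_universe U2" and U: "U \<in> elts U2"
  shows "large_vdc U2 V"
proof -
  have Ob: "set_in U2 (Ob K)" and Hom1: "\<And>A B. A \<in> Ob K \<Longrightarrow> B \<in> Ob K \<Longrightarrow> set_in U2 (Hom1 K A B)"
    and Hom2: "\<And>A B f g. A \<in> Ob K \<Longrightarrow> B \<in> Ob K \<Longrightarrow> f \<in> Hom1 K A B \<Longrightarrow> g \<in> Hom1 K A B \<Longrightarrow> set_in U2 (Hom2 K A B f g)"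
    using K unfolding large_two_cat_def by blast+
  have "set_in U2 (elts (Fo F A))" if "A \<in> Ob K" for A
    using F.fo[OF that] universe_transitive[OF U2 U] by (intro set_in_elts[OF U2]) auto
  then have "set_in U2 {vpair A x | A x. A \<in> Ob K \<and> x \<in> elts (Fo F A)}"
    by (intro set_in_Sigma[OF U2] Ob)
  then have 1: "set_in U2 (VOb V)" by (simp add: LL_def)
  have 2: "set_in U2 (VHom V p q)" if "p \<in> VOb V" "q \<in> VOb V" for p q
    by (rule set_in_subset[OF U2 Hom1[of "vfst p" "vfst q"]]) (use that in \<open>auto simp: VObD LL_VHom\<close>)
  have 3: "set_in U2 (HHom V p q)" for p q
    by (rule set_in_subset[OF U2 set_in_singleton[OF U2 vempty_in_universe[OF U2]]]) auto
  have 4: "set_in U2 (MCell V p \<Gamma>s \<Delta> f f')" if "is_bdry V p \<Gamma>s \<Delta> f f'" for p \<Gamma>s \<Delta> f f'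
    using LL_bdryD[OF that] by (simp add: Hom2)
  show ?thesis unfolding large_vdc_def using 1 2 3 4 by blast
qed

end

section \<open>The 2-functor to virtual double categories\<close>

text \<open>The action of \<open>L\<close> on a 1-cell \<open>H\<close> over \<open>Set_lc\<close>. The points are not moved, as \<open>H\<close> commutes with the
  projections.\<close>

definition L1 :: "('v::zf, 'v, 'v) two_cat \<Rightarrow> ('v, 'v, 'v, 'v, 'v, 'v) two_fun \<Rightarrow>
    ('v, 'v, 'v, 'v, 'v, 'v) two_fun \<Rightarrow> 'v vd_funv" where
  "L1 K F H = mk_vd_fun (LL K F) (\<lambda>p. vpair (Fo H (vfst p)) (vsnd p)) (\<lambda>p q f. F1 H (vfst p) (vfst q) f)
     (\<lambda>p q \<gamma>. vempty) (\<lambda>p \<Gamma>s \<Delta> f f' \<alpha>. F2 H (vfst p) (vfst (hsrc \<Delta>)) f f' \<alpha>)"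

text \<open>The action of \<open>L\<close> on a 2-cell over \<open>Set_lc\<close>. Its components may serve as vertical morphisms between
  pointed objects, as they lie over identity functions.\<close>

definition L2 :: "('v::zf, 'v, 'v) two_cat \<Rightarrow> ('v, 'v, 'v, 'v, 'v, 'v) two_fun \<Rightarrow> ('v, 'v, 'v) two_cat \<Rightarrow>
    ('v, 'v, 'v, 'v, 'v, 'v) two_fun \<Rightarrow> ('v, 'v, 'v, 'v, 'v, 'v) two_fun \<Rightarrow> ('v \<Rightarrow> 'v) \<Rightarrow> 'v vtransv" where
  "L2 K F L H H' \<sigma> = mk_vtrans (LL K F) (\<lambda>p. \<sigma> (vfst p))
     (\<lambda>\<Gamma>. Id2 L (Fo H (vfst (hsrc \<Gamma>))) (Fo H' (vfst (hsrc \<Gamma>))) (\<sigma> (vfst (hsrc \<Gamma>))))"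

lemma L1_sel [simp]:
  "p \<in> VOb (LL K F) \<Longrightarrow> Go (L1 K F H) p = vpair (Fo H (vfst p)) (vsnd p)"
  "p \<in> VOb (LL K F) \<Longrightarrow> q \<in> VOb (LL K F) \<Longrightarrow> f \<in> VHom (LL K F) p q \<Longrightarrow> GV (L1 K F H) p q f = F1 H (vfst p) (vfst q) f"
  "p \<in> VOb (LL K F) \<Longrightarrow> q \<in> VOb (LL K F) \<Longrightarrow> \<gamma> \<in> HHom (LL K F) p q \<Longrightarrow> GH (L1 K F H) p q \<gamma> = vempty"
  "is_bdry (LL K F) p \<Gamma>s \<Delta> f f' \<Longrightarrow> \<alpha> \<in> MCell (LL K F) p \<Gamma>s \<Delta> f f' \<Longrightarrow>
    GM (L1 K F H) p \<Gamma>s \<Delta> f f' \<alpha> = F2 H (vfst p) (vfst (hsrc \<Delta>)) f f' \<alpha>"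
  unfolding L1_def by simp_all

lemma L2_sel [simp]:
  "p \<in> VOb (LL K F) \<Longrightarrow> TV (L2 K F L H H' \<sigma>) p = \<sigma> (vfst p)"
  "is_hmor (LL K F) \<Gamma> \<Longrightarrow> TC (L2 K F L H H' \<sigma>) \<Gamma>
    = Id2 L (Fo H (vfst (hsrc \<Gamma>))) (Fo H' (vfst (hsrc \<Gamma>))) (\<sigma> (vfst (hsrc \<Gamma>)))"
  unfolding L2_def by simp_all

lemma L2_normal: "mk_vtrans (LL K F) (TV (L2 K F L H H' \<sigma>)) (TC (L2 K F L H H' \<sigma>)) = L2 K F L H H' \<sigma>"
  unfolding L2_def by simp

locale set_functor_morphism = K: set_functor K U F + L: set_functor L U G + two_functor K L H
  for K L :: "('v::zf, 'v, 'v) two_cat" and U :: 'v and F G H :: "('v, 'v, 'v, 'v, 'v, 'v) two_fun" +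
  assumes over: "cmp_two_fun K G H = F"
begin

lemma over_Fo: "A \<in> Ob K \<Longrightarrow> Fo G (Fo H A) = Fo F A"
  using cmp_two_fun_sel(1)[of A K G H] by (simp add: over)

lemma over_F1: "\<lbrakk>A \<in> Ob K; B \<in> Ob K; f \<in> Hom1 K A B\<rbrakk> \<Longrightarrow> F1 G (Fo H A) (Fo H B) (F1 H A B f) = F1 F A B f"
  using cmp_two_fun_sel(2)[of A K B f G H] by (simp add: over)

lemma L1_ob: "p \<in> VOb K.V \<Longrightarrow> Go (L1 K F H) p \<in> VOb L.V"
  by (simp add: fo over_Fo K.VObD)

lemma pasted_L1:
  "row K.V p q f bs \<Longrightarrow> pasted L (Fo H (vfst p)) (Fo H (vfst q)) (F1 H (vfst p) (vfst q) f) (map_row (L1 K F H) p f bs)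
    = F2 H (vfst p) (vfst q) f (rvert f bs) (pasted K (vfst p) (vfst q) f bs) \<and>
   rvert (F1 H (vfst p) (vfst q) f) (map_row (L1 K F H) p f bs) = F1 H (vfst p) (vfst q) (rvert f bs)"
proof (induction bs arbitrary: p q f)
  case Nil
  then show ?case by (simp add: f2_id K.VObD K.LL_VHom)
next
  case (Cons B bs)
  then have B: "is_bdry K.V p (btop B) (bbot B) f (bvert B)" "hsrc (bbot B) = q"
    "bcell B \<in> MCell K.V p (btop B) (bbot B) f (bvert B)"
    "row K.V (hend p (btop B)) (htgt (bbot B)) (bvert B) bs" by (simp_all del: K.LL_sel)
  show ?case
    using Cons.IH[OF B(4)] K.LL_bdryD[OF B(1)] B K.row_pasted[OF B(4)] is_bdryD[OF B(1)]
    by (simp add: K.pasted_Cons f2_vc)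
qed

lemma virtual_double_functor_L1: "virtual_double_functor K.V L.V (L1 K F H)"
proof
  show "L1 K F H = mk_vd_fun K.V (Go (L1 K F H)) (GV (L1 K F H)) (GH (L1 K F H)) (GM (L1 K F H))"
    unfolding L1_def by simp
next
  fix a b u bs \<Lambda> v v' \<kappa>
  assume r: "row K.V a b u bs" and b: "is_bdry K.V b (bots bs) \<Lambda> v v'" and \<kappa>: "\<kappa> \<in> MCell K.V b (bots bs) \<Lambda> v v'"
  interpret V: virtual_double_category K.V by (rule K.virtual_double_category_LL)
  show "GM (L1 K F H) a (tops bs) \<Lambda> (VCmp K.V a b (hsrc \<Lambda>) v u)
      (VCmp K.V (hend a (tops bs)) (hend b (bots bs)) (htgt \<Lambda>) v' (rvert u bs)) (MCmp K.V a b u bs \<Lambda> v v' \<kappa>)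
    = MCmp L.V (Go (L1 K F H) a) (Go (L1 K F H) b) (GV (L1 K F H) a b u) (map_row (L1 K F H) a u bs) (hmap (L1 K F H) \<Lambda>)
      (GV (L1 K F H) b (hsrc \<Lambda>) v) (GV (L1 K F H) (hend b (bots bs)) (htgt \<Lambda>) v') (GM (L1 K F H) b (bots bs) \<Lambda> v v' \<kappa>)"
    using V.bdry_cmp[OF r b] V.mcmp[OF r b \<kappa>] b \<kappa> K.row_pasted[OF r] K.LL_bdryD[OF b] is_bdryD[OF b]
      row_start[OF r] pasted_L1[OF r]
    by (simp add: f2_hc)
next
  fix a \<Gamma>s \<Delta> u u' \<theta> assume b: "is_bdry K.V a \<Gamma>s \<Delta> u u'" and \<theta>: "\<theta> \<in> MCell K.V a \<Gamma>s \<Delta> u u'"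
  show "GM (L1 K F H) a \<Gamma>s \<Delta> u u' \<theta> \<in> MCell L.V (Go (L1 K F H) a) (map (hmap (L1 K F H)) \<Gamma>s) (hmap (L1 K F H) \<Delta>)
            (GV (L1 K F H) a (hsrc \<Delta>) u) (GV (L1 K F H) (hend a \<Gamma>s) (htgt \<Delta>) u')"
    using b \<theta> K.LL_bdryD[OF b] is_bdryD[OF b] by (simp add: f2)
next
  fix \<Gamma> assume \<Gamma>: "is_hmor K.V \<Gamma>"
  interpret V: virtual_double_category K.V by (rule K.virtual_double_category_LL)
  have "is_bdry K.V (hsrc \<Gamma>) [\<Gamma>] \<Gamma> (VId K.V (hsrc \<Gamma>)) (VId K.V (htgt \<Gamma>))"
    using \<Gamma> V.vid[OF is_hmorD(1)[OF \<Gamma>]] V.vid[OF is_hmorD(2)[OF \<Gamma>]] is_hmorD[OF \<Gamma>]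
    by (simp add: is_bdry_def del: K.LL_sel)
  from L1_sel(4)[OF this V.mid[OF \<Gamma>]] show "GM (L1 K F H) (hsrc \<Gamma>) [\<Gamma>] \<Gamma> (VId K.V (hsrc \<Gamma>)) (VId K.V (htgt \<Gamma>)) (MId K.V \<Gamma>)
    = MId L.V (hmap (L1 K F H) \<Gamma>)"
    using \<Gamma> by (simp add: K.LL_hmor K.VObD f2_id f1_id K.K.id1)
next
  fix a b u assume "a \<in> VOb K.V" "b \<in> VOb K.V" "u \<in> VHom K.V a b"
  then show "GV (L1 K F H) a b u \<in> VHom L.V (Go (L1 K F H) a) (Go (L1 K F H) b)"
    by (simp add: K.LL_VHom L.LL_VHom K.VObD f1 over_F1)
next
  fix a assume "a \<in> VOb K.V"
  then show "GV (L1 K F H) a a (VId K.V a) = VId L.V (Go (L1 K F H) a)"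
    by (subst L1_sel(2)) (simp_all add: K.LL_VHom K.VObD K.K.id1 K.F1_id_app f1_id)
next
  fix a b c u v assume *: "a \<in> VOb K.V" "b \<in> VOb K.V" "c \<in> VOb K.V" "u \<in> VHom K.V a b" "v \<in> VHom K.V b c"
  interpret V: virtual_double_category K.V by (rule K.virtual_double_category_LL)
  show "GV (L1 K F H) a c (VCmp K.V a b c v u) = VCmp L.V (Go (L1 K F H) a) (Go (L1 K F H) b) (Go (L1 K F H) c)
      (GV (L1 K F H) b c v) (GV (L1 K F H) a b u)"
    using * V.vcmp[OF *] by (simp add: K.LL_VHom K.VObD f1_cmp)
next
  fix a b \<gamma> assume "a \<in> VOb K.V" "b \<in> VOb K.V" "\<gamma> \<in> HHom K.V a b"
  then show "GH (L1 K F H) a b \<gamma> \<in> HHom L.V (Go (L1 K F H) a) (Go (L1 K F H) b)" by simp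
qed (rule L1_ob)

end

text \<open>The row of components of the transformation consists of identity 2-cells, so that the naturality law
  for multicells reduces to the 2-dimensional naturality of \<open>\<sigma>\<close>.\<close>

lemma vertical_transformation_L2:
  assumes H: "set_functor_morphism K L U F G H" and H': "set_functor_morphism K L U F G H'"
    and \<sigma>: "two_nat K L H H' \<sigma>"
    and over: "\<forall>A \<in> Ob K. \<forall>x \<in> elts (Fo F A). vapp (F1 G (Fo H A) (Fo H' A) (\<sigma> A)) x = x"
  shows "vertical_transformation (LL K F) (LL L G) (L1 K F H) (L1 K F H') (L2 K F L H H' \<sigma>)"
proof -
  interpret H: set_functor_morphism K L U F G H by fact
  interpret H': set_functor_morphism K L U F G H' by fact
  interpret \<sigma>: two_nat K L H H' \<sigma> by fact
  let ?c = "L2 K F L H H' \<sigma>"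
  note [simp] = H.fo H'.fo \<sigma>.comp H.f1 H'.f1 H.f2 H'.f2 H.K.VObD H.L.K.id2
  show ?thesis
  proof
    fix a \<Gamma>s \<Delta> u u' \<theta> assume b: "is_bdry (LL K F) a \<Gamma>s \<Delta> u u'" and \<theta>: "\<theta> \<in> MCell (LL K F) a \<Gamma>s \<Delta> u u'"
    note d = H.K.LL_bdryD[OF b] is_bdryD[OF b]
    have "rvert (TV ?c a) (trans_row (L1 K F H) (L1 K F H') ?c \<Gamma>s) = TV ?c (hend a \<Gamma>s)" by simp
    moreover have "hpath (LL K F) a \<Gamma>s \<Longrightarrow> pasted L (Fo H (vfst a)) (Fo H' (vfst a)) (\<sigma> (vfst a))
        (trans_row (L1 K F H) (L1 K F H') ?c \<Gamma>s) = Id2 L (Fo H (vfst a)) (Fo H' (vfst a)) (\<sigma> (vfst a))" for a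
    proof (induction \<Gamma>s arbitrary: a)
      case (Cons \<Gamma> \<Gamma>s)
      then have "rvert (\<sigma> (vfst (hsrc \<Gamma>))) (trans_row (L1 K F H) (L1 K F H') ?c \<Gamma>s) = \<sigma> (vfst (hsrc \<Gamma>))"
        using rvert_trans_row[of ?c "htgt \<Gamma>" "L1 K F H" "L1 K F H'" \<Gamma>s] H.K.vfst_hend[of "htgt \<Gamma>" \<Gamma>s]
        by (simp add: H.K.LL_hmor hpath_start hpath_hend)
      then show ?case using Cons.IH[of "htgt \<Gamma>"] Cons.prems by (auto simp: H.K.LL_hmor H.L.K.vc_id_left)
    qed simp
    ultimately show "MCmp (LL L G) (Go (L1 K F H) a) (Go (L1 K F H) (hsrc \<Delta>)) (GV (L1 K F H) a (hsrc \<Delta>) u)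
            [Block (map (hmap (L1 K F H)) \<Gamma>s) (GM (L1 K F H) a \<Gamma>s \<Delta> u u' \<theta>) (hmap (L1 K F H) \<Delta>)
               (GV (L1 K F H) (hend a \<Gamma>s) (htgt \<Delta>) u')]
            (hmap (L1 K F H') \<Delta>) (TV ?c (hsrc \<Delta>)) (TV ?c (htgt \<Delta>)) (TC ?c \<Delta>)
        = MCmp (LL L G) (Go (L1 K F H) a) (Go (L1 K F H') a) (TV ?c a)
            (trans_row (L1 K F H) (L1 K F H') ?c \<Gamma>s)
            (hmap (L1 K F H') \<Delta>) (GV (L1 K F H') a (hsrc \<Delta>) u) (GV (L1 K F H') (hend a \<Gamma>s) (htgt \<Delta>) u')
            (GM (L1 K F H') a \<Gamma>s \<Delta> u u' \<theta>)"
      using b \<theta> d \<sigma>.nat2[of "vfst a" "vfst (hsrc \<Delta>)" u u' \<theta>] by (simp add: H.L.K.vc_id_left)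
  next
    show "?c = mk_vtrans (LL K F) (TV ?c) (TC ?c)" by (simp add: L2_normal)
  next
    fix a assume "a \<in> VOb (LL K F)"
    then show "TV ?c a \<in> VHom (LL L G) (Go (L1 K F H) a) (Go (L1 K F H') a)"
      using over by (simp add: H.L.LL_VHom)
  next
    fix a b u assume "a \<in> VOb (LL K F)" "b \<in> VOb (LL K F)" "u \<in> VHom (LL K F) a b"
    then show "VCmp (LL L G) (Go (L1 K F H) a) (Go (L1 K F H) b) (Go (L1 K F H') b) (TV ?c b) (GV (L1 K F H) a b u)
        = VCmp (LL L G) (Go (L1 K F H) a) (Go (L1 K F H') a) (Go (L1 K F H') b) (GV (L1 K F H') a b u) (TV ?c a)"
      by (simp add: H.K.LL_VHom \<sigma>.nat1)
  next
    fix \<Gamma> assume "is_hmor (LL K F) \<Gamma>"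
    then show "TC ?c \<Gamma> \<in> MCell (LL L G) (Go (L1 K F H) (hsrc \<Gamma>)) [hmap (L1 K F H) \<Gamma>] (hmap (L1 K F H') \<Gamma>)
                (TV ?c (hsrc \<Gamma>)) (TV ?c (htgt \<Gamma>))"
      by (simp add: H.K.LL_hmor)
  qed
qed

definition L_functor :: "'v::zf \<Rightarrow> 'v \<Rightarrow>
   (('v, 'v, 'v) two_cat \<times> ('v, 'v, 'v, 'v, 'v, 'v) two_fun, ('v, 'v, 'v, 'v, 'v, 'v) two_fun, 'v \<Rightarrow> 'v,
    'v vdcv, 'v vd_funv, 'v vtransv) two_fun" where
  "L_functor U1 U2 = mk_two_fun (slice (two_CAT U2) (Set_lc U1)) (\<lambda>(K, F). LL K F)
     (\<lambda>(K, F) (L, G) H. L1 K F H) (\<lambda>(K, F) (L, G) H H' \<sigma>. L2 K F L H H' \<sigma>)"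

lemma set_functorI: "(K, F) \<in> Ob (slice (two_CAT U2) (Set_lc U1)) \<Longrightarrow> set_functor K U1 F"
  by (simp add: set_functor_def)

lemma set_functor_morphismI:
  "\<lbrakk>(K, F) \<in> Ob (slice (two_CAT U2) (Set_lc U1)); (L, G) \<in> Ob (slice (two_CAT U2) (Set_lc U1));
    H \<in> Hom1 (slice (two_CAT U2) (Set_lc U1)) (K, F) (L, G)\<rbrakk> \<Longrightarrow> set_functor_morphism K L U1 F G H"
  by (simp add: set_functor_morphism_def set_functor_morphism_axioms_def set_functor_def)

theorem two_functor_L:
  assumes U2: "grothendieck_universe U2" and U1: "U1 \<in> elts U2"
  shows "two_functor (slice (two_CAT U2) (Set_lc U1)) (VDBL U2) (L_functor U1 U2)"
    (is "two_functor ?S _ ?L")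
proof (unfold_locales)
  show "?L = mk_two_fun ?S (Fo ?L) (F1 ?L) (F2 ?L)" unfolding L_functor_def by simp
  have S: "two_category ?S"
    by (intro two_category_slice two_category_two_CAT Set_lc_in_two_CAT U2 U1)
  have Fo: "Fo ?L (K, F) = LL K F" if "(K, F) \<in> Ob ?S" for K F
    using that by (simp add: L_functor_def del: slice_sel)
  have F1: "F1 ?L (K, F) (L, G) H = L1 K F H"
    if "(K, F) \<in> Ob ?S" "(L, G) \<in> Ob ?S" "H \<in> Hom1 ?S (K, F) (L, G)" for K F L G H
    using that by (simp add: L_functor_def del: slice_sel)
  have F2: "F2 ?L (K, F) (L, G) H H' \<sigma> = L2 K F L H H' \<sigma>"
    if "(K, F) \<in> Ob ?S" "(L, G) \<in> Ob ?S" "H \<in> Hom1 ?S (K, F) (L, G)" "H' \<in> Hom1 ?S (K, F) (L, G)"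
      "\<sigma> \<in> Hom2 ?S (K, F) (L, G) H H'" for K F L G H H' \<sigma>
    using that by (simp add: L_functor_def del: slice_sel)
  have f1: "virtual_double_functor (LL K F) (LL L G) (L1 K F H)"
    if "(K, F) \<in> Ob ?S" "(L, G) \<in> Ob ?S" "H \<in> Hom1 ?S (K, F) (L, G)" for K F L G H
    by (rule set_functor_morphism.virtual_double_functor_L1[OF set_functor_morphismI[OF that]])
  {
    fix P assume P: "P \<in> Ob ?S"
    obtain K F where KF: "P = (K, F)" by (cases P)
    note P = P[unfolded KF]
    interpret K: set_functor K U1 F by (rule set_functorI[OF P])
    show "Fo ?L P \<in> Ob (VDBL U2)"
      using P K.virtual_double_category_LL K.large_LL[OF _ U2 U1] by (simp add: KF Fo[OF P])
    show "F1 ?L P P (Id1 ?S P) = Id1 (VDBL U2) (Fo ?L P)"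
    proof -
      have i: "id_two_fun K \<in> Hom1 ?S (K, F) (K, F)"
        using two_category.id1[OF S P] by simp
      show ?thesis
        unfolding KF Fo[OF P] slice_sel(4) two_CAT_sel VDBL_sel F1[OF P P i]
      proof (rule virtual_double_functor_eqI[OF f1[OF P P i] virtual_double_functor_id[OF K.virtual_double_category_LL]])
        fix a \<Gamma>s \<Delta> u u' \<theta> assume b: "is_bdry K.V a \<Gamma>s \<Delta> u u'" "\<theta> \<in> MCell K.V a \<Gamma>s \<Delta> u u'"
        show "GM (L1 K F (id_two_fun K)) a \<Gamma>s \<Delta> u u' \<theta> = GM (id_vd_fun K.V) a \<Gamma>s \<Delta> u u' \<theta>"
          using b K.LL_bdryD[OF b(1)] by simp
      qed (auto simp: K.VObD K.LL_VHom K.LL_VOb[symmetric] dest: K.LL_VOb[THEN iffD1])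
    qed
    fix Q H assume Q: "Q \<in> Ob ?S" and H: "H \<in> Hom1 ?S P Q"
    obtain L G where LG: "Q = (L, G)" by (cases Q)
    note Q = Q[unfolded LG] and H = H[unfolded LG KF]
    interpret H: set_functor_morphism K L U1 F G H by (rule set_functor_morphismI[OF P Q H])
    show "F1 ?L P Q H \<in> Hom1 (VDBL U2) (Fo ?L P) (Fo ?L Q)"
      using f1[OF P Q H] by (simp add: KF LG Fo[OF P] Fo[OF Q] F1[OF P Q H])
    show "F2 ?L P Q H H (Id2 ?S P Q H) = Id2 (VDBL U2) (Fo ?L P) (Fo ?L Q) (F1 ?L P Q H)"
      unfolding KF LG Fo[OF P] Fo[OF Q] F1[OF P Q H] F2[OF P Q H H two_category.id2[OF S P Q H]]
      by (simp, rule vtrans_eqI[where A = "K.V"])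
        (simp_all add: L2_normal K.VObD K.LL_hmor)
    fix H' assume H': "H' \<in> Hom1 ?S P Q"
    note H' = H'[unfolded KF LG]
    interpret H': set_functor_morphism K L U1 F G H' by (rule set_functor_morphismI[OF P Q H'])
    {
      fix \<sigma> assume \<sigma>: "\<sigma> \<in> Hom2 ?S P Q H H'"
      note \<sigma> = \<sigma>[unfolded KF LG]
      then have \<sigma>': "two_nat K L H H' \<sigma>" by simp
      interpret \<sigma>: two_nat K L H H' \<sigma> by fact
      have over: "\<forall>A \<in> Ob K. \<forall>x \<in> elts (Fo F A). vapp (F1 G (Fo H A) (Fo H' A) (\<sigma> A)) x = x"
        using \<sigma> two_nat_over_Set_lc_iff[OF H.two_functor_axioms H'.two_functor_axioms \<sigma>' H.L.F.two_functor_axioms H.over H'.over]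
        unfolding slice_sel by blast
      show "F2 ?L P Q H H' \<sigma> \<in> Hom2 (VDBL U2) (Fo ?L P) (Fo ?L Q) (F1 ?L P Q H) (F1 ?L P Q H')"
        unfolding KF LG Fo[OF P] Fo[OF Q] F1[OF P Q H] F1[OF P Q H'] F2[OF P Q H H' \<sigma>] VDBL_sel mem_Collect_eq
        by (rule vertical_transformation_L2[OF H.set_functor_morphism_axioms H'.set_functor_morphism_axioms \<sigma>' over])
      note [simp] = H.fo H'.fo \<sigma>.comp K.VObD H.L.K.id2 H.L.K.id1
      fix H'' \<tau> assume H'': "H'' \<in> Hom1 ?S P Q" and \<tau>: "\<tau> \<in> Hom2 ?S P Q H' H''"
      note H'' = H''[unfolded KF LG] and \<tau> = \<tau>[unfolded KF LG]
      then interpret H'': two_functor K L H'' by simp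
      interpret \<tau>: two_nat K L H' H'' \<tau> using \<tau> by simp
      note [simp] = H''.fo \<tau>.comp
      show "F2 ?L P Q H H'' (Vc ?S P Q H H' H'' \<tau> \<sigma>)
        = Vc (VDBL U2) (Fo ?L P) (Fo ?L Q) (F1 ?L P Q H) (F1 ?L P Q H') (F1 ?L P Q H'') (F2 ?L P Q H' H'' \<tau>) (F2 ?L P Q H H' \<sigma>)"
        unfolding KF LG Fo[OF P] Fo[OF Q] F1[OF P Q H] F1[OF P Q H'] F1[OF P Q H''] F2[OF P Q H H' \<sigma>] F2[OF P Q H' H'' \<tau>]
          F2[OF P Q H H'' two_category.vc[OF S P Q H H' H'' \<sigma> \<tau>]]
        by (rule vtrans_eqI[where A = "K.V"])
          (simp_all add: L2_normal K.LL_hmor H.L.K.vc_id_left H.L.K.hc_id2)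
    next
      fix R J assume R: "R \<in> Ob ?S" and J: "J \<in> Hom1 ?S Q R"
      obtain M E where ME: "R = (M, E)" by (cases R)
      note R = R[unfolded ME] and J = J[unfolded ME LG]
      interpret J: set_functor_morphism L M U1 G E J by (rule set_functor_morphismI[OF Q R J])
      note JH = two_category.cmp1[OF S P Q R H J]
      have JH': "cmp_two_fun K J H \<in> Hom1 ?S (K, F) (M, E)" using JH by simp
      show "F1 ?L P R (Cmp1 ?S P Q R J H) = Cmp1 (VDBL U2) (Fo ?L P) (Fo ?L Q) (Fo ?L R) (F1 ?L Q R J) (F1 ?L P Q H)"
        unfolding KF LG ME Fo[OF P] Fo[OF Q] Fo[OF R] F1[OF P Q H] F1[OF Q R J] slice_sel(5) two_CAT_sel VDBL_sel F1[OF P R JH']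
      proof (rule virtual_double_functor_eqI[OF f1[OF P R JH'] virtual_double_functor_cmp[OF K.virtual_double_category_LL f1[OF P Q H] f1[OF Q R J]]])
        interpret h: virtual_double_functor "LL K F" "LL L G" "L1 K F H" by (rule f1[OF P Q H])
        fix a assume "a \<in> VOb K.V"
        then show "Go (L1 K F (cmp_two_fun K J H)) a = Go (cmp_vd_fun K.V (L1 L G J) (L1 K F H)) a"
          using h.go[of a] by (simp add: K.VObD)
        fix b assume "b \<in> VOb K.V"
        {
          fix u assume "u \<in> VHom K.V a b"
          then show "GV (L1 K F (cmp_two_fun K J H)) a b u = GV (cmp_vd_fun K.V (L1 L G J) (L1 K F H)) a b u"
            using h.go[of a] h.go[of b] h.gv[of a b u] \<open>a \<in> VOb K.V\<close> \<open>b \<in> VOb K.V\<close> by (simp add: K.VObD K.LL_VHom)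
        next
          fix \<gamma> assume "\<gamma> \<in> HHom K.V a b"
          then show "GH (L1 K F (cmp_two_fun K J H)) a b \<gamma> = GH (cmp_vd_fun K.V (L1 L G J) (L1 K F H)) a b \<gamma>"
            using h.go[of a] h.go[of b] h.gh[of a b \<gamma>] \<open>a \<in> VOb K.V\<close> \<open>b \<in> VOb K.V\<close> by simp
        }
      next
        interpret h: virtual_double_functor "LL K F" "LL L G" "L1 K F H" by (rule f1[OF P Q H])
        fix a \<Gamma>s \<Delta> u u' \<theta> assume b: "is_bdry K.V a \<Gamma>s \<Delta> u u'" "\<theta> \<in> MCell K.V a \<Gamma>s \<Delta> u u'"
        show "GM (L1 K F (cmp_two_fun K J H)) a \<Gamma>s \<Delta> u u' \<theta> = GM (cmp_vd_fun K.V (L1 L G J) (L1 K F H)) a \<Gamma>s \<Delta> u u' \<theta>"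
          using h.bdry[OF b(1)] h.gm[OF b] b K.LL_bdryD[OF b(1)] is_bdryD[OF b(1)] by simp
      qed
      fix J' \<sigma> \<tau> assume J': "J' \<in> Hom1 ?S Q R" and \<sigma>: "\<sigma> \<in> Hom2 ?S P Q H H'" and \<tau>: "\<tau> \<in> Hom2 ?S Q R J J'"
      note J' = J'[unfolded LG ME] and \<sigma> = \<sigma>[unfolded KF LG] and \<tau> = \<tau>[unfolded LG ME]
      interpret J': set_functor_morphism L M U1 G E J' by (rule set_functor_morphismI[OF Q R J'])
      interpret \<sigma>: two_nat K L H H' \<sigma> using \<sigma> by simp
      interpret \<tau>: two_nat L M J J' \<tau> using \<tau> by simp
      interpret s: vertical_transformation "LL K F" "LL L G" "L1 K F H" "L1 K F H'" "L2 K F L H H' \<sigma>"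
        using \<sigma> two_nat_over_Set_lc_iff[OF H.two_functor_axioms H'.two_functor_axioms \<sigma>.two_nat_axioms H.L.F.two_functor_axioms H.over H'.over]
        unfolding slice_sel by (intro vertical_transformation_L2[OF H.set_functor_morphism_axioms H'.set_functor_morphism_axioms \<sigma>.two_nat_axioms]) blast
      interpret h: virtual_double_functor "LL K F" "LL L G" "L1 K F H" by (rule f1[OF P Q H])
      interpret h': virtual_double_functor "LL K F" "LL L G" "L1 K F H'" by (rule f1[OF P Q H'])
      note [simp] = H.fo H'.fo \<sigma>.comp K.VObD H.L.K.id2 H.L.K.id1 J.fo J'.fo \<tau>.comp J.f1
      have 1: "GV (L1 L G J) (vpair (Fo H A) x) (vpair (Fo H' A) x) (\<sigma> A) = F1 J (Fo H A) (Fo H' A) (\<sigma> A)"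
        if "vpair A x \<in> VOb K.V" for A x
        using h.go[OF that] h'.go[OF that] s.tv[OF that] that by simp
      show "F2 ?L P R (Cmp1 ?S P Q R J H) (Cmp1 ?S P Q R J' H') (Hc ?S P Q R H H' J J' \<tau> \<sigma>)
        = Hc (VDBL U2) (Fo ?L P) (Fo ?L Q) (Fo ?L R) (F1 ?L P Q H) (F1 ?L P Q H') (F1 ?L Q R J) (F1 ?L Q R J')
            (F2 ?L Q R J J' \<tau>) (F2 ?L P Q H H' \<sigma>)"
        unfolding KF LG ME Fo[OF P] Fo[OF Q] Fo[OF R] F1[OF P Q H] F1[OF P Q H'] F1[OF Q R J] F1[OF Q R J']
          F2[OF P Q H H' \<sigma>] F2[OF Q R J J' \<tau>]
          F2[OF P R JH two_category.cmp1[OF S P Q R H' J'] two_category.hc[OF S P Q R H H' J J' \<sigma> \<tau>]]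
      proof (rule vtrans_eqI[where A = "K.V"])
        fix a assume a: "a \<in> VOb K.V"
        then show "TV (L2 K F M (Cmp1 ?S (K, F) (L, G) (M, E) J H) (Cmp1 ?S (K, F) (L, G) (M, E) J' H')
            (Hc ?S (K, F) (L, G) (M, E) H H' J J' \<tau> \<sigma>)) a
          = TV (Hc (VDBL U2) K.V (LL L G) (LL M E) (L1 K F H) (L1 K F H') (L1 L G J) (L1 L G J') (L2 L G M J J' \<tau>) (L2 K F L H H' \<sigma>)) a"
          using h.go[OF a] h'.go[OF a] s.tv[OF a] by (simp add: VDBL_Hc_sel)
      next
        fix \<Gamma> assume \<Gamma>: "is_hmor K.V \<Gamma>"
        then show "TC (L2 K F M (Cmp1 ?S (K, F) (L, G) (M, E) J H) (Cmp1 ?S (K, F) (L, G) (M, E) J' H')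
            (Hc ?S (K, F) (L, G) (M, E) H H' J J' \<tau> \<sigma>)) \<Gamma>
          = TC (Hc (VDBL U2) K.V (LL L G) (LL M E) (L1 K F H) (L1 K F H') (L1 L G J) (L1 L G J') (L2 L G M J J' \<tau>) (L2 K F L H H' \<sigma>)) \<Gamma>"
          using h.go[of "hsrc \<Gamma>"] h'.go[of "hsrc \<Gamma>"] h.go[of "htgt \<Gamma>"] h'.go[of "htgt \<Gamma>"] s.tv[of "hsrc \<Gamma>"] s.tv[of "htgt \<Gamma>"]
            s.tc[OF \<Gamma>] h'.hmor[OF \<Gamma>]
            s.tc_bdry[OF h.virtual_double_functor_axioms h'.virtual_double_functor_axioms \<Gamma>] is_hmorD[OF \<Gamma>]
          by (simp add: VDBL_Hc_sel K.LL_hmor J.f2_id J.L.K.vc_id_left J.L.K.hc_id2 J.L.K.id2)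
      qed (simp_all add: L2_normal VDBL_def)
    }
  }
qed

section \<open>The unit\<close>

text \<open>The unit turns an object of \<open>K\<close> into an enriched category whose structure consists of identities, a
  1-cell into an enriched functor and a 2-cell into a constant transformation.\<close>

definition eta_ob :: "('v::zf, 'v, 'v) two_cat \<Rightarrow> ('v, 'v, 'v, 'v, 'v, 'v) two_fun \<Rightarrow> 'v \<Rightarrow> 'v" where
  "eta_ob K F A = mk_cat (Fo F A) (\<lambda>x. vpair A x) (\<lambda>x x'. vempty) (\<lambda>x. Id2 K A A (Id1 K A))
     (\<lambda>x x' x''. Id2 K A A (Id1 K A))"

definition eta_mor :: "('v::zf, 'v, 'v) two_cat \<Rightarrow> ('v, 'v, 'v, 'v, 'v, 'v) two_fun \<Rightarrow> 'v \<Rightarrow> 'v \<Rightarrow> 'v \<Rightarrow> 'v" where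
  "eta_mor K F A B f = mk_fun (Fo F A) (\<lambda>x. vapp (F1 F A B f) x) (\<lambda>x. f) (\<lambda>x x'. Id2 K A B f)"

definition eta_nat :: "('v::zf, 'v, 'v, 'v, 'v, 'v) two_fun \<Rightarrow> 'v \<Rightarrow> 'v \<Rightarrow> 'v" where
  "eta_nat F A \<alpha> = vlam (elts (Fo F A)) (\<lambda>x. \<alpha>)"

definition eta :: "('v::zf, 'v, 'v) two_cat \<Rightarrow> ('v, 'v, 'v, 'v, 'v, 'v) two_fun \<Rightarrow> ('v, 'v, 'v, 'v, 'v, 'v) two_fun" where
  "eta K F = mk_two_fun K (eta_ob K F) (eta_mor K F) (\<lambda>A B f g. eta_nat F A)"

lemma eta_ob_sel [simp]:
  "cat_obset (eta_ob K F A) = Fo F A"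
  "x \<in> elts (Fo F A) \<Longrightarrow> ext (eta_ob K F A) x = vpair A x"
  "x \<in> elts (Fo F A) \<Longrightarrow> x' \<in> elts (Fo F A) \<Longrightarrow> cat_hom (eta_ob K F A) x x' = vempty"
  "x \<in> elts (Fo F A) \<Longrightarrow> cat_unit (eta_ob K F A) x = Id2 K A A (Id1 K A)"
  "x \<in> elts (Fo F A) \<Longrightarrow> x' \<in> elts (Fo F A) \<Longrightarrow> x'' \<in> elts (Fo F A) \<Longrightarrow>
    cat_mult (eta_ob K F A) x x' x'' = Id2 K A A (Id1 K A)"
  by (simp_all add: eta_ob_def)

lemma eta_mor_sel [simp]:
  "x \<in> elts (Fo F A) \<Longrightarrow> fun_ob (eta_mor K F A B f) x = vapp (F1 F A B f) x"
  "x \<in> elts (Fo F A) \<Longrightarrow> fun_vert (eta_mor K F A B f) x = f"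
  "x \<in> elts (Fo F A) \<Longrightarrow> x' \<in> elts (Fo F A) \<Longrightarrow> fun_cell (eta_mor K F A B f) x x' = Id2 K A B f"
  "fun_obmap (eta_mor K F A B f) = vlam (elts (Fo F A)) (vapp (F1 F A B f))"
  by (simp_all add: eta_mor_def)

lemma eta_nat_sel [simp]: "x \<in> elts (Fo F A) \<Longrightarrow> vapp (eta_nat F A \<alpha>) x = \<alpha>"
  by (simp add: eta_nat_def)

lemma eta_sel [simp]:
  "A \<in> Ob K \<Longrightarrow> Fo (eta K F) A = eta_ob K F A"
  "A \<in> Ob K \<Longrightarrow> B \<in> Ob K \<Longrightarrow> f \<in> Hom1 K A B \<Longrightarrow> F1 (eta K F) A B f = eta_mor K F A B f"
  "A \<in> Ob K \<Longrightarrow> B \<in> Ob K \<Longrightarrow> f \<in> Hom1 K A B \<Longrightarrow> g \<in> Hom1 K A B \<Longrightarrow> \<alpha> \<in> Hom2 K A B f g \<Longrightarrow>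
    F2 (eta K F) A B f g \<alpha> = eta_nat F A \<alpha>"
  by (simp_all add: eta_def)

context set_functor
begin

lemma enrichment_V: "enrichment V"
  by (simp add: enrichment_def virtual_double_category_LL)

lemma eta_ob: "A \<in> Ob K \<Longrightarrow> eta_ob K F A \<in> enr_cats U V"
proof -
  assume A: "A \<in> Ob K"
  then have "\<exists>X\<in>elts U. \<exists>e h n m. eta_ob K F A = mk_cat X e h n m"
    unfolding eta_ob_def using F.fo[OF A] by simp blast
  then show ?thesis
    unfolding enr_cats_def using A by (simp add: K.id1 K.id2 K.vc_id_left K.hc_id2 K.cmp1_id_left)
qed

lemma eta_mor: "\<lbrakk>A \<in> Ob K; B \<in> Ob K; f \<in> Hom1 K A B\<rbrakk> \<Longrightarrow> eta_mor K F A B f \<in> enr_funs V (eta_ob K F A) (eta_ob K F B)"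
  unfolding enr_funs_def
  by (auto simp: F1_app LL_VHom K.id1 K.id2 K.vc_id_left K.hc_id2 K.cmp1_id_left K.cmp1_id_right eta_mor_def[of K F A B f])

lemma eta_nat: "\<lbrakk>A \<in> Ob K; B \<in> Ob K; f \<in> Hom1 K A B; f' \<in> Hom1 K A B; \<alpha> \<in> Hom2 K A B f f'\<rbrakk> \<Longrightarrow>
    eta_nat F A \<alpha> \<in> enr_nats V (eta_ob K F A) (eta_ob K F B) (eta_mor K F A B f) (eta_mor K F A B f')"
  unfolding enr_nats_def
  by (auto simp: F1_app K.id1 K.id2 K.vc_id_left K.vc_id_right K.hc_id_left eta_nat_def)

lemma eta_mor_cmp:
  assumes "A \<in> Ob K" "B \<in> Ob K" "C \<in> Ob K" "f \<in> Hom1 K A B" "g \<in> Hom1 K B C"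
  shows "eta_mor K F A C (Cmp1 K A B C g f)
    = cmp_fun V (eta_ob K F A) (eta_ob K F B) (eta_ob K F C) (eta_mor K F B C g) (eta_mor K F A B f)"
proof (rule enr_fun_eqI[where X = "Fo F A"])
  fix x x' assume "x \<in> elts (Fo F A)" "x' \<in> elts (Fo F A)"
  then show "fun_cell (eta_mor K F A C (Cmp1 K A B C g f)) x x'
    = fun_cell (cmp_fun V (eta_ob K F A) (eta_ob K F B) (eta_ob K F C) (eta_mor K F B C g) (eta_mor K F A B f)) x x'"
    using assms by (simp add: eapp_def ecmp_def eblock_def F1_app K.vc_id_left K.id2 K.hc_id2)
qed (use assms fun_mk_fun(2)[of V "eta_ob K F A"] in \<open>auto simp: F1_app F1_cmp_app eta_mor_def[of K F A C]\<close>)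

lemma two_functor_eta: "two_functor K (ACat U V) (eta K F)"
proof (unfold_locales; (unfold ACat_sel)?)
  show "eta K F = mk_two_fun K (Fo (eta K F)) (F1 (eta K F)) (F2 (eta K F))"
    unfolding eta_def by simp
next
  fix A assume A: "A \<in> Ob K"
  then show "F1 (eta K F) A A (Id1 K A) = id_fun V (Fo (eta K F) A)"
    by (simp add: K.id1 eta_mor_def id_fun_def) (rule mk_fun_cong; simp add: F1_id_app)
next
  fix A B f assume "A \<in> Ob K" "B \<in> Ob K" "f \<in> Hom1 K A B"
  then show "F2 (eta K F) A B f f (Id2 K A B f) = id_nat V (Fo (eta K F) A) (Fo (eta K F) B) (F1 (eta K F) A B f)"
    by (simp add: K.id2 eta_nat_def id_nat_def)
      (rule vlam_cong; simp add: F1_app K.hc_id2 K.id1 K.cmp1_id_left)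
next
  fix A B f g h \<alpha> \<beta> assume "A \<in> Ob K" "B \<in> Ob K" "f \<in> Hom1 K A B" "g \<in> Hom1 K A B" "h \<in> Hom1 K A B"
    "\<alpha> \<in> Hom2 K A B f g" "\<beta> \<in> Hom2 K A B g h"
  then show "F2 (eta K F) A B f h (Vc K A B f g h \<beta> \<alpha>)
    = vcmp_nat V (Fo (eta K F) A) (Fo (eta K F) B) (F1 (eta K F) A B f) (F1 (eta K F) A B g) (F1 (eta K F) A B h)
        (F2 (eta K F) A B g h \<beta>) (F2 (eta K F) A B f g \<alpha>)"
    by (simp add: K.vc vcmp_nat_def eta_nat_def[of F A "Vc K A B f g h \<beta> \<alpha>"])
      (rule vlam_cong; simp add: F1_app K.hc_id_left K.vc_id_left K.vc)
next
  fix A B C f f' g g' \<alpha> \<beta>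
  assume *: "A \<in> Ob K" "B \<in> Ob K" "C \<in> Ob K" "f \<in> Hom1 K A B" "f' \<in> Hom1 K A B" "g \<in> Hom1 K B C" "g' \<in> Hom1 K B C"
    "\<alpha> \<in> Hom2 K A B f f'" "\<beta> \<in> Hom2 K B C g g'"
  let ?A = "eta_ob K F A" and ?B = "eta_ob K F B" and ?C = "eta_ob K F C"
  let ?f = "eta_mor K F A B f" and ?f' = "eta_mor K F A B f'" and ?g = "eta_mor K F B C g" and ?g' = "eta_mor K F B C g'"
  have "eta_nat F A (Hc K A B C f f' g g' \<beta> \<alpha>)
    = vcmp_nat V ?A ?C (cmp_fun V ?A ?B ?C ?g ?f) (cmp_fun V ?A ?B ?C ?g ?f') (cmp_fun V ?A ?B ?C ?g' ?f')
        (rwhisker V ?A ?B ?C ?f' ?g ?g' (eta_nat F B \<beta>)) (lwhisker V ?A ?B ?C ?f ?f' ?g (eta_nat F A \<alpha>))"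
    (is "?l = ?r")
  proof (rule vlam_extend)
    show "\<exists>t. ?l = vlam (elts (Fo F A)) t" by (auto simp: eta_nat_def)
    show "\<exists>t. ?r = vlam (elts (Fo F A)) t" using nat_vlam(2)[where C = ?A] by simp
    fix x assume "x \<in> elts (Fo F A)"
    moreover have "Vc K A C (Cmp1 K A B C g f) (Cmp1 K A B C g f') (Cmp1 K A B C g' f')
        (Hc K A B C f' f' g g' \<beta> (Id2 K A B f')) (Hc K A B C f f' g g (Id2 K B C g) \<alpha>) = Hc K A B C f f' g g' \<beta> \<alpha>"
      using * K.interchange[of A B C f f' f' g g g' \<alpha> "Id2 K A B f'" "Id2 K B C g" \<beta>]
      by (simp add: K.id2 K.vc_id_left K.vc_id_right)
    ultimately show "vapp ?l x = vapp ?r x"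
      using * by (simp add: vcmp_nat_def lwhisker_def rwhisker_def F1_app K.vc_id_left K.hc K.cmp1 K.id2 K.hc_id_left)
  qed
  then show "F2 (eta K F) A C (Cmp1 K A B C g f) (Cmp1 K A B C g' f') (Hc K A B C f f' g g' \<beta> \<alpha>)
    = vcmp_nat V (Fo (eta K F) A) (Fo (eta K F) C)
        (cmp_fun V (Fo (eta K F) A) (Fo (eta K F) B) (Fo (eta K F) C) (F1 (eta K F) B C g) (F1 (eta K F) A B f))
        (cmp_fun V (Fo (eta K F) A) (Fo (eta K F) B) (Fo (eta K F) C) (F1 (eta K F) B C g) (F1 (eta K F) A B f'))
        (cmp_fun V (Fo (eta K F) A) (Fo (eta K F) B) (Fo (eta K F) C) (F1 (eta K F) B C g') (F1 (eta K F) A B f'))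
        (rwhisker V (Fo (eta K F) A) (Fo (eta K F) B) (Fo (eta K F) C) (F1 (eta K F) A B f') (F1 (eta K F) B C g)
          (F1 (eta K F) B C g') (F2 (eta K F) B C g g' \<beta>))
        (lwhisker V (Fo (eta K F) A) (Fo (eta K F) B) (Fo (eta K F) C) (F1 (eta K F) A B f) (F1 (eta K F) A B f')
          (F1 (eta K F) B C g) (F2 (eta K F) A B f f' \<alpha>))"
    using * by (simp add: K.cmp1 K.hc)
qed (simp_all add: eta_ob eta_mor eta_nat eta_mor_cmp K.cmp1)

text \<open>The unit is a 1-cell of the slice.\<close>

lemma ob_eta: "cmp_two_fun K (ob_functor U V) (eta K F) = F"
proof -
  have "cmp_two_fun K (ob_functor U V) (eta K F) = mk_two_fun K (Fo F) (F1 F) (F2 F)"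
    unfolding cmp_two_fun_def
  proof (rule mk_two_fun_cong)
    fix A B f g \<alpha> assume *: "A \<in> Ob K" "B \<in> Ob K" "f \<in> Hom1 K A B" "g \<in> Hom1 K A B" "\<alpha> \<in> Hom2 K A B f g"
    show "F2 (ob_functor U V) (Fo (eta K F) A) (Fo (eta K F) B) (F1 (eta K F) A B f) (F1 (eta K F) A B g) (F2 (eta K F) A B f g \<alpha>)
      = F2 F A B f g \<alpha>"
      using F.f2[OF *] * by (simp add: ob_functor_def eta_ob eta_mor eta_nat)
  qed (simp_all add: ob_functor_def eta_ob eta_mor F1_vlam)
  then show ?thesis by (simp add: F.normal[symmetric])
qed

end

context set_functor_morphism
begin

lemma eta_natural1:
  "cmp_two_fun K (eta L G) H
    = cmp_two_fun K (Push U K.V (L1 K F H)) (eta K F)"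
  unfolding cmp_two_fun_def
proof (rule mk_two_fun_cong)
  note [simp] = K.eta_ob K.eta_mor K.eta_nat over_Fo over_F1 fo f1 f2
  fix A assume A: "A \<in> Ob K"
  show "Fo (eta L G) (Fo H A) = Fo (Push U K.V (L1 K F H)) (Fo (eta K F) A)"
    using A by (simp add: push_cat_def eta_ob_def[of L])
      (rule mk_cat_cong; simp add: is_bdry_def K.LL_hmor K.LL_VHom K.K.id1 K.K.id2 K.F1_id_app f1_id f2_id)
  fix B f assume B: "B \<in> Ob K" and f: "f \<in> Hom1 K A B"
  show "F1 (eta L G) (Fo H A) (Fo H B) (F1 H A B f)
    = F1 (Push U K.V (L1 K F H)) (Fo (eta K F) A) (Fo (eta K F) B)
        (F1 (eta K F) A B f)"
    using A B f by (simp add: push_fun_def eta_mor_def[of L])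
      (rule mk_fun_cong; simp add: is_bdry_def K.LL_hmor K.LL_VHom K.K.id1 K.K.id2 K.F1_app f2_id)
  fix g \<alpha> assume g: "g \<in> Hom1 K A B" and \<alpha>: "\<alpha> \<in> Hom2 K A B f g"
  show "F2 (eta L G) (Fo H A) (Fo H B) (F1 H A B f) (F1 H A B g) (F2 H A B f g \<alpha>)
    = F2 (Push U K.V (L1 K F H)) (Fo (eta K F) A) (Fo (eta K F) B)
        (F1 (eta K F) A B f) (F1 (eta K F) A B g) (F2 (eta K F) A B f g \<alpha>)"
    using A B f g \<alpha> by (simp add: push_nat_def eta_nat_def[of G])
      (rule vlam_cong; simp add: is_bdry_def K.LL_hmor K.LL_VHom K.F1_app)
qed

end

text \<open>Horizontal composites with identity 2-cells, which occur in the 2-naturality axiom, are whiskerings.\<close>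

lemma two_CAT_Hc_id:
  assumes "two_category M" "two_functor K L F" "two_functor K L F'" "two_functor L M Q" "two_functor L M Q'"
  shows "two_nat K L F F' \<sigma> \<Longrightarrow> Hc (two_CAT U) K L M F F' Q Q (Id2 (two_CAT U) L M Q) \<sigma>
      = (\<lambda>A\<in>Ob K. F1 Q (Fo F A) (Fo F' A) (\<sigma> A))"
    and "two_nat L M Q Q' \<tau> \<Longrightarrow> Hc (two_CAT U) K L M F F Q Q' \<tau> (Id2 (two_CAT U) K L F)
      = (\<lambda>A\<in>Ob K. \<tau> (Fo F A))"
proof -
  interpret M: two_category M by fact
  interpret F: two_functor K L F by fact
  interpret F': two_functor K L F' by fact
  interpret Q: two_functor L M Q by fact
  interpret Q': two_functor L M Q' by fact
  note [simp] = F.fo F'.fo Q.fo Q'.fo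
  {
    assume "two_nat K L F F' \<sigma>"
    then interpret \<sigma>: two_nat K L F F' \<sigma> .
    show "Hc (two_CAT U) K L M F F' Q Q (Id2 (two_CAT U) L M Q) \<sigma> = (\<lambda>A\<in>Ob K. F1 Q (Fo F A) (Fo F' A) (\<sigma> A))"
      by (simp add: \<sigma>.comp Q.f1 M.cmp1_id_left cong: restrict_cong)
  next
    assume "two_nat L M Q Q' \<tau>"
    then interpret \<tau>: two_nat L M Q Q' \<tau> .
    show "Hc (two_CAT U) K L M F F Q Q' \<tau> (Id2 (two_CAT U) K L F) = (\<lambda>A\<in>Ob K. \<tau> (Fo F A))"
      by (simp add: \<tau>.comp Q.f1_id M.cmp1_id_right cong: restrict_cong)
  }
qed

definition eta_transf :: "'v::zf \<Rightarrow> 'v \<Rightarrow> ('v, 'v, 'v) two_cat \<times> ('v, 'v, 'v, 'v, 'v, 'v) two_fun \<Rightarrow>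
    ('v, 'v, 'v, 'v, 'v, 'v) two_fun" where
  "eta_transf U1 U2 = (\<lambda>X\<in>Ob (slice (two_CAT U2) (Set_lc U1)). eta (fst X) (snd X))"

lemma L_functor_sel:
  assumes KF: "(K, F) \<in> Ob (slice (two_CAT U2) (Set_lc U1))"
  shows "Fo (L_functor U1 U2) (K, F) = LL K F"
    "\<lbrakk>(L, G) \<in> Ob (slice (two_CAT U2) (Set_lc U1)); H \<in> Hom1 (slice (two_CAT U2) (Set_lc U1)) (K, F) (L, G)\<rbrakk>
      \<Longrightarrow> F1 (L_functor U1 U2) (K, F) (L, G) H = L1 K F H"
    "\<lbrakk>(L, G) \<in> Ob (slice (two_CAT U2) (Set_lc U1)); H \<in> Hom1 (slice (two_CAT U2) (Set_lc U1)) (K, F) (L, G);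
      H' \<in> Hom1 (slice (two_CAT U2) (Set_lc U1)) (K, F) (L, G);
      \<sigma> \<in> Hom2 (slice (two_CAT U2) (Set_lc U1)) (K, F) (L, G) H H'\<rbrakk>
      \<Longrightarrow> F2 (L_functor U1 U2) (K, F) (L, G) H H' \<sigma> = L2 K F L H H' \<sigma>"
  using KF by (simp_all add: L_functor_def del: slice_sel)

theorem two_nat_eta:
  assumes U2: "grothendieck_universe U2" and U1: "U1 \<in> elts U2"
  shows "two_nat (slice (two_CAT U2) (Set_lc U1)) (slice (two_CAT U2) (Set_lc U1))
    (id_two_fun (slice (two_CAT U2) (Set_lc U1)))
    (cmp_two_fun (slice (two_CAT U2) (Set_lc U1)) (Enr1 U1 U2) (L_functor U1 U2)) (eta_transf U1 U2)"
    (is "two_nat ?S _ _ ?RL _")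
proof (unfold_locales)
  interpret R: two_functor "VDBL U2" ?S "Enr1 U1 U2" by (rule two_functor_Enr1[OF U2 U1])
  interpret L: two_functor ?S "VDBL U2" "L_functor U1 U2" by (rule two_functor_L[OF U2 U1])
  show "eta_transf U1 U2 \<in> extensional (Ob ?S)" unfolding eta_transf_def by simp
  fix X assume X: "X \<in> Ob ?S"
  obtain K F where KF: "X = (K, F)" by (cases X)
  note X = X[unfolded KF]
  interpret K: set_functor K U1 F by (rule set_functorI[OF X])
  have FoX: "Fo ?RL X = (ACat U1 K.V, ob_functor U1 K.V)"
    using X L.fo[OF X] unfolding KF by (simp add: L_functor_sel[OF X] Enr1_sel(1) del: VDBL_sel slice_sel)
  have etaX: "eta_transf U1 U2 X = eta K F" using X by (simp add: KF eta_transf_def)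
  show "eta_transf U1 U2 X \<in> Hom1 ?S (Fo (id_two_fun ?S) X) (Fo ?RL X)"
    using X K.two_functor_eta K.ob_eta by (simp add: FoX etaX) (simp add: KF)
  fix Y H assume Y: "Y \<in> Ob ?S" and H: "H \<in> Hom1 ?S X Y"
  obtain L G where LG: "Y = (L, G)" by (cases Y)
  note Y = Y[unfolded LG] and H = H[unfolded LG KF]
  interpret H: set_functor_morphism K L U1 F G H by (rule set_functor_morphismI[OF X Y H])
  have FoY: "Fo ?RL Y = (ACat U1 H.L.V, ob_functor U1 H.L.V)"
    using Y L.fo[OF Y] unfolding LG by (simp add: L_functor_sel[OF Y] Enr1_sel(1) del: VDBL_sel slice_sel)
  have etaY: "eta_transf U1 U2 Y = eta L G" using Y by (simp add: LG eta_transf_def)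
  have F1: "F1 ?RL X Y J = Push U1 K.V (L1 K F J)"
    if J: "J \<in> Hom1 ?S (K, F) (L, G)" for J
    using X Y J L.fo[OF X] L.fo[OF Y] L.f1[OF X Y J] unfolding KF LG
    by (simp add: L_functor_sel[OF X] L_functor_sel[OF Y] Enr1_sel(2) del: VDBL_sel slice_sel)
  show "Cmp1 ?S (Fo (id_two_fun ?S) X) (Fo (id_two_fun ?S) Y) (Fo ?RL Y) (eta_transf U1 U2 Y) (F1 (id_two_fun ?S) X Y H)
    = Cmp1 ?S (Fo (id_two_fun ?S) X) (Fo ?RL X) (Fo ?RL Y) (F1 ?RL X Y H) (eta_transf U1 U2 X)"
    using X Y H H.eta_natural1 F1[OF H] unfolding FoX FoY etaX etaY by (simp add: KF LG)
  fix H' \<sigma> assume H': "H' \<in> Hom1 ?S X Y" and \<sigma>: "\<sigma> \<in> Hom2 ?S X Y H H'"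
  note H' = H'[unfolded LG KF] and \<sigma> = \<sigma>[unfolded LG KF]
  interpret H': set_functor_morphism K L U1 F G H' by (rule set_functor_morphismI[OF X Y H'])
  have \<sigma>': "two_nat K L H H' \<sigma>" using \<sigma> by simp
  interpret \<sigma>: two_nat K L H H' \<sigma> by fact
  have over: "\<forall>A \<in> Ob K. \<forall>x \<in> elts (Fo F A). vapp (F1 G (Fo H A) (Fo H' A) (\<sigma> A)) x = x"
    using \<sigma> two_nat_over_Set_lc_iff[OF H.two_functor_axioms H'.two_functor_axioms \<sigma>' H.L.F.two_functor_axioms H.over H'.over]
    unfolding slice_sel by blast
  have F2: "F2 ?RL X Y H H' \<sigma> = (\<lambda>C\<in>enr_cats U1 K.V. trans_fun (L2 K F L H H' \<sigma>) C)"
    using X Y H H' \<sigma> L.fo[OF X] L.fo[OF Y] L.f1[OF X Y H] L.f1[OF X Y H'] L.f2[OF X Y H H' \<sigma>] unfolding KF LG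
    by (simp add: L_functor_sel[OF X] L_functor_sel[OF Y] Enr1_sel(3) del: VDBL_sel slice_sel)
  have RX: "Fo ?RL X \<in> Ob ?S" and RY: "Fo ?RL Y \<in> Ob ?S"
    using X Y L.fo[OF X] L.fo[OF Y] R.fo by (simp_all add: KF LG del: slice_sel)
  have RH: "F1 ?RL X Y H \<in> Hom1 ?S (Fo ?RL X) (Fo ?RL Y)" and RH': "F1 ?RL X Y H' \<in> Hom1 ?S (Fo ?RL X) (Fo ?RL Y)"
    using X Y H H' L.fo[OF X] L.fo[OF Y] L.f1[OF X Y H] L.f1[OF X Y H'] R.f1 by (simp_all add: KF LG del: slice_sel)
  have R\<sigma>: "F2 ?RL X Y H H' \<sigma> \<in> Hom2 ?S (Fo ?RL X) (Fo ?RL Y) (F1 ?RL X Y H) (F1 ?RL X Y H')"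
    using X Y H H' \<sigma> L.fo[OF X] L.fo[OF Y] L.f1[OF X Y H] L.f1[OF X Y H'] L.f2[OF X Y H H' \<sigma>] R.f2 by (simp add: KF LG del: slice_sel)
  have R: "two_category (ACat U1 H.L.V)" "two_functor (ACat U1 K.V) (ACat U1 H.L.V) (F1 ?RL X Y H)"
    "two_functor (ACat U1 K.V) (ACat U1 H.L.V) (F1 ?RL X Y H')"
    "two_nat (ACat U1 K.V) (ACat U1 H.L.V) (F1 ?RL X Y H) (F1 ?RL X Y H') (F2 ?RL X Y H H' \<sigma>)"
    using RY RH RH' R\<sigma> unfolding FoX FoY by simp_all
  have "Hc (two_CAT U2) K L (ACat U1 H.L.V) H H' (eta L G) (eta L G) (Id2 (two_CAT U2) L (ACat U1 H.L.V) (eta L G)) \<sigma>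
    = (\<lambda>A\<in>Ob K. F1 (eta L G) (Fo H A) (Fo H' A) (\<sigma> A))"
    by (rule two_CAT_Hc_id(1)[OF R(1) H.two_functor_axioms H'.two_functor_axioms H.L.two_functor_eta H.L.two_functor_eta \<sigma>'])
  also have "\<dots> = (\<lambda>A\<in>Ob K. F2 ?RL X Y H H' \<sigma> (Fo (eta K F) A))"
  proof (rule restrict_ext)
    fix A assume A: "A \<in> Ob K"
    have "eta_mor L G (Fo H A) (Fo H' A) (\<sigma> A) = trans_fun (L2 K F L H H' \<sigma>) (eta_ob K F A)"
      using A over by (simp add: eta_mor_def trans_fun_def H.over_Fo)
        (rule mk_fun_cong; simp add: K.LL_hmor)
    then show "F1 (eta L G) (Fo H A) (Fo H' A) (\<sigma> A) = F2 ?RL X Y H H' \<sigma> (Fo (eta K F) A)"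
      using A by (simp add: F2 K.eta_ob H.fo H'.fo \<sigma>.comp)
  qed
  also have "\<dots> = Hc (two_CAT U2) K (ACat U1 K.V) (ACat U1 H.L.V) (eta K F) (eta K F) (F1 ?RL X Y H) (F1 ?RL X Y H')
      (F2 ?RL X Y H H' \<sigma>) (Id2 (two_CAT U2) K (ACat U1 K.V) (eta K F))"
    by (rule two_CAT_Hc_id(2)[OF R(1) K.two_functor_eta K.two_functor_eta R(2,3,4), symmetric])
  finally show "Hc ?S (Fo (id_two_fun ?S) X) (Fo (id_two_fun ?S) Y) (Fo ?RL Y) (F1 (id_two_fun ?S) X Y H) (F1 (id_two_fun ?S) X Y H')
      (eta_transf U1 U2 Y) (eta_transf U1 U2 Y) (Id2 ?S (Fo (id_two_fun ?S) Y) (Fo ?RL Y) (eta_transf U1 U2 Y)) (F2 (id_two_fun ?S) X Y H H' \<sigma>)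
    = Hc ?S (Fo (id_two_fun ?S) X) (Fo ?RL X) (Fo ?RL Y) (eta_transf U1 U2 X) (eta_transf U1 U2 X) (F1 ?RL X Y H) (F1 ?RL X Y H')
      (F2 ?RL X Y H H' \<sigma>) (Id2 ?S (Fo (id_two_fun ?S) X) (Fo ?RL X) (eta_transf U1 U2 X))"
    using X Y H H' \<sigma> unfolding FoX FoY etaX etaY by (simp add: KF LG del: two_CAT_sel)
qed

section \<open>The counit\<close>

text \<open>The product in \<open>D\<close> of the actions of \<open>f\<close> along the path of objects \<open>c = c\<^sub>0, \<dots>, c\<^sub>n\<close> of \<open>C\<close> that \<open>\<Gamma>s\<close>
  records by the targets of its entries; a multicell from \<open>(C(c\<^sub>0, c\<^sub>1), \<dots>, C(c\<^sub>n\<^sub>-\<^sub>1, c\<^sub>n))\<close> to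
  \<open>D(fc\<^sub>0, fc\<^sub>n)\<close>. For \<open>n = 0\<close> it is the unit at \<open>fc\<close>.\<close>

fun fpath :: "'v::zf vdcv \<Rightarrow> 'v \<Rightarrow> 'v \<Rightarrow> 'v \<Rightarrow> 'v \<Rightarrow> ('v, 'v) hmor list \<Rightarrow> 'v elem" where
  "fpath A C D f c [] = eunit A D (ext C c) (fun_ob f c) (fun_vert f c)"
| "fpath A C D f c (\<Gamma> # \<Gamma>s)
    = emul A D (felem C f c (vsnd (htgt \<Gamma>))) (fpath A C D f (vsnd (htgt \<Gamma>)) \<Gamma>s)"

text \<open>The same with the component of \<open>\<alpha>\<close> at \<open>c\<close> multiplied from the left: a multicell with target
  \<open>D(fc\<^sub>0, f'c\<^sub>n)\<close>.\<close>

definition tpath :: "'v::zf vdcv \<Rightarrow> 'v \<Rightarrow> 'v \<Rightarrow> 'v \<Rightarrow> 'v \<Rightarrow> 'v \<Rightarrow> 'v \<Rightarrow> ('v, 'v) hmor list \<Rightarrow> 'v elem" where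
  "tpath A C D f f' \<alpha> c \<Gamma>s = emul A D (nelem C f f' \<alpha> c) (fpath A C D f' c \<Gamma>s)"

definition epsilon :: "'v::zf \<Rightarrow> 'v vdcv \<Rightarrow> 'v vd_funv" where
  "epsilon U A = mk_vd_fun (LL (ACat U A) (ob_functor U A))
     (\<lambda>p. ext (vfst p) (vsnd p))
     (\<lambda>p q f. fun_vert f (vsnd p))
     (\<lambda>p q \<gamma>. cat_hom (vfst p) (vsnd p) (vsnd q))
     (\<lambda>p \<Gamma>s \<Delta> f f' \<alpha>. ecell (tpath A (vfst p) (vfst (hsrc \<Delta>)) f f' \<alpha> (vsnd p) \<Gamma>s))"

lemma epsilon_sel [simp]:
  "p \<in> VOb (LL (ACat U A) (ob_functor U A)) \<Longrightarrow> Go (epsilon U A) p = ext (vfst p) (vsnd p)"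
  "p \<in> VOb (LL (ACat U A) (ob_functor U A)) \<Longrightarrow> q \<in> VOb (LL (ACat U A) (ob_functor U A)) \<Longrightarrow>
    f \<in> VHom (LL (ACat U A) (ob_functor U A)) p q \<Longrightarrow> GV (epsilon U A) p q f = fun_vert f (vsnd p)"
  "p \<in> VOb (LL (ACat U A) (ob_functor U A)) \<Longrightarrow> q \<in> VOb (LL (ACat U A) (ob_functor U A)) \<Longrightarrow>
    \<gamma> \<in> HHom (LL (ACat U A) (ob_functor U A)) p q \<Longrightarrow> GH (epsilon U A) p q \<gamma> = cat_hom (vfst p) (vsnd p) (vsnd q)"
  "is_bdry (LL (ACat U A) (ob_functor U A)) p \<Gamma>s \<Delta> f f' \<Longrightarrow> \<alpha> \<in> MCell (LL (ACat U A) (ob_functor U A)) p \<Gamma>s \<Delta> f f' \<Longrightarrow>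
    GM (epsilon U A) p \<Gamma>s \<Delta> f f' \<alpha> = ecell (tpath A (vfst p) (vfst (hsrc \<Delta>)) f f' \<alpha> (vsnd p) \<Gamma>s)"
  unfolding epsilon_def by simp_all

lemma ob_functor_sel [simp]:
  "C \<in> enr_cats U A \<Longrightarrow> Fo (ob_functor U A) C = cat_obset C"
  "C \<in> enr_cats U A \<Longrightarrow> D \<in> enr_cats U A \<Longrightarrow> f \<in> enr_funs A C D \<Longrightarrow> F1 (ob_functor U A) C D f = fun_obmap f"
  by (simp_all add: ob_functor_def)

text \<open>The construction \<open>L\<close> applied to \<open>ob_functor U A\<close>. The objects of \<open>P\<close> are \<open>A\<close>-categories with a chosen
  object, and a path in \<open>P\<close> is a sequence of objects of a single \<open>A\<close>-category.\<close>

locale pointed_cats = enrichment A U + LV: set_functor "ACat U A" U "ob_functor U A"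
  for A :: "'v::zf vdcv" and U :: 'v
begin

abbreviation P :: "'v vdcv" where "P \<equiv> LV.V"

lemma P_VOb: "p \<in> VOb P \<longleftrightarrow> vfst p \<in> enr_cats U A \<and> vsnd p \<in> cat_ob (vfst p) \<and> p = vpair (vfst p) (vsnd p)"
  using ob_functor_sel(1)[of "vfst p"] by (auto simp: LV.LL_VOb)

lemma P_VObD: "p \<in> VOb P \<Longrightarrow> vfst p \<in> enr_cats U A" "p \<in> VOb P \<Longrightarrow> vsnd p \<in> cat_ob (vfst p)"
  by (simp_all add: P_VOb)

lemma P_VHom: "p \<in> VOb P \<Longrightarrow> q \<in> VOb P \<Longrightarrow>
    f \<in> VHom P p q \<longleftrightarrow> f \<in> enr_funs A (vfst p) (vfst q) \<and> fun_ob f (vsnd p) = vsnd q"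
  using P_VObD[of p] P_VObD[of q] by (auto simp: LV.LL_VHom)

lemma hmap_epsilon: "is_hmor P \<Gamma> \<Longrightarrow>
    hmap (epsilon U A) \<Gamma> = chom (vfst (hsrc \<Gamma>)) (vsnd (hsrc \<Gamma>)) (vsnd (htgt \<Gamma>))"
  by (simp add: hmap_def LV.LL_hmor)

lemma P_path: "hpath P p \<Gamma>s \<Longrightarrow> vfst (hend p \<Gamma>s) = vfst p \<and> vfst p \<in> enr_cats U A \<and> vsnd p \<in> cat_ob (vfst p)
    \<and> vsnd (hend p \<Gamma>s) \<in> cat_ob (vfst p)"
  using LV.vfst_hend[of p \<Gamma>s] P_VObD[OF hpath_start, of p \<Gamma>s] P_VObD[OF hpath_hend, of p \<Gamma>s] by simp

lemma P_path_Cons: "hpath P p (\<Gamma> # \<Gamma>s) \<Longrightarrow> vfst (hsrc \<Gamma>) = vfst p \<and> vfst (htgt \<Gamma>) = vfst p \<and>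
    vsnd (hsrc \<Gamma>) = vsnd p \<and> vsnd (htgt \<Gamma>) \<in> cat_ob (vfst p) \<and> is_hmor P \<Gamma>"
  by (auto simp: LV.LL_hmor P_VObD dest: P_VObD(2))

lemma fpath_facts:
  assumes "hpath P p \<Gamma>s" and D: "D \<in> enr_cats U A" and "f \<in> enr_funs A (vfst p) D"
  shows "is_elem A D (fpath A (vfst p) D f (vsnd p) \<Gamma>s) \<and>
    estart (fpath A (vfst p) D f (vsnd p) \<Gamma>s) = ext (vfst p) (vsnd p) \<and>
    epath (fpath A (vfst p) D f (vsnd p) \<Gamma>s) = map (hmap (epsilon U A)) \<Gamma>s \<and>
    hend (ext (vfst p) (vsnd p)) (map (hmap (epsilon U A)) \<Gamma>s) = ext (vfst p) (vsnd (hend p \<Gamma>s)) \<and>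
    esrc (fpath A (vfst p) D f (vsnd p) \<Gamma>s) = fun_ob f (vsnd p) \<and>
    etgt (fpath A (vfst p) D f (vsnd p) \<Gamma>s) = fun_ob f (vsnd (hend p \<Gamma>s)) \<and>
    eleft (fpath A (vfst p) D f (vsnd p) \<Gamma>s) = fun_vert f (vsnd p) \<and>
    eright (fpath A (vfst p) D f (vsnd p) \<Gamma>s) = fun_vert f (vsnd (hend p \<Gamma>s))"
  using assms(1,3)
proof (induction \<Gamma>s arbitrary: p)
  case Nil
  then have C: "vfst p \<in> enr_cats U A" and c: "vsnd p \<in> cat_ob (vfst p)" by (auto simp: P_VObD)
  show ?case using c catD[OF C] funD[OF C D Nil(2)] by (simp add: eunit_elem[OF D])
next
  case (Cons \<Gamma> \<Gamma>s)
  note p = P_path_Cons[OF Cons.prems(1)] and q = P_path[OF Cons.prems(1)]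
  have C: "vfst p \<in> enr_cats U A" using q by simp
  have "hpath P (htgt \<Gamma>) \<Gamma>s" using Cons.prems(1) by simp
  note IH = Cons.IH[OF this, unfolded conjunct1[OF conjunct2[OF p]], OF Cons.prems(2)]
  show ?case
    using IH p q funD(1,2,3)[OF C D Cons.prems(2)]
    by (simp add: emul_elem[OF D] follows_def hmap_epsilon)
qed

lemma fpath_sel:
  assumes "hpath P p \<Gamma>s" "C = vfst p" "c = vsnd p" and D: "D \<in> enr_cats U A" and "f \<in> enr_funs A C D"
  shows "is_elem A D (fpath A C D f c \<Gamma>s)" "estart (fpath A C D f c \<Gamma>s) = ext C c"
    "epath (fpath A C D f c \<Gamma>s) = map (hmap (epsilon U A)) \<Gamma>s"
    "hend (ext C c) (map (hmap (epsilon U A)) \<Gamma>s) = ext C (vsnd (hend p \<Gamma>s))"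
    "esrc (fpath A C D f c \<Gamma>s) = fun_ob f c" "etgt (fpath A C D f c \<Gamma>s) = fun_ob f (vsnd (hend p \<Gamma>s))"
    "eleft (fpath A C D f c \<Gamma>s) = fun_vert f c" "eright (fpath A C D f c \<Gamma>s) = fun_vert f (vsnd (hend p \<Gamma>s))"
  using fpath_facts[OF assms(1) D, of f] assms by auto

lemma fpath_append:
  assumes "hpath P p (\<Gamma>s @ \<Gamma>s')" and D: "D \<in> enr_cats U A" and "f \<in> enr_funs A (vfst p) D"
  shows "fpath A (vfst p) D f (vsnd p) (\<Gamma>s @ \<Gamma>s')
    = emul A D (fpath A (vfst p) D f (vsnd p) \<Gamma>s) (fpath A (vfst p) D f (vsnd (hend p \<Gamma>s)) \<Gamma>s')"
  using assms(1,3)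
proof (induction \<Gamma>s arbitrary: p)
  case Nil
  note s = fpath_sel[OF Nil(1)[simplified] refl refl D Nil(2)]
  show ?case using s by (simp add: emul_eunit_left[OF D])
next
  case (Cons \<Gamma> \<Gamma>s)
  have h: "hpath P (htgt \<Gamma>) (\<Gamma>s @ \<Gamma>s')" using Cons.prems(1) by simp
  have pc: "hpath P p (\<Gamma> # (\<Gamma>s @ \<Gamma>s'))" using Cons.prems(1) by simp
  note p = P_path_Cons[OF pc] and q = P_path[OF pc]
  have C: "vfst p \<in> enr_cats U A" using q by simp
  have v: "vfst (htgt \<Gamma>) = vfst p" using p by simp
  note IH = Cons.IH[OF h, unfolded v, OF Cons.prems(2)]
  have h1: "hpath P (htgt \<Gamma>) \<Gamma>s" and h2: "hpath P (hend (htgt \<Gamma>) \<Gamma>s) \<Gamma>s'" using h by simp_all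
  have v2: "vfst p = vfst (hend (htgt \<Gamma>) \<Gamma>s)" using P_path[OF h1] v by simp
  note s1 = fpath_sel[OF h1 v[symmetric] refl D Cons.prems(2)] and s2 = fpath_sel[OF h2 v2 refl D Cons.prems(2)]
  show ?case
    using IH s1 s2 p q funD(1,2,3)[OF C D Cons.prems(2)] by (simp add: emul_assoc[OF D] follows_def)
qed

lemma eapp_fpath:
  assumes "hpath P p \<Gamma>s" and D: "D \<in> enr_cats U A" and E: "E \<in> enr_cats U A"
    and "f \<in> enr_funs A (vfst p) D" and g: "g \<in> enr_funs A D E"
  shows "eapp A D E g (fpath A (vfst p) D f (vsnd p) \<Gamma>s)
    = fpath A (vfst p) E (cmp_fun A (vfst p) D E g f) (vsnd p) \<Gamma>s"
  using assms(1,4)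
proof (induction \<Gamma>s arbitrary: p)
  case Nil
  then have C: "vfst p \<in> enr_cats U A" and c: "vsnd p \<in> cat_ob (vfst p)" by (auto simp: P_VObD)
  show ?case using c catD[OF C] funD[OF C D Nil(2)] by (simp add: eapp_eunit[OF D E g])
next
  case (Cons \<Gamma> \<Gamma>s)
  note p = P_path_Cons[OF Cons.prems(1)] and q = P_path[OF Cons.prems(1)]
  have C: "vfst p \<in> enr_cats U A" using q by simp
  have v: "vfst (htgt \<Gamma>) = vfst p" using p by simp
  have h: "hpath P (htgt \<Gamma>) \<Gamma>s" using Cons.prems(1) by simp
  note IH = Cons.IH[OF h, unfolded v, OF Cons.prems(2)] and s = fpath_sel[OF h v[symmetric] refl D Cons.prems(2)]
  show ?case
    using IH s p q funD(1,2,3)[OF C D Cons.prems(2)] by (simp add: eapp_emul[OF D E g] felem_cmp follows_def)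
qed

text \<open>Naturality of \<open>\<alpha>\<close> with respect to each hom-object along the path allows its component to travel from one
  end of the product to the other.\<close>

lemma fpath_natural:
  assumes "hpath P p \<Gamma>s" and D: "D \<in> enr_cats U A" and "f \<in> enr_funs A (vfst p) D" "f' \<in> enr_funs A (vfst p) D"
    and "\<alpha> \<in> enr_nats A (vfst p) D f f'"
  shows "emul A D (fpath A (vfst p) D f (vsnd p) \<Gamma>s) (nelem (vfst p) f f' \<alpha> (vsnd (hend p \<Gamma>s)))
    = emul A D (nelem (vfst p) f f' \<alpha> (vsnd p)) (fpath A (vfst p) D f' (vsnd p) \<Gamma>s)"
  using assms(1,3-)
proof (induction \<Gamma>s arbitrary: p)
  case Nil
  then have C: "vfst p \<in> enr_cats U A" and c: "vsnd p \<in> cat_ob (vfst p)" by (auto simp: P_VObD)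
  show ?case using c natD(1)[OF C D Nil(2-)] by (simp add: emul_eunit_left[OF D] emul_eunit_right[OF D])
next
  case (Cons \<Gamma> \<Gamma>s)
  note p = P_path_Cons[OF Cons.prems(1)] and q = P_path[OF Cons.prems(1)]
  have C: "vfst p \<in> enr_cats U A" using q by simp
  have v: "vfst (htgt \<Gamma>) = vfst p" using p by simp
  have h: "hpath P (htgt \<Gamma>) \<Gamma>s" using Cons.prems(1) by simp
  note f = Cons.prems(2,3) and \<alpha> = Cons.prems(4)
  note IH = Cons.IH[OF h, unfolded v, OF f \<alpha>] and s = fpath_sel[OF h v[symmetric] refl D f(1)]
    and s' = fpath_sel[OF h v[symmetric] refl D f(2)]
  let ?n = "nelem (vfst p) f f' \<alpha>" and ?c = "vsnd (htgt \<Gamma>)"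
  note [simp] = s s' p q funD(1,2,3)[OF C D f(1)] funD(1,2,3)[OF C D f(2)] natD(1)[OF C D f \<alpha>]
  have "emul A D (emul A D (felem (vfst p) f (vsnd p) ?c) (fpath A (vfst p) D f ?c \<Gamma>s)) (?n (vsnd (hend (htgt \<Gamma>) \<Gamma>s)))
    = emul A D (felem (vfst p) f (vsnd p) ?c) (emul A D (?n ?c) (fpath A (vfst p) D f' ?c \<Gamma>s))"
    using q by (simp add: emul_assoc[OF D] follows_def IH)
  also have "\<dots> = emul A D (emul A D (felem (vfst p) f (vsnd p) ?c) (?n ?c)) (fpath A (vfst p) D f' ?c \<Gamma>s)"
    by (simp add: emul_assoc[OF D] follows_def)
  also have "\<dots> = emul A D (emul A D (?n (vsnd p)) (felem (vfst p) f' (vsnd p) ?c)) (fpath A (vfst p) D f' ?c \<Gamma>s)"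
    using natD(2)[OF C D f \<alpha>, of "vsnd p" ?c] by simp
  also have "\<dots> = emul A D (?n (vsnd p)) (emul A D (felem (vfst p) f' (vsnd p) ?c) (fpath A (vfst p) D f' ?c \<Gamma>s))"
    by (simp add: emul_assoc[OF D] follows_def)
  finally show ?case by simp
qed

lemma tpath_sel:
  assumes h: "hpath P p \<Gamma>s" and C: "C = vfst p" "c = vsnd p" and D: "D \<in> enr_cats U A"
    and f: "f \<in> enr_funs A C D" "f' \<in> enr_funs A C D" and \<alpha>: "\<alpha> \<in> enr_nats A C D f f'"
  shows "is_elem A D (tpath A C D f f' \<alpha> c \<Gamma>s)" "estart (tpath A C D f f' \<alpha> c \<Gamma>s) = ext C c"
    "epath (tpath A C D f f' \<alpha> c \<Gamma>s) = map (hmap (epsilon U A)) \<Gamma>s"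
    "esrc (tpath A C D f f' \<alpha> c \<Gamma>s) = fun_ob f c" "etgt (tpath A C D f f' \<alpha> c \<Gamma>s) = fun_ob f' (vsnd (hend p \<Gamma>s))"
    "eleft (tpath A C D f f' \<alpha> c \<Gamma>s) = fun_vert f c" "eright (tpath A C D f f' \<alpha> c \<Gamma>s) = fun_vert f' (vsnd (hend p \<Gamma>s))"
proof -
  have C': "C \<in> enr_cats U A" and c: "c \<in> cat_ob C" using P_path[OF h] C by simp_all
  note s = fpath_sel[OF h C D f(2)]
  show "is_elem A D (tpath A C D f f' \<alpha> c \<Gamma>s)" "estart (tpath A C D f f' \<alpha> c \<Gamma>s) = ext C c"
    "epath (tpath A C D f f' \<alpha> c \<Gamma>s) = map (hmap (epsilon U A)) \<Gamma>s"
    "esrc (tpath A C D f f' \<alpha> c \<Gamma>s) = fun_ob f c" "etgt (tpath A C D f f' \<alpha> c \<Gamma>s) = fun_ob f' (vsnd (hend p \<Gamma>s))"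
    "eleft (tpath A C D f f' \<alpha> c \<Gamma>s) = fun_vert f c" "eright (tpath A C D f f' \<alpha> c \<Gamma>s) = fun_vert f' (vsnd (hend p \<Gamma>s))"
    using s c natD(1)[OF C' D f \<alpha>] by (simp_all add: tpath_def emul_elem[OF D] follows_def)
qed

text \<open>By \<open>fpath_natural\<close> the component of \<open>\<beta>\<close>, which stands in the middle of the product on the left hand side,
  moves to the front, where it meets that of \<open>\<alpha>\<close>.\<close>

lemma tpath_vcmp:
  assumes h: "hpath P p (\<Gamma>s @ \<Gamma>s')" and C: "C = vfst p" "c = vsnd p" "c' = vsnd (hend p \<Gamma>s)" and D: "D \<in> enr_cats U A"
    and f: "f \<in> enr_funs A C D" "f' \<in> enr_funs A C D" "f'' \<in> enr_funs A C D"
    and \<alpha>: "\<alpha> \<in> enr_nats A C D f f'" and \<beta>: "\<beta> \<in> enr_nats A C D f' f''"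
  shows "emul A D (tpath A C D f f' \<alpha> c \<Gamma>s) (tpath A C D f' f'' \<beta> c' \<Gamma>s')
    = tpath A C D f f'' (vcmp_nat A C D f f' f'' \<beta> \<alpha>) c (\<Gamma>s @ \<Gamma>s')"
proof -
  have h1: "hpath P p \<Gamma>s" and h2: "hpath P (hend p \<Gamma>s) \<Gamma>s'" using h by simp_all
  note q = P_path[OF h1]
  have C': "C \<in> enr_cats U A" and c: "c \<in> cat_ob C" "c' \<in> cat_ob C" and v: "C = vfst (hend p \<Gamma>s)"
    using q C by simp_all
  note s1 = fpath_sel[OF h1 C(1,2) D f(2)] and s2 = fpath_sel[OF h1 C(1,2) D f(3)]
    and s3 = fpath_sel[OF h2 v C(3) D f(3)]
  note [simp] = s1 s2 s3 c natD(1)[OF C' D f(1,2) \<alpha>] natD(1)[OF C' D f(2,3) \<beta>]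
    emul_elem[OF D] C(3)[symmetric]
  have n: "emul A D (fpath A C D f' c \<Gamma>s) (nelem C f' f'' \<beta> c')
    = emul A D (nelem C f' f'' \<beta> c) (fpath A C D f'' c \<Gamma>s)"
    by (rule fpath_natural[OF h1 D, folded C, OF f(2,3) \<beta>])
  have a: "fpath A C D f'' c (\<Gamma>s @ \<Gamma>s') = emul A D (fpath A C D f'' c \<Gamma>s) (fpath A C D f'' c' \<Gamma>s')"
    by (rule fpath_append[OF h D, folded C, OF f(3)])
  have "emul A D (tpath A C D f f' \<alpha> c \<Gamma>s) (tpath A C D f' f'' \<beta> c' \<Gamma>s')
    = emul A D (nelem C f f' \<alpha> c) (emul A D (emul A D (fpath A C D f' c \<Gamma>s) (nelem C f' f'' \<beta> c')) (fpath A C D f'' c' \<Gamma>s'))"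
    by (simp add: tpath_def emul_assoc[OF D] follows_def)
  also have "\<dots> = tpath A C D f f'' (vcmp_nat A C D f f' f'' \<beta> \<alpha>) c (\<Gamma>s @ \<Gamma>s')"
    unfolding n by (simp add: a tpath_def emul_assoc[OF D] follows_def nelem_vcmp)
  finally show ?thesis .
qed

lemma tpath_id:
  assumes h: "hpath P p \<Gamma>s" and C: "C = vfst p" "c = vsnd p" and D: "D \<in> enr_cats U A"
    and f: "f \<in> enr_funs A C D"
  shows "tpath A C D f f (id_nat A C D f) c \<Gamma>s = fpath A C D f c \<Gamma>s"
  using fpath_sel[OF h C D f] P_path[OF h] C
  by (simp add: tpath_def nelem_id emul_eunit_left[OF D])

lemma P_bdryD:
  assumes b: "is_bdry P p \<Gamma>s \<Delta> f f'"
  shows "vfst p \<in> enr_cats U A" "vfst (hsrc \<Delta>) \<in> enr_cats U A" "vfst (htgt \<Delta>) = vfst (hsrc \<Delta>)"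
    "vfst (hend p \<Gamma>s) = vfst p" "f \<in> enr_funs A (vfst p) (vfst (hsrc \<Delta>))" "f' \<in> enr_funs A (vfst p) (vfst (hsrc \<Delta>))"
    "fun_ob f (vsnd p) = vsnd (hsrc \<Delta>)" "fun_ob f' (vsnd (hend p \<Gamma>s)) = vsnd (htgt \<Delta>)"
    "vsnd p \<in> cat_ob (vfst p)" "vsnd (hend p \<Gamma>s) \<in> cat_ob (vfst p)"
    "vsnd (hsrc \<Delta>) \<in> cat_ob (vfst (hsrc \<Delta>))" "vsnd (htgt \<Delta>) \<in> cat_ob (vfst (hsrc \<Delta>))"
  using LV.LL_bdryD[OF b] is_bdryD[OF b] P_VHom[of p "hsrc \<Delta>" f] P_VHom[of "hend p \<Gamma>s" "htgt \<Delta>" f']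
    P_VObD[of p] P_VObD[of "hend p \<Gamma>s"] P_VObD[of "hsrc \<Delta>"] P_VObD[of "htgt \<Delta>"]
  by simp_all

lemma map_row_epsilon_Cons:
  assumes b: "is_bdry P p \<Gamma>s \<Delta> f f'" and \<theta>: "\<theta> \<in> MCell P p \<Gamma>s \<Delta> f f'"
  shows "map_row (epsilon U A) p f (Block \<Gamma>s \<theta> \<Delta> f' # bs)
    = eblock (vfst (hsrc \<Delta>)) (tpath A (vfst p) (vfst (hsrc \<Delta>)) f f' \<theta> (vsnd p) \<Gamma>s)
        # map_row (epsilon U A) (hend p \<Gamma>s) f' bs"
proof -
  note d = P_bdryD[OF b]
  have \<theta>': "\<theta> \<in> enr_nats A (vfst p) (vfst (hsrc \<Delta>)) f f'" using \<theta> by simp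
  show ?thesis
    using b \<theta> d is_bdryD[OF b] tpath_sel[OF is_bdryD(1)[OF b] refl refl d(2,5,6) \<theta>']
    by (simp add: eblock_def hmap_epsilon)
qed

lemma row_epsilon:
  "row P p q f bs \<Longrightarrow> row A (ext (vfst p) (vsnd p)) (ext (vfst q) (vsnd q)) (fun_vert f (vsnd p)) (map_row (epsilon U A) p f bs)"
proof (induction bs arbitrary: p q f)
  case Nil
  then have C: "vfst p \<in> enr_cats U A" and c: "vsnd p \<in> cat_ob (vfst p)"
    and D: "vfst q \<in> enr_cats U A" and d: "vsnd q \<in> cat_ob (vfst q)"
    and f: "f \<in> enr_funs A (vfst p) (vfst q)" "fun_ob f (vsnd p) = vsnd q"
    by (auto simp: P_VObD P_VHom)
  show ?case using funD(2)[OF C D f(1) c] f(2) catD[OF C] catD[OF D] c d by simp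
next
  case (Cons B bs)
  obtain \<Gamma>s \<theta> \<Delta> f\<^sub>1 where B: "B = Block \<Gamma>s \<theta> \<Delta> f\<^sub>1" by (cases B)
  have b: "is_bdry P p \<Gamma>s \<Delta> f f\<^sub>1" and q: "q = hsrc \<Delta>" and \<theta>: "\<theta> \<in> MCell P p \<Gamma>s \<Delta> f f\<^sub>1"
    and r: "row P (hend p \<Gamma>s) (htgt \<Delta>) f\<^sub>1 bs"
    using Cons.prems unfolding B by (auto simp del: LV.LL_sel)
  note d = P_bdryD[OF b]
  have \<theta>': "\<theta> \<in> enr_nats A (vfst p) (vfst (hsrc \<Delta>)) f f\<^sub>1" using \<theta> by simp
  note t = tpath_sel[OF is_bdryD(1)[OF b] refl refl d(2,5,6) \<theta>']
  show ?case
    using Cons.IH[OF r] is_elemD(11,12)[OF t(1)] t d fpath_sel(4)[OF is_bdryD(1)[OF b] refl refl d(2) d(6)] 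
    unfolding B map_row_epsilon_Cons[OF b \<theta>] by (simp add: q)
qed

text \<open>For a functor \<open>g\<close>, the compatibility of the counit with composition: substituting the images of a row of
  2-cells into the product of the actions of \<open>g\<close> yields the action of \<open>g\<close> on the image of their pasting. Each
  step of the induction uses that \<open>g\<close> preserves products, and \<open>tpath_vcmp\<close>.\<close>

lemma ecmp_fpath_row:
  assumes "row P p q f bs" and E: "E \<in> enr_cats U A" and "g \<in> enr_funs A (vfst q) E"
  shows "ecmp A E (fpath A (vfst q) E g (vsnd q) (bots bs)) (ext (vfst p) (vsnd p)) (fun_vert f (vsnd p))
      (map_row (epsilon U A) p f bs)
    = eapp A (vfst q) E g (tpath A (vfst p) (vfst q) f (rvert f bs) (pasted (ACat U A) (vfst p) (vfst q) f bs)
        (vsnd p) (tops bs))"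
  using assms(1,3)
proof (induction bs arbitrary: p q f)
  case Nil
  then have C: "vfst p \<in> enr_cats U A" and c: "vsnd p \<in> cat_ob (vfst p)"
    and D: "vfst q \<in> enr_cats U A" and d: "vsnd q \<in> cat_ob (vfst q)"
    and f: "f \<in> enr_funs A (vfst p) (vfst q)" "fun_ob f (vsnd p) = vsnd q"
    by (auto simp: P_VObD P_VHom)
  have h: "hpath P p []" using Nil by simp
  show ?case
    using c d f(2) funD(1,2)[OF C D f(1) c] funD(1,2)[OF D E Nil(2) d] catD(1)[OF C c] catD(1)[OF D d]
      ecmp_eunit[OF E, of "fun_ob g (vsnd q)" "ext (vfst p) (vsnd p)" "ext (vfst q) (vsnd q)" "fun_vert f (vsnd p)" "fun_vert g (vsnd q)"]
      eapp_eunit[OF D E Nil(2), of "ext (vfst p) (vsnd p)" "vsnd q" "fun_vert f (vsnd p)"]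
    by (simp add: tpath_id[OF h refl refl D f(1)])
next
  case (Cons B bs)
  obtain \<Gamma>s \<theta> \<Delta> f\<^sub>1 where B: "B = Block \<Gamma>s \<theta> \<Delta> f\<^sub>1" by (cases B)
  have b: "is_bdry P p \<Gamma>s \<Delta> f f\<^sub>1" and q: "q = hsrc \<Delta>" and \<theta>: "\<theta> \<in> MCell P p \<Gamma>s \<Delta> f f\<^sub>1"
    and r: "row P (hend p \<Gamma>s) (htgt \<Delta>) f\<^sub>1 bs"
    using Cons.prems(1) unfolding B by (auto simp del: LV.LL_sel)
  note d = P_bdryD[OF b]
  note rp = LV.row_pasted[OF r, unfolded ACat_sel, unfolded d(3,4)]
  have C: "vfst p \<in> enr_cats U A" and D: "vfst (hsrc \<Delta>) \<in> enr_cats U A" using d by simp_all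
  have g: "g \<in> enr_funs A (vfst (hsrc \<Delta>)) E" using Cons.prems(2) q by simp
  have \<theta>': "\<theta> \<in> enr_nats A (vfst p) (vfst (hsrc \<Delta>)) f f\<^sub>1" using \<theta> by simp
  note IH = Cons.IH[OF r, unfolded d(3,4), OF g]
  have h1: "hpath P p \<Gamma>s" using is_bdryD[OF b] by simp
  have h: "hpath P p (\<Gamma>s @ tops bs)" using row_paths[OF Cons.prems(1)] by (simp add: B)
  have hb: "hpath P (htgt \<Delta>) (bots bs)" using row_paths[OF r] by simp
  note t = tpath_sel[OF h1 refl refl D d(5,6) \<theta>']
  have h2: "hpath P (hend p \<Gamma>s) (tops bs)" using h by simp
  let ?C = "vfst p" and ?D = "vfst (hsrc \<Delta>)"
  let ?P = "pasted (ACat U A) ?C ?D f\<^sub>1 bs"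
  have P': "?P \<in> enr_nats A ?C ?D f\<^sub>1 (rvert f\<^sub>1 bs)" using rp by simp
  note t2 = tpath_sel[OF h2 d(4)[symmetric] refl D d(6) rp(4) P']
  note s = fpath_sel[OF hb d(3)[symmetric] refl E g]
  let ?b = "eblock ?D (tpath A ?C ?D f f\<^sub>1 \<theta> (vsnd p) \<Gamma>s)"
  have mr: "map_row (epsilon U A) p f (B # bs) = [?b] @ map_row (epsilon U A) (hend p \<Gamma>s) f\<^sub>1 bs"
    unfolding B map_row_epsilon_Cons[OF b \<theta>] by simp
  have r': "row A (ext ?C (vsnd p)) (ext ?D (vsnd (hsrc \<Delta>))) (fun_vert f (vsnd p)) ([?b] @ map_row (epsilon U A) (hend p \<Gamma>s) f\<^sub>1 bs)"
    using row_epsilon[OF Cons.prems(1)] unfolding mr q .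
  have e: "hend (ext ?C (vsnd p)) (map (hmap (epsilon U A)) \<Gamma>s) = ext ?C (vsnd (hend p \<Gamma>s))"
    by (rule fpath_sel(4)[OF h1 refl refl D d(6)])
  have "ecmp A E (fpath A ?D E g (vsnd (hsrc \<Delta>)) (bots (B # bs))) (ext ?C (vsnd p)) (fun_vert f (vsnd p))
      ([?b] @ map_row (epsilon U A) (hend p \<Gamma>s) f\<^sub>1 bs)
    = emul A E (ecmp A E (felem ?D g (vsnd (hsrc \<Delta>)) (vsnd (htgt \<Delta>))) (ext ?C (vsnd p)) (fun_vert f (vsnd p)) [?b])
        (ecmp A E (fpath A ?D E g (vsnd (htgt \<Delta>)) (bots bs)) (ext ?C (vsnd (hend p \<Gamma>s))) (fun_vert f\<^sub>1 (vsnd (hend p \<Gamma>s)))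
          (map_row (epsilon U A) (hend p \<Gamma>s) f\<^sub>1 bs))"
    using ecmp_emul[OF E, of "felem ?D g (vsnd (hsrc \<Delta>)) (vsnd (htgt \<Delta>))" "fpath A ?D E g (vsnd (htgt \<Delta>)) (bots bs)"
        "ext ?C (vsnd p)" "fun_vert f (vsnd p)" "[?b]" "map_row (epsilon U A) (hend p \<Gamma>s) f\<^sub>1 bs"] r' t d s e
      funD(1,2,3)[OF D E g]
    by (simp add: B follows_def)
  also have "\<dots> = emul A E (eapp A ?D E g (tpath A ?C ?D f f\<^sub>1 \<theta> (vsnd p) \<Gamma>s))
      (eapp A ?D E g (tpath A ?C ?D f\<^sub>1 (rvert f\<^sub>1 bs) ?P (vsnd (hend p \<Gamma>s)) (tops bs)))"
    unfolding IH using t d by (simp add: eapp_def)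
  also have "\<dots> = eapp A ?D E g (emul A ?D (tpath A ?C ?D f f\<^sub>1 \<theta> (vsnd p) \<Gamma>s)
      (tpath A ?C ?D f\<^sub>1 (rvert f\<^sub>1 bs) ?P (vsnd (hend p \<Gamma>s)) (tops bs)))"
    by (rule eapp_emul[OF D E g t(1) t2(1), symmetric]) (use t t2 e in \<open>simp add: follows_def\<close>)
  also have "\<dots> = eapp A ?D E g (tpath A ?C ?D f (rvert f\<^sub>1 bs) (vcmp_nat A ?C ?D f f\<^sub>1 (rvert f\<^sub>1 bs) ?P \<theta>) (vsnd p) (\<Gamma>s @ tops bs))"
    by (simp only: tpath_vcmp[OF h refl refl refl D d(5,6) rp(4) \<theta>' P'])
  finally show ?case
    unfolding mr q by (simp add: B)
qed

lemma virtual_double_category_P: "virtual_double_category P"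
  by (rule LV.virtual_double_category_LL)

text \<open>For a composite with a 2-cell \<open>\<kappa>\<close> from \<open>g\<close> to \<open>g'\<close>, the product that defines the image of \<open>\<kappa>\<close> begins
  with a component of \<open>\<kappa>\<close> and continues with the actions of \<open>g'\<close>, to which \<open>ecmp_fpath_row\<close> applies.\<close>

lemma virtual_double_functor_epsilon: "virtual_double_functor P A (epsilon U A)"
proof
  interpret V: virtual_double_category P by (rule virtual_double_category_P)
  {
    fix p q f bs \<Lambda> g g' \<kappa>
    assume r: "row P p q f bs" and b: "is_bdry P q (bots bs) \<Lambda> g g'" and \<kappa>: "\<kappa> \<in> MCell P q (bots bs) \<Lambda> g g'"
    note d = P_bdryD[OF b] and rp = LV.row_pasted[OF r, unfolded ACat_sel]
    let ?C = "vfst p" and ?D = "vfst q" and ?E = "vfst (hsrc \<Lambda>)" and ?c = "vsnd p"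
    let ?f' = "rvert f bs" and ?P = "pasted (ACat U A) (vfst p) (vfst q) f bs"
    have C: "?C \<in> enr_cats U A" and D: "?D \<in> enr_cats U A" and E: "?E \<in> enr_cats U A" using rp d by simp_all
    have pq: "p \<in> VOb P" "q \<in> VOb P" "f \<in> VHom P p q" using row_start[OF r] by simp_all
    have c: "?c \<in> cat_ob ?C" and fc: "fun_ob f ?c = vsnd q" using pq by (simp_all add: P_VObD P_VHom)
    have \<kappa>': "\<kappa> \<in> enr_nats A ?D ?E g g'" using \<kappa> by simp
    have h: "hpath P p (tops bs)" using row_paths[OF r] by simp
    have hb: "hpath P q (bots bs)" using row_paths[OF r] by simp
    note s = fpath_sel[OF h refl refl D rp(4)] and sb = fpath_sel[OF hb refl refl E d(6)]
      and t = tpath_sel[OF h refl refl D rp(3,4) rp(7)] and tb = tpath_sel[OF hb refl refl E d(5,6) \<kappa>']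
    note [simp] = funD(1,2,3)[OF C D rp(3)] funD(1,2,3)[OF C D rp(4)] funD(1,2,3)[OF D E d(5)] funD(1,2,3)[OF D E d(6)]
      natD(1)[OF C D rp(3,4,7)] natD(1)[OF D E d(5,6) \<kappa>'] catD[OF C] catD[OF D] catD[OF E] c
    let ?K = "ecmp A ?E (nelem ?D g g' \<kappa> (vsnd q)) (ext ?C ?c) (fun_vert f ?c) []"
    have K: "is_elem A ?E ?K" using d(9) fc funD(2)[OF C D rp(3) c] by (intro ecmp_elem) simp_all
    \<comment> \<open>the exchange law brings the component of \<open>\<kappa>\<close> to the front of the horizontal composite\<close>
    have "tpath A ?C ?E (cmp_fun A ?C ?D ?E g f) (cmp_fun A ?C ?D ?E g' ?f') (Hc (ACat U A) ?C ?D ?E f ?f' g g' \<kappa> ?P) ?c (tops bs)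
      = emul A ?E (emul A ?E ?K (eapp A ?D ?E g' (nelem ?C f ?f' ?P ?c))) (eapp A ?D ?E g' (fpath A ?C ?D ?f' ?c (tops bs)))"
      unfolding ACat_sel exchange[OF C D E rp(3,4) d(5,6) rp(7) \<kappa>']
      using fc by (simp add: tpath_def nelem_vcmp nelem_lwhisker nelem_rwhisker eapp_fpath[OF h D E rp(4) d(6)])
    also have "\<dots> = emul A ?E ?K (eapp A ?D ?E g' (tpath A ?C ?D f ?f' ?P ?c (tops bs)))"
      unfolding tpath_def
      using s K d(9) fc by (simp add: emul_assoc[OF E] eapp_elem[OF D E d(6)] eapp_emul[OF D E d(6)] follows_def)
    also have "\<dots> = ecmp A ?E (tpath A ?D ?E g g' \<kappa> (vsnd q) (bots bs)) (ext ?C ?c) (fun_vert f ?c) ([] @ map_row (epsilon U A) p f bs)"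
      unfolding ecmp_fpath_row[OF r E d(6), symmetric] tpath_def[of A ?D]
      using row_epsilon[OF r] sb d(9)
      by (subst ecmp_emul[OF E]) (simp_all add: follows_def)
    finally have eq: "tpath A ?C ?E (cmp_fun A ?C ?D ?E g f) (cmp_fun A ?C ?D ?E g' ?f') (Hc (ACat U A) ?C ?D ?E f ?f' g g' \<kappa> ?P) ?c (tops bs)
      = ecmp A ?E (tpath A ?D ?E g g' \<kappa> (vsnd q) (bots bs)) (ext ?C ?c) (fun_vert f ?c) (map_row (epsilon U A) p f bs)"
      by simp
    have l: "GM (epsilon U A) p (tops bs) \<Lambda> (VCmp P p q (hsrc \<Lambda>) g f)
        (VCmp P (hend p (tops bs)) (hend q (bots bs)) (htgt \<Lambda>) g' ?f') (MCmp P p q f bs \<Lambda> g g' \<kappa>)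
      = ecell (tpath A ?C ?E (cmp_fun A ?C ?D ?E g f) (cmp_fun A ?C ?D ?E g' ?f') (Hc (ACat U A) ?C ?D ?E f ?f' g g' \<kappa> ?P) ?c (tops bs))"
      unfolding epsilon_sel(4)[OF V.bdry_cmp[OF r b] V.mcmp[OF r b \<kappa>]] using rp d by simp
    show "GM (epsilon U A) p (tops bs) \<Lambda> (VCmp P p q (hsrc \<Lambda>) g f)
        (VCmp P (hend p (tops bs)) (hend q (bots bs)) (htgt \<Lambda>) g' ?f') (MCmp P p q f bs \<Lambda> g g' \<kappa>)
      = MCmp A (Go (epsilon U A) p) (Go (epsilon U A) q) (GV (epsilon U A) p q f) (map_row (epsilon U A) p f bs)
          (hmap (epsilon U A) \<Lambda>) (GV (epsilon U A) q (hsrc \<Lambda>) g) (GV (epsilon U A) (hend q (bots bs)) (htgt \<Lambda>) g')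
          (GM (epsilon U A) q (bots bs) \<Lambda> g g' \<kappa>)"
      unfolding l eq epsilon_sel(4)[OF b \<kappa>]
      using pq tb d is_bdryD[OF b] by (simp add: ecmp_def hmap_epsilon)
  next
    fix \<Gamma> assume \<Gamma>: "is_hmor P \<Gamma>"
    let ?C = "vfst (hsrc \<Gamma>)"
    have C: "?C \<in> enr_cats U A" and c: "vsnd (hsrc \<Gamma>) \<in> cat_ob ?C" "vsnd (htgt \<Gamma>) \<in> cat_ob ?C" and v: "vfst (htgt \<Gamma>) = ?C"
      using \<Gamma> P_VObD[of "hsrc \<Gamma>"] P_VObD[of "htgt \<Gamma>"] by (simp_all add: LV.LL_hmor)
    have h: "hpath P (hsrc \<Gamma>) [\<Gamma>]" using \<Gamma> is_hmorD[OF \<Gamma>] by simp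
    have b: "is_bdry P (hsrc \<Gamma>) [\<Gamma>] \<Gamma> (VId P (hsrc \<Gamma>)) (VId P (htgt \<Gamma>))"
      using \<Gamma> V.vid[OF is_hmorD(1)[OF \<Gamma>]] V.vid[OF is_hmorD(2)[OF \<Gamma>]] is_hmorD[OF \<Gamma>]
      by (simp add: is_bdry_def del: LV.LL_sel)
    show "GM (epsilon U A) (hsrc \<Gamma>) [\<Gamma>] \<Gamma> (VId P (hsrc \<Gamma>)) (VId P (htgt \<Gamma>)) (MId P \<Gamma>) = MId A (hmap (epsilon U A) \<Gamma>)"
      unfolding epsilon_sel(4)[OF b V.mid[OF \<Gamma>]]
      using c tpath_id[OF h refl refl C id_fun[OF C]] ielem_elem[OF C c]
      by (simp add: v hmap_epsilon[OF \<Gamma>] felem_id emul_eunit_right[OF C]) (simp add: ielem_def)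
  next
    fix p \<Gamma>s \<Delta> f f' \<alpha> assume b: "is_bdry P p \<Gamma>s \<Delta> f f'" and \<alpha>: "\<alpha> \<in> MCell P p \<Gamma>s \<Delta> f f'"
    note d = P_bdryD[OF b]
    have \<alpha>': "\<alpha> \<in> enr_nats A (vfst p) (vfst (hsrc \<Delta>)) f f'" using \<alpha> by simp
    note t = tpath_sel[OF is_bdryD(1)[OF b] refl refl d(2,5,6) \<alpha>']
    show "GM (epsilon U A) p \<Gamma>s \<Delta> f f' \<alpha> \<in> MCell A (Go (epsilon U A) p) (map (hmap (epsilon U A)) \<Gamma>s) (hmap (epsilon U A) \<Delta>)
            (GV (epsilon U A) p (hsrc \<Delta>) f) (GV (epsilon U A) (hend p \<Gamma>s) (htgt \<Delta>) f')"
      using is_elemD(12)[OF t(1)] t d is_bdryD[OF b] b \<alpha> by (simp add: hmap_epsilon)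
  next
    fix p q f assume *: "p \<in> VOb P" "q \<in> VOb P" "f \<in> VHom P p q"
    then show "GV (epsilon U A) p q f \<in> VHom A (Go (epsilon U A) p) (Go (epsilon U A) q)"
      using funD(2)[OF P_VObD(1)[OF *(1)] P_VObD(1)[OF *(2)], of f "vsnd p"] by (simp add: P_VHom P_VObD)
    fix r g assume **: "r \<in> VOb P" "g \<in> VHom P q r"
    show "GV (epsilon U A) p r (VCmp P p q r g f) = VCmp A (Go (epsilon U A) p) (Go (epsilon U A) q) (Go (epsilon U A) r)
        (GV (epsilon U A) q r g) (GV (epsilon U A) p q f)"
      using * ** V.vcmp[OF *(1,2) **(1) *(3) **(2)] by (simp add: P_VHom P_VObD)
  next
    fix p assume p: "p \<in> VOb P"
    show "GV (epsilon U A) p p (VId P p) = VId A (Go (epsilon U A) p)"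
      using p V.vid[OF p] by (simp add: P_VObD)
    show "Go (epsilon U A) p \<in> VOb A" using p catD(1)[OF P_VObD(1)[OF p] P_VObD(2)[OF p]] by simp
  next
    fix p q \<gamma> assume *: "p \<in> VOb P" "q \<in> VOb P" "\<gamma> \<in> HHom P p q"
    then have "is_hmor A (chom (vfst p) (vsnd p) (vsnd q))"
      using P_VObD[of p] P_VObD[of q] by (intro catD(2)) simp_all
    then show "GH (epsilon U A) p q \<gamma> \<in> HHom A (Go (epsilon U A) p) (Go (epsilon U A) q)"
      using * by (simp add: is_hmor_def)
  }
  show "epsilon U A = mk_vd_fun P (Go (epsilon U A)) (GV (epsilon U A)) (GH (epsilon U A)) (GM (epsilon U A))"
    unfolding epsilon_def by simp
qed

end

section \<open>Naturality of the counit\<close>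

lemma pointed_catsI: "virtual_double_category A \<Longrightarrow> pointed_cats A U"
  by (simp add: pointed_cats_def enrichment_def set_functor_def enrichment.two_category_ACat two_functor_ob)

text \<open>A virtual double functor \<open>G\<close> together with the induced virtual double functor \<open>LG\<close> between the virtual double
  categories of pointed enriched categories.\<close>

locale pointed_push = PA: pointed_cats A U + PB: pointed_cats B U + enr_push A B U G
  for A B :: "'v::zf vdcv" and U :: 'v and G :: "'v vd_funv"
begin

abbreviation LG :: "'v vd_funv" where
  "LG \<equiv> L1 (ACat U A) (ob_functor U A) (Push U A G)"

lemma set_functor_morphism_Push:
  "set_functor_morphism (ACat U A) (ACat U B) U (ob_functor U A) (ob_functor U B) (Push U A G)"
  unfolding set_functor_morphism_def set_functor_morphism_axioms_def
  using PA.LV.set_functor_axioms PB.LV.set_functor_axioms two_functor_Push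
    ob_push[OF PA.virtual_double_category_axioms PB.virtual_double_category_axioms virtual_double_functor_axioms]
  by simp

lemma virtual_double_functor_LG: "virtual_double_functor PA.P PB.P LG"
  by (rule set_functor_morphism.virtual_double_functor_L1[OF set_functor_morphism_Push])

text \<open>\<open>G\<close> preserves products of generalised elements, hence it maps the product along a path to the product along
  the image of the path.\<close>

lemma fpath_push:
  assumes "hpath PA.P p \<Gamma>s" and D: "D \<in> enr_cats U A" and f: "f \<in> enr_funs A (vfst p) D"
  shows "fpath B (push_cat A G (vfst p)) (push_cat A G D) (push_fun G (vfst p) D f) (vsnd p) (map (hmap LG) \<Gamma>s)
    = epush G D (fpath A (vfst p) D f (vsnd p) \<Gamma>s)"
  using assms(1,3)
proof (induction \<Gamma>s arbitrary: p)
  case Nil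
  then have C: "vfst p \<in> enr_cats U A" and c: "vsnd p \<in> cat_ob (vfst p)" by (auto simp: PA.P_VObD)
  show ?case using c PA.catD[OF C] PA.funD[OF C D Nil(2)] by (simp add: epush_eunit[OF D])
next
  case (Cons \<Gamma> \<Gamma>s)
  note p = PA.P_path_Cons[OF Cons.prems(1)] and q = PA.P_path[OF Cons.prems(1)]
  have C: "vfst p \<in> enr_cats U A" using q by simp
  have v: "vfst (htgt \<Gamma>) = vfst p" using p by simp
  have h: "hpath PA.P (htgt \<Gamma>) \<Gamma>s" using Cons.prems(1) by simp
  note IH = Cons.IH[OF h, unfolded v, OF Cons.prems(2)] and s = PA.fpath_sel[OF h v[symmetric] refl D Cons.prems(2)]
  have "htgt \<Gamma> \<in> VOb PA.P" using h by (rule hpath_start)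
  then show ?case
    using IH s p q PA.funD(1,2,3)[OF C D Cons.prems(2)] by (simp add: epush_emul[OF D] felem_push follows_def)
qed

lemma tpath_push:
  assumes h: "hpath PA.P p \<Gamma>s" and D: "D \<in> enr_cats U A"
    and f: "f \<in> enr_funs A (vfst p) D" "f' \<in> enr_funs A (vfst p) D" and \<alpha>: "\<alpha> \<in> enr_nats A (vfst p) D f f'"
  shows "tpath B (push_cat A G (vfst p)) (push_cat A G D) (push_fun G (vfst p) D f) (push_fun G (vfst p) D f')
      (push_nat G (vfst p) D f f' \<alpha>) (vsnd p) (map (hmap LG) \<Gamma>s)
    = epush G D (tpath A (vfst p) D f f' \<alpha> (vsnd p) \<Gamma>s)"
  using PA.P_path[OF h] PA.natD(1)[OF _ D f \<alpha>, of "vsnd p"] PA.fpath_sel[OF h refl refl D f(2)]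
  by (simp add: tpath_def fpath_push[OF h D f(2)] nelem_push epush_emul[OF D] follows_def)

lemma epsilon_natural1: "cmp_vd_fun PA.P (epsilon U B) LG = cmp_vd_fun PA.P G (epsilon U A)"
proof (rule virtual_double_functor_eqI)
  interpret L: virtual_double_functor PA.P PB.P LG by (rule virtual_double_functor_LG)
  interpret S: set_functor_morphism "ACat U A" "ACat U B" U "ob_functor U A" "ob_functor U B" "Push U A G"
    by (rule set_functor_morphism_Push)
  interpret eA: virtual_double_functor PA.P A "epsilon U A" by (rule PA.virtual_double_functor_epsilon)
  show "virtual_double_functor PA.P B (cmp_vd_fun PA.P (epsilon U B) LG)"
    by (rule virtual_double_functor_cmp[OF PA.virtual_double_category_P virtual_double_functor_LG PB.virtual_double_functor_epsilon])
  show "virtual_double_functor PA.P B (cmp_vd_fun PA.P G (epsilon U A))"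
    by (rule virtual_double_functor_cmp[OF PA.virtual_double_category_P PA.virtual_double_functor_epsilon virtual_double_functor_axioms])
  {
    fix p assume p: "p \<in> VOb PA.P"
    then show "Go (cmp_vd_fun PA.P (epsilon U B) LG) p = Go (cmp_vd_fun PA.P G (epsilon U A)) p"
      using L.go[OF p] by (simp add: PA.P_VObD)
    fix q assume q: "q \<in> VOb PA.P"
    {
      fix f assume f: "f \<in> VHom PA.P p q"
      then show "GV (cmp_vd_fun PA.P (epsilon U B) LG) p q f = GV (cmp_vd_fun PA.P G (epsilon U A)) p q f"
        using p q L.go[OF p] L.go[OF q] L.gv[OF p q f] by (simp add: PA.P_VObD PA.P_VHom)
    next
      fix \<gamma> assume \<gamma>: "\<gamma> \<in> HHom PA.P p q"
      then show "GH (cmp_vd_fun PA.P (epsilon U B) LG) p q \<gamma> = GH (cmp_vd_fun PA.P G (epsilon U A)) p q \<gamma>"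
        using p q L.go[OF p] L.go[OF q] L.gh[OF p q \<gamma>] PA.P_VObD[OF p] PA.P_VObD[OF q] by simp
    }
  next
    fix p \<Gamma>s \<Delta> f f' \<alpha> assume b: "is_bdry PA.P p \<Gamma>s \<Delta> f f'" and \<alpha>: "\<alpha> \<in> MCell PA.P p \<Gamma>s \<Delta> f f'"
    note d = PA.P_bdryD[OF b] is_bdryD[OF b]
    have \<alpha>': "\<alpha> \<in> enr_nats A (vfst p) (vfst (hsrc \<Delta>)) f f'" using \<alpha> by simp
    have h: "hpath PA.P p \<Gamma>s" using d by simp
    note t = PA.tpath_sel[OF h refl refl d(2,5,6) \<alpha>']
    have "GM (epsilon U B) (Go LG p) (map (hmap LG) \<Gamma>s) (hmap LG \<Delta>)
        (GV LG p (hsrc \<Delta>) f) (GV LG (hend p \<Gamma>s) (htgt \<Delta>) f') (GM LG p \<Gamma>s \<Delta> f f' \<alpha>)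
      = ecell (epush G (vfst (hsrc \<Delta>)) (tpath A (vfst p) (vfst (hsrc \<Delta>)) f f' \<alpha> (vsnd p) \<Gamma>s))"
      using L.bdry[OF b] L.gm[OF b \<alpha>] b \<alpha> \<alpha>' d by (simp add: tpath_push[OF h d(2,5,6) \<alpha>', symmetric])
    also have "\<dots> = GM G (Go (epsilon U A) p) (map (hmap (epsilon U A)) \<Gamma>s) (hmap (epsilon U A) \<Delta>)
        (GV (epsilon U A) p (hsrc \<Delta>) f) (GV (epsilon U A) (hend p \<Gamma>s) (htgt \<Delta>) f') (GM (epsilon U A) p \<Gamma>s \<Delta> f f' \<alpha>)"
      using b \<alpha> d t by (simp add: epush_def PA.hmap_epsilon)
    finally show "GM (cmp_vd_fun PA.P (epsilon U B) LG) p \<Gamma>s \<Delta> f f' \<alpha> = GM (cmp_vd_fun PA.P G (epsilon U A)) p \<Gamma>s \<Delta> f f' \<alpha>"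
      using b \<alpha> by simp
  }
qed

end

text \<open>The whiskerings occurring in the 2-naturality axiom.\<close>

lemma VDBL_Hc_id:
  assumes A: "A \<in> Ob (VDBL U)" and B: "B \<in> Ob (VDBL U)" and C: "C \<in> Ob (VDBL U)"
    and F: "F \<in> Hom1 (VDBL U) A B" "F' \<in> Hom1 (VDBL U) A B" and G: "G \<in> Hom1 (VDBL U) B C" "G' \<in> Hom1 (VDBL U) B C"
  shows "\<sigma> \<in> Hom2 (VDBL U) A B F F' \<Longrightarrow> Hc (VDBL U) A B C F F' G G (Id2 (VDBL U) B C G) \<sigma> = lwhisker_vtrans A F F' G \<sigma>"
    and "\<tau> \<in> Hom2 (VDBL U) B C G G' \<Longrightarrow> Hc (VDBL U) A B C F F G G' \<tau> (Id2 (VDBL U) A B F) = rwhisker_vtrans A F \<tau>"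
proof -
  interpret B: virtual_double_category B using B by simp
  interpret C: virtual_double_category C using C by simp
  interpret F: virtual_double_functor A B F using F by simp
  interpret F': virtual_double_functor A B F' using F by simp
  interpret G: virtual_double_functor B C G using G by simp
  interpret G': virtual_double_functor B C G' using G by simp
  note [simp] = F.go F'.go G.go G'.go F.gv F'.gv G.gv G'.gv F.hmor F'.hmor G.hmor G'.hmor is_hmorD
  {
    assume \<sigma>: "\<sigma> \<in> Hom2 (VDBL U) A B F F'"
    then interpret \<sigma>: vertical_transformation A B F F' \<sigma> by simp
    show "Hc (VDBL U) A B C F F' G G (Id2 (VDBL U) B C G) \<sigma> = lwhisker_vtrans A F F' G \<sigma>"
    proof (rule vtrans_eqI[where A = A])
      fix \<Gamma> assume \<Gamma>: "is_hmor A \<Gamma>"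
      note b = \<sigma>.tc_bdry[OF F.virtual_double_functor_axioms F'.virtual_double_functor_axioms \<Gamma>]
      show "TC (Hc (VDBL U) A B C F F' G G (Id2 (VDBL U) B C G) \<sigma>) \<Gamma> = TC (lwhisker_vtrans A F F' G \<sigma>) \<Gamma>"
        using \<Gamma> C.mcmp_id_left[OF G.bdry[OF b] G.gm[OF b \<sigma>.tc[OF \<Gamma>]]] by (simp add: VDBL_Hc_sel)
    qed (simp_all add: VDBL_Hc_sel \<sigma>.tv C.vcmp_id_left, simp add: VDBL_def)
  next
    assume \<tau>: "\<tau> \<in> Hom2 (VDBL U) B C G G'"
    then interpret \<tau>: vertical_transformation B C G G' \<tau> by simp
    show "Hc (VDBL U) A B C F F G G' \<tau> (Id2 (VDBL U) A B F) = rwhisker_vtrans A F \<tau>"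
    proof (rule vtrans_eqI[where A = A])
      fix \<Gamma> assume \<Gamma>: "is_hmor A \<Gamma>"
      note b = \<tau>.tc_bdry[OF G.virtual_double_functor_axioms G'.virtual_double_functor_axioms F.hmor[OF \<Gamma>]]
      show "TC (Hc (VDBL U) A B C F F G G' \<tau> (Id2 (VDBL U) A B F)) \<Gamma> = TC (rwhisker_vtrans A F \<tau>) \<Gamma>"
        using \<Gamma> C.mcmp_id_right[OF b \<tau>.tc[OF F.hmor[OF \<Gamma>]]] F.hmor[OF \<Gamma>] G.gm_id[OF F.hmor[OF \<Gamma>]] G.gv_id
        by (simp add: VDBL_Hc_sel)
    qed (simp_all add: VDBL_Hc_sel \<tau>.tv C.vcmp_id_right G.gv_id, simp add: VDBL_def)
  }
qed

text \<open>The components of the left hand side are images under the counit of identity transformations over paths of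
  length 1, that is, hom-actions of the functors \<open>trans_fun \<sigma> C\<close>. These are the components of \<open>\<sigma>\<close>.\<close>

lemma epsilon_natural2:
  assumes "enr_trans A B F G \<sigma>"
  shows "lwhisker_vtrans (LL (ACat U A) (ob_functor U A))
      (L1 (ACat U A) (ob_functor U A) (Push U A F))
      (L1 (ACat U A) (ob_functor U A) (Push U A G)) (epsilon U B)
      (L2 (ACat U A) (ob_functor U A) (ACat U B) (Push U A F)
        (Push U A G) (\<lambda>C\<in>enr_cats U A. trans_fun \<sigma> C))
    = rwhisker_vtrans (LL (ACat U A) (ob_functor U A)) (epsilon U A) \<sigma>"
proof -
  interpret enr_trans A B U F G \<sigma> by fact
  interpret PA: pointed_cats A U by (rule pointed_catsI[OF F.A.virtual_double_category_axioms])
  interpret PB: pointed_cats B U by (rule pointed_catsI[OF F.B.virtual_double_category_axioms])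
  interpret PF: pointed_push A B U F
    by (simp add: pointed_push_def PA.pointed_cats_axioms PB.pointed_cats_axioms F.enr_push_axioms)
  interpret PG: pointed_push A B U G
    by (simp add: pointed_push_def PA.pointed_cats_axioms PB.pointed_cats_axioms G.enr_push_axioms)
  interpret LF: virtual_double_functor PA.P PB.P PF.LG by (rule PF.virtual_double_functor_LG)
  interpret LG: virtual_double_functor PA.P PB.P PG.LG by (rule PG.virtual_double_functor_LG)
  let ?\<sigma> = "\<lambda>C\<in>enr_cats U A. trans_fun \<sigma> C"
  let ?L = "L2 (ACat U A) (ob_functor U A) (ACat U B) (Push U A F) (Push U A G) ?\<sigma>"
  have over: "vapp (F1 (ob_functor U B) (Fo (Push U A F) C) (Fo (Push U A G) C) (?\<sigma> C)) c = c" if "C \<in> enr_cats U A" "c \<in> cat_ob C" for C c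
    using that by (simp add: F.push_cat G.push_cat trans_fun)
  have "vertical_transformation PA.P PB.P PF.LG PG.LG ?L"
    by (rule vertical_transformation_L2[OF PF.set_functor_morphism_Push PG.set_functor_morphism_Push two_nat_trans])
      (use over in simp)
  then interpret L: vertical_transformation PA.P PB.P PF.LG PG.LG ?L .
  show ?thesis
  proof (rule vtrans_eqI[where A = PA.P])
    fix p assume p: "p \<in> VOb PA.P"
    show "TV (lwhisker_vtrans PA.P PF.LG PG.LG (epsilon U B) ?L) p = TV (rwhisker_vtrans PA.P (epsilon U A) \<sigma>) p"
      using p LF.go[OF p] LG.go[OF p] L.tv[OF p] by (simp add: PA.P_VObD)
  next
    fix \<Gamma> assume \<Gamma>: "is_hmor PA.P \<Gamma>"
    let ?C = "vfst (hsrc \<Gamma>)" and ?c = "vsnd (hsrc \<Gamma>)" and ?c' = "vsnd (htgt \<Gamma>)"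
    have C: "?C \<in> enr_cats U A" and c: "?c \<in> cat_ob ?C" "?c' \<in> cat_ob ?C" and v: "vfst (htgt \<Gamma>) = ?C"
      using \<Gamma> PA.P_VObD[of "hsrc \<Gamma>"] PA.P_VObD[of "htgt \<Gamma>"] by (simp_all add: PA.LV.LL_hmor)
    note b = L.tc_bdry[OF LF.virtual_double_functor_axioms LG.virtual_double_functor_axioms \<Gamma>]
    have h: "hpath PB.P (Go PF.LG (hsrc \<Gamma>)) [hmap PF.LG \<Gamma>]" using is_bdryD(1)[OF b] .
    have e: "push_cat A F ?C = vfst (Go PF.LG (hsrc \<Gamma>))" "?c = vsnd (Go PF.LG (hsrc \<Gamma>))"
      "vsnd (htgt (hmap PF.LG \<Gamma>)) = ?c'"
      using C by (simp_all only: hmap_sel L1_sel(1)[OF is_hmorD(1)[OF \<Gamma>]] L1_sel(1)[OF is_hmorD(2)[OF \<Gamma>]] mk_two_fun_sel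
          ACat_sel vfst_vpair vsnd_vpair)
    have "TC (lwhisker_vtrans PA.P PF.LG PG.LG (epsilon U B) ?L) \<Gamma>
      = ecell (tpath B (push_cat A F ?C) (push_cat A G ?C) (trans_fun \<sigma> ?C) (trans_fun \<sigma> ?C)
          (id_nat B (push_cat A F ?C) (push_cat A G ?C) (trans_fun \<sigma> ?C)) ?c [hmap PF.LG \<Gamma>])"
      unfolding lwhisker_vtrans_sel(2)[OF \<Gamma>] epsilon_sel(4)[OF b L.tc[OF \<Gamma>]]
      using C by (simp only: hmap_sel L1_sel(1)[OF is_hmorD(1)[OF \<Gamma>]] L2_sel(1)[OF is_hmorD(1)[OF \<Gamma>]]
          L2_sel(1)[OF is_hmorD(2)[OF \<Gamma>]] L2_sel(2)[OF \<Gamma>] v mk_two_fun_sel ACat_sel vfst_vpair vsnd_vpair restrict_apply if_True)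
    also have "\<dots> = ecell (emul B (push_cat A G ?C) (felem (push_cat A F ?C) (trans_fun \<sigma> ?C) ?c ?c')
        (eunit B (push_cat A G ?C) (Go F (ext ?C ?c')) ?c' (TV \<sigma> (ext ?C ?c'))))"
      by (simp only: PB.tpath_id[OF h e(1,2) G.push_cat[OF C] trans_fun[OF C]] fpath.simps e(3)) (simp add: c)
    also have "emul B (push_cat A G ?C) (felem (push_cat A F ?C) (trans_fun \<sigma> ?C) ?c ?c')
        (eunit B (push_cat A G ?C) (Go F (ext ?C ?c')) ?c' (TV \<sigma> (ext ?C ?c'))) = felem (push_cat A F ?C) (trans_fun \<sigma> ?C) ?c ?c'"
      using F.B.emul_eunit_right[OF G.push_cat[OF C] trans_elem[OF C c]] c by simp
    also have "ecell (felem (push_cat A F ?C) (trans_fun \<sigma> ?C) ?c ?c') = TC (rwhisker_vtrans PA.P (epsilon U A) \<sigma>) \<Gamma>"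
      using \<Gamma> c by (simp add: PA.hmap_epsilon)
    finally show "TC (lwhisker_vtrans PA.P PF.LG PG.LG (epsilon U B) ?L) \<Gamma> = TC (rwhisker_vtrans PA.P (epsilon U A) \<sigma>) \<Gamma>" .
  qed simp_all
qed

lemma two_nat_epsilon:
  assumes U2: "grothendieck_universe U2" and U1: "U1 \<in> elts U2"
  shows "two_nat (VDBL U2) (VDBL U2) (cmp_two_fun (VDBL U2) (L_functor U1 U2) (Enr1 U1 U2)) (id_two_fun (VDBL U2))
    (\<lambda>A\<in>Ob (VDBL U2). epsilon U1 A)" (is "two_nat _ _ ?LR _ ?e")
proof (unfold_locales)
  let ?S = "slice (two_CAT U2) (Set_lc U1)"
  interpret R: two_functor "VDBL U2" ?S "Enr1 U1 U2" by (rule two_functor_Enr1[OF U2 U1])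
  interpret L: two_functor ?S "VDBL U2" "L_functor U1 U2" by (rule two_functor_L[OF U2 U1])
  have RO: "(ACat U1 A, ob_functor U1 A) \<in> Ob ?S" if "A \<in> Ob (VDBL U2)" for A
    using R.fo[OF that] by (simp add: Enr1_sel(1)[OF that] del: VDBL_sel slice_sel)
  have LRo: "Fo ?LR A = LL (ACat U1 A) (ob_functor U1 A)" if "A \<in> Ob (VDBL U2)" for A
    using that RO[OF that] by (simp add: Enr1_sel(1)[OF that] L_functor_sel(1) del: VDBL_sel slice_sel)
  show "?e \<in> extensional (Ob (VDBL U2))" by simp
  fix A assume A: "A \<in> Ob (VDBL U2)"
  then have A': "virtual_double_category A" by simp
  interpret PA: pointed_cats A U1 by (rule pointed_catsI[OF A'])
  have LA: "PA.P \<in> Ob (VDBL U2)" using L.fo[OF R.fo[OF A]] LRo[OF A] A by simp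
  have eA: "?e A \<in> Hom1 (VDBL U2) PA.P A" using A PA.virtual_double_functor_epsilon by simp
  show "?e A \<in> Hom1 (VDBL U2) (Fo ?LR A) (Fo (id_two_fun (VDBL U2)) A)"
    using eA A by (simp add: LRo[OF A] del: VDBL_sel)
  fix B F assume B: "B \<in> Ob (VDBL U2)" and F: "F \<in> Hom1 (VDBL U2) A B"
  then have B': "virtual_double_category B" and F': "virtual_double_functor A B F" by simp_all
  interpret PB: pointed_cats B U1 by (rule pointed_catsI[OF B'])
  have LB: "PB.P \<in> Ob (VDBL U2)" using L.fo[OF R.fo[OF B]] LRo[OF B] B by simp
  have eB: "?e B \<in> Hom1 (VDBL U2) PB.P B" using B PB.virtual_double_functor_epsilon by simp
  have RH: "Push U1 A G
      \<in> Hom1 ?S (ACat U1 A, ob_functor U1 A) (ACat U1 B, ob_functor U1 B)" if "G \<in> Hom1 (VDBL U2) A B" for G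
    using R.f1[OF A B that] by (simp add: Enr1_sel(1)[OF A] Enr1_sel(1)[OF B] Enr1_sel(2)[OF A B that] del: VDBL_sel slice_sel)
  have LR1: "F1 ?LR A B G = L1 (ACat U1 A) (ob_functor U1 A) (Push U1 A G)"
    if G: "G \<in> Hom1 (VDBL U2) A B" for G
    using A B G RO[OF A] RO[OF B] RH[OF G]
    by (simp add: Enr1_sel(1)[OF A] Enr1_sel(1)[OF B] Enr1_sel(2)[OF A B G] L_functor_sel(2) del: VDBL_sel slice_sel)
  interpret PF: pointed_push A B U1 F
    by (simp add: pointed_push_def PA.pointed_cats_axioms PB.pointed_cats_axioms enr_push_def enrichment_def A' B' F')
  show "Cmp1 (VDBL U2) (Fo ?LR A) (Fo ?LR B) (Fo (id_two_fun (VDBL U2)) B) (?e B) (F1 ?LR A B F)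
    = Cmp1 (VDBL U2) (Fo ?LR A) (Fo (id_two_fun (VDBL U2)) A) (Fo (id_two_fun (VDBL U2)) B) (F1 (id_two_fun (VDBL U2)) A B F) (?e A)"
    using PF.epsilon_natural1 A B F unfolding LRo[OF A] LRo[OF B] LR1[OF F] by simp
  fix G \<sigma> assume G: "G \<in> Hom1 (VDBL U2) A B" and \<sigma>: "\<sigma> \<in> Hom2 (VDBL U2) A B F G"
  have R2: "(\<lambda>C\<in>enr_cats U1 A. trans_fun \<sigma> C)
      \<in> Hom2 ?S (ACat U1 A, ob_functor U1 A) (ACat U1 B, ob_functor U1 B)
         (Push U1 A F)
         (Push U1 A G)"
    using R.f2[OF A B F G \<sigma>]
    by (simp add: Enr1_sel(1)[OF A] Enr1_sel(1)[OF B] Enr1_sel(2)[OF A B F] Enr1_sel(2)[OF A B G] Enr1_sel(3)[OF A B F G \<sigma>]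
        del: VDBL_sel slice_sel)
  have LR2: "F2 ?LR A B F G \<sigma> = L2 (ACat U1 A) (ob_functor U1 A) (ACat U1 B)
      (Push U1 A F)
      (Push U1 A G) (\<lambda>C\<in>enr_cats U1 A. trans_fun \<sigma> C)"
    using A B F G \<sigma> RO[OF A] RO[OF B] RH[OF F] RH[OF G] R2
    by (simp add: Enr1_sel(1)[OF A] Enr1_sel(1)[OF B] Enr1_sel(2)[OF A B F] Enr1_sel(2)[OF A B G] Enr1_sel(3)[OF A B F G \<sigma>]
        L_functor_sel(3) del: VDBL_sel slice_sel)
  have LR: "F1 ?LR A B F \<in> Hom1 (VDBL U2) PA.P PB.P" "F1 ?LR A B G \<in> Hom1 (VDBL U2) PA.P PB.P"
    "F2 ?LR A B F G \<sigma> \<in> Hom2 (VDBL U2) PA.P PB.P (F1 ?LR A B F) (F1 ?LR A B G)"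
    using L.f1[OF R.fo[OF A] R.fo[OF B] R.f1[OF A B F]] L.f1[OF R.fo[OF A] R.fo[OF B] R.f1[OF A B G]]
      L.f2[OF R.fo[OF A] R.fo[OF B] R.f1[OF A B F] R.f1[OF A B G] R.f2[OF A B F G \<sigma>]] A B F G \<sigma> LRo[OF A] LRo[OF B]
    by (simp_all del: VDBL_sel slice_sel)
  have t: "enr_trans A B F G \<sigma>"
    using \<sigma> G by (simp add: enr_trans_def enr_push_def enrichment_def A' B' F')
  have "Hc (VDBL U2) PA.P PB.P B (F1 ?LR A B F) (F1 ?LR A B G) (?e B) (?e B) (Id2 (VDBL U2) PB.P B (?e B)) (F2 ?LR A B F G \<sigma>)
    = lwhisker_vtrans PA.P (F1 ?LR A B F) (F1 ?LR A B G) (?e B) (F2 ?LR A B F G \<sigma>)"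
    by (rule VDBL_Hc_id(1)[OF LA LB B LR(1,2) eB eB LR(3)])
  also have "\<dots> = rwhisker_vtrans PA.P (?e A) \<sigma>"
    using epsilon_natural2[OF t, of U1] A B unfolding LR1[OF F] LR1[OF G] LR2 by simp
  also have "\<dots> = Hc (VDBL U2) PA.P A B (?e A) (?e A) F G \<sigma> (Id2 (VDBL U2) PA.P A (?e A))"
    by (rule VDBL_Hc_id(2)[OF LA A B eA eA F G \<sigma>, symmetric])
  finally show "Hc (VDBL U2) (Fo ?LR A) (Fo ?LR B) (Fo (id_two_fun (VDBL U2)) B) (F1 ?LR A B F) (F1 ?LR A B G) (?e B) (?e B)
      (Id2 (VDBL U2) (Fo ?LR B) (Fo (id_two_fun (VDBL U2)) B) (?e B)) (F2 ?LR A B F G \<sigma>)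
    = Hc (VDBL U2) (Fo ?LR A) (Fo (id_two_fun (VDBL U2)) A) (Fo (id_two_fun (VDBL U2)) B) (?e A) (?e A)
      (F1 (id_two_fun (VDBL U2)) A B F) (F1 (id_two_fun (VDBL U2)) A B G) (F2 (id_two_fun (VDBL U2)) A B F G \<sigma>)
      (Id2 (VDBL U2) (Fo ?LR A) (Fo (id_two_fun (VDBL U2)) A) (?e A))"
    using A B F G \<sigma> unfolding LRo[OF A] LRo[OF B] by (simp del: VDBL_sel)
qed

section \<open>The triangle identities\<close>

context set_functor
begin

lemma set_functor_morphism_eta:
  "set_functor_morphism K (ACat U V) U F (ob_functor U V) (eta K F)"
proof -
  interpret P: pointed_cats V U by (rule pointed_catsI[OF virtual_double_category_LL])
  show ?thesis
    by (simp add: set_functor_morphism_def set_functor_morphism_axioms_def set_functor_axioms P.LV.set_functor_axioms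
        two_functor_eta ob_eta)
qed

lemma fpath_eta_sel:
  assumes h: "hpath V p \<Gamma>s" and A: "A = vfst p" and B: "B \<in> Ob K" and f: "f \<in> Hom1 K A B"
  shows "eright (fpath V (eta_ob K F A) (eta_ob K F B) (eta_mor K F A B f) (vsnd p) (map (hmap (L1 K F (eta K F))) \<Gamma>s)) = f"
    "esrc (fpath V (eta_ob K F A) (eta_ob K F B) (eta_mor K F A B f) (vsnd p) (map (hmap (L1 K F (eta K F))) \<Gamma>s)) \<in> elts (Fo F B)"
    "etgt (fpath V (eta_ob K F A) (eta_ob K F B) (eta_mor K F A B f) (vsnd p) (map (hmap (L1 K F (eta K F))) \<Gamma>s)) \<in> elts (Fo F B)"
proof -
  interpret E: enrichment V U by (rule enrichment_V)
  interpret M: set_functor_morphism K "ACat U V" U F "ob_functor U V" "eta K F" by (rule set_functor_morphism_eta)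
  interpret P: pointed_cats V U by (rule pointed_catsI[OF virtual_double_category_LL])
  interpret L: virtual_double_functor V P.P "L1 K F (eta K F)" by (rule M.virtual_double_functor_L1)
  have p: "p \<in> VOb V" and q: "hend p \<Gamma>s \<in> VOb V" and v: "vfst (hend p \<Gamma>s) = A"
    using hpath_start[OF h] hpath_hend[OF h] vfst_hend[OF h] A by simp_all
  have A': "A \<in> Ob K" and x: "vsnd p \<in> elts (Fo F A)" "vsnd (hend p \<Gamma>s) \<in> elts (Fo F A)"
    using VObD[OF p] VObD[OF q] A v by simp_all
  have e: "eta_ob K F A = vfst (Go (L1 K F (eta K F)) p)" "vsnd p = vsnd (Go (L1 K F (eta K F)) p)"
    using A A' L1_sel(1)[OF p, of "eta K F"] by simp_all
  have e': "vsnd (hend (Go (L1 K F (eta K F)) p) (map (hmap (L1 K F (eta K F))) \<Gamma>s)) = vsnd (hend p \<Gamma>s)"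
    using L1_sel(1)[OF q, of "eta K F"] by simp
  note s = P.fpath_sel[OF L.path[OF h] e eta_ob[OF B] eta_mor[OF A' B f], unfolded e']
  show "eright (fpath V (eta_ob K F A) (eta_ob K F B) (eta_mor K F A B f) (vsnd p) (map (hmap (L1 K F (eta K F))) \<Gamma>s)) = f"
    unfolding s(8) by (rule eta_mor_sel(2)[OF x(2)])
  show "esrc (fpath V (eta_ob K F A) (eta_ob K F B) (eta_mor K F A B f) (vsnd p) (map (hmap (L1 K F (eta K F))) \<Gamma>s)) \<in> elts (Fo F B)"
    "etgt (fpath V (eta_ob K F A) (eta_ob K F B) (eta_mor K F A B f) (vsnd p) (map (hmap (L1 K F (eta K F))) \<Gamma>s)) \<in> elts (Fo F B)"
    unfolding s(5,6) eta_mor_sel(1)[OF x(1)] eta_mor_sel(1)[OF x(2)] by (rule F1_app[OF A' B f x(1)] F1_app[OF A' B f x(2)])+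
qed

text \<open>Every factor is an identity 2-cell, and so is the composition of the enriched category in which the product
  is formed.\<close>

lemma fpath_eta:
  assumes "hpath V p \<Gamma>s" and "B \<in> Ob K" "f \<in> Hom1 K (vfst p) B"
  shows "ecell (fpath V (eta_ob K F (vfst p)) (eta_ob K F B) (eta_mor K F (vfst p) B f) (vsnd p) (map (hmap (L1 K F (eta K F))) \<Gamma>s))
    = Id2 K (vfst p) B f"
  using assms(1,3)
proof (induction \<Gamma>s arbitrary: p)
  case Nil
  then show ?case using assms(2) by (simp add: eunit_def VObD hpath_start F1_app K.hc_id2 K.id1 K.cmp1_id_left)
next
  case (Cons \<Gamma> \<Gamma>s)
  have \<Gamma>: "hsrc \<Gamma> = p" "p \<in> VOb V" "htgt \<Gamma> \<in> VOb V" "vfst (htgt \<Gamma>) = vfst p" and h: "hpath V (htgt \<Gamma>) \<Gamma>s"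
    using Cons.prems(1) by (auto simp: LL_hmor)
  have A: "vfst p \<in> Ob K" using VObD(1)[OF \<Gamma>(2)] .
  note f = Cons.prems(2)
  note IH = Cons.IH[OF h, unfolded \<Gamma>(4), OF f]
  note s = fpath_eta_sel[OF h \<Gamma>(4)[symmetric] assms(2) f]
  show ?case
    using IH s A f assms(2) \<Gamma> VObD(2)[OF \<Gamma>(2)] VObD(2)[OF \<Gamma>(3)]
    by (simp add: emul_def eblock_def F1_app K.hc_id2 K.id1 K.id2 K.cmp1_id_left K.vc_id_left)
qed

text \<open>By \<open>fpath_eta\<close> only the component of the constant transformation remains in the product.\<close>

lemma epsilon_eta: "cmp_vd_fun V (epsilon U V) (L1 K F (eta K F)) = id_vd_fun V"
proof (rule virtual_double_functor_eqI)
  interpret E: enrichment V U by (rule enrichment_V)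
  interpret M: set_functor_morphism K "ACat U V" U F "ob_functor U V" "eta K F" by (rule set_functor_morphism_eta)
  interpret P: pointed_cats V U by (rule pointed_catsI[OF virtual_double_category_LL])
  interpret L: virtual_double_functor V P.P "L1 K F (eta K F)" by (rule M.virtual_double_functor_L1)
  show "virtual_double_functor V V (cmp_vd_fun V (epsilon U V) (L1 K F (eta K F)))"
    by (rule virtual_double_functor_cmp[OF virtual_double_category_LL M.virtual_double_functor_L1 P.virtual_double_functor_epsilon])
  show "virtual_double_functor V V (id_vd_fun V)" by (rule virtual_double_functor_id[OF virtual_double_category_LL])
  {
    fix p assume p: "p \<in> VOb V"
    then show "Go (cmp_vd_fun V (epsilon U V) (L1 K F (eta K F))) p = Go (id_vd_fun V) p"
      using L.go[OF p] VObD[OF p] LL_VOb[of p] by simp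
    fix q assume q: "q \<in> VOb V"
    {
      fix f assume f: "f \<in> VHom V p q"
      then show "GV (cmp_vd_fun V (epsilon U V) (L1 K F (eta K F))) p q f = GV (id_vd_fun V) p q f"
        using p q L.go[OF p] L.go[OF q] L.gv[OF p q f] VObD[OF p] VObD[OF q] LL_VHom[of f p q] by simp
    next
      fix \<gamma> assume \<gamma>: "\<gamma> \<in> HHom V p q"
      then show "GH (cmp_vd_fun V (epsilon U V) (L1 K F (eta K F))) p q \<gamma> = GH (id_vd_fun V) p q \<gamma>"
        using p q L.go[OF p] L.go[OF q] L.gh[OF p q \<gamma>] VObD[OF p] VObD[OF q] by simp
    }
  next
    fix p \<Gamma>s \<Delta> f f' \<alpha> assume b: "is_bdry V p \<Gamma>s \<Delta> f f'" and \<alpha>: "\<alpha> \<in> MCell V p \<Gamma>s \<Delta> f f'"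
    note d = LL_bdryD[OF b] is_bdryD[OF b]
    have c: "vsnd p \<in> elts (Fo F (vfst p))" using VObD d by blast
    have \<alpha>': "\<alpha> \<in> Hom2 K (vfst p) (vfst (hsrc \<Delta>)) f f'" using \<alpha> by simp
    have h: "hpath V p \<Gamma>s" using d by simp
    note s = fpath_eta_sel[OF h refl d(2,6)]
    have "ecell (tpath V (eta_ob K F (vfst p)) (eta_ob K F (vfst (hsrc \<Delta>))) (eta_mor K F (vfst p) (vfst (hsrc \<Delta>)) f)
        (eta_mor K F (vfst p) (vfst (hsrc \<Delta>)) f') (eta_nat F (vfst p) \<alpha>) (vsnd p) (map (hmap (L1 K F (eta K F))) \<Gamma>s)) = \<alpha>"
      using s d c \<alpha>' fpath_eta[OF h d(2,6)] VObD(2)[of "hsrc \<Delta>"]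
      by (simp add: tpath_def emul_def eblock_def F1_app K.id2 K.vc_id_left K.hc_id_left)
    then show "GM (cmp_vd_fun V (epsilon U V) (L1 K F (eta K F))) p \<Gamma>s \<Delta> f f' \<alpha> = GM (id_vd_fun V) p \<Gamma>s \<Delta> f f' \<alpha>"
      using L.bdry[OF b] L.gm[OF b \<alpha>] b \<alpha> d \<alpha>' by simp
  }
qed

end

context pointed_cats
begin

text \<open>The units of \<open>C\<close> are recovered from the empty path, its compositions from paths of length 2, and the hom-action
  of a functor from paths of length 1.\<close>

lemma eta_epsilon:
  "cmp_two_fun (ACat U A) (Push U P (epsilon U A))
     (eta (ACat U A) (ob_functor U A)) = id_two_fun (ACat U A)"
  unfolding cmp_two_fun_def id_two_fun_def
proof (rule mk_two_fun_cong)
  interpret PE: enrichment P U by (rule LV.enrichment_V)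
  let ?e = "epsilon U A" and ?H = "Push U P (epsilon U A)"
  let ?ob = "eta_ob (ACat U A) (ob_functor U A)" and ?mor = "eta_mor (ACat U A) (ob_functor U A)" and ?nat = "eta_nat (ob_functor U A)"
  note [simp] = LV.eta_ob[unfolded ACat_sel] LV.eta_mor[unfolded ACat_sel] LV.eta_nat[unfolded ACat_sel]
  fix C assume C: "C \<in> Ob (ACat U A)"
  then have C': "C \<in> enr_cats U A" by simp
  have EC: "?ob C \<in> enr_cats U P" using C' by simp
  note [simp] = P_VObD
  have "push_cat P ?e (?ob C) = C"
  proof (rule enr_cat_eqI[OF C', symmetric])
    show "\<exists>e h n m. push_cat P ?e (?ob C) = mk_cat (cat_obset C) e h n m"
      using push_mk(1)[of P ?e "?ob C"] C' by simp
  next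
    fix c assume c: "c \<in> cat_ob C"
    then show "ext C c = ext (push_cat P ?e (?ob C)) c" using C' by simp
    have b: "is_bdry P (vpair C c) [] (chom (?ob C) c c) (VId P (vpair C c)) (VId P (vpair C c))"
      using PE.is_bdry_id[OF EC, of c c "[]"] c C' by simp
    have m: "id_nat A C C (id_fun A C) \<in> MCell P (vpair C c) [] (chom (?ob C) c c) (VId P (vpair C c)) (VId P (vpair C c))"
      using PE.catD(3)[OF EC, of c] c C' by simp
    show "cat_unit C c = cat_unit (push_cat P ?e (?ob C)) c"
      using c C' tpath_id[of "vpair C c" "[]" C c C "id_fun A C"] epsilon_sel(4)[OF b m] id_fun[OF C'] eunit_VId[OF C' c]
      by simp
    fix c' assume c': "c' \<in> cat_ob C"
    show "cat_hom C c c' = cat_hom (push_cat P ?e (?ob C)) c c'" using C' c c' by simp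
    fix c'' assume c'': "c'' \<in> cat_ob C"
    let ?h = "[chom (?ob C) c c', chom (?ob C) c' c'']"
    have b: "is_bdry P (vpair C c) ?h (chom (?ob C) c c'') (VId P (vpair C c)) (VId P (vpair C c''))"
      using PE.is_bdry_id[OF EC, of c c'' ?h] c c' c'' C' PE.catD(2)[OF EC, of c c'] PE.catD(2)[OF EC, of c' c''] by simp
    have m: "id_nat A C C (id_fun A C) \<in> MCell P (vpair C c) ?h (chom (?ob C) c c'') (VId P (vpair C c)) (VId P (vpair C c''))"
      using PE.catD(4)[OF EC, of c c' c''] c c' c'' C' by simp
    have h: "hpath P (vpair C c) ?h" using is_bdryD(1)[OF b] .
    show "cat_mult C c c' c'' = cat_mult (push_cat P ?e (?ob C)) c c' c''"
      using c c' c'' C' tpath_id[OF h, of C c C "id_fun A C"] epsilon_sel(4)[OF b m] id_fun[OF C'] 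
        emul_ielem[OF C' c c' c''] ielem_elem[OF C' c' c''] catD(1)[OF C' c'']
      by (simp add: felem_id emul_eunit_right)
  qed
  then show eC: "Fo ?H (Fo (eta (ACat U A) (ob_functor U A)) C) = C" using C by simp
  note eC' = \<open>push_cat P ?e (?ob C) = C\<close>
  fix D f assume D: "D \<in> Ob (ACat U A)" and f: "f \<in> Hom1 (ACat U A) C D"
  then have D': "D \<in> enr_cats U A" and f': "f \<in> enr_funs A C D" by simp_all
  have ED: "?ob D \<in> enr_cats U P" using D' by simp
  have Ef: "?mor C D f \<in> enr_funs P (?ob C) (?ob D)" using C' D' f' by simp
  have "push_fun ?e (?ob C) (?ob D) (?mor C D f) = f"
  proof (rule enr_fun_eqI[where X = "cat_obset C"])
    show "\<exists>fo fv fw. push_fun ?e (?ob C) (?ob D) (?mor C D f) = mk_fun (cat_obset C) fo fv fw"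
      using push_mk(2)[of ?e "?ob C" "?ob D" "?mor C D f"] C' by simp
    show "\<exists>fo fv fw. f = mk_fun (cat_obset C) fo fv fw" by (rule fun_mk_fun(3)[OF f'])
  next
    fix c assume c: "c \<in> cat_ob C"
    note fc = funD(1)[OF C' D' f' c]
    show "fun_ob (push_fun ?e (?ob C) (?ob D) (?mor C D f)) c = fun_ob f c" using c C' D' f' by simp
    show "fun_vert (push_fun ?e (?ob C) (?ob D) (?mor C D f)) c = fun_vert f c"
      using c C' D' f' fc PE.funD(2)[OF EC ED Ef, of c] by simp
    fix c' assume c': "c' \<in> cat_ob C"
    note fc' = funD(1)[OF C' D' f' c']
    note e = PE.funD(3)[OF EC ED Ef, of c c']
    have h: "hpath P (vpair C c) [chom (?ob C) c c']" using is_elemD(7)[OF e] c c' C' by simp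
    show "fun_cell (push_fun ?e (?ob C) (?ob D) (?mor C D f)) c c' = fun_cell f c c'"
      using is_elemD(11,12)[OF e] c c' C' D' f' fc fc' tpath_id[OF h, of C c D f] funD(3)[OF C' D' f' c c']
      by (simp add: emul_eunit_right)
  qed
  then show "F1 ?H (Fo (eta (ACat U A) (ob_functor U A)) C) (Fo (eta (ACat U A) (ob_functor U A)) D) (F1 (eta (ACat U A) (ob_functor U A)) C D f) = f"
    using C D f by simp
  fix g \<alpha> assume g: "g \<in> Hom1 (ACat U A) C D" and \<alpha>: "\<alpha> \<in> Hom2 (ACat U A) C D f g"
  then have g': "g \<in> enr_funs A C D" and \<alpha>': "\<alpha> \<in> enr_nats A C D f g" by simp_all
  have Eg: "?mor C D g \<in> enr_funs P (?ob C) (?ob D)" and E\<alpha>: "?nat C \<alpha> \<in> enr_nats P (?ob C) (?ob D) (?mor C D f) (?mor C D g)"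
    using C' D' f' g' \<alpha>' by simp_all
  have "push_nat ?e (?ob C) (?ob D) (?mor C D f) (?mor C D g) (?nat C \<alpha>) = \<alpha>"
  proof (rule vlam_extend)
    show "\<exists>t. push_nat ?e (?ob C) (?ob D) (?mor C D f) (?mor C D g) (?nat C \<alpha>) = vlam (cat_ob C) t"
      using push_mk(3)[of ?e "?ob C" "?ob D" "?mor C D f" "?mor C D g" "?nat C \<alpha>"] C' by simp
    show "\<exists>t. \<alpha> = vlam (cat_ob C) t" by (rule nat_mk_nat[OF \<alpha>'])
    fix c assume c: "c \<in> cat_ob C"
    note fc = funD(1)[OF C' D' f' c] funD(1)[OF C' D' g' c]
    note e = PE.natD(1)[OF EC ED Ef Eg E\<alpha>, of c]
    show "vapp (push_nat ?e (?ob C) (?ob D) (?mor C D f) (?mor C D g) (?nat C \<alpha>)) c = vapp \<alpha> c"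
      using is_elemD(11,12)[OF e] c C' D' f' g' fc natD(1)[OF C' D' f' g' \<alpha>' c]
      by (simp add: tpath_def emul_eunit_right)
  qed
  then show "F2 ?H (Fo (eta (ACat U A) (ob_functor U A)) C) (Fo (eta (ACat U A) (ob_functor U A)) D) (F1 (eta (ACat U A) (ob_functor U A)) C D f)
      (F1 (eta (ACat U A) (ob_functor U A)) C D g) (F2 (eta (ACat U A) (ob_functor U A)) C D f g \<alpha>) = \<alpha>"
    using C D f g \<alpha> by simp
qed

end

section \<open>The adjunction\<close>

theorem theorem3p1:
  fixes U1 U2 :: "'v::zf"
  assumes "grothendieck_universe U1" and "grothendieck_universe U2" and "U1 \<in> elts U2"
  shows "\<exists>L. (\<forall>(K, F) \<in> Ob (slice (two_CAT U2) (Set_lc U1)). Fo L (K, F) = LL K F) \<and>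
             left_two_adjoint (slice (two_CAT U2) (Set_lc U1)) (VDBL U2) L (Enr1 U1 U2)"
proof (intro exI conjI)
  let ?S = "slice (two_CAT U2) (Set_lc U1)" and ?L = "L_functor U1 U2" and ?R = "Enr1 U1 U2"
  let ?e = "\<lambda>A\<in>Ob (VDBL U2). epsilon U1 A"
  show "\<forall>(K, F) \<in> Ob ?S. Fo ?L (K, F) = LL K F"
    using L_functor_sel(1) by (auto simp del: slice_sel)
  interpret R: two_functor "VDBL U2" ?S ?R by (rule two_functor_Enr1[OF assms(2,3)])
  interpret L: two_functor ?S "VDBL U2" ?L by (rule two_functor_L[OF assms(2,3)])
  have S: "two_category ?S"
    by (intro two_category_slice two_category_two_CAT Set_lc_in_two_CAT assms)
  have t1: "Cmp1 (VDBL U2) (Fo ?L X) (Fo ?L (Fo ?R (Fo ?L X))) (Fo ?L X)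
      (?e (Fo ?L X)) (F1 ?L X (Fo ?R (Fo ?L X)) (eta_transf U1 U2 X)) = Id1 (VDBL U2) (Fo ?L X)"
    if X: "X \<in> Ob ?S" for X
  proof -
    obtain K F where KF: "X = (K, F)" by (cases X)
    note X' = X[unfolded KF]
    interpret K: set_functor K U1 F by (rule set_functorI[OF X'])
    have LX: "Fo ?L X = K.V" unfolding KF by (rule L_functor_sel(1)[OF X'])
    have V: "K.V \<in> Ob (VDBL U2)" using L.fo[OF X] unfolding LX .
    note RX = Enr1_sel(1)[OF V, of U1]
    have "(ACat U1 K.V, ob_functor U1 K.V) \<in> Ob ?S" using R.fo[OF V] unfolding RX .
    moreover have "eta K F \<in> Hom1 ?S (K, F) (ACat U1 K.V, ob_functor U1 K.V)"
      using K.two_functor_eta K.ob_eta by simp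
    ultimately have "F1 ?L (K, F) (ACat U1 K.V, ob_functor U1 K.V) (eta K F) = L1 K F (eta K F)"
      by (rule L_functor_sel(2)[OF X'])
    moreover have "eta_transf U1 U2 X = eta K F" using X by (simp add: eta_transf_def KF)
    ultimately show ?thesis
      using K.epsilon_eta V unfolding LX RX by (simp add: KF)
  qed
  have t2: "Cmp1 ?S (Fo ?R Y) (Fo ?R (Fo ?L (Fo ?R Y))) (Fo ?R Y)
      (F1 ?R (Fo ?L (Fo ?R Y)) Y (?e Y)) (eta_transf U1 U2 (Fo ?R Y)) = Id1 ?S (Fo ?R Y)"
    if Y: "Y \<in> Ob (VDBL U2)" for Y
  proof -
    have "virtual_double_category Y" using Y by simp
    then interpret P: pointed_cats Y U1 by (rule pointed_catsI)
    note RY = Enr1_sel(1)[OF Y, of U1]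
    have S: "(ACat U1 Y, ob_functor U1 Y) \<in> Ob ?S" using R.fo[OF Y] unfolding RY .
    note LY = L_functor_sel(1)[OF S]
    have PO: "P.P \<in> Ob (VDBL U2)" using L.fo[OF S] unfolding LY .
    have "epsilon U1 Y \<in> Hom1 (VDBL U2) P.P Y" using P.virtual_double_functor_epsilon by simp
    note R1 = Enr1_sel(2)[OF PO Y this]
    have "eta_transf U1 U2 (ACat U1 Y, ob_functor U1 Y) = eta (ACat U1 Y) (ob_functor U1 Y)" using S by (simp add: eta_transf_def)
    then show ?thesis
      using P.eta_epsilon Y unfolding RY LY Enr1_sel(1)[OF PO] by (simp add: R1 del: VDBL_sel)
  qed
  show "left_two_adjoint ?S (VDBL U2) ?L ?R"
    unfolding left_two_adjoint_def
    using S two_category_VDBL L.two_functor_axioms R.two_functor_axioms two_nat_eta[OF assms(2,3)] two_nat_epsilon[OF assms(2,3)] t1 t2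
    by blast
qed

end
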